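(* Let $n\ge2$, $\ell>0$, $\alpha\colon[0,\ell]\to(0,\infty)$ of bounded variation with $1/\alpha$ bounded, $a_1,a_2\in\mathbb{R}^n$, $T_1,T_2\in S^{n-1}$. Suppose $\gamma\in\mathcal{G}$, and let $T=\gamma'$, $k=\mathcal{K}_\alpha(\gamma)$. Then $\gamma$ is an $\infty$-elastica if, and only if, there exists $\lambda\in S^{n-1}$ such that at least one of the following holds. (i) There exist a line $\mathcal{L}\subseteq\mathbb{R}^n$ parallel to $\lambda$ and finitely many pairwise disjoint intervals $J_1,\dots,J_N\subseteq[0,\ell]$, open relative to $[0,\ell]$, such that $\gamma^{-1}(\mathcal{L})=[0,\ell]\setminus\bigcup_{i=1}^NJ_i$ and such that for each $i=1,\dots,N$: $\gamma(\overline{J_i})\cup\mathcal{L}$ is contained in a plane; $\alpha\gamma''$ is continuous on $J_i$ with $\alpha|\gamma''|\equiv k$ on $J_i$; and for every $s_0\in\overline{J_i}\setminus J_i$ there exists $\delta>0$ with $\lambda\cdot\gamma''>0$ on $(s_0,s_0+\delta)\cap J_i$ and $\lambda\cdot\gamma''<0$ on $(s_0-\delta,s_0)\cap J_i$. (ii) $\gamma([0,\ell])$ is contained in a three-dimensional affine subspace of $\mathbb{R}^n$; moreover $\alpha\gamma''\in W^{1,\infty}((0,\ell);\mathbb{R}^n)$ with $\alpha|\gamma''|\equiv k$, and there exists $g\in W^{2,\infty}(0,\ell)$ with $g>0$ such that $g((\alpha T')'+k^2T/\alpha)=k^2\,\mathrm{proj}^\perp_{T,T'}(\lambda)$ and $g'=\alpha\,\lambda\cdot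 T'$ hold almost everywhere in $(0,\ell)$.
   Context: $S^{n-1}$ is the unit sphere in $\mathbb{R}^n$. $\mathcal{G}$ is the set of all $\gamma\in W^{2,\infty}((0,\ell);\mathbb{R}^n)$ with $|\gamma'|\equiv1$ on $[0,\ell]$ and $\gamma(0)=a_1$, $\gamma(\ell)=a_2$, $\gamma'(0)=T_1$, $\gamma'(\ell)=T_2$. $\mathcal{K}_\alpha(\gamma)=\operatorname{ess\,sup}_{[0,\ell]}\alpha|\gamma''|$. A curve $\gamma\in\mathcal{G}$ is an $\infty$-elastica if there exists $M\in\mathbb{R}$ such that $\mathcal{K}_\alpha(\gamma)\le\mathcal{K}_\alpha(\tilde\gamma)+\frac M2\int_0^\ell|\tilde\gamma'-\gamma'|^2\,ds$ for all $\tilde\gamma\in\mathcal{G}$. $\mathrm{proj}^\perp_{V,W}$ is the orthogonal projection onto the orthogonal complement of the span of $V,W\in\mathbb{R}^n$. *)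

theory Defs
  imports "HOL-Analysis.Analysis"
begin

definition bounded_variation_on :: "real \<Rightarrow> real \<Rightarrow> (real \<Rightarrow> real) \<Rightarrow> bool" where
  "bounded_variation_on a b f \<longleftrightarrow>
     (\<exists>B. \<forall>(p::nat \<Rightarrow> real) m. (a \<le> p 0 \<and> p m \<le> b \<and> (\<forall>i<m. p i \<le> p (Suc i)))
            \<longrightarrow> (\<Sum>i<m. \<bar>f (p (Suc i)) - f (p i)\<bar>) \<le> B)"

definition vel :: "real \<Rightarrow> (real \<Rightarrow> 'a::real_normed_vector) \<Rightarrow> real \<Rightarrow> 'a" where
  "vel l f s = vector_derivative f (at s within {0..l})"

text \<open>W^{2,infinity}(0,l) (continuous representative): C^1 on [0,l] with Lipschitz derivative.\<close>
definition W2inf :: "real \<Rightarrow> (real \<Rightarrow> 'a::real_normed_vector) \<Rightarrow> bool" where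
  "W2inf l f \<longleftrightarrow> (\<forall>s\<in>{0..l}. f differentiable (at s within {0..l}))
                  \<and> (\<exists>L. L-lipschitz_on {0..l} (vel l f))"

definition weak_deriv :: "real \<Rightarrow> (real \<Rightarrow> 'a::euclidean_space) \<Rightarrow> (real \<Rightarrow> 'a) \<Rightarrow> bool" where
  "weak_deriv l f h \<longleftrightarrow>
     (\<forall>s t. 0 \<le> s \<and> s \<le> t \<and> t \<le> l \<longrightarrow> (h has_integral (f t - f s)) {s..t})"

text \<open>A fixed representative of gamma'' (weak derivative of gamma'); any two agree a.e.\<close>
definition acc :: "real \<Rightarrow> (real \<Rightarrow> 'a::euclidean_space) \<Rightarrow> real \<Rightarrow> 'a" where
  "acc l f = (SOME h. weak_deriv l (vel l f) h)"

definition ess_sup_on :: "real \<Rightarrow> (real \<Rightarrow> real) \<Rightarrow> real" where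
  "ess_sup_on l f = Inf {c. AE s in lebesgue. s \<in> {0..l} \<longrightarrow> f s \<le> c}"

definition K_alpha :: "real \<Rightarrow> (real \<Rightarrow> real) \<Rightarrow> (real \<Rightarrow> 'a::euclidean_space) \<Rightarrow> real" where
  "K_alpha l \<alpha> f = ess_sup_on l (\<lambda>s. \<alpha> s * norm (acc l f s))"

definition adm :: "real \<Rightarrow> 'a \<Rightarrow> 'a \<Rightarrow> 'a \<Rightarrow> 'a \<Rightarrow> (real \<Rightarrow> 'a::euclidean_space) \<Rightarrow> bool" where
  "adm l a1 a2 T1 T2 f \<longleftrightarrow> W2inf l f \<and> (\<forall>s\<in>{0..l}. norm (vel l f s) = 1)
      \<and> f 0 = a1 \<and> f l = a2 \<and> vel l f 0 = T1 \<and> vel l f l = T2"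

definition inf_elastica ::
  "real \<Rightarrow> (real \<Rightarrow> real) \<Rightarrow> 'a \<Rightarrow> 'a \<Rightarrow> 'a \<Rightarrow> 'a \<Rightarrow> (real \<Rightarrow> 'a::euclidean_space) \<Rightarrow> bool" where
  "inf_elastica l \<alpha> a1 a2 T1 T2 \<gamma> \<longleftrightarrow> adm l a1 a2 T1 T2 \<gamma> \<and>
     (\<exists>M::real. \<forall>\<gamma>'. adm l a1 a2 T1 T2 \<gamma>' \<longrightarrow>
        K_alpha l \<alpha> \<gamma> \<le> K_alpha l \<alpha> \<gamma>' + M / 2 * integral {0..l} (\<lambda>s. (norm (vel l \<gamma>' s - vel l \<gamma> s))\<^sup>2))"

definition proj_perp :: "'a \<Rightarrow> 'a \<Rightarrow> 'a \<Rightarrow> 'a::euclidean_space" where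
  "proj_perp V W x = (THE y. x - y \<in> span {V, W} \<and> y \<bullet> V = 0 \<and> y \<bullet> W = 0)"

end

theory Submission
  imports Defs
begin

text \<open>Writing \<open>T\<close> for the tangent, an admissible \<open>\<gamma>\<close> solves a control problem with control constraint
  \<open>\<alpha> |T'| \<le> k\<close>. The costate is a path of 2-forms \<open>W = \<lambda> \<and> \<gamma> + W\<^sub>0\<close>, the momentum conserved under
  rigid motions, and criticality says \<open>W = \<phi> \<and> T\<close> with \<open>\<phi> = W T\<close> and \<open>\<alpha> T' = k \<phi> / |\<phi>|\<close> wherever
  \<open>\<phi> \<noteq> 0\<close>.

  Sufficiency is a calibration argument: testing \<open>\<phi>\<close> against the difference of two tangents \<open>S - T\<close>,
  the identity \<open>T \<bullet> (S - T) = - |S - T|\<^sup>2 / 2\<close> produces exactly the quadratic penalty.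

  For necessity, the tangent is deformed by paths of rotations. To first order only the derivative of
  the path changes \<open>|T'|\<close>, and the end conditions become finitely many linear conditions, so a
  separating hyperplane in a finite-dimensional space yields the multiplier; Brouwer's theorem
  corrects the end point of the deformed curve.

  If \<open>\<phi>\<close> has no zero, dividing by \<open>|\<phi>|\<close> gives the system (ii). If \<open>\<phi>\<close> vanishes somewhere, then
  \<open>\<phi> = 0\<close> exactly on the line \<open>\<L>\<close>, and \<open>1 - \<lambda> \<bullet> T + k |\<phi>| / \<alpha>\<close>, which is conserved for constant
  \<open>\<alpha>\<close>, stays positive because \<open>\<alpha>\<close> has bounded variation. Hence \<open>\<lambda> \<bullet> T < 1\<close> on \<open>\<L>\<close>, which excludes
  accumulation of short arcs and yields (i).\<close>

section \<open>Densities of Lipschitz functions\<close>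

text \<open>The weight \<alpha> may jump, so no identity may contain its derivative, and the energy
  can only be followed over fine subdivisions, with a variation function of \<alpha> measuring the
  loss.

  The link between \<open>\<lambda> \<bullet> T < 1\<close> and short arcs is a rotation. Write nu
  for the direction of \<open>\<phi>\<close>. On an arc the unit vector \<open>\<lambda>\<close>
  lies in the plane of T and nu; its components tau (along T) and f (along nu) satisfy tau' = (k /
  \<alpha>) f and f' = - (k / \<alpha>) tau, while the derivative of \<open>|\<phi>|\<close> is f.
  An arc between two zeros of \<open>\<phi>\<close> starts with f > 0 and ends with f < 0. In
  between, f must decrease through 0, which needs tau to come up to 1. Near a point with tau < 1
  this cannot happen, so no such arc lies close to that point.

  Two degenerate situations need care. The vector \<open>\<lambda>\<close> produced by separation
  may be 0; then W is constant, the curve stays in a plane, and (ii) holds with a different unit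
  vector.\<close>

lemma has_integral_zero_nonneg_AE:
  fixes h :: "real \<Rightarrow> real"
  assumes "(h has_integral 0) {a..b}" "\<And>x. x \<in> {a..b} \<Longrightarrow> 0 \<le> h x"
  shows "AE x\<in>{a..b} in lebesgue. h x = 0"
proof -
  have abs: "h absolutely_integrable_on {a..b}"
    using assms by (intro nonnegative_absolutely_integrable_1) auto
  then have int: "integrable lebesgue (\<lambda>x. indicator {a..b} x *\<^sub>R h x)"
    by (simp add: set_integrable_def)
  have "integral\<^sup>L lebesgue (\<lambda>x. indicator {a..b} x *\<^sub>R h x) = 0"
    using set_lebesgue_integral_eq_integral(2)[OF abs] integral_unique[OF assms(1)]
    by (simp add: set_lebesgue_integral_def)
  then have "AE x in lebesgue. indicator {a..b} x *\<^sub>R h x = 0"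
    using assms(2) by (subst (asm) integral_nonneg_eq_0_iff_AE[OF int]) (auto simp: indicator_def)
  then show ?thesis by (auto elim!: eventually_mono)
qed

text \<open>As each cell integral is nonnegative, replacing \<open>h x\<close> by its absolute value
  moves a term of a Riemann sum no farther from the cell integral. By Henstock's lemma
  \<open>\<bar>h x\<bar>\<close> has the same integral as \<open>h\<close>, so the nonnegative
  difference vanishes almost everywhere. This turns monotonicity of a function into a sign of its
  density without any differentiation theorem.\<close>

lemma nonneg_integrals_imp_nonneg_AE:
  fixes h :: "real \<Rightarrow> real"
  assumes ab: "a \<le> b"
    and h: "\<And>s t. a \<le> s \<Longrightarrow> s \<le> t \<Longrightarrow> t \<le> b \<Longrightarrow> \<exists>I\<ge>0. (h has_integral I) {s..t}"
  shows "AE x\<in>{a..b} in lebesgue. 0 \<le> h x"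
proof -
  obtain I where I: "I \<ge> 0" "(h has_integral I) {a..b}" using h[of a b] ab by auto
  have int: "h integrable_on cbox a b" using I by auto
  have "((\<lambda>x. \<bar>h x\<bar>) has_integral I) (cbox a b)"
    unfolding has_integral
  proof (intro allI impI)
    fix e :: real assume "e > 0"
    obtain \<gamma> where g: "gauge \<gamma>" and gp: "\<And>p. \<lbrakk>p tagged_partial_division_of (cbox a b); \<gamma> fine p\<rbrakk> \<Longrightarrow>
             sum (\<lambda>(x,k). norm(measure lborel k *\<^sub>R h x - integral k h)) p < e"
      using Henstock_lemma[OF int \<open>e > 0\<close>] by blast
    show "\<exists>\<gamma>. gauge \<gamma> \<and> (\<forall>p. p tagged_division_of cbox a b \<and> \<gamma> fine p \<longrightarrow>
            norm ((\<Sum>(x, k)\<in>p. measure lborel k *\<^sub>R \<bar>h x\<bar>) - I) < e)"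
    proof (intro exI conjI allI impI, rule g, elim conjE)
      fix p assume p: "p tagged_division_of cbox a b" "\<gamma> fine p"
      have "I = (\<Sum>(x,k)\<in>p. integral k h)"
        using integral_combine_tagged_division_topdown[OF int p(1)] I(2) by (simp add: integral_unique)
      then have "norm ((\<Sum>(x, k)\<in>p. measure lborel k *\<^sub>R \<bar>h x\<bar>) - I)
          = norm (\<Sum>(x, k)\<in>p. measure lborel k *\<^sub>R \<bar>h x\<bar> - integral k h)"
        by (simp add: sum_subtractf case_prod_beta)
      also have "\<dots> \<le> (\<Sum>(x, k)\<in>p. norm (measure lborel k *\<^sub>R h x - integral k h))"
      proof (rule sum_norm_le, clarify)
        fix x k assume xk: "(x, k) \<in> p"
        obtain u v where uv: "k = cbox u v" using tagged_division_ofD(4)[OF p(1) xk] by auto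
        have sub: "k \<subseteq> cbox a b" using tagged_division_ofD(3)[OF p(1) xk] .
        have ne: "x \<in> k" using tagged_division_ofD(2)[OF p(1) xk] .
        have "u \<le> v" "a \<le> u" "v \<le> b" using ne sub uv by (auto simp: cbox_interval)
        then have nn: "integral k h \<ge> 0" using h[of u v] uv by (auto simp: integral_unique)
        have c: "measure lborel k \<ge> 0" by simp
        have "\<bar>measure lborel k * h x\<bar> = measure lborel k * \<bar>h x\<bar>" using c by (simp add: abs_mult)
        then show "norm (measure lborel k *\<^sub>R \<bar>h x\<bar> - integral k h) \<le> norm (measure lborel k *\<^sub>R h x - integral k h)"
          using abs_triangle_ineq3[of "measure lborel k * h x" "integral k h"] abs_of_nonneg[OF nn]
          unfolding real_norm_def real_scaleR_def by metis
      qed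
      also have "\<dots> < e" using gp[of p] p by (auto simp: tagged_division_of_def)
      finally show "norm ((\<Sum>(x, k)\<in>p. measure lborel k *\<^sub>R \<bar>h x\<bar>) - I) < e" .
    qed
  qed
  then have "((\<lambda>x. \<bar>h x\<bar> - h x) has_integral I - I) {a..b}"
    using I(2) by (intro has_integral_diff) auto
  then have "AE x\<in>{a..b} in lebesgue. \<bar>h x\<bar> - h x = 0"
    by (intro has_integral_zero_nonneg_AE) auto
  then show ?thesis by eventually_elim auto
qed

text \<open>The density is read off from the Radon-Nikodym derivative of \<open>A \<mapsto> |g(A)|\<close>, where
  \<open>g(x) = f(x) + (L + 1) x\<close> is bi-Lipschitz.\<close>

lemma lipschitz_has_density_real:
  fixes f :: "real \<Rightarrow> real"
  assumes f: "L-lipschitz_on {a..b} f" and ab: "a \<le> b"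
  shows "\<exists>h. \<forall>s t. a \<le> s \<and> s \<le> t \<and> t \<le> b \<longrightarrow> (h has_integral (f t - f s)) {s..t}"
proof -
  \<comment> \<open>Clamping the argument extends \<open>f\<close> to the whole line with the same
    Lipschitz constant.\<close>
  define F where "F x = f (max a (min b x))" for x
  have L: "L \<ge> 0" using f by (rule lipschitz_on_nonneg)
  have F: "\<bar>F x - F y\<bar> \<le> L * \<bar>x - y\<bar>" for x y
  proof -
    have "\<bar>F x - F y\<bar> \<le> L * \<bar>max a (min b x) - max a (min b y)\<bar>"
      unfolding F_def using lipschitz_onD[OF f, of "max a (min b x)" "max a (min b y)"] ab
      by (auto simp: dist_real_def)
    also have "\<dots> \<le> L * \<bar>x - y\<bar>" using L by (intro mult_left_mono) auto
    finally show ?thesis .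
  qed
  \<comment> \<open>The slope L + 1 beats the Lipschitz constant by 1, so \<open>g\<close> expands
    distances; its inverse \<open>G\<close> is then 1-Lipschitz and \<open>g\<close> maps intervals
    onto intervals.\<close>
  define g where "g x = F x + (L + 1) * x" for x
  have g1: "g y - g x \<ge> y - x" if "x \<le> y" for x y
    using F[of x y] that by (auto simp: g_def algebra_simps abs_if split: if_splits)
  have gL: "\<bar>g x - g y\<bar> \<le> (2 * L + 1) * \<bar>x - y\<bar>" for x y
  proof -
    have "\<bar>g x - g y\<bar> \<le> \<bar>F x - F y\<bar> + \<bar>(L+1) * (x - y)\<bar>" by (simp add: g_def algebra_simps)
    also have "\<bar>(L+1) * (x - y)\<bar> = (L+1) * \<bar>x - y\<bar>" using L by (simp add: abs_mult)
    finally show ?thesis using F[of x y] by (simp add: algebra_simps)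
  qed
  have cont: "continuous_on UNIV g"
  proof (rule lipschitz_on_continuous_on)
    show "(2 * L + 1)-lipschitz_on UNIV g" using gL L by (intro lipschitz_onI) (auto simp: dist_real_def)
  qed
  have mono: "strict_mono g" by (rule strict_monoI) (metis g1 less_imp_le diff_gt_0_iff_gt order_less_le_trans)
  then have inj: "inj g" by (rule strict_mono_imp_inj_on)
  have surj: "surj g"
  proof (rule surjI[of g "\<lambda>y. SOME x. g x = y"])
    fix y
    define x0 where "x0 = min 0 (y - g 0)"
    define x1 where "x1 = max 0 (y - g 0)"
    have "g x0 \<le> y" using g1[of x0 0] by (auto simp: x0_def)
    moreover have "y \<le> g x1" using g1[of 0 x1] by (auto simp: x1_def)
    moreover have "x0 \<le> x1" by (auto simp: x0_def x1_def)
    ultimately have "\<exists>x. g x = y"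
      using IVT'[of g x0 y x1] continuous_on_subset[OF cont] by blast
    then show "g (SOME x. g x = y) = y" by (rule someI_ex)
  qed
  define G where "G = inv g"
  have gG: "g (G y) = y" and Gg: "G (g x) = x" for x y
    using surj inj by (auto simp: G_def surj_f_inv_f)
  have GL: "\<bar>G x - G y\<bar> \<le> \<bar>x - y\<bar>" for x y
    using g1[of "G x" "G y"] g1[of "G y" "G x"] gG by (cases "G x \<le> G y") auto
  have "1-lipschitz_on UNIV G" using GL by (intro lipschitz_onI) (auto simp: dist_real_def)
  then have "continuous_on UNIV G" by (rule lipschitz_on_continuous_on)
  then have [measurable]: "G \<in> borel_measurable borel" by (rule borel_measurable_continuous_onI)
  define N where "N = distr lborel borel G"
  have vim: "G -` A = g ` A" for A
  proof (intro equalityI subsetI)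
    fix y assume "y \<in> G -` A"
    then show "y \<in> g ` A" using gG[of y] by (intro image_eqI[of _ _ "G y"]) auto
  qed (use Gg in auto)
  have Nem: "emeasure N A = emeasure lborel (g ` A)" if "A \<in> sets borel" for A :: "real set"
    unfolding N_def using that by (subst emeasure_distr) (auto simp: vim)
  have "absolutely_continuous lborel N"
    unfolding absolutely_continuous_def
  proof
    fix A :: "real set" assume A: "A \<in> null_sets lborel"
    then have Ab: "A \<in> sets borel" by auto
    have "negligible A" using A by (simp add: negligible_iff_null_sets null_sets_completionI)
    then have "negligible (g ` A)"
      by (intro negligible_locally_Lipschitz_image)
         (auto intro!: exI[of _ UNIV] exI[of _ "2*L+1"] simp: gL)
    moreover have "g ` A \<in> sets borel"
      using measurable_sets[OF \<open>G \<in> borel_measurable borel\<close> Ab] by (simp add: vim)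
    ultimately have "g ` A \<in> null_sets lborel"
      by (simp add: negligible_iff_null_sets null_sets_completion_iff)
    then show "A \<in> null_sets N" using Nem[OF Ab] Ab by (auto simp: null_sets_def N_def)
  qed
  moreover have "sets N = sets lborel" by (simp add: N_def)
  ultimately obtain D where Dm[measurable]: "D \<in> borel_measurable lborel" and D: "density lborel D = N"
    using sigma_finite_measure.Radon_Nikodym[OF sigma_finite_lborel] by blast
  have gim: "g ` {s..t} = {g s..g t}" if "s \<le> t" for s t
  proof
    show "g ` {s..t} \<subseteq> {g s..g t}" using mono by (auto simp: strict_mono_less_eq)
    show "{g s..g t} \<subseteq> g ` {s..t}"
    proof
      fix y assume y: "y \<in> {g s..g t}"
      then have "s \<le> G y" "G y \<le> t"
        using strict_mono_less_eq[OF mono, of s "G y"] strict_mono_less_eq[OF mono, of "G y" t] gG by auto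
      then show "y \<in> g ` {s..t}" using gG by (intro image_eqI[of _ _ "G y"]) auto
    qed
  qed
  have Dint: "(\<integral>\<^sup>+x. D x * indicator {s..t} x \<partial>lborel) = ennreal (g t - g s)" if "s \<le> t" for s t
  proof -
    have "(\<integral>\<^sup>+x. D x * indicator {s..t} x \<partial>lborel) = emeasure N {s..t}"
      by (subst D[symmetric], subst emeasure_density) auto
    also have "\<dots> = ennreal (g t - g s)"
      using that g1[OF that] by (subst Nem) (auto simp: gim)
    finally show ?thesis .
  qed
  have Dfin: "AE x in lborel. x \<in> {a..b} \<longrightarrow> D x \<noteq> \<infinity>"
  proof -
    have "AE x in lborel. D x * indicator {a..b} x \<noteq> \<infinity>"
      by (rule nn_integral_PInf_AE) (use Dint[OF ab] in auto)
    then show ?thesis by eventually_elim (auto simp: indicator_def)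
  qed
  \<comment> \<open>The constant removes the slope added in \<open>g\<close>;
    \<open>enn2real\<close> loses nothing because \<open>D\<close> is finite almost everywhere on
    the interval.\<close>
  define h where "h x = enn2real (D x) - (L + 1)" for x
  have "(h has_integral (f t - f s)) {s..t}" if st: "a \<le> s" "s \<le> t" "t \<le> b" for s t
  proof -
    have "((\<lambda>x. indicator {s..t} x * enn2real (D x)) has_integral (g t - g s)) UNIV"
    proof (rule nn_integral_has_integral)
      show "(\<lambda>x. indicator {s..t} x * enn2real (D x)) \<in> borel_measurable borel" using Dm by measurable
      show "(\<integral>\<^sup>+x. ennreal (indicator {s..t} x * enn2real (D x)) \<partial>lborel) = ennreal (g t - g s)"
      proof (subst Dint[OF st(2), symmetric], rule nn_integral_cong_AE)
        show "AE x in lborel. ennreal (indicator {s..t} x * enn2real (D x)) = D x * indicator {s..t} x"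
          using Dfin by eventually_elim (use st in \<open>auto simp: indicator_def less_top\<close>)
      qed
    qed (use g1[OF st(2)] st in auto)
    then have "((\<lambda>x. if x \<in> {s..t} then enn2real (D x) else 0) has_integral (g t - g s)) UNIV"
      by (rule has_integral_eq[rotated]) auto
    then have "((\<lambda>x. enn2real (D x)) has_integral (g t - g s)) {s..t}"
      by (simp only: has_integral_restrict_UNIV)
    then have "(h has_integral (g t - g s) - (t - s) *\<^sub>R (L + 1)) {s..t}"
      unfolding h_def using st has_integral_const_real[of "L+1" s t]
      by (intro has_integral_diff) auto
    moreover have "(g t - g s) - (t - s) *\<^sub>R (L + 1) = f t - f s"
      using st by (simp add: g_def F_def algebra_simps)
    ultimately show ?thesis by simp
  qed
  then show ?thesis by blast
qed

section \<open>Weak derivatives of Lipschitz functions\<close>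

text \<open>\<open>f\<close> is Lipschitz on \<open>[a, b]\<close> with weak derivative \<open>h\<close>. No differentiability almost everywhere is
  used: identities between derivatives follow from the uniqueness of the density \<open>h\<close> up to null sets.\<close>

definition WD :: "real \<Rightarrow> real \<Rightarrow> (real \<Rightarrow> 'a::euclidean_space) \<Rightarrow> (real \<Rightarrow> 'a) \<Rightarrow> bool" where
  "WD a b f h \<longleftrightarrow> (\<exists>L. L-lipschitz_on {a..b} f) \<and>
     (\<forall>s t. a \<le> s \<and> s \<le> t \<and> t \<le> b \<longrightarrow> (h has_integral (f t - f s)) {s..t})"

lemma WD_lip: "WD a b f h \<Longrightarrow> \<exists>L. L-lipschitz_on {a..b} f"
  by (simp add: WD_def)

lemma WD_continuous: "WD a b f h \<Longrightarrow> continuous_on {a..b} f"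
  using WD_lip lipschitz_on_continuous_on by blast

lemma WD_int: "WD a b f h \<Longrightarrow> a \<le> s \<Longrightarrow> s \<le> t \<Longrightarrow> t \<le> b \<Longrightarrow> (h has_integral (f t - f s)) {s..t}"
  by (simp add: WD_def)

lemma WD_subset: "WD a b f h \<Longrightarrow> a \<le> c \<Longrightarrow> d \<le> b \<Longrightarrow> WD c d f h"
  unfolding WD_def
  using lipschitz_on_subset[of _ "{a..b}" f "{c..d}"] atLeastatMost_subset_iff[of c d a b] by (meson order_trans)

lemma WD_iff_weak_deriv: "WD 0 l f h \<longleftrightarrow> weak_deriv l f h \<and> (\<exists>L. L-lipschitz_on {0..l} f)"
  by (auto simp: WD_def weak_deriv_def)

lemma has_integral_cong_AE:
  assumes "(h has_integral I) {s..t::real}" "AE x\<in>{s..t} in lebesgue. h x = h' x"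
  shows "(h' has_integral I) {s..t}"
proof -
  have "AE x in lborel. x \<in> {s..t} \<longrightarrow> h x = h' x" using assms(2) by (simp add: AE_completion_iff)
  then show ?thesis using has_integral_AE assms(1) by blast
qed

lemma WD_cong_AE:
  assumes "WD a b f h" "AE x\<in>{a..b} in lebesgue. h x = h' x"
  shows "WD a b f h'"
  unfolding WD_def
proof (intro conjI allI impI)
  show "\<exists>L. L-lipschitz_on {a..b} f" using WD_lip[OF assms(1)] .
  fix s t assume st: "a \<le> s \<and> s \<le> t \<and> t \<le> b"
  then have "(h has_integral f t - f s) {s..t}" using WD_int[OF assms(1)] by auto
  moreover have "AE x\<in>{s..t} in lebesgue. h x = h' x"
    using assms(2) st by (auto elim!: eventually_mono)
  ultimately show "(h' has_integral f t - f s) {s..t}" by (rule has_integral_cong_AE)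
qed

lemma WD_cong:
  assumes "WD a b f h" "\<And>x. x \<in> {a..b} \<Longrightarrow> f x = f' x"
  shows "WD a b f' h"
proof -
  obtain L where "L-lipschitz_on {a..b} f" using WD_lip[OF assms(1)] by auto
  then have "L-lipschitz_on {a..b} f'" using assms(2) by (simp add: lipschitz_on_def)
  then show ?thesis using WD_int[OF assms(1)] assms(2) by (auto simp: WD_def)
qed

section \<open>Linear operations on weak derivatives\<close>

lemma WD_add: "WD a b f h \<Longrightarrow> WD a b f' h' \<Longrightarrow> WD a b (\<lambda>x. f x + f' x) (\<lambda>x. h x + h' x)"
  unfolding WD_def by (auto intro!: lipschitz_on_add has_integral_add simp: add_diff_add)

lemma WD_linear:
  assumes "WD a b f h" "bounded_linear T"
  shows "WD a b (\<lambda>x. T (f x)) (\<lambda>x. T (h x))"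
proof -
  interpret bounded_linear T by fact
  obtain L where L: "L-lipschitz_on {a..b} f" using WD_lip[OF assms(1)] by auto
  obtain K where K: "\<And>x. norm (T x) \<le> norm x * K" "K \<ge> 0" using nonneg_bounded by auto
  have "(L * K)-lipschitz_on {a..b} (\<lambda>x. T (f x))"
  proof (rule lipschitz_onI)
    fix x y assume "x \<in> {a..b}" "y \<in> {a..b}"
    then have "norm (f x - f y) \<le> L * dist x y" using lipschitz_onD[OF L] by (simp add: dist_norm)
    then have "norm (f x - f y) * K \<le> L * dist x y * K" using K by (intro mult_right_mono) auto
    then show "dist (T (f x)) (T (f y)) \<le> L * K * dist x y"
      using K(1)[of "f x - f y"] by (simp add: dist_norm diff algebra_simps)
  qed (use K lipschitz_on_nonneg[OF L] in auto)
  moreover have "((\<lambda>x. T (h x)) has_integral T (f t) - T (f s)) {s..t}"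
    if "a \<le> s" "s \<le> t" "t \<le> b" for s t
    using has_integral_linear[OF WD_int[OF assms(1) that] assms(2)] by (simp add: o_def diff)
  ultimately show ?thesis by (auto simp: WD_def)
qed

lemma WD_minus: "WD a b f h \<Longrightarrow> WD a b (\<lambda>x. - f x) (\<lambda>x. - h x)"
  using WD_linear[of a b f h uminus] bounded_linear_minus[OF bounded_linear_ident] by simp

lemma WD_diff: "WD a b f h \<Longrightarrow> WD a b f' h' \<Longrightarrow> WD a b (\<lambda>x. f x - f' x) (\<lambda>x. h x - h' x)"
  using WD_add[of a b f h "\<lambda>x. - f' x" "\<lambda>x. - h' x"] WD_minus by auto

lemma WD_const: "WD a b (\<lambda>x. c) (\<lambda>x. 0)"
  unfolding WD_def by (auto intro: lipschitz_on_constant)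

lemma WD_ident: "WD a b (\<lambda>x. x) (\<lambda>x. 1)"
proof -
  have "((\<lambda>x::real. 1::real) has_integral t - s) {s..t}" if "s \<le> t" for s t
    using has_integral_const_real[of "1::real" s t] that by simp
  then show ?thesis unfolding WD_def by (auto intro: lipschitz_on_id)
qed

lemma WD_inner_left: "WD a b f h \<Longrightarrow> WD a b (\<lambda>x. f x \<bullet> e) (\<lambda>x. h x \<bullet> e)"
  by (rule WD_linear[OF _ bounded_linear_inner_left])

lemma WD_scaleR_const: "WD a b f h \<Longrightarrow> WD a b (\<lambda>x. c *\<^sub>R f x) (\<lambda>x. c *\<^sub>R h x)"
  by (rule WD_linear[OF _ bounded_linear_scaleR_right])

text \<open>The function c - h has nonnegative integral over every subinterval. All
  almost-everywhere information on densities, in particular bounds and uniqueness, is obtained from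
  increments in this way.\<close>

lemma WD_le_AE:
  fixes f :: "real \<Rightarrow> real"
  assumes "WD a b f h" "a \<le> b" and c: "\<And>s t. a \<le> s \<Longrightarrow> s \<le> t \<Longrightarrow> t \<le> b \<Longrightarrow> f t - f s \<le> c * (t - s)"
  shows "AE x\<in>{a..b} in lebesgue. h x \<le> c"
proof -
  have "AE x\<in>{a..b} in lebesgue. 0 \<le> c - h x"
  proof (rule nonneg_integrals_imp_nonneg_AE[OF assms(2)])
    fix s t assume st: "a \<le> s" "s \<le> t" "t \<le> b"
    have "((\<lambda>x. c - h x) has_integral (t - s) *\<^sub>R c - (f t - f s)) {s..t}"
      using has_integral_const_real[of c s t] st by (intro has_integral_diff WD_int[OF assms(1)]) auto
    moreover have "(t - s) *\<^sub>R c - (f t - f s) \<ge> 0" using c[OF st] by (simp add: algebra_simps)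
    ultimately show "\<exists>I\<ge>0. ((\<lambda>x. c - h x) has_integral I) {s..t}" by blast
  qed
  then show ?thesis by eventually_elim auto
qed

section \<open>Bounds, existence and uniqueness of densities\<close>

lemma AE_ball_finite_imp:
  assumes "finite I" "\<And>i. i \<in> I \<Longrightarrow> AE x in M. P x \<longrightarrow> Q i x"
  shows "AE x in M. P x \<longrightarrow> (\<forall>i\<in>I. Q i x)"
proof -
  have "AE x in M. \<forall>i\<in>I. P x \<longrightarrow> Q i x" using assms by (intro AE_finite_allI) auto
  then show ?thesis by eventually_elim auto
qed

lemma WD_bounded_AE:
  fixes f :: "real \<Rightarrow> 'a::euclidean_space"
  assumes "WD a b f h" "a \<le> b"
  shows "\<exists>B\<ge>0. AE x\<in>{a..b} in lebesgue. norm (h x) \<le> B"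
proof -
  obtain L where L: "L-lipschitz_on {a..b} f" using WD_lip[OF assms(1)] by auto
  have L0: "L \<ge> 0" using lipschitz_on_nonneg[OF L] .
  have bd: "\<bar>(f t - f s) \<bullet> e\<bar> \<le> L * (t - s)"
    if "e \<in> Basis" "a \<le> s" "s \<le> t" "t \<le> b" for e s t
  proof -
    have "\<bar>(f t - f s) \<bullet> e\<bar> \<le> norm (f t - f s)" using that Basis_le_norm by blast
    also have "\<dots> \<le> L * (t - s)" using lipschitz_onD[OF L, of t s] that by (simp add: dist_norm)
    finally show ?thesis .
  qed
  have "AE x\<in>{a..b} in lebesgue. (\<forall>e\<in>Basis. \<bar>h x \<bullet> e\<bar> \<le> L)"
  proof (rule AE_ball_finite_imp)
    fix e :: 'a assume e: "e \<in> Basis"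
    have "AE x\<in>{a..b} in lebesgue. h x \<bullet> e \<le> L"
      by (rule WD_le_AE[OF WD_inner_left[OF assms(1)] assms(2)])
         (use bd[OF e] in \<open>force simp: inner_diff_left abs_le_iff\<close>)
    moreover have "AE x\<in>{a..b} in lebesgue. - (h x \<bullet> e) \<le> L"
      by (rule WD_le_AE[OF WD_minus[OF WD_inner_left[OF assms(1)]] assms(2)])
         (use bd[OF e] in \<open>force simp: inner_diff_left abs_le_iff\<close>)
    ultimately show "AE x\<in>{a..b} in lebesgue. \<bar>h x \<bullet> e\<bar> \<le> L"
      by eventually_elim auto
  qed simp
  then have "AE x\<in>{a..b} in lebesgue. norm (h x) \<le> DIM('a) * L"
  proof eventually_elim
    case (elim x)
    show ?case
    proof
      assume "x \<in> {a..b}"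
      then have "(\<Sum>e\<in>Basis. \<bar>h x \<bullet> e\<bar>) \<le> DIM('a) * L"
        using elim sum_bounded_above[of Basis "\<lambda>e. \<bar>h x \<bullet> e\<bar>" L] by auto
      then show "norm (h x) \<le> DIM('a) * L" using norm_le_l1[of "h x"] by linarith
    qed
  qed
  then show ?thesis using L0 by (intro exI[of _ "DIM('a) * L"]) auto
qed

text \<open>A density in \<open>WD\<close> is tied to \<open>f\<close> only through gauge integrals
  over subintervals of [a, b]. Passing to a version that is measurable on the whole line and bounded
  everywhere makes its products with continuous functions integrable.\<close>

lemma WD_nice:
  fixes f :: "real \<Rightarrow> 'a::euclidean_space"
  assumes "WD a b f h" "a \<le> b"
  obtains h' B where "h' \<in> borel_measurable lebesgue" "\<And>x. norm (h' x) \<le> B" "B \<ge> 0" "WD a b f h'"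
    "AE x\<in>{a..b} in lebesgue. h' x = h x"
proof -
  obtain B where B: "B \<ge> 0" "AE x\<in>{a..b} in lebesgue. norm (h x) \<le> B"
    using WD_bounded_AE[OF assms] by auto
  have m: "(\<lambda>x. indicator {a..b} x *\<^sub>R h x) \<in> borel_measurable lebesgue"
    using has_integral_implies_lebesgue_measurable WD_int[OF assms(1) order_refl assms(2) order_refl] by blast
  define h1 where "h1 x = indicator {a..b} x *\<^sub>R h x" for x
  have m1[measurable]: "h1 \<in> borel_measurable lebesgue" using m by (simp add: h1_def[abs_def])
  define h' where "h' x = (if norm (h1 x) \<le> B then h1 x else 0)" for x
  have "h' \<in> borel_measurable lebesgue" unfolding h'_def[abs_def] by measurable
  moreover have "norm (h' x) \<le> B" for x using B(1) by (auto simp: h'_def)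
  moreover have ae: "AE x\<in>{a..b} in lebesgue. h' x = h x"
    using B(2) by eventually_elim (auto simp: h'_def h1_def)
  moreover have "WD a b f h'"
    by (rule WD_cong_AE[OF assms(1)]) (use ae in \<open>eventually_elim, auto\<close>)
  ultimately show ?thesis using that B(1) by blast
qed

lemma WD_exists:
  fixes f :: "real \<Rightarrow> 'a::euclidean_space"
  assumes f: "L-lipschitz_on {a..b} f" and ab: "a \<le> b"
  obtains h where "WD a b f h"
proof -
  have "\<exists>h. \<forall>s t. a \<le> s \<and> s \<le> t \<and> t \<le> b \<longrightarrow> (h has_integral (f t \<bullet> e - f s \<bullet> e)) {s..t}"
    if "e \<in> Basis" for e
  proof (rule lipschitz_has_density_real[OF _ ab])
    show "L-lipschitz_on {a..b} (\<lambda>x. f x \<bullet> e)"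
    proof (rule lipschitz_onI)
      fix x y assume "x \<in> {a..b}" "y \<in> {a..b}"
      then show "dist (f x \<bullet> e) (f y \<bullet> e) \<le> L * dist x y"
        using lipschitz_onD[OF f] Basis_le_norm[OF that, of "f x - f y"]
        by (force simp: dist_norm inner_diff_left)
    qed (use lipschitz_on_nonneg[OF f] in auto)
  qed
  then obtain H where H: "\<And>e s t. e \<in> Basis \<Longrightarrow> a \<le> s \<Longrightarrow> s \<le> t \<Longrightarrow> t \<le> b \<Longrightarrow>
      (H e has_integral (f t \<bullet> e - f s \<bullet> e)) {s..t}" by metis
  define h where "h x = (\<Sum>e\<in>Basis. H e x *\<^sub>R e)" for x
  have he: "h x \<bullet> e = H e x" if "e \<in> Basis" for x e
    using that by (simp add: h_def)
  have "(h has_integral (f t - f s)) {s..t}" if "a \<le> s" "s \<le> t" "t \<le> b" for s t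
    unfolding has_integral_componentwise_iff[of h]

  proof
    fix e :: 'a assume e: "e \<in> Basis"
    have "(\<lambda>x. h x \<bullet> e) = H e" using he[OF e] by auto
    then show "((\<lambda>x. h x \<bullet> e) has_integral (f t - f s) \<bullet> e) {s..t}"
      using H[OF e that] by (simp add: inner_diff_left)
  qed
  then have "WD a b f h" using f by (auto simp: WD_def)
  then show ?thesis using that by blast
qed

lemma WD_zero_AE:
  fixes f :: "real \<Rightarrow> 'a::euclidean_space"
  assumes "WD a b f h" "a \<le> b" "\<And>x. x \<in> {a..b} \<Longrightarrow> f x = c"
  shows "AE x\<in>{a..b} in lebesgue. h x = 0"
proof -
  have "AE x\<in>{a..b} in lebesgue. (\<forall>e\<in>Basis. h x \<bullet> e = 0)"
  proof (rule AE_ball_finite_imp)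
    fix e :: 'a assume e: "e \<in> Basis"
    have "AE x\<in>{a..b} in lebesgue. h x \<bullet> e \<le> 0"
      by (rule WD_le_AE[OF WD_inner_left[OF assms(1)] assms(2)]) (use assms(3) in auto)
    moreover have "AE x\<in>{a..b} in lebesgue. - (h x \<bullet> e) \<le> 0"
      by (rule WD_le_AE[OF WD_minus[OF WD_inner_left[OF assms(1)]] assms(2)]) (use assms(3) in auto)
    ultimately show "AE x\<in>{a..b} in lebesgue. h x \<bullet> e = 0"
      by eventually_elim auto
  qed simp
  then show ?thesis by eventually_elim (auto simp: euclidean_all_zero_iff)
qed

lemma WD_unique:
  assumes "WD a b f h" "WD a b f' h'" "a \<le> b" "\<And>x. x \<in> {a..b} \<Longrightarrow> f x = f' x"
  shows "AE x\<in>{a..b} in lebesgue. h x = h' x"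
  using WD_zero_AE[OF WD_diff[OF assms(1,2)] assms(3), of 0] assms(4) by auto

lemma WD_mono:
  fixes f :: "real \<Rightarrow> real"
  assumes "WD a b f h" "AE x\<in>{a..b} in lebesgue. 0 \<le> h x" "a \<le> b"
  shows "f a \<le> f b"
proof -
  have "((\<lambda>x. max 0 (h x)) has_integral f b - f a) {a..b}"
    by (rule has_integral_cong_AE[OF WD_int[OF assms(1)]]) (use assms(2,3) in \<open>auto elim!: eventually_mono\<close>)
  then have "0 \<le> f b - f a" by (rule has_integral_nonneg) auto
  then show ?thesis by simp
qed

lemma WD_const_if_zero:
  assumes "WD a b f h" "AE x\<in>{a..b} in lebesgue. h x = 0" "a \<le> b"
  shows "f a = f b"
proof -
  have "((\<lambda>x. 0) has_integral f b - f a) {a..b}"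
    by (rule has_integral_cong_AE[OF WD_int[OF assms(1)]]) (use assms in auto)
  then have "f b - f a = 0" using has_integral_unique has_integral_0 by blast
  then show ?thesis by simp
qed

section \<open>The product rule\<close>

lemma bounded_measurable_integrable:
  fixes h :: "real \<Rightarrow> 'a::euclidean_space"
  assumes "h \<in> borel_measurable lebesgue" "\<And>x. x \<in> {a..b} \<Longrightarrow> norm (h x) \<le> B"
  shows "h integrable_on {a..b}"
  using measurable_bounded_lemma[OF assms(1), of "\<lambda>x. B" a b] assms(2) by auto

lemma WD_integral:
  fixes h :: "real \<Rightarrow> 'a::euclidean_space"
  assumes h: "h \<in> borel_measurable lebesgue" and B: "\<And>x. x \<in> {a..b} \<Longrightarrow> norm (h x) \<le> B"
  shows "WD a b (\<lambda>s. integral {a..s} h) h"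
proof -
  have int: "h integrable_on {s..t}" if "a \<le> s" "t \<le> b" for s t
    using that by (intro bounded_measurable_integrable[OF h, of _ _ B] B) auto
  have di: "integral {a..t} h - integral {a..s} h = integral {s..t} h" if "a \<le> s" "s \<le> t" "t \<le> b" for s t
    using Henstock_Kurzweil_Integration.integral_combine[OF that(1,2) int[OF order_refl that(3)]] by (metis add_diff_cancel_left')
  have "(max B 0)-lipschitz_on {a..b} (\<lambda>s. integral {a..s} h)"
  proof (rule lipschitz_on_leI)
    fix s t assume st: "s \<in> {a..b}" "t \<in> {a..b}" "s \<le> t"
    have "norm (integral {s..t} h) \<le> max B 0 * measure lborel {s..t}"
    proof (rule has_integral_bound_real[of _ "{}"])
      show "(h has_integral integral {s..t} h) {s..t}"
        using int[of s t] st by (simp add: integrable_integral)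
    qed (use st B in \<open>auto simp: le_max_iff_disj\<close>)
    then show "dist (integral {a..s} h) (integral {a..t} h) \<le> max B 0 * dist s t"
      using st di[of s t] by (simp add: dist_norm norm_minus_commute[of "integral {a..s} h"])
  qed auto
  moreover have "(h has_integral integral {a..t} h - integral {a..s} h) {s..t}"
    if "a \<le> s" "s \<le> t" "t \<le> b" for s t
    using di[OF that] int[OF that(1,3)] by (simp add: integrable_integral)
  ultimately show ?thesis by (auto simp: WD_def)
qed

text \<open>Increments of second order force the derivative to vanish at every point. The estimate
  is required only for x \<le> y, the form in which bounds on integrals over [x, y] deliver
  it.\<close>

lemma quadratic_increment_const:
  fixes \<Phi> :: "real \<Rightarrow> 'a::real_normed_vector"
  assumes "\<And>x y. x \<in> {a..b} \<Longrightarrow> y \<in> {a..b} \<Longrightarrow> x \<le> y \<Longrightarrow> norm (\<Phi> y - \<Phi> x) \<le> C * (y - x)\<^sup>2"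
    and "a \<le> s" "s \<le> t" "t \<le> b"
  shows "\<Phi> t = \<Phi> s"
proof (rule has_derivative_zero_unique[of "{a..b}"])
  have sym: "norm (\<Phi> y - \<Phi> x) \<le> \<bar>C\<bar> * (y - x)\<^sup>2" if "x \<in> {a..b}" "y \<in> {a..b}" for x y
  proof (cases "x \<le> y")
    case True
    have "C * (y - x)\<^sup>2 \<le> \<bar>C\<bar> * (y - x)\<^sup>2" by (intro mult_right_mono) auto
    with assms(1)[OF that True] show ?thesis by linarith
  next
    case False
    have "C * (x - y)\<^sup>2 \<le> \<bar>C\<bar> * (x - y)\<^sup>2" by (intro mult_right_mono) auto
    moreover have "norm (\<Phi> x - \<Phi> y) \<le> C * (x - y)\<^sup>2" using assms(1)[of y x] that False by auto
    ultimately show ?thesis by (metis norm_minus_commute power2_commute order_trans)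
  qed
  fix x assume x: "x \<in> {a..b}"
  show "(\<Phi> has_derivative (\<lambda>h. 0)) (at x within {a..b})"
    unfolding has_derivative_within_alt
  proof (intro conjI allI impI bounded_linear_zero)
    fix e :: real assume e: "e > 0"
    show "\<exists>d>0. \<forall>y\<in>{a..b}. norm (y - x) < d \<longrightarrow> norm (\<Phi> y - \<Phi> x - 0) \<le> e * norm (y - x)"
    proof (intro exI[of _ "e / (\<bar>C\<bar> + 1)"] conjI ballI impI)
      show "0 < e / (\<bar>C\<bar> + 1)" using e by simp
      fix y assume y: "y \<in> {a..b}" "norm (y - x) < e / (\<bar>C\<bar> + 1)"
      have "\<bar>C\<bar> * \<bar>y - x\<bar> \<le> (\<bar>C\<bar> + 1) * \<bar>y - x\<bar>" by (intro mult_right_mono) auto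
      also have "\<dots> \<le> e" using y(2) by (simp add: field_simps)
      finally have "\<bar>C\<bar> * \<bar>y - x\<bar> * \<bar>y - x\<bar> \<le> e * \<bar>y - x\<bar>" by (intro mult_right_mono) auto
      then show "norm (\<Phi> y - \<Phi> x - 0) \<le> e * norm (y - x)"
        using sym[OF x y(1)] by (simp add: power2_eq_square mult.assoc flip: abs_mult)
    qed
  qed
qed (use assms in auto)

lemma lipschitz_bounded_norm:
  fixes f :: "real \<Rightarrow> 'a::real_normed_vector"
  assumes "L-lipschitz_on {a..b} f"
  obtains B where "B \<ge> 0" "\<And>x. x \<in> {a..b} \<Longrightarrow> norm (f x) \<le> B"
proof -
  have "compact (f ` {a..b})"
    by (intro compact_continuous_image lipschitz_on_continuous_on[OF assms]) auto
  then have "bounded (f ` {a..b})" by (rule compact_imp_bounded)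
  then obtain B where B: "\<forall>y\<in>f ` {a..b}. norm y \<le> B" unfolding bounded_iff by blast
  show ?thesis
  proof (rule that[of "max B 0"])
    fix x assume "x \<in> {a..b}"
    then have "norm (f x) \<le> B" using B by blast
    then show "norm (f x) \<le> max B 0" by simp
  qed simp
qed

lemma continuous_indicator_measurable:
  fixes f :: "real \<Rightarrow> 'a::euclidean_space"
  assumes "continuous_on {a..b} f"
  shows "(\<lambda>x. indicator {a..b} x *\<^sub>R f x) \<in> borel_measurable lebesgue"
proof -
  have "(\<lambda>x. indicator {a..b} x *\<^sub>R f x) \<in> borel_measurable borel"
    by (rule borel_measurable_continuous_on_indicator) (use assms in auto)
  then show ?thesis by (simp add: measurable_completion)
qed

lemma measurable_bilinear:
  fixes u :: "real \<Rightarrow> 'a::euclidean_space" and v :: "real \<Rightarrow> 'b::euclidean_space"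
    and p :: "'a \<Rightarrow> 'b \<Rightarrow> 'c::euclidean_space"
  assumes "bounded_bilinear p" "u \<in> borel_measurable M" "v \<in> borel_measurable M"
  shows "(\<lambda>x. p (u x) (v x)) \<in> borel_measurable M"
proof -
  have "continuous_on UNIV (\<lambda>x. p (fst x) (snd x))"
    by (intro bounded_bilinear.continuous_on[OF assms(1)] continuous_intros)
  then have "(\<lambda>x. p (fst x) (snd x)) \<in> borel_measurable borel" by (rule borel_measurable_continuous_onI)
  moreover have "(\<lambda>x. (u x, v x)) \<in> borel_measurable M" using assms by measurable
  ultimately have "(\<lambda>x. p (fst (u x, v x)) (snd (u x, v x))) \<in> borel_measurable M"
    by (rule measurable_compose[rotated])
  then show ?thesis by simp
qed

text \<open>The two sides of the product rule differ by a function with quadratically small increments.\<close>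

lemma WD_bilinear:
  fixes f :: "real \<Rightarrow> 'a::euclidean_space" and g :: "real \<Rightarrow> 'b::euclidean_space"
    and p :: "'a \<Rightarrow> 'b \<Rightarrow> 'c::euclidean_space"
  assumes p: "bounded_bilinear p" and f: "WD a b f h" and g: "WD a b g k" and ab: "a \<le> b"
  shows "WD a b (\<lambda>x. p (f x) (g x)) (\<lambda>x. p (h x) (g x) + p (f x) (k x))"
proof -
  interpret bounded_bilinear p by fact
  obtain h' Bh where h': "h' \<in> borel_measurable lebesgue" "\<And>x. norm (h' x) \<le> Bh" "Bh \<ge> 0" "WD a b f h'"
    "AE x\<in>{a..b} in lebesgue. h' x = h x" by (rule WD_nice[OF f ab]) (rule that)
  obtain k' Bk where k': "k' \<in> borel_measurable lebesgue" "\<And>x. norm (k' x) \<le> Bk" "Bk \<ge> 0" "WD a b g k'"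
    "AE x\<in>{a..b} in lebesgue. k' x = k x" by (rule WD_nice[OF g ab]) (rule that)
  obtain Lf where Lf: "Lf-lipschitz_on {a..b} f" using WD_lip[OF f] by auto
  obtain Lg where Lg: "Lg-lipschitz_on {a..b} g" using WD_lip[OF g] by auto
  obtain Bf where Bf: "Bf \<ge> 0" "\<And>x. x \<in> {a..b} \<Longrightarrow> norm (f x) \<le> Bf" by (rule lipschitz_bounded_norm[OF Lf]) (rule that)
  obtain Bg where Bg: "Bg \<ge> 0" "\<And>x. x \<in> {a..b} \<Longrightarrow> norm (g x) \<le> Bg" by (rule lipschitz_bounded_norm[OF Lg]) (rule that)
  obtain K where K: "K > 0" "\<And>x y. norm (p x y) \<le> norm x * norm y * K" using pos_bounded by auto
  have L0: "Lf \<ge> 0" "Lg \<ge> 0" using lipschitz_on_nonneg Lf Lg by auto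
  \<comment> \<open>The factors are cut off outside [a, b], where they are arbitrary, so that the
    candidate density \<open>H\<close> is measurable on the whole line.\<close>
  define fi where "fi x = indicator {a..b} x *\<^sub>R f x" for x
  define gi where "gi x = indicator {a..b} x *\<^sub>R g x" for x
  have mf: "fi \<in> borel_measurable lebesgue" "gi \<in> borel_measurable lebesgue"
    unfolding fi_def[abs_def] gi_def[abs_def]
    by (intro continuous_indicator_measurable WD_continuous[OF f] WD_continuous[OF g])+
  define H where "H x = p (h' x) (gi x) + p (fi x) (k' x)" for x
  have Hm: "H \<in> borel_measurable lebesgue"
    unfolding H_def[abs_def] by (intro borel_measurable_add measurable_bilinear[OF p] mf h' k')
  have HB: "norm (H x) \<le> Bh * Bg * K + Bf * Bk * K" for x
  proof -
    have "norm (gi x) \<le> Bg" "norm (fi x) \<le> Bf" using Bf Bg by (auto simp: fi_def gi_def indicator_def)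
    then have "norm (h' x) * norm (gi x) * K \<le> Bh * Bg * K" "norm (fi x) * norm (k' x) * K \<le> Bf * Bk * K"
      using h'(2)[of x] k'(2)[of x] h'(3) k'(3) K Bf Bg
      by (intro mult_right_mono mult_mono; simp)+
    then show ?thesis unfolding H_def
      using K(2)[of "h' x" "gi x"] K(2)[of "fi x" "k' x"] norm_triangle_ineq[of "p (h' x) (gi x)" "p (fi x) (k' x)"]
      by linarith
  qed
  have WH: "WD a b (\<lambda>s. integral {a..s} H) H" using WD_integral[OF Hm HB] .
  obtain LH where LH: "LH-lipschitz_on {a..b} (\<lambda>s. integral {a..s} H)" using WD_lip[OF WH] by auto
  define \<Phi> where "\<Phi> s = p (f s) (g s) - integral {a..s} H" for s
  have quad: "norm (\<Phi> y - \<Phi> x) \<le> ((Bh * Lg + Lf * Bk) * K) * (y - x)\<^sup>2"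
    if xy: "x \<in> {a..b}" "y \<in> {a..b}" "x \<le> y" for x y
  proof -
    have xy': "a \<le> x" "x \<le> y" "y \<le> b" using xy by auto
    \<comment> \<open>Freezing \<open>g\<close> at \<open>y\<close> and \<open>f\<close> at
      \<open>x\<close> splits the increment of the product exactly into two integrals. Compared with
      \<open>H\<close>, each integrand is off by a Lipschitz difference times a bounded density,
      hence by O(y - x); integration gives the second order.\<close>
    have i1: "((\<lambda>z. p (h' z) (g y)) has_integral p (f y - f x) (g y)) {x..y}"
      using has_integral_linear[OF WD_int[OF h'(4) xy'] bounded_linear_left] by (simp add: o_def)
    have i2: "((\<lambda>z. p (f x) (k' z)) has_integral p (f x) (g y - g x)) {x..y}"
      using has_integral_linear[OF WD_int[OF k'(4) xy'] bounded_linear_right] by (simp add: o_def)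
    have i3: "(H has_integral (integral {a..y} H - integral {a..x} H)) {x..y}"
      using WD_int[OF WH xy'] .
    have "((\<lambda>z. p (h' z) (g y) + p (f x) (k' z) - H z) has_integral
        p (f y - f x) (g y) + p (f x) (g y - g x) - (integral {a..y} H - integral {a..x} H)) {x..y}"
      by (intro has_integral_diff has_integral_add i1 i2 i3)
    moreover have "p (f y - f x) (g y) + p (f x) (g y - g x) - (integral {a..y} H - integral {a..x} H)
        = \<Phi> y - \<Phi> x"
      by (simp add: \<Phi>_def diff_left diff_right)
    ultimately have i4: "((\<lambda>z. p (h' z) (g y) + p (f x) (k' z) - H z) has_integral \<Phi> y - \<Phi> x) {x..y}" by simp
    have "norm (\<Phi> y - \<Phi> x) \<le> ((Bh * Lg + Lf * Bk) * K * (y - x)) * measure lborel {x..y}"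
    proof (rule has_integral_bound_real[OF _ finite.emptyI i4])
      show "0 \<le> (Bh * Lg + Lf * Bk) * K * (y - x)" using xy K L0 h'(3) k'(3) by simp
      fix z assume "z \<in> {x..y} - {}"
      then have z: "z \<in> {x..y}" by simp
      then have zab: "z \<in> {a..b}" using xy by auto
      have e: "p (h' z) (g y) + p (f x) (k' z) - H z = p (h' z) (g y - g z) + p (f x - f z) (k' z)"
        using zab by (simp add: H_def fi_def gi_def diff_left diff_right)
      have "norm (g y - g z) \<le> Lg * (y - z)" using lipschitz_onD[OF Lg, of y z] xy z by (auto simp: dist_norm)
      also have "\<dots> \<le> Lg * (y - x)" using z L0 by (intro mult_left_mono) auto
      finally have n1: "norm (g y - g z) \<le> Lg * (y - x)" .
      have "norm (f x - f z) \<le> Lf * (z - x)" using lipschitz_onD[OF Lf, of x z] xy z by (auto simp: dist_norm)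
      also have "\<dots> \<le> Lf * (y - x)" using z L0 by (intro mult_left_mono) auto
      finally have n2: "norm (f x - f z) \<le> Lf * (y - x)" .
      have "norm (h' z) * norm (g y - g z) * K \<le> Bh * (Lg * (y - x)) * K"
        using n1 h'(2)[of z] h'(3) K by (intro mult_right_mono mult_mono) auto
      moreover have "norm (f x - f z) * norm (k' z) * K \<le> Lf * (y - x) * Bk * K"
        using n2 k'(2)[of z] k'(3) K L0 xy by (intro mult_right_mono mult_mono) auto
      ultimately show "norm (p (h' z) (g y) + p (f x) (k' z) - H z) \<le> (Bh * Lg + Lf * Bk) * K * (y - x)"
        unfolding e using K(2)[of "h' z" "g y - g z"] K(2)[of "f x - f z" "k' z"]
          norm_triangle_ineq[of "p (h' z) (g y - g z)" "p (f x - f z) (k' z)"]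
        by (simp add: algebra_simps)
    qed
    then show ?thesis using xy by (simp add: power2_eq_square mult.assoc)
  qed
  have const: "\<Phi> s = \<Phi> a" if "s \<in> {a..b}" for s
    using quadratic_increment_const[of a b \<Phi>, OF quad, of a s] that by auto
  have eq: "integral {a..s} H + \<Phi> a = p (f s) (g s)" if "s \<in> {a..b}" for s
    using const[OF that] by (simp add: \<Phi>_def diff_eq_eq)
  have "WD a b (\<lambda>s. integral {a..s} H + \<Phi> a) (\<lambda>x. H x + 0)"
    by (intro WD_add WH WD_const)
  then have "WD a b (\<lambda>s. p (f s) (g s)) H" using WD_cong eq by fastforce
  moreover have "AE x\<in>{a..b} in lebesgue. H x = p (h x) (g x) + p (f x) (k x)"
    using h'(5) k'(5) by eventually_elim (auto simp: H_def fi_def gi_def)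
  ultimately show ?thesis by (rule WD_cong_AE)
qed

section \<open>Reciprocals, norms and level sets\<close>

lemma WD_mult:
  fixes f g :: "real \<Rightarrow> real"
  assumes "WD a b f h" "WD a b g k" "a \<le> b"
  shows "WD a b (\<lambda>x. f x * g x) (\<lambda>x. h x * g x + f x * k x)"
  by (rule WD_bilinear[OF bounded_bilinear_mult assms])

lemma WD_scaleR:
  assumes "WD a b f h" "WD a b g k" "a \<le> b"
  shows "WD a b (\<lambda>x. f x *\<^sub>R g x) (\<lambda>x. h x *\<^sub>R g x + f x *\<^sub>R k x)"
  by (rule WD_bilinear[OF bounded_bilinear_scaleR assms])

lemma WD_inner:
  assumes "WD a b f h" "WD a b g k" "a \<le> b"
  shows "WD a b (\<lambda>x. f x \<bullet> g x) (\<lambda>x. h x \<bullet> g x + f x \<bullet> k x)"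
  by (rule WD_bilinear[OF bounded_bilinear_inner assms])

text \<open>The reciprocal is Lipschitz and so has some density; the product rule for u * (1/u) = 1
  then identifies it.\<close>

lemma WD_inverse:
  fixes u :: "real \<Rightarrow> real"
  assumes u: "WD a b u h" and ab: "a \<le> b" and c: "c > 0" "\<And>x. x \<in> {a..b} \<Longrightarrow> c \<le> u x"
  shows "WD a b (\<lambda>x. inverse (u x)) (\<lambda>x. - h x * (inverse (u x))\<^sup>2)"
proof -
  obtain L where L: "L-lipschitz_on {a..b} u" using WD_lip[OF u] by auto
  have "(L / c\<^sup>2)-lipschitz_on {a..b} (\<lambda>x. inverse (u x))"
  proof (rule lipschitz_onI)
    fix x y assume xy: "x \<in> {a..b}" "y \<in> {a..b}"
    have ux: "c \<le> u x" "c \<le> u y" using c(2) xy by auto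
    have "\<bar>inverse (u x) - inverse (u y)\<bar> = \<bar>u x - u y\<bar> / (u x * u y)"
      using ux c(1) by (simp add: field_simps abs_if)
    also have "\<dots> \<le> (L * dist x y) / (c * c)"
    proof (rule frac_le)
      show "\<bar>u x - u y\<bar> \<le> L * dist x y" using lipschitz_onD[OF L xy] by (simp add: dist_norm)
      show "c * c \<le> u x * u y" using ux c(1) by (intro mult_mono) auto
    qed (use c lipschitz_on_nonneg[OF L] in auto)
    finally show "dist (inverse (u x)) (inverse (u y)) \<le> L / c\<^sup>2 * dist x y"
      by (simp add: dist_norm power2_eq_square)
  qed (use lipschitz_on_nonneg[OF L] in auto)
  then obtain k where k: "WD a b (\<lambda>x. inverse (u x)) k" using WD_exists ab by blast
  have "AE x\<in>{a..b} in lebesgue. h x * inverse (u x) + u x * k x = 0"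
    by (rule WD_zero_AE[OF WD_mult[OF u k ab] ab, of 1]) (use c in force)
  then have "AE x\<in>{a..b} in lebesgue. k x = - h x * (inverse (u x))\<^sup>2"
  proof eventually_elim
    case (elim x)
    show ?case
    proof
      assume "x \<in> {a..b}"
      then have e: "h x * inverse (u x) + u x * k x = 0" and "u x \<noteq> 0" using elim c by force+
      have "k x = inverse (u x) * (u x * k x)" using \<open>u x \<noteq> 0\<close> by simp
      also have "u x * k x = - (h x * inverse (u x))" using e by linarith
      finally show "k x = - h x * (inverse (u x))\<^sup>2" by (simp add: power2_eq_square)
    qed
  qed
  then show ?thesis by (rule WD_cong_AE[OF k])
qed

lemma lipschitz_on_norm:
  fixes f :: "real \<Rightarrow> 'a::real_normed_vector"
  assumes "L-lipschitz_on X f"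
  shows "L-lipschitz_on X (\<lambda>x. norm (f x))"
proof (rule lipschitz_onI)
  fix x y assume "x \<in> X" "y \<in> X"
  then have "norm (f x - f y) \<le> L * dist x y" using lipschitz_onD[OF assms] by (simp add: dist_norm)
  then show "dist (norm (f x)) (norm (f y)) \<le> L * dist x y"
    using norm_triangle_ineq3[of "f x" "f y"] by (simp add: dist_real_def)
qed (rule lipschitz_on_nonneg[OF assms])

text \<open>The norm is Lipschitz, and the product rule is applied to both sides of
  \<open>norm (f x) * norm (f x) = f x \<bullet> f x\<close>. The factor \<open>norm (f x)\<close>
  is not divided out since \<open>f\<close> may vanish; at zeros of \<open>f\<close> the identity
  leaves the value of \<open>m\<close> open.\<close>

lemma WD_norm_exists:
  assumes "WD a b f h" "a \<le> b"
  obtains m where "WD a b (\<lambda>x. norm (f x)) m"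
    "AE x\<in>{a..b} in lebesgue. norm (f x) * m x = f x \<bullet> h x"
proof -
  obtain L where "L-lipschitz_on {a..b} f" using WD_lip[OF assms(1)] by auto
  then have "L-lipschitz_on {a..b} (\<lambda>x. norm (f x))" by (rule lipschitz_on_norm)
  then obtain m where m: "WD a b (\<lambda>x. norm (f x)) m" using WD_exists assms(2) by blast
  have "AE x\<in>{a..b} in lebesgue. m x * norm (f x) + norm (f x) * m x = h x \<bullet> f x + f x \<bullet> h x"
    by (rule WD_unique[OF WD_mult[OF m m assms(2)] WD_inner[OF assms(1,1,2)] assms(2)])
       (simp add: norm_eq_sqrt_inner)
  then have "AE x\<in>{a..b} in lebesgue. norm (f x) * m x = f x \<bullet> h x"
    by eventually_elim (auto simp: inner_commute mult.commute)
  with m show ?thesis using that by blast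
qed

lemma continuous_nonzero_lower_bound:
  fixes f :: "real \<Rightarrow> 'a::real_normed_vector"
  assumes "continuous_on {a..b} f" "\<And>x. x \<in> {a..b} \<Longrightarrow> f x \<noteq> 0"
  obtains c where "c > 0" "\<And>x. x \<in> {a..b} \<Longrightarrow> c \<le> norm (f x)"
proof (cases "a \<le> b")
  case True
  have "continuous_on {a..b} (\<lambda>x. norm (f x))" using assms(1) by (rule continuous_on_norm)
  then obtain z where "z \<in> {a..b}" "\<And>y. y \<in> {a..b} \<Longrightarrow> norm (f z) \<le> norm (f y)"
    using continuous_attains_inf[of "{a..b}" "\<lambda>x. norm (f x)"] True by (auto simp del: atLeastAtMost_iff)
  then show ?thesis using that[of "norm (f z)"] assms(2) by simp
qed (use that[of 1] in auto)

lemma WD_norm: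
  assumes "WD a b f h" "a \<le> b" "\<And>x. x \<in> {a..b} \<Longrightarrow> f x \<noteq> 0"
  shows "WD a b (\<lambda>x. norm (f x)) (\<lambda>x. (f x \<bullet> h x) / norm (f x))"
proof -
  obtain m where m: "WD a b (\<lambda>x. norm (f x)) m"
    "AE x\<in>{a..b} in lebesgue. norm (f x) * m x = f x \<bullet> h x"
    by (rule WD_norm_exists[OF assms(1,2)]) (rule that)
  have "AE x\<in>{a..b} in lebesgue. m x = (f x \<bullet> h x) / norm (f x)"
    using m(2) by eventually_elim (use assms(3) in \<open>auto simp: field_simps\<close>)
  then show ?thesis by (rule WD_cong_AE[OF m(1)])
qed

lemma WD_inverse_norm:
  assumes "WD a b f h" "a \<le> b" "\<And>x. x \<in> {a..b} \<Longrightarrow> f x \<noteq> 0"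
  shows "WD a b (\<lambda>x. inverse (norm (f x))) (\<lambda>x. - (f x \<bullet> h x) / norm (f x) ^ 3)"
proof -
  obtain c where c: "c > 0" "\<And>x. x \<in> {a..b} \<Longrightarrow> c \<le> norm (f x)"
    by (rule continuous_nonzero_lower_bound[OF WD_continuous[OF assms(1)] assms(3)]) auto
  show ?thesis
    by (rule WD_cong_AE[OF WD_inverse[OF WD_norm[OF assms] assms(2) c]])
       (use assms(3) in \<open>auto simp: divide_simps power2_eq_square power3_eq_cube\<close>)
qed

lemma WD_normalize:
  assumes "WD a b f h" "a \<le> b" "\<And>x. x \<in> {a..b} \<Longrightarrow> f x \<noteq> 0"
  shows "WD a b (\<lambda>x. f x /\<^sub>R norm (f x))
    (\<lambda>x. (- (f x \<bullet> h x) / norm (f x) ^ 3) *\<^sub>R f x + h x /\<^sub>R norm (f x))"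
  using WD_scaleR[OF WD_inverse_norm[OF assms] assms(1,2)] by simp

text \<open>\<open>f\<close> is the limit of \<open>f\<^sup>3 / (f\<^sup>2 + \<epsilon>)\<close>, whose derivative vanishes on the zero set of \<open>f\<close> and
  tends to that of \<open>f\<close> elsewhere.\<close>

lemma WD_level_set:
  fixes f :: "real \<Rightarrow> real"
  assumes f: "WD a b f h" and ab: "a \<le> b"
  shows "AE x\<in>{a..b} in lebesgue. f x = 0 \<longrightarrow> h x = 0"
proof -
  obtain h' B where h': "h' \<in> borel_measurable lebesgue" "\<And>x. norm (h' x) \<le> B" "B \<ge> 0" "WD a b f h'"
    "AE x\<in>{a..b} in lebesgue. h' x = h x" by (rule WD_nice[OF f ab]) (rule that)
  define e where "e n = inverse (real (Suc n))" for n
  have e0: "e n > 0" for n by (simp add: e_def)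
  have elim: "e \<longlonglongrightarrow> 0" unfolding e_def[abs_def] by (rule LIMSEQ_inverse_real_of_nat)
  define q where "q n x = inverse (f x * f x + e n)" for n x
  \<comment> \<open>\<open>F n\<close> is the derivative of \<open>P n\<close>. Writing f^3 / (f^2 +
    e) as f - e f / (f^2 + e) means that only the reciprocal \<open>q n\<close> has to be
    differentiated.\<close>
  define F where "F n x = h' x * (1 - e n * q n x * (1 - 2 * (f x * f x) * q n x))" for n x
  define P where "P n x = f x - e n * (f x * q n x)" for n x
  have den: "f x * f x + e n > 0" for n x using e0[of n] by (simp add: add_nonneg_pos)
  have W: "WD a b (P n) (F n)" for n
  proof -
    have w1: "WD a b (\<lambda>x. f x * f x + e n) (\<lambda>x. (h' x * f x + f x * h' x) + 0)"
      by (intro WD_add WD_mult h'(4) ab WD_const)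
    have w2: "WD a b (q n) (\<lambda>x. - ((h' x * f x + f x * h' x) + 0) * (q n x)\<^sup>2)"
      unfolding q_def[abs_def] by (rule WD_inverse[OF w1 ab e0[of n]]) simp
    have w3: "WD a b (\<lambda>x. f x * q n x) (\<lambda>x. h' x * q n x + f x * (- ((h' x * f x + f x * h' x) + 0) * (q n x)\<^sup>2))"
      by (rule WD_mult[OF h'(4) w2 ab])
    have w4: "WD a b (P n) (\<lambda>x. h' x - e n *\<^sub>R (h' x * q n x + f x * (- ((h' x * f x + f x * h' x) + 0) * (q n x)\<^sup>2)))"
      using WD_diff[OF h'(4) WD_scaleR_const[OF w3, of "e n"]] by (simp add: P_def[abs_def])
    show ?thesis by (rule WD_cong_AE[OF w4]) (simp add: F_def algebra_simps power2_eq_square)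
  qed
  define G where "G x = (if f x = 0 then 0 else h' x)" for x
  have eq0: "e n * q n x = 1" if "f x = 0" for n x using e0[of n] that by (simp add: q_def)
  have eqlim: "(\<lambda>n. e n * q n x) \<longlonglongrightarrow> 0" if "f x \<noteq> 0" for x
  proof -
    have "(\<lambda>n. e n * inverse (f x * f x + e n)) \<longlonglongrightarrow> 0 * inverse (f x * f x + 0)"
      by (intro tendsto_intros elim) (use that in auto)
    then show ?thesis by (simp add: q_def)
  qed
  have qlim: "(\<lambda>n. q n x) \<longlonglongrightarrow> inverse (f x * f x)" if "f x \<noteq> 0" for x
  proof -
    have "(\<lambda>n. inverse (f x * f x + e n)) \<longlonglongrightarrow> inverse (f x * f x + 0)"
      by (intro tendsto_intros elim) (use that in auto)
    then show ?thesis by (simp add: q_def)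
  qed
  have Plim: "(\<lambda>n. P n x) \<longlonglongrightarrow> f x" for x
  proof (cases "f x = 0")
    case True then show ?thesis by (simp add: P_def)
  next
    case False
    have "(\<lambda>n. f x - f x * (e n * q n x)) \<longlonglongrightarrow> f x - f x * 0"
      by (intro tendsto_intros eqlim False)
    then show ?thesis by (simp add: P_def mult_ac)
  qed
  have Flim: "(\<lambda>n. F n x) \<longlonglongrightarrow> G x" for x
  proof (cases "f x = 0")
    case True then show ?thesis using eq0[OF True] by (simp add: F_def G_def)
  next
    case False
    have "(\<lambda>n. F n x) \<longlonglongrightarrow> h' x * (1 - 0 * (1 - 2 * (f x * f x) * inverse (f x * f x)))"
      unfolding F_def by (intro tendsto_intros eqlim qlim False)
    then show ?thesis using False by (simp add: G_def)
  qed
  have Fb: "norm (F n x) \<le> B * 2" for n x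
  proof -
    have q0: "q n x > 0" using den by (simp add: q_def)
    have one: "e n * q n x + (f x * f x) * q n x = 1"
    proof -
      have "(f x * f x + e n) * inverse (f x * f x + e n) = 1" using den[of x n] by (intro right_inverse) simp
      then show ?thesis by (simp add: q_def algebra_simps)
    qed
    \<comment> \<open>As u and v are nonnegative with sum 1, the factor 1 - u (1 - 2 v) is at most 2
      in modulus for every n; this is the domination needed to pass to the limit.\<close>
    define u where "u = e n * q n x"
    define v where "v = (f x * f x) * q n x"
    have uv: "u + v = 1" "u \<ge> 0" "v \<ge> 0" using one q0 e0[of n] by (auto simp: u_def v_def)
    have "\<bar>1 - u * (1 - 2 * v)\<bar> \<le> 2"
    proof -
      have "u * (1 - 2 * v) \<le> 1"
      proof -
        have "u * (1 - 2 * v) = u - 2 * (u * v)" by (simp add: algebra_simps)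
        then show ?thesis using uv mult_nonneg_nonneg[OF uv(2,3)] by linarith
      qed
      moreover have "u * (1 - 2 * v) \<ge> - 1"
      proof -
        have "u * (2 * v - 1) \<le> u * 1" using uv by (intro mult_left_mono) auto
        then show ?thesis using uv by (simp add: algebra_simps)
      qed
      ultimately show ?thesis by auto
    qed
    moreover have "F n x = h' x * (1 - u * (1 - 2 * v))" by (simp add: F_def u_def v_def)
    ultimately show ?thesis using h'(2)[of x] h'(3) by (auto simp: abs_mult intro!: mult_mono)
  qed
  have "WD a b f G"
    unfolding WD_def
  proof (intro conjI allI impI)
    show "\<exists>L. L-lipschitz_on {a..b} f" using WD_lip[OF f] .
    fix s t assume st: "a \<le> s \<and> s \<le> t \<and> t \<le> b"
    show "(G has_integral f t - f s) {s..t}"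
    proof (rule has_integral_dominated_convergence)
      show "(F n has_integral P n t - P n s) {s..t}" for n using WD_int[OF W] st by auto
      show "(\<lambda>x. B * 2) integrable_on {s..t}" by (rule integrable_const_ivl)
      show "(\<lambda>n. P n t - P n s) \<longlonglongrightarrow> f t - f s" by (intro tendsto_diff Plim)
    qed (use Fb Flim in auto)
  qed
  then have "AE x\<in>{a..b} in lebesgue. h x = G x"
    by (rule WD_unique[OF f _ ab]) auto
  then show ?thesis by eventually_elim (auto simp: G_def)
qed

section \<open>Classical against weak derivatives\<close>

lemma WD_has_vector_derivative:
  fixes f :: "real \<Rightarrow> 'a::euclidean_space"
  assumes f: "WD a b f h" and h: "continuous_on {a..b} h" and x: "x \<in> {a..b}"
  shows "(f has_vector_derivative h x) (at x within {a..b})"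
proof -
  have "((\<lambda>u. f a + integral {a..u} h) has_vector_derivative 0 + h x) (at x within {a..b})"
    by (intro has_vector_derivative_add has_vector_derivative_const integral_has_vector_derivative h x)
  moreover have "f a + integral {a..u} h = f u" if "u \<in> {a..b}" for u
    using integral_unique[OF WD_int[OF f order_refl, of u]] that by auto
  ultimately show ?thesis
    using has_vector_derivative_transform[OF x] by (metis (no_types, lifting) add_0)
qed

lemma has_vector_derivative_imp_WD:
  fixes f :: "real \<Rightarrow> 'a::euclidean_space"
  assumes "\<And>x. x \<in> {a..b} \<Longrightarrow> (f has_vector_derivative h x) (at x within {a..b})"
    and "L-lipschitz_on {a..b} f"
  shows "WD a b f h"
proof -
  have "(h has_integral f t - f s) {s..t}" if "a \<le> s" "s \<le> t" "t \<le> b" for s t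
  proof (rule fundamental_theorem_of_calculus[OF that(2)])
    fix x assume "x \<in> {s..t}"
    then show "(f has_vector_derivative h x) (at x within {s..t})"
      using assms(1)[of x] that by (auto intro: has_vector_derivative_within_subset)
  qed
  then show ?thesis using assms(2) by (auto simp: WD_def)
qed

lemma C1_imp_WD:
  fixes f :: "real \<Rightarrow> 'a::euclidean_space"
  assumes f: "\<And>x. x \<in> {a..b} \<Longrightarrow> (f has_vector_derivative h x) (at x within {a..b})"
    and h: "continuous_on {a..b} h"
  shows "WD a b f h"
proof -
  have "compact (h ` {a..b})" by (intro compact_continuous_image h) auto
  then have "bounded (h ` {a..b})" by (rule compact_imp_bounded)
  then obtain B where B: "\<forall>y\<in>h ` {a..b}. norm y \<le> B" unfolding bounded_iff by blast
  have "(max B 0)-lipschitz_on {a..b} f"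
  proof (rule bounded_derivative_imp_lipschitz)
    show "(f has_derivative (\<lambda>t. t *\<^sub>R h x)) (at x within {a..b})" if "x \<in> {a..b}" for x
      using f[OF that] by (simp add: has_vector_derivative_def)
    show "onorm (\<lambda>t. t *\<^sub>R h x) \<le> max B 0" if "x \<in> {a..b}" for x
    proof (rule onorm_le)
      fix t :: real
      have "norm (h x) \<le> max B 0" using B that by (auto simp: le_max_iff_disj)
      then show "norm (t *\<^sub>R h x) \<le> max B 0 * norm t"
        by (simp add: mult.commute mult_left_mono)
    qed
  qed auto
  with f show ?thesis by (rule has_vector_derivative_imp_WD)
qed

text \<open>\<open>V t\<close> is the total variation over {a..t}: any partition of {a..x} can be
  prolonged to one of {a..y} that contains the jump from x to y. The inequality for \<open>V\<close>
  is the only form in which bounded variation is used later.\<close>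

lemma bounded_variation_dominating_function:
  assumes "bounded_variation_on a b \<alpha>"
  obtains V where "\<And>x y. a \<le> x \<Longrightarrow> x \<le> y \<Longrightarrow> y \<le> b \<Longrightarrow> \<bar>\<alpha> y - \<alpha> x\<bar> \<le> V y - V x"
proof -
  define P where "P t p m \<longleftrightarrow> a \<le> p 0 \<and> p m \<le> t \<and> (\<forall>i<m. p i \<le> p (Suc i))"
    for t :: real and p :: "nat \<Rightarrow> real" and m :: nat
  define S where "S p m = (\<Sum>i<m. \<bar>\<alpha> (p (Suc i)) - \<alpha> (p i)\<bar>)" for p :: "nat \<Rightarrow> real" and m
  obtain B where B: "\<And>p m. P b p m \<Longrightarrow> S p m \<le> B"
    using assms unfolding bounded_variation_on_def P_def S_def by blast
  define X where "X t = {S p m |p m. P t p m}" for t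
  define V where "V t = Sup (X t)" for t
  have bdd: "bdd_above (X t)" if "t \<le> b" for t
    using B that unfolding X_def P_def by (intro bdd_aboveI[of _ B]) force
  have "\<bar>\<alpha> y - \<alpha> x\<bar> \<le> V y - V x" if xy: "a \<le> x" "x \<le> y" "y \<le> b" for x y
  proof -
    have "V x \<le> V y - \<bar>\<alpha> y - \<alpha> x\<bar>"
      unfolding V_def[of x]
    proof (rule cSup_least)
      have "P x (\<lambda>_. a) 0" using xy by (simp add: P_def)
      then show "X x \<noteq> {}" unfolding X_def by blast
      fix v assume "v \<in> X x"
      then obtain p m where v: "v = S p m" and pm: "P x p m" unfolding X_def by blast
      \<comment> \<open>Two points are appended, since the last point \<open>p m\<close> may lie
        strictly before \<open>x\<close>.\<close>
      define p' where "p' i = (if i \<le> m then p i else if i = Suc m then x else y)" for i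
      have "P y p' (Suc (Suc m))"
        unfolding P_def
      proof (intro conjI allI impI)
        fix i assume "i < Suc (Suc m)"
        then consider "i < m" | "i = m" | "i = Suc m" by linarith
        then show "p' i \<le> p' (Suc i)" using pm xy by cases (auto simp: p'_def P_def)
      qed (use pm xy in \<open>auto simp: p'_def P_def\<close>)
      then have "S p' (Suc (Suc m)) \<le> V y"
        unfolding V_def using xy by (intro cSup_upper bdd) (auto simp: X_def)
      moreover have "S p' m = S p m" unfolding S_def by (intro sum.cong) (auto simp: p'_def)
      moreover have "S p' (Suc (Suc m)) = S p' m + \<bar>\<alpha> (p' (Suc m)) - \<alpha> (p' m)\<bar> + \<bar>\<alpha> (p' (Suc (Suc m))) - \<alpha> (p' (Suc m))\<bar>"
        by (simp add: S_def)
      moreover have "p' (Suc m) = x" "p' (Suc (Suc m)) = y" by (auto simp: p'_def)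
      ultimately show "v \<le> V y - \<bar>\<alpha> y - \<alpha> x\<bar>" using v by auto
    qed
    then show ?thesis by simp
  qed
  then show ?thesis using that by blast
qed

text \<open>Jordan decomposition: \<alpha> = V - (V - \<alpha>) with both terms monotone. Clamping
  the argument makes them monotone on the whole line.\<close>

lemma dominated_variation_measurable:
  fixes \<alpha> V :: "real \<Rightarrow> real"
  assumes V: "\<And>x y. a \<le> x \<Longrightarrow> x \<le> y \<Longrightarrow> y \<le> b \<Longrightarrow> \<bar>\<alpha> y - \<alpha> x\<bar> \<le> V y - V x" and ab: "a \<le> b"
  shows "(\<lambda>x. \<alpha> (max a (min b x))) \<in> borel_measurable borel"
proof -
  let ?c = "\<lambda>x. max a (min b x)"
  have c: "a \<le> ?c x" "?c x \<le> b" "x \<le> y \<Longrightarrow> ?c x \<le> ?c y" for x y using ab by auto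
  have "mono (\<lambda>x. V (?c x))"
  proof (rule monoI)
    fix x y :: real assume "x \<le> y"
    then have "\<bar>\<alpha> (?c y) - \<alpha> (?c x)\<bar> \<le> V (?c y) - V (?c x)" by (intro V c)
    then show "V (?c x) \<le> V (?c y)" by (meson abs_ge_zero diff_ge_0_iff_ge order_trans)
  qed
  moreover have "mono (\<lambda>x. V (?c x) - \<alpha> (?c x))"
  proof (rule monoI)
    fix x y :: real assume "x \<le> y"
    then have "\<bar>\<alpha> (?c y) - \<alpha> (?c x)\<bar> \<le> V (?c y) - V (?c x)" by (intro V c)
    then show "V (?c x) - \<alpha> (?c x) \<le> V (?c y) - \<alpha> (?c y)" by linarith
  qed
  ultimately have "(\<lambda>x. V (?c x) - (V (?c x) - \<alpha> (?c x))) \<in> borel_measurable borel"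
    by (intro borel_measurable_diff borel_measurable_mono)
  then show ?thesis by simp
qed

section \<open>The curvature functional\<close>

lemma AE_neq_two: "AE s in lebesgue. s \<noteq> u \<and> s \<noteq> (v::real)"
proof -
  have "AE s in lborel. s \<noteq> u \<and> s \<noteq> v"
    using AE_lborel_singleton[of u] AE_lborel_singleton[of v] by eventually_elim auto
  then show ?thesis by (simp add: AE_completion_iff)
qed

lemma AE_interval_ex:
  assumes "AE x\<in>{a..b} in lebesgue. P x" "a < (b::real)"
  shows "\<exists>x\<in>{a..b}. P x"
proof (rule ccontr)
  assume "\<not> ?thesis"
  then have "AE x in lebesgue. x \<notin> {a..b}" using assms(1) by (auto elim!: eventually_mono)
  then have "AE x in lborel. x \<notin> {a..b}" by (simp add: AE_completion_iff)
  then have "emeasure lborel {x \<in> space lborel. \<not> x \<notin> {a..b}} = 0"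
    by (rule AE_E2)
  moreover have "{x \<in> space lborel. \<not> x \<notin> {a..b}} = {a..b}" by auto
  ultimately show False using assms(2) by simp
qed

lemma has_integral_le_AE:
  fixes f g :: "real \<Rightarrow> real"
  assumes "(f has_integral i) {a..b}" "(g has_integral j) {a..b}"
    and "AE x\<in>{a..b} in lebesgue. f x \<le> g x"
  shows "i \<le> j"
proof -
  have "((\<lambda>x. max (f x) (g x)) has_integral j) {a..b}"
    by (rule has_integral_cong_AE[OF assms(2)]) (use assms(3) in \<open>auto elim!: eventually_mono\<close>)
  with assms(1) show ?thesis by (rule has_integral_le) auto
qed

text \<open>The choice in \<open>acc\<close> is legitimate because a Lipschitz velocity has a
  density.\<close>

lemma W2inf_acc:
  assumes "W2inf l f" "0 \<le> l"
  shows "WD 0 l (vel l f) (acc l f)"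
proof -
  obtain L where L: "L-lipschitz_on {0..l} (vel l f)" using assms(1) by (auto simp: W2inf_def)
  obtain h where "WD 0 l (vel l f) h" by (rule WD_exists[OF L assms(2)])
  then have "weak_deriv l (vel l f) h" by (simp add: WD_iff_weak_deriv)
  then have "weak_deriv l (vel l f) (acc l f)" unfolding acc_def using someI[of "weak_deriv l (vel l f)"] by blast
  then show ?thesis using L by (auto simp: WD_iff_weak_deriv)
qed

lemma W2inf_WD_vel:
  fixes f :: "real \<Rightarrow> 'a::euclidean_space"
  assumes "W2inf l f"
  shows "WD 0 l f (vel l f)"
proof (rule C1_imp_WD)
  fix x assume "x \<in> {0..l}"
  then have "f differentiable (at x within {0..l})" using assms by (simp add: W2inf_def)
  then show "(f has_vector_derivative vel l f x) (at x within {0..l})"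
    unfolding vel_def by (simp add: vector_derivative_works)
next
  show "continuous_on {0..l} (vel l f)"
    using assms lipschitz_on_continuous_on by (auto simp: W2inf_def)
qed

section \<open>Essential suprema\<close>

lemma ess_sup_on_bdd_below:
  fixes l :: real
  assumes "0 < l" "\<And>s. s \<in> {0..l} \<Longrightarrow> 0 \<le> f s"
  shows "bdd_below {c. AE s\<in>{0..l} in lebesgue. f s \<le> c}"
proof (rule bdd_belowI)
  fix c assume "c \<in> {c. AE s\<in>{0..l} in lebesgue. f s \<le> c}"
  then have "AE s\<in>{0..l} in lebesgue. f s \<le> c" by simp
  then have "\<exists>s\<in>{0..l}. f s \<le> c" using assms(1) by (rule AE_interval_ex)
  then obtain s where "s \<in> {0..l}" "f s \<le> c" by blast
  moreover have "0 \<le> f s" using assms(2)[OF \<open>s \<in> {0..l}\<close>] .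
  ultimately show "0 \<le> c" by (rule_tac order_trans)
qed

lemma ess_sup_on_le:
  assumes "0 < l" "\<And>s. s \<in> {0..l} \<Longrightarrow> 0 \<le> f s" "AE s\<in>{0..l} in lebesgue. f s \<le> c"
  shows "ess_sup_on l f \<le> c"
  unfolding ess_sup_on_def using assms by (intro cInf_lower ess_sup_on_bdd_below) auto

text \<open>The infimum is attained: the exceptional sets for the bounds with surplus 1/(n + 1) have
  a null union. Some finite bound \<open>B\<close> is assumed, because the infimum of an empty set
  of reals carries no information.\<close>

lemma ess_sup_on_AE:
  assumes "0 < l" "\<And>s. s \<in> {0..l} \<Longrightarrow> 0 \<le> f s" "AE s\<in>{0..l} in lebesgue. f s \<le> B"
  shows "AE s\<in>{0..l} in lebesgue. f s \<le> ess_sup_on l f"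
proof -
  let ?X = "{c. AE s\<in>{0..l} in lebesgue. f s \<le> c}"
  have "AE s\<in>{0..l} in lebesgue. f s \<le> ess_sup_on l f + inverse (real (Suc n))" for n
  proof -
    have "Inf ?X < ess_sup_on l f + inverse (real (Suc n))" by (simp add: ess_sup_on_def)
    then obtain c where c: "c \<in> ?X" "c < ess_sup_on l f + inverse (real (Suc n))"
      using cInf_lessD[of ?X] assms(3) by blast
    have "AE s\<in>{0..l} in lebesgue. f s \<le> c" using c(1) by blast
    then show ?thesis by eventually_elim (use c(2) in auto)
  qed
  then have "AE s in lebesgue. \<forall>n. s \<in> {0..l} \<longrightarrow> f s \<le> ess_sup_on l f + inverse (real (Suc n))"
    by (intro AE_all_countable[THEN iffD2] allI)
  then show ?thesis
  proof eventually_elim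
    case (elim s)
    show ?case
    proof
      assume "s \<in> {0..l}"
      then have le: "f s \<le> ess_sup_on l f + inverse (real (Suc n))" for n using elim by blast
      show "f s \<le> ess_sup_on l f"
      proof (rule LIMSEQ_le_const)
        show "(\<lambda>n. ess_sup_on l f + inverse (real (Suc n))) \<longlonglongrightarrow> ess_sup_on l f"
          using tendsto_add[OF tendsto_const LIMSEQ_inverse_real_of_nat, of "ess_sup_on l f"] by simp
      qed (use le in auto)
    qed
  qed
qed

lemma ess_sup_on_cong_AE:
  assumes "AE s\<in>{0..l} in lebesgue. f s = g s"
  shows "ess_sup_on l f = ess_sup_on l g"
proof -
  have "(AE s\<in>{0..l} in lebesgue. f s \<le> c) \<longleftrightarrow> (AE s\<in>{0..l} in lebesgue. g s \<le> c)" for c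
  proof
    assume "AE s\<in>{0..l} in lebesgue. f s \<le> c"
    with assms show "AE s\<in>{0..l} in lebesgue. g s \<le> c" by eventually_elim auto
  next
    assume "AE s\<in>{0..l} in lebesgue. g s \<le> c"
    with assms show "AE s\<in>{0..l} in lebesgue. f s \<le> c" by eventually_elim auto
  qed
  then show ?thesis by (simp add: ess_sup_on_def)
qed

section \<open>Weights of bounded variation with bounded reciprocal\<close>

locale weight =
  fixes l :: real and \<alpha> :: "real \<Rightarrow> real"
  assumes l_pos: "0 < l"
    and alpha_pos: "\<And>s. s \<in> {0..l} \<Longrightarrow> 0 < \<alpha> s"
    and alpha_bv: "bounded_variation_on 0 l \<alpha>"
    and alpha_inv_bdd: "bounded ((\<lambda>s. 1 / \<alpha> s) ` {0..l})"
begin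

lemma l_nonneg: "0 \<le> l" using l_pos by simp

lemma alpha_bounds:
  obtains A B where "A > 0" "B > 0" "\<And>s. s \<in> {0..l} \<Longrightarrow> A \<le> \<alpha> s" "\<And>s. s \<in> {0..l} \<Longrightarrow> \<alpha> s \<le> B"
proof -
  obtain V where V: "\<And>x y. 0 \<le> x \<Longrightarrow> x \<le> y \<Longrightarrow> y \<le> l \<Longrightarrow> \<bar>\<alpha> y - \<alpha> x\<bar> \<le> V y - V x"
    by (rule bounded_variation_dominating_function[OF alpha_bv]) (rule that)
  obtain C where C: "\<forall>x\<in>(\<lambda>s. 1 / \<alpha> s) ` {0..l}. norm x \<le> C" using alpha_inv_bdd unfolding bounded_iff by blast
  define C' where "C' = max C 1"
  have C': "C' > 0" by (simp add: C'_def)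
  show ?thesis
  proof (rule that[of "1 / C'" "\<bar>\<alpha> 0\<bar> + \<bar>V l - V 0\<bar> + 1"])
    fix s assume s: "s \<in> {0..l}"
    have "norm (1 / \<alpha> s) \<le> C" using C s by blast
    then have "1 / \<alpha> s \<le> C'" using alpha_pos[OF s] by (simp add: C'_def)
    then show "1 / C' \<le> \<alpha> s" using alpha_pos[OF s] C' by (simp add: field_simps)
    have "\<bar>\<alpha> s - \<alpha> 0\<bar> \<le> V s - V 0" "\<bar>\<alpha> l - \<alpha> s\<bar> \<le> V l - V s" using V s by auto
    then show "\<alpha> s \<le> \<bar>\<alpha> 0\<bar> + \<bar>V l - V 0\<bar> + 1" by linarith
  qed (use C' in auto)
qed

lemma over_alpha_measurable:
  assumes "continuous_on {0..l} (u :: real \<Rightarrow> real)"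
  shows "(\<lambda>s. indicator {0..l} s * (u s / \<alpha> s)) \<in> borel_measurable lebesgue"
proof -
  obtain V where V: "\<And>x y. 0 \<le> x \<Longrightarrow> x \<le> y \<Longrightarrow> y \<le> l \<Longrightarrow> \<bar>\<alpha> y - \<alpha> x\<bar> \<le> V y - V x"
    by (rule bounded_variation_dominating_function[OF alpha_bv]) (rule that)
  have [measurable]: "(\<lambda>x. \<alpha> (max 0 (min l x))) \<in> borel_measurable lebesgue"
    by (rule measurable_completion) (use dominated_variation_measurable[OF V l_nonneg] in simp)
  have [measurable]: "(\<lambda>s. indicator {0..l} s *\<^sub>R u s) \<in> borel_measurable lebesgue"
    by (rule continuous_indicator_measurable[OF assms])
  have "(\<lambda>s. (indicator {0..l} s *\<^sub>R u s) / \<alpha> (max 0 (min l s))) \<in> borel_measurable lebesgue"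
    by measurable
  moreover have "(\<lambda>s. (indicator {0..l} s *\<^sub>R u s) / \<alpha> (max 0 (min l s))) = (\<lambda>s. indicator {0..l} s * (u s / \<alpha> s))"
    by (auto simp: indicator_def fun_eq_iff)
  ultimately show ?thesis by simp
qed

lemma over_alpha_integrable:
  assumes "continuous_on {0..l} (u :: real \<Rightarrow> real)"
  shows "(\<lambda>s. u s / \<alpha> s) integrable_on {0..l}"
proof -
  obtain A B where AB: "A > 0" "B > 0" "\<And>s. s \<in> {0..l} \<Longrightarrow> A \<le> \<alpha> s" "\<And>s. s \<in> {0..l} \<Longrightarrow> \<alpha> s \<le> B"
    by (rule alpha_bounds) (rule that)
  have "compact (u ` {0..l})" by (intro compact_continuous_image assms) auto
  then have "bounded (u ` {0..l})" by (rule compact_imp_bounded)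
  then obtain C where C: "\<forall>y\<in>u ` {0..l}. norm y \<le> C" unfolding bounded_iff by blast
  have "(\<lambda>s. indicator {0..l} s * (u s / \<alpha> s)) integrable_on {0..l}"
  proof (rule bounded_measurable_integrable[OF over_alpha_measurable[OF assms], of _ _ "\<bar>C\<bar> / A"])
    fix s assume s: "s \<in> {0..l}"
    have "\<bar>u s\<bar> / \<alpha> s \<le> \<bar>C\<bar> / A"
      using C s AB by (intro frac_le) force+
    then show "norm (indicator {0..l} s * (u s / \<alpha> s)) \<le> \<bar>C\<bar> / A"
      using s alpha_pos[OF s] by simp
  qed
  then show ?thesis by (rule integrable_eq) auto
qed

lemma K_alpha_eq:
  assumes "W2inf l f" "WD 0 l (vel l f) h"
  shows "K_alpha l \<alpha> f = ess_sup_on l (\<lambda>s. \<alpha> s * norm (h s))"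
  unfolding K_alpha_def
  by (rule ess_sup_on_cong_AE)
     (use WD_unique[OF W2inf_acc[OF assms(1) l_nonneg] assms(2) l_nonneg] in \<open>auto elim!: eventually_mono\<close>)

lemma alpha_norm_nonneg: "s \<in> {0..l} \<Longrightarrow> 0 \<le> \<alpha> s * norm x"
  using alpha_pos[of s] by simp

lemma K_alpha_AE:
  assumes "W2inf l f" "WD 0 l (vel l f) h"
  shows "AE s\<in>{0..l} in lebesgue. \<alpha> s * norm (h s) \<le> K_alpha l \<alpha> f"
proof -
  obtain A B where AB: "A > 0" "B > 0" "\<And>s. s \<in> {0..l} \<Longrightarrow> A \<le> \<alpha> s" "\<And>s. s \<in> {0..l} \<Longrightarrow> \<alpha> s \<le> B"
    by (rule alpha_bounds) (rule that)
  obtain C where C: "C \<ge> 0" "AE x\<in>{0..l} in lebesgue. norm (h x) \<le> C"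
    using WD_bounded_AE[OF assms(2) l_nonneg] by blast
  have ae: "AE s\<in>{0..l} in lebesgue. \<alpha> s * norm (h s) \<le> B * C"
    using C(2) by eventually_elim (use AB C in \<open>auto intro!: mult_mono\<close>)
  show ?thesis unfolding K_alpha_eq[OF assms] by (rule ess_sup_on_AE[OF l_pos alpha_norm_nonneg ae])
qed

lemma K_alpha_le:
  assumes "W2inf l f" "WD 0 l (vel l f) h" "AE s\<in>{0..l} in lebesgue. \<alpha> s * norm (h s) \<le> c"
  shows "K_alpha l \<alpha> f \<le> c"
  unfolding K_alpha_eq[OF assms(1,2)] by (rule ess_sup_on_le[OF l_pos alpha_norm_nonneg assms(3)])

lemma K_alpha_nonneg:
  assumes "W2inf l f"
  shows "0 \<le> K_alpha l \<alpha> f"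
proof -
  obtain s where "s \<in> {0..l}" "\<alpha> s * norm (acc l f s) \<le> K_alpha l \<alpha> f"
    using AE_interval_ex[OF K_alpha_AE[OF assms W2inf_acc[OF assms l_nonneg]] l_pos] by blast
  then show ?thesis using alpha_pos by (meson mult_nonneg_nonneg norm_ge_zero less_imp_le order_trans)
qed

end

section \<open>The fixed curve and the calibration\<close>

locale curve = weight l \<alpha> for l \<alpha> +
  fixes a1 a2 T1 T2 :: "real ^ 'n" and \<gamma> :: "real \<Rightarrow> real ^ 'n"
  assumes gamma_adm: "adm l a1 a2 T1 T2 \<gamma>"
begin

abbreviation "T \<equiv> vel l \<gamma>"
abbreviation "k \<equiv> K_alpha l \<alpha> \<gamma>"
abbreviation "h \<equiv> acc l \<gamma>"

lemma gamma_W2inf: "W2inf l \<gamma>" using gamma_adm by (simp add: adm_def)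

lemma WD_gamma: "WD 0 l \<gamma> T" by (rule W2inf_WD_vel[OF gamma_W2inf])

lemma WD_T: "WD 0 l T h" by (rule W2inf_acc[OF gamma_W2inf l_nonneg])

lemma norm_T: "s \<in> {0..l} \<Longrightarrow> norm (T s) = 1" using gamma_adm by (simp add: adm_def)

lemma T_T: "s \<in> {0..l} \<Longrightarrow> T s \<bullet> T s = 1" using norm_T by (simp add: norm_eq_1)

lemma T_ends: "T 0 = T1" "T l = T2" using gamma_adm by (auto simp: adm_def)

lemma gamma_ends: "\<gamma> 0 = a1" "\<gamma> l = a2" using gamma_adm by (auto simp: adm_def)

lemma k_nonneg: "0 \<le> k" by (rule K_alpha_nonneg[OF gamma_W2inf])

lemma WD_T_unique: "WD 0 l T h' \<Longrightarrow> AE s\<in>{0..l} in lebesgue. h' s = h s"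
  by (rule WD_unique[OF _ WD_T l_nonneg]) auto

lemma h_bound: "AE s\<in>{0..l} in lebesgue. \<alpha> s * norm (h s) \<le> k"
  by (rule K_alpha_AE[OF gamma_W2inf WD_T])

lemma T_h: "AE s\<in>{0..l} in lebesgue. T s \<bullet> h s = 0"
proof -
  have "AE s\<in>{0..l} in lebesgue. h s \<bullet> T s + T s \<bullet> h s = 0"
    by (rule WD_zero_AE[OF WD_inner[OF WD_T WD_T l_nonneg] l_nonneg, of 1]) (rule T_T)
  then show ?thesis by eventually_elim (auto simp: inner_commute)
qed

text \<open>Let D be the difference of the two tangents. The integral of the derivative of
  \<open>\<phi> \<bullet> D\<close> is 0 because the tangents agree at both ends, and that of
  \<open>lam \<bullet> D\<close> is 0 because the end points agree. What is left of
  \<open>\<psi> \<bullet> D\<close> is a bounded multiple of |D|^2, and \<open>phi_h\<close> with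
  Cauchy-Schwarz bounds the other term by (K - k) \<open>|\<phi>|\<close> / \<alpha>, where K is the
  value of the competitor. One point with \<open>\<phi> \<noteq> 0\<close> makes the total weight of
  K - k positive.\<close>

lemma certificate_imp_elastica:
  assumes phi: "WD 0 l \<phi> \<psi>"
    and psi: "AE s\<in>{0..l} in lebesgue. \<psi> s = lam - (lam \<bullet> T s + \<phi> s \<bullet> h s) *\<^sub>R T s"
    and phi_h: "AE s\<in>{0..l} in lebesgue. \<phi> s \<bullet> h s = norm (\<phi> s) * k / \<alpha> s"
    and nz: "s0 \<in> {0..l}" "\<phi> s0 \<noteq> 0"
  shows "inf_elastica l \<alpha> a1 a2 T1 T2 \<gamma>"
proof -
  obtain A B where AB: "A > 0" "B > 0" "\<And>s. s \<in> {0..l} \<Longrightarrow> A \<le> \<alpha> s" "\<And>s. s \<in> {0..l} \<Longrightarrow> \<alpha> s \<le> B"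
    by (rule alpha_bounds) (rule that)
  obtain L where L: "L-lipschitz_on {0..l} \<phi>" using WD_lip[OF phi] by blast
  obtain F where F: "F \<ge> 0" "\<And>s. s \<in> {0..l} \<Longrightarrow> norm (\<phi> s) \<le> F" by (rule lipschitz_bounded_norm[OF L]) (rule that)
  \<comment> \<open>\<open>C\<close> bounds the coefficient
    \<open>lam \<bullet> T s + \<phi> s \<bullet> h s\<close> of T in \<open>\<psi>\<close>.\<close>
  define C where "C = norm lam + F * k / A"
  have cphi: "continuous_on {0..l} (\<lambda>s. norm (\<phi> s))" by (intro continuous_on_norm WD_continuous[OF phi])
  define Q where "Q = integral {0..l} (\<lambda>s. norm (\<phi> s) / \<alpha> s)"
  have Qi: "((\<lambda>s. norm (\<phi> s) / \<alpha> s) has_integral Q) {0..l}"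
    unfolding Q_def by (intro integrable_integral over_alpha_integrable cphi)
  have Qpos: "Q > 0"
  proof -
    have "integral {0..l} (\<lambda>s. norm (\<phi> s)) \<noteq> 0"
      using integral_eq_0_iff[OF cphi l_pos] nz by auto
    moreover have "integral {0..l} (\<lambda>s. norm (\<phi> s)) \<ge> 0" by (rule integral_nonneg) (use cphi integrable_continuous_real in auto)
    ultimately have "integral {0..l} (\<lambda>s. norm (\<phi> s)) / B > 0" using AB by simp
    moreover have "integral {0..l} (\<lambda>s. norm (\<phi> s)) / B \<le> Q"
    proof (rule has_integral_le[OF _ Qi])
      show "((\<lambda>s. norm (\<phi> s) / B) has_integral integral {0..l} (\<lambda>s. norm (\<phi> s)) / B) {0..l}"
        by (intro has_integral_divide integrable_integral integrable_continuous_real cphi)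
      show "norm (\<phi> s) / B \<le> norm (\<phi> s) / \<alpha> s" if "s \<in> {0..l}" for s
        using AB(4)[OF that] alpha_pos[OF that] by (intro divide_left_mono) (auto intro!: mult_pos_pos AB)
    qed
    ultimately show ?thesis by simp
  qed
  \<comment> \<open>\<open>C / Q\<close> plays the role of M; it does not depend on the
    competitor.\<close>
  have "k \<le> K_alpha l \<alpha> g + (C / Q) / 2 * integral {0..l} (\<lambda>s. (norm (vel l g s - T s))\<^sup>2)"
    if g: "adm l a1 a2 T1 T2 g" for g
  proof -
    let ?S = "vel l g" and ?K = "K_alpha l \<alpha> g" and ?g = "acc l g"
    have gW: "W2inf l g" using g by (simp add: adm_def)
    have WS: "WD 0 l ?S ?g" by (rule W2inf_acc[OF gW l_nonneg])
    define D where "D s = ?S s - T s" for s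
    have WDD: "WD 0 l D (\<lambda>s. ?g s - h s)" unfolding D_def[abs_def] by (rule WD_diff[OF WS WD_T])
    have D0: "D 0 = 0" "D l = 0" using g T_ends by (auto simp: D_def adm_def)
    have i1: "((\<lambda>s. \<psi> s \<bullet> D s + \<phi> s \<bullet> (?g s - h s)) has_integral 0) {0..l}"
      using WD_int[OF WD_inner[OF phi WDD l_nonneg], of 0 l] D0 l_nonneg by simp
    have "(D has_integral 0) {0..l}"
      using WD_int[OF WD_diff[OF W2inf_WD_vel[OF gW] WD_gamma], of 0 l] g gamma_ends l_nonneg
      by (simp add: D_def[abs_def] adm_def)
    then have i2: "((\<lambda>s. lam \<bullet> D s) has_integral 0) {0..l}"
      using has_integral_linear[OF _ bounded_linear_inner_right, of D 0 "{0..l}" lam] by (simp add: o_def)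
    have cD: "continuous_on {0..l} (\<lambda>s. (norm (D s))\<^sup>2)"
      by (intro continuous_intros WD_continuous[OF WDD])
    define I where "I = integral {0..l} (\<lambda>s. (norm (D s))\<^sup>2)"
    have i3: "((\<lambda>s. (norm (D s))\<^sup>2) has_integral I) {0..l}"
      unfolding I_def by (intro integrable_integral integrable_continuous_real cD)
    have i4: "((\<lambda>s. C / 2 * (norm (D s))\<^sup>2 + (?K - k) * (norm (\<phi> s) / \<alpha> s)) has_integral C / 2 * I + (?K - k) * Q) {0..l}"
      by (intro has_integral_add has_integral_mult_right i3 Qi)
    have "AE s\<in>{0..l} in lebesgue. (\<psi> s \<bullet> D s + \<phi> s \<bullet> (?g s - h s)) - lam \<bullet> D s
        \<le> C / 2 * (norm (D s))\<^sup>2 + (?K - k) * (norm (\<phi> s) / \<alpha> s)"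
      using psi phi_h K_alpha_AE[OF gW WS]
    proof eventually_elim
      case (elim s)
      show ?case
      proof
        assume s: "s \<in> {0..l}"
        have a: "\<alpha> s > 0" "A \<le> \<alpha> s" using alpha_pos AB s by auto
        have p: "\<psi> s = lam - (lam \<bullet> T s + \<phi> s \<bullet> h s) *\<^sub>R T s" "\<phi> s \<bullet> h s = norm (\<phi> s) * k / \<alpha> s"
          "\<alpha> s * norm (?g s) \<le> ?K" using elim s by auto
        have S1: "?S s \<bullet> ?S s = 1" using g s by (simp add: adm_def norm_eq_1)
        have TD: "T s \<bullet> D s = - (norm (D s))\<^sup>2 / 2"
          unfolding D_def power2_norm_eq_inner using S1 T_T[OF s]
          by (simp add: inner_diff_left inner_diff_right inner_commute)
        define b where "b = lam \<bullet> T s + \<phi> s \<bullet> h s"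
        have "\<bar>lam \<bullet> T s\<bar> \<le> norm lam" using Cauchy_Schwarz_ineq2[of lam "T s"] norm_T[OF s] by simp
        moreover have "norm (\<phi> s) * k / \<alpha> s \<le> F * k / A"
          using F(2)[OF s] k_nonneg a AB F(1) by (intro frac_le mult_right_mono) auto
        ultimately have "b \<le> C" unfolding b_def C_def p(2) by linarith
        then have bC: "b * ((norm (D s))\<^sup>2 / 2) \<le> C * ((norm (D s))\<^sup>2 / 2)" by (intro mult_right_mono) auto
        have "\<phi> s \<bullet> ?g s \<le> norm (\<phi> s) * norm (?g s)" by (rule norm_cauchy_schwarz)
        also have "\<dots> \<le> norm (\<phi> s) * (?K / \<alpha> s)" using p(3) a by (intro mult_left_mono) (auto simp: field_simps)
        finally have pg: "\<phi> s \<bullet> ?g s \<le> norm (\<phi> s) * (?K / \<alpha> s)" .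
        have "(\<psi> s \<bullet> D s + \<phi> s \<bullet> (?g s - h s)) - lam \<bullet> D s = - b * (T s \<bullet> D s) + \<phi> s \<bullet> ?g s - \<phi> s \<bullet> h s"
          by (simp add: p(1) b_def inner_diff_left inner_diff_right algebra_simps)
        also have "\<dots> \<le> C * ((norm (D s))\<^sup>2 / 2) + norm (\<phi> s) * (?K / \<alpha> s) - norm (\<phi> s) * k / \<alpha> s"
          using bC pg by (simp add: TD p(2))
        also have "\<dots> = C / 2 * (norm (D s))\<^sup>2 + (?K - k) * (norm (\<phi> s) / \<alpha> s)"
          using a by (simp add: field_simps)
        finally show "(\<psi> s \<bullet> D s + \<phi> s \<bullet> (?g s - h s)) - lam \<bullet> D s
          \<le> C / 2 * (norm (D s))\<^sup>2 + (?K - k) * (norm (\<phi> s) / \<alpha> s)" .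
      qed
    qed
    then have "0 - 0 \<le> C / 2 * I + (?K - k) * Q"
      by (rule has_integral_le_AE[OF has_integral_diff[OF i1 i2] i4])
    then have "k * Q \<le> ?K * Q + C / 2 * I" by (simp add: algebra_simps)
    then have "k \<le> (?K * Q + C / 2 * I) / Q" using Qpos by (simp add: pos_le_divide_eq)
    also have "\<dots> = ?K + (C / Q) / 2 * I" using Qpos by (simp add: field_simps)
    finally show ?thesis by (simp add: I_def D_def)
  qed
  then show ?thesis unfolding inf_elastica_def using gamma_adm by blast
qed

end

section \<open>Sufficiency of the two conditions\<close>

text \<open>Two vectors with the defining properties differ by an element of the span that is
  orthogonal to the span, so the description in \<open>proj_perp\<close> is unique; for orthogonal
  arguments the two components are subtracted separately.\<close>

lemma proj_perp_orthogonal: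
  fixes t h x :: "'a::euclidean_space"
  assumes t: "t \<bullet> t = 1" and th: "t \<bullet> h = 0" and h: "h \<noteq> 0"
  shows "proj_perp t h x = x - (x \<bullet> t) *\<^sub>R t - (x \<bullet> h / (h \<bullet> h)) *\<^sub>R h"
proof -
  define y where "y = x - (x \<bullet> t) *\<^sub>R t - (x \<bullet> h / (h \<bullet> h)) *\<^sub>R h"
  have ht: "h \<bullet> t = 0" using th by (simp add: inner_commute)
  have "(x \<bullet> t) *\<^sub>R t + (x \<bullet> h / (h \<bullet> h)) *\<^sub>R h \<in> span {t, h}"
    by (intro span_add span_scale span_base) auto
  moreover have "x - y = (x \<bullet> t) *\<^sub>R t + (x \<bullet> h / (h \<bullet> h)) *\<^sub>R h" by (simp add: y_def)
  ultimately have 1: "x - y \<in> span {t, h}" by simp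
  have 2: "y \<bullet> t = 0" using t ht by (simp add: y_def inner_diff_left)
  have 3: "y \<bullet> h = 0" using th h by (simp add: y_def inner_diff_left)
  have "proj_perp t h x = y"
    unfolding proj_perp_def
  proof (rule the_equality)
    show "x - y \<in> span {t, h} \<and> y \<bullet> t = 0 \<and> y \<bullet> h = 0" using 1 2 3 by blast
    fix z assume z: "x - z \<in> span {t, h} \<and> z \<bullet> t = 0 \<and> z \<bullet> h = 0"
    have "(x - y) - (x - z) \<in> span {t, h}" using 1 z by (blast intro: span_diff[of "x - y" _ "x - z"])
    then have zy: "z - y \<in> span {t, h}" by simp
    have "(z - y) \<bullet> u = 0" if "u \<in> span {t, h}" for u
      using that
    proof (induction rule: span_induct_alt)
      case base show ?case by simp
    next
      case (step c x y') then show ?case using 2 3 z by (auto simp: inner_add_right inner_diff_left)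
    qed
    from this[OF zy] show "z = y" by simp
  qed
  then show ?thesis by (simp add: y_def)
qed

section \<open>Subspaces, planes and intervals\<close>

lemma continuous_AE_zero:
  fixes f :: "real \<Rightarrow> 'a::real_normed_vector"
  assumes f: "continuous_on {a..b} f" and ab: "a < b"
    and ae: "AE x\<in>{a..b} in lebesgue. f x = 0" and x: "x \<in> {a..b}"
  shows "f x = 0"
proof (rule ccontr)
  assume "f x \<noteq> 0"
  then obtain d where d: "d > 0" "\<And>y. y \<in> {a..b} \<Longrightarrow> dist y x < d \<Longrightarrow> dist (f y) (f x) < norm (f x)"
    using f x unfolding continuous_on_iff by (metis zero_less_norm_iff)
  define u where "u = max a (x - d / 2)"
  define v where "v = min b (x + d / 2)"
  have "u < v" using ab x d(1) by (auto simp: u_def v_def)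
  moreover have "AE y\<in>{u..v} in lebesgue. f y = 0"
    using ae by eventually_elim (auto simp: u_def v_def)
  ultimately have "\<exists>y\<in>{u..v}. f y = 0" by (rule AE_interval_ex[rotated])
  then obtain y where y: "y \<in> {u..v}" "f y = 0" by blast
  have "y \<in> {a..b}" "dist y x < d" using y(1) d(1) x by (auto simp: u_def v_def dist_real_def)
  then have "dist (f y) (f x) < norm (f x)" by (rule d(2))
  then show False using y(2) by simp
qed

text \<open>A basis of the orthogonal complement serves, as D is its own double complement.
  Membership becomes finitely many scalar equations, so that almost-everywhere statements can be
  proved one equation at a time.\<close>

lemma subspace_finite_annihilator:
  fixes D :: "'a::euclidean_space set"
  assumes "subspace D"
  obtains B where "finite B" "\<And>v. v \<in> D \<longleftrightarrow> (\<forall>b\<in>B. v \<bullet> b = 0)"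
proof -
  obtain B where B: "B \<subseteq> orthogonal_comp D" "independent B" "orthogonal_comp D \<subseteq> span B"
    by (rule basis_exists[of "orthogonal_comp D"]) (rule that)
  have "v \<in> D \<longleftrightarrow> (\<forall>b\<in>B. v \<bullet> b = 0)" for v
  proof
    assume "v \<in> D"
    then show "\<forall>b\<in>B. v \<bullet> b = 0"
      using B(1) by (force simp: orthogonal_comp_def orthogonal_def)
  next
    assume vb: "\<forall>b\<in>B. v \<bullet> b = 0"
    have "v \<in> orthogonal_comp (orthogonal_comp D)"
      unfolding orthogonal_comp_def[of "orthogonal_comp D"]
    proof clarify
      fix y assume "y \<in> orthogonal_comp D"
      then have "y \<in> span B" using B(3) by blast
      then have "v \<bullet> y = 0"
      proof (induction rule: span_induct_alt)
        case base show ?case by simp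
      next
        case (step c x y) then show ?case using vb by (simp add: inner_add_right)
      qed
      then show "orthogonal y v" by (simp add: orthogonal_def inner_commute)
    qed
    then show "v \<in> D" using orthogonal_comp_self[OF assms] by simp
  qed
  then show ?thesis using that B(2) independent_imp_finite by blast
qed

lemma WD_in_subspace:
  fixes f :: "real \<Rightarrow> 'a::euclidean_space"
  assumes f: "WD a b f h" and ab: "a \<le> b" and D: "subspace D" and fD: "\<And>s. s \<in> {a..b} \<Longrightarrow> f s - c \<in> D"
  shows "AE s\<in>{a..b} in lebesgue. h s \<in> D"
proof -
  obtain B where B: "finite B" "\<And>v. v \<in> D \<longleftrightarrow> (\<forall>b\<in>B. v \<bullet> b = 0)"
    by (rule subspace_finite_annihilator[OF D]) (rule that)
  have "AE s\<in>{a..b} in lebesgue. (\<forall>x\<in>B. h s \<bullet> x = 0)"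
  proof (rule AE_ball_finite_imp[OF B(1)])
    fix x assume x: "x \<in> B"
    show "AE s\<in>{a..b} in lebesgue. h s \<bullet> x = 0"
    proof (rule WD_zero_AE[OF WD_inner_left[OF f] ab, of x "c \<bullet> x"])
      fix s assume "s \<in> {a..b}"
      then have "(f s - c) \<bullet> x = 0" using fD B(2) x by blast
      then show "f s \<bullet> x = c \<bullet> x" by (simp add: inner_diff_left)
    qed
  qed
  then show ?thesis by eventually_elim (use B(2) in auto)
qed

lemma continuous_AE_in_subspace:
  fixes f :: "real \<Rightarrow> 'a::euclidean_space"
  assumes f: "continuous_on {a..b} f" and ab: "a < b" and D: "subspace D"
    and ae: "AE s\<in>{a..b} in lebesgue. f s \<in> D" and s: "s \<in> {a..b}"
  shows "f s \<in> D"
proof -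
  obtain B where B: "finite B" "\<And>v. v \<in> D \<longleftrightarrow> (\<forall>b\<in>B. v \<bullet> b = 0)"
    by (rule subspace_finite_annihilator[OF D]) (rule that)
  have "f s \<bullet> x = 0" if "x \<in> B" for x
  proof (rule continuous_AE_zero[OF _ ab _ s])
    show "continuous_on {a..b} (\<lambda>s. f s \<bullet> x)" by (intro continuous_intros f)
    show "AE s\<in>{a..b} in lebesgue. f s \<bullet> x = 0"
      using ae by eventually_elim (use B(2) that in auto)
  qed
  then show ?thesis using B(2) by blast
qed

text \<open>A nonzero remainder would be orthogonal to both \<open>T\<close> and \<open>h\<close>
  and so give three independent vectors in a space of dimension at most 2.\<close>

lemma plane_orthogonal_decomposition:
  fixes D :: "'a::euclidean_space set"
  assumes D: "subspace D" "dim D \<le> 2" and "T \<in> D" "h \<in> D" "x \<in> D" "T \<bullet> h = 0" "T \<bullet> T = 1" "h \<noteq> 0"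
  shows "x = (x \<bullet> T) *\<^sub>R T + (x \<bullet> h / (h \<bullet> h)) *\<^sub>R h"
proof (rule ccontr)
  assume neq: "\<not> ?thesis"
  define y where "y = x - (x \<bullet> T) *\<^sub>R T - (x \<bullet> h / (h \<bullet> h)) *\<^sub>R h"
  have y0: "y \<noteq> 0" using neq by (simp add: y_def algebra_simps)
  have yD: "y \<in> D" unfolding y_def using assms by (intro subspace_diff subspace_scale) auto
  have hT: "h \<bullet> T = 0" using assms(6) by (simp add: inner_commute)
  have yT: "y \<bullet> T = 0" unfolding y_def using assms hT by (simp add: inner_diff_left)
  have yh: "y \<bullet> h = 0" unfolding y_def using assms by (simp add: inner_diff_left)
  have T0: "T \<noteq> 0" using assms(7) by auto
  have "pairwise orthogonal {y, T, h}"
    using yT yh assms(6) hT by (auto simp: pairwise_def orthogonal_def inner_commute)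
  then have ind: "independent {y, T, h}"
    using y0 T0 assms(8) by (intro pairwise_orthogonal_independent) auto
  have "y \<noteq> T" "y \<noteq> h" "T \<noteq> h" using yT yh assms(6) T0 y0 assms(8) by auto
  then have "card {y, T, h} = 3" by simp
  moreover have "card {y, T, h} \<le> dim D"
    using ind yD assms by (intro independent_card_le_dim) auto
  ultimately show False using D(2) by simp
qed

lemma interval_closure_cases:
  fixes J :: "real set"
  assumes "is_interval J" "bounded J" "J \<noteq> {}"
  obtains a b where "a \<le> b" "closure J = {a..b}" "{a<..<b} \<subseteq> J" "J \<subseteq> {a..b}"
proof -
  have conv: "convex J" using assms(1) by (rule is_interval_convex)
  have "is_interval (closure J)" using conv convex_closure is_interval_convex_1 by blast
  moreover have "compact (closure J)" using assms(2) compact_closure by blast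
  ultimately obtain a b where ab: "closure J = cbox a b" using is_interval_compact by blast
  have "closure J \<noteq> {}" using assms(3) closure_eq_empty by blast
  then have "a \<le> b" using ab by (simp add: cbox_interval)
  moreover have "{a<..<b} \<subseteq> J"
  proof -
    have "interior (closure J) = interior J" using conv by (rule convex_interior_closure)
    then have "{a<..<b} = interior J" by (simp add: ab cbox_interval)
    then show ?thesis using interior_subset by blast
  qed
  moreover have "J \<subseteq> {a..b}" using closure_subset[of J] ab by (simp add: cbox_interval)
  ultimately show ?thesis using that ab by (simp add: cbox_interval)
qed

lemma affine_plane_direction:
  fixes P :: "'a::euclidean_space set"
  assumes "affine P" "aff_dim P = 2" "p \<in> P"
  obtains D where "subspace D" "dim D = 2" "\<And>x. x \<in> P \<longleftrightarrow> x - p \<in> D"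
proof -
  define D where "D = (\<lambda>x. - p + x) ` P"
  have sub: "subspace D" unfolding D_def using affine_diffs_subspace[OF assms(1,3)] by simp
  moreover have "dim D = 2"
    using aff_dim_subspace[OF sub] aff_dim_translation_eq[of "- p" P] assms(2) by (simp add: D_def)
  moreover have "x \<in> P \<longleftrightarrow> x - p \<in> D" for x by (force simp: D_def)
  ultimately show ?thesis using that by blast
qed

section \<open>Straight curves and the sufficiency of (ii)\<close>

context curve
begin

lemma continuous_T: "continuous_on {0..l} T" by (rule WD_continuous[OF WD_T])

lemma zero_curvature_imp_elastica: "k = 0 \<Longrightarrow> inf_elastica l \<alpha> a1 a2 T1 T2 \<gamma>"
  unfolding inf_elastica_def using gamma_adm K_alpha_nonneg
  by (auto simp: adm_def intro!: exI[of _ 0])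

lemma const_T_imp_zero_curvature:
  assumes "\<And>s. s \<in> {0..l} \<Longrightarrow> T s = v"
  shows "k = 0"
proof -
  have "AE s\<in>{0..l} in lebesgue. h s = 0" by (rule WD_zero_AE[OF WD_T l_nonneg assms])
  then have "AE s\<in>{0..l} in lebesgue. \<alpha> s * norm (h s) \<le> 0" by eventually_elim auto
  then have "k \<le> 0" by (rule K_alpha_le[OF gamma_W2inf WD_T])
  then show ?thesis using k_nonneg by simp
qed

text \<open>The derivative of T is parallel to \<open>v\<close>, hence to T, and at the same time
  orthogonal to the unit vector T; so it vanishes.\<close>

lemma parallel_T_imp_const:
  assumes "\<And>s. s \<in> {0..l} \<Longrightarrow> T s \<in> span {v}"
  shows "\<exists>w. \<forall>s\<in>{0..l}. T s = w"
proof -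
  have "AE s\<in>{0..l} in lebesgue. h s \<in> span {v}"
    by (rule WD_in_subspace[OF WD_T l_nonneg, of _ 0]) (use assms in auto)
  then have h0: "AE s\<in>{0..l} in lebesgue. h s = 0"
    using T_h
  proof eventually_elim
    case (elim s)
    show ?case
    proof
      assume s: "s \<in> {0..l}"
      obtain x y where xy: "T s = x *\<^sub>R v" "h s = y *\<^sub>R v"
        using elim assms[OF s] s by (auto simp: span_singleton)
      have "T s \<noteq> 0" using norm_T[OF s] by auto
      then have "x \<noteq> 0" "v \<noteq> 0" using xy by auto
      moreover have "x * y * (v \<bullet> v) = 0" using elim s xy by auto
      ultimately show "h s = 0" using xy by simp
    qed
  qed
  have "T s = T 0" if "s \<in> {0..l}" for s
  proof -
    have "T 0 = T s"
      by (rule WD_const_if_zero[OF WD_subset[OF WD_T, of 0 s]]) (use that h0 in \<open>auto elim!: eventually_mono\<close>)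
    then show ?thesis by simp
  qed
  then show ?thesis by blast
qed

text \<open>The certificate is \<open>\<phi> = g \<alpha> T' / k\<^sup>2\<close>, of norm g / k.
  When it is differentiated, \<open>g'\<close> contributes the component of \<open>lam\<close> along
  T', which is exactly what the projection has removed; the component along T becomes the multiple
  of T allowed in \<open>\<psi>\<close>.\<close>

lemma lipschitz_system_imp_elastica:
  assumes lam: "norm lam = 1" and wd: "weak_deriv l T h'" and Lip: "L-lipschitz_on {0..l} (\<lambda>s. \<alpha> s *\<^sub>R h' s)"
    and hk: "\<And>s. s \<in> {0..l} \<Longrightarrow> \<alpha> s * norm (h' s) = k"
    and w: "weak_deriv l (\<lambda>s. \<alpha> s *\<^sub>R h' s) w"
    and g: "W2inf l g" and gpos: "\<And>s. s \<in> {0..l} \<Longrightarrow> 0 < g s"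
    and eq: "AE s in lebesgue. s \<in> {0<..<l} \<longrightarrow>
        g s *\<^sub>R (w s + (k\<^sup>2 / \<alpha> s) *\<^sub>R T s) = k\<^sup>2 *\<^sub>R proj_perp (T s) (h' s) lam
        \<and> vel l g s = \<alpha> s * (lam \<bullet> h' s)"
  shows "inf_elastica l \<alpha> a1 a2 T1 T2 \<gamma>"
proof (cases "k = 0")
  case True then show ?thesis by (rule zero_curvature_imp_elastica)
next
  case False
  then have k: "k > 0" using k_nonneg by simp
  have WDT': "WD 0 l T h'" using wd WD_lip[OF WD_T] by (simp add: WD_iff_weak_deriv)
  have WDa: "WD 0 l (\<lambda>s. \<alpha> s *\<^sub>R h' s) w" using w Lip by (auto simp: WD_iff_weak_deriv)
  define \<phi> where "\<phi> s = (1 / k\<^sup>2) *\<^sub>R (g s *\<^sub>R (\<alpha> s *\<^sub>R h' s))" for s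
  define \<psi> where "\<psi> s = (1 / k\<^sup>2) *\<^sub>R (vel l g s *\<^sub>R (\<alpha> s *\<^sub>R h' s) + g s *\<^sub>R w s)" for s
  have WDp: "WD 0 l \<phi> \<psi>"
    unfolding \<phi>_def[abs_def] \<psi>_def[abs_def]
    by (intro WD_scaleR_const WD_scaleR W2inf_WD_vel[OF g] WDa l_nonneg)
  have endsneg: "AE s in lebesgue. s \<noteq> 0 \<and> s \<noteq> l" by (rule AE_neq_two)
  have ph: "\<phi> s \<bullet> h' s = norm (\<phi> s) * k / \<alpha> s" if s: "s \<in> {0..l}" for s
  proof -
    have a: "\<alpha> s > 0" and gs: "g s > 0" using alpha_pos gpos s by auto
    have nh: "norm (h' s) = k / \<alpha> s" using hk[OF s] a by (simp add: field_simps)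
    have "norm (\<phi> s) = (1 / k\<^sup>2) * (g s * (\<alpha> s * norm (h' s)))"
      using a gs k by (simp add: \<phi>_def)
    moreover have "\<phi> s \<bullet> h' s = (1 / k\<^sup>2) * (g s * (\<alpha> s * (norm (h' s))\<^sup>2))"
      by (simp add: \<phi>_def power2_norm_eq_inner)
    ultimately show ?thesis by (simp add: nh power2_eq_square)
  qed
  have heq: "AE s\<in>{0..l} in lebesgue. h' s = h s" by (rule WD_T_unique[OF WDT'])
  show ?thesis
  proof (rule certificate_imp_elastica[OF WDp])
    show "AE s\<in>{0..l} in lebesgue. \<phi> s \<bullet> h s = norm (\<phi> s) * k / \<alpha> s"
      using heq by eventually_elim (metis ph)
    show "(0::real) \<in> {0..l}" using l_pos by simp
    then show "\<phi> 0 \<noteq> 0"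
      using gpos[of 0] hk[of 0] k alpha_pos[of 0] by (auto simp: \<phi>_def)
    show "AE s\<in>{0..l} in lebesgue. \<psi> s = lam - (lam \<bullet> T s + \<phi> s \<bullet> h s) *\<^sub>R T s"
      using heq eq endsneg T_h
    proof eventually_elim
      case (elim s)
      show ?case
      proof
        assume s: "s \<in> {0..l}"
        then have s': "s \<in> {0<..<l}" using elim by auto
        have a: "\<alpha> s > 0" and gs: "g s > 0" using alpha_pos gpos s by auto
        have Th: "T s \<bullet> h' s = 0" using elim s by simp
        have nh: "norm (h' s) = k / \<alpha> s" using hk[OF s] a by (simp add: field_simps)
        have hh: "h' s \<bullet> h' s = (k / \<alpha> s)\<^sup>2" by (simp add: nh flip: power2_norm_eq_inner)
        have e1: "g s *\<^sub>R (w s + (k\<^sup>2 / \<alpha> s) *\<^sub>R T s) = k\<^sup>2 *\<^sub>R proj_perp (T s) (h' s) lam"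
          and e2: "vel l g s = \<alpha> s * (lam \<bullet> h' s)" using elim(2) s' by blast+
        define y where "y = lam - (lam \<bullet> T s) *\<^sub>R T s - ((\<alpha> s / k)\<^sup>2 * (lam \<bullet> h' s)) *\<^sub>R h' s"
        have h0: "h' s \<noteq> 0" using nh a k by auto
        have "proj_perp (T s) (h' s) lam = y"
          unfolding proj_perp_orthogonal[OF T_T[OF s] Th h0] y_def hh by (simp add: power_divide)
        then have e3: "g s *\<^sub>R w s = k\<^sup>2 *\<^sub>R y - (g s * (k\<^sup>2 / \<alpha> s)) *\<^sub>R T s"
          using e1 by (simp add: scaleR_add_right eq_diff_eq)
        have e4: "\<phi> s \<bullet> h s = g s / \<alpha> s"
        proof -
          have "\<phi> s \<bullet> h s = (1 / k\<^sup>2) * (g s * (\<alpha> s * (k / \<alpha> s)\<^sup>2))"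
            using elim(1) s hh by (simp add: \<phi>_def)
          then show ?thesis using a k by (simp add: field_simps power2_eq_square)
        qed
        have "\<psi> s = (1 / k\<^sup>2) *\<^sub>R ((\<alpha> s * (lam \<bullet> h' s)) *\<^sub>R (\<alpha> s *\<^sub>R h' s) + (k\<^sup>2 *\<^sub>R y - (g s * (k\<^sup>2 / \<alpha> s)) *\<^sub>R T s))"
          by (simp only: \<psi>_def e2 e3)
        also have "\<dots> = ((\<alpha> s / k)\<^sup>2 * (lam \<bullet> h' s)) *\<^sub>R h' s + y - (g s / \<alpha> s) *\<^sub>R T s"
          using k by (simp add: scaleR_add_right scaleR_diff_right power2_eq_square field_simps)
        also have "\<dots> = lam - (lam \<bullet> T s + g s / \<alpha> s) *\<^sub>R T s"
          by (simp add: y_def scaleR_add_left)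
        finally show "\<psi> s = lam - (lam \<bullet> T s + \<phi> s \<bullet> h s) *\<^sub>R T s" using e4 by simp
      qed
    qed
  qed
qed

end

text \<open>A set that is open and closed in a connected interval is empty or everything. It is used
  to see that an arc other than [0, l] misses one of its end points, so that the condition at the
  ends of arcs is not vacuous.\<close>

lemma openin_interval_subset:
  fixes J :: "real set"
  assumes "openin (top_of_set {0..l}) J" "closed J" "J \<noteq> {}" "0 \<le> l"
  shows "J = {0..l}"
proof -
  have "J \<subseteq> {0..l}" using assms(1) openin_imp_subset by blast
  moreover have "closedin (top_of_set {0..l}) J" using assms(2) calculation by (rule closed_subset[rotated])
  moreover have "connected {0..l}" by simp
  ultimately show ?thesis using assms(1,3) unfolding connected_clopen by blast
qed

lemma nonvanishing_sign:
  fixes p :: "real \<Rightarrow> real"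
  assumes "connected J" "continuous_on J p" "\<And>s. s \<in> J \<Longrightarrow> p s \<noteq> 0"
  shows "(\<forall>s\<in>J. 0 < p s) \<or> (\<forall>s\<in>J. p s < 0)"
proof (rule ccontr)
  assume "\<not> ?thesis"
  then obtain s t where st: "s \<in> J" "t \<in> J" "p s \<le> 0" "0 \<le> p t" by (meson not_le_imp_less less_imp_le)
  have "connected (p ` J)" using assms(1,2) connected_continuous_image by blast
  then have "0 \<in> p ` J" using st connectedD_interval[of "p ` J" "p s" "p t" 0] by blast
  then show False using assms(3) by force
qed

section \<open>The sufficiency of (i)\<close>

context curve
begin

text \<open>Here \<open>\<phi>\<close> is the 2-form lam \<and> c applied to T, where
  \<open>c\<close> is the position relative to a point of the line. On the line \<open>c\<close> is
  parallel to \<open>lam\<close> and \<open>\<phi>\<close> is 0.\<close>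

lemma line_system:
  fixes lam p :: "real ^ 'n"
  defines "c \<equiv> \<lambda>s. \<gamma> s - p"
  defines "\<phi> \<equiv> \<lambda>s. (c s \<bullet> T s) *\<^sub>R lam - (lam \<bullet> T s) *\<^sub>R c s"
  defines "\<psi> \<equiv> \<lambda>s. lam - (lam \<bullet> T s) *\<^sub>R T s + ((c s \<bullet> h s) *\<^sub>R lam - (lam \<bullet> h s) *\<^sub>R c s)"
  shows "WD 0 l \<phi> \<psi>" and "\<And>s. \<phi> s \<bullet> T s = 0"
proof -
  have c: "WD 0 l c (\<lambda>s. T s - 0)" unfolding c_def by (intro WD_diff WD_gamma WD_const)
  have "WD 0 l \<phi> (\<lambda>s. (((T s - 0) \<bullet> T s + c s \<bullet> h s) *\<^sub>R lam + (c s \<bullet> T s) *\<^sub>R 0)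
     - ((0 \<bullet> T s + lam \<bullet> h s) *\<^sub>R c s + (lam \<bullet> T s) *\<^sub>R (T s - 0)))"
    unfolding \<phi>_def by (intro WD_diff WD_scaleR WD_inner WD_const WD_T c l_nonneg)
  then show "WD 0 l \<phi> \<psi>"
    by (rule WD_cong_AE) (auto simp: \<psi>_def T_T scaleR_add_left algebra_simps)
  show "\<phi> s \<bullet> T s = 0" for s by (simp add: \<phi>_def inner_diff_left mult.commute)
qed

text \<open>On an arc everything lives in a plane, so the curvature vector and
  \<open>\<phi>\<close>, both normal to T, are parallel, and \<open>\<psi>\<close> has the required
  form. The sign of \<open>\<phi> \<bullet> h\<close> is constant on each arc. The end condition
  makes it positive: were it negative, the norm of \<open>\<phi>\<close> could not grow away from
  its zero at an end of the arc. Only when one arc is all of [0, l] is the sign free, and then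
  \<open>- \<phi>\<close> can replace \<open>\<phi>\<close>.\<close>

lemma planar_arcs_imp_elastica:
  fixes J :: "nat \<Rightarrow> real set" and lam p :: "real ^ 'n"
  assumes lam: "norm lam = 1"
    and int: "\<And>i. i < N \<Longrightarrow> is_interval (J i)"
    and sub: "\<And>i. i < N \<Longrightarrow> J i \<subseteq> {0..l}"
    and op: "\<And>i. i < N \<Longrightarrow> openin (top_of_set {0..l}) (J i)"
    and disj: "\<And>i j. i < N \<Longrightarrow> j < N \<Longrightarrow> i \<noteq> j \<Longrightarrow> J i \<inter> J j = {}"
    and line: "{s\<in>{0..l}. \<gamma> s \<in> range (\<lambda>t. p + t *\<^sub>R lam)} = {0..l} - (\<Union>i<N. J i)"
    and plane: "\<And>i. i < N \<Longrightarrow> \<exists>P. affine P \<and> aff_dim P = 2 \<and> \<gamma> ` closure (J i) \<union> range (\<lambda>t. p + t *\<^sub>R lam) \<subseteq> P"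
    and wd: "weak_deriv l T h'"
    and cont: "\<And>i. i < N \<Longrightarrow> continuous_on (J i) (\<lambda>s. \<alpha> s *\<^sub>R h' s)"
    and hk: "\<And>i s. i < N \<Longrightarrow> s \<in> J i \<Longrightarrow> \<alpha> s * norm (h' s) = k"
    and ends: "\<And>i s0. i < N \<Longrightarrow> s0 \<in> closure (J i) - J i \<Longrightarrow> \<exists>\<delta>>0.
                     (\<forall>s\<in>{s0<..<s0+\<delta>} \<inter> J i. lam \<bullet> h' s > 0)
                   \<and> (\<forall>s\<in>{s0-\<delta><..<s0} \<inter> J i. lam \<bullet> h' s < 0)"
  shows "inf_elastica l \<alpha> a1 a2 T1 T2 \<gamma>"
proof (cases "k = 0")
  case True then show ?thesis by (rule zero_curvature_imp_elastica)
next
  case False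
  then have k: "k > 0" using k_nonneg by simp
  have lam0: "lam \<noteq> 0" using lam by auto
  have WDT': "WD 0 l T h'" using wd WD_lip[OF WD_T] by (simp add: WD_iff_weak_deriv)
  have heq: "AE s\<in>{0..l} in lebesgue. h' s = h s" by (rule WD_T_unique[OF WDT'])
  define c where "c s = \<gamma> s - p" for s
  define \<phi> where "\<phi> s = (c s \<bullet> T s) *\<^sub>R lam - (lam \<bullet> T s) *\<^sub>R c s" for s
  define \<psi> where "\<psi> s = lam - (lam \<bullet> T s) *\<^sub>R T s + ((c s \<bullet> h s) *\<^sub>R lam - (lam \<bullet> h s) *\<^sub>R c s)" for s
  have WDp: "WD 0 l \<phi> \<psi>" and phiT: "\<And>s. \<phi> s \<bullet> T s = 0"
    using line_system[where p = p and lam = lam] unfolding \<phi>_def[abs_def] \<psi>_def[abs_def] c_def by auto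
  have cphi: "continuous_on {0..l} \<phi>" by (rule WD_continuous[OF WDp])
  have on_line: "\<gamma> s \<in> range (\<lambda>t. p + t *\<^sub>R lam) \<longleftrightarrow> c s \<in> span {lam}" for s
    by (auto simp: span_singleton c_def image_iff algebra_simps)
  have off: "c s \<in> span {lam} \<longleftrightarrow> (\<forall>i<N. s \<notin> J i)" if "s \<in> {0..l}" for s
    using line that on_line[of s] by blast
  have phi0: "\<phi> s = 0" if "s \<in> {0..l}" "\<And>i. i < N \<Longrightarrow> s \<notin> J i" for s
  proof -
    have "c s \<in> span {lam}" using off[OF that(1)] that(2) by blast
    then obtain x where "c s = x *\<^sub>R lam" by (auto simp: span_singleton)
    then show ?thesis by (simp add: \<phi>_def)
  qed
  have arc: "\<exists>a b. a \<le> b \<and> closure (J i) = {a..b} \<and> {a<..<b} \<subseteq> J i \<and> J i \<subseteq> {a..b} \<and> 0 \<le> a \<and> b \<le> l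
      \<and> (\<forall>s\<in>J i. \<phi> s \<noteq> 0)
      \<and> (AE s\<in>{a..b} in lebesgue. \<psi> s = lam - (lam \<bullet> T s + \<phi> s \<bullet> h s) *\<^sub>R T s)
      \<and> (AE s\<in>{a..b} in lebesgue. s \<in> J i \<longrightarrow> h s = ((h s \<bullet> \<phi> s) / (\<phi> s \<bullet> \<phi> s)) *\<^sub>R \<phi> s)"
    if i: "i < N" and ne: "J i \<noteq> {}" for i
  proof -
    have bJ: "bounded (J i)" using sub[OF i] bounded_subset bounded_closed_interval by blast
    obtain a b where ab: "a \<le> b" "closure (J i) = {a..b}" "{a<..<b} \<subseteq> J i" "J i \<subseteq> {a..b}"
      by (rule interval_closure_cases[OF int[OF i] bJ ne]) (rule that)
    have "{a..b} \<subseteq> {0..l}" using closure_minimal[OF sub[OF i]] ab(2) by simp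
    then have ab0: "0 \<le> a" "b \<le> l" using ab(1) by auto
    have ltab: "a < b"
    proof (rule ccontr)
      assume "\<not> a < b"
      then have "J i = {a}" using ab ne by auto
      then have "J i = {0..l}" by (intro openin_interval_subset op i) (use l_pos in auto)
      with \<open>J i = {a}\<close> have "{0..l} = {a}" by simp
      moreover have "0 \<in> {0..l}" "l \<in> {0..l}" using l_pos by auto
      ultimately show False using l_pos by auto
    qed
    obtain P where P: "affine P" "aff_dim P = 2" "\<gamma> ` closure (J i) \<union> range (\<lambda>t. p + t *\<^sub>R lam) \<subseteq> P"
      using plane[OF i] by blast
    have pP: "p \<in> P" using P(3) by (force intro: image_eqI[of _ _ 0])
    obtain D where D: "subspace D" "dim D = 2" "\<And>x. x \<in> P \<longleftrightarrow> x - p \<in> D"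
      by (rule affine_plane_direction[OF P(1,2) pP]) (rule that)
    have "p + 1 *\<^sub>R lam \<in> P" using P(3) by blast
    then have lamD: "lam \<in> D" using D(3) by simp
    have cD: "c s \<in> D" if "s \<in> {a..b}" for s
      using that P(3) D(3) ab(2) by (force simp: c_def)
    have WDg: "WD a b \<gamma> T" and WDTab: "WD a b T h" using WD_subset WD_gamma WD_T ab0 by blast+
    have "AE s\<in>{a..b} in lebesgue. T s \<in> D"
      by (rule WD_in_subspace[OF WDg ab(1) D(1), of p]) (use cD in \<open>simp add: c_def\<close>)
    then have TD: "T s \<in> D" if "s \<in> {a..b}" for s
      by (rule continuous_AE_in_subspace[OF WD_continuous[OF WDTab] ltab D(1) _ that])
    have hD: "AE s\<in>{a..b} in lebesgue. h s \<in> D"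
      by (rule WD_in_subspace[OF WDTab ab(1) D(1), of 0]) (use TD in simp)
    have phiD: "\<phi> s \<in> D" if "s \<in> {a..b}" for s
      unfolding \<phi>_def using D(1) lamD cD[OF that] by (intro subspace_diff subspace_scale)
    \<comment> \<open>If \<open>\<phi> s = 0\<close> and
      \<open>lam \<bullet> T s \<noteq> 0\<close>, then \<open>c s\<close> is a multiple of
      \<open>lam\<close>. If \<open>lam \<bullet> T s = 0\<close>, then \<open>c s\<close> is
      orthogonal to T as well, and in the plane this again makes it a multiple of
      \<open>lam\<close>.\<close>
    have nz: "\<phi> s \<noteq> 0" if s: "s \<in> J i" for s
    proof
      assume z: "\<phi> s = 0"
      have sab: "s \<in> {a..b}" "s \<in> {0..l}" using s ab ab0 by auto
      have ns: "c s \<notin> span {lam}" using off[OF sab(2)] s i by blast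
      have lT: "lam \<bullet> T s = 0"
      proof (rule ccontr)
        assume nl: "lam \<bullet> T s \<noteq> 0"
        have "(lam \<bullet> T s) *\<^sub>R c s = (c s \<bullet> T s) *\<^sub>R lam" using z by (simp add: \<phi>_def)
        then have "inverse (lam \<bullet> T s) *\<^sub>R ((lam \<bullet> T s) *\<^sub>R c s)
            = inverse (lam \<bullet> T s) *\<^sub>R ((c s \<bullet> T s) *\<^sub>R lam)" by simp
        then have "c s = (inverse (lam \<bullet> T s) * (c s \<bullet> T s)) *\<^sub>R lam" using nl by simp
        then show False using ns by (metis span_base span_scale singletonI)
      qed
      then have cT: "c s \<bullet> T s = 0" using z lam0 by (simp add: \<phi>_def)
      have "c s = (c s \<bullet> T s) *\<^sub>R T s + (c s \<bullet> lam / (lam \<bullet> lam)) *\<^sub>R lam"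
        using lT lam0 D(2) by (intro plane_orthogonal_decomposition[OF D(1) _ TD lamD cD])
          (use sab T_T in \<open>auto simp: inner_commute\<close>)
      then have "c s = (c s \<bullet> lam / (lam \<bullet> lam)) *\<^sub>R lam" using cT by simp
      then show False using ns by (metis span_base span_scale singletonI)
    qed
    have b1: "AE s\<in>{a..b} in lebesgue. \<psi> s = lam - (lam \<bullet> T s + \<phi> s \<bullet> h s) *\<^sub>R T s"
      using hD T_h
    proof eventually_elim
      case (elim s)
      show ?case
      proof
        assume s: "s \<in> {a..b}"
        then have s0: "s \<in> {0..l}" using ab0 by auto
        \<comment> \<open>\<open>x\<close> is lam \<and> c applied to the curvature vector. It is
          orthogonal to that vector, so within the plane it is a multiple of T.\<close>
        define x where "x = (c s \<bullet> h s) *\<^sub>R lam - (lam \<bullet> h s) *\<^sub>R c s"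
        have Th: "T s \<bullet> h s = 0" using elim s0 by simp
        have "x = - (\<phi> s \<bullet> h s) *\<^sub>R T s"
        proof (cases "h s = 0")
          case True then show ?thesis by (simp add: x_def)
        next
          case False
          have "x \<in> D" unfolding x_def using D(1) lamD cD[OF s] by (intro subspace_diff subspace_scale)
          then have "x = (x \<bullet> T s) *\<^sub>R T s + (x \<bullet> h s / (h s \<bullet> h s)) *\<^sub>R h s"
            using False D(2) elim(1) s by (intro plane_orthogonal_decomposition[OF D(1) _ TD _ _ Th T_T[OF s0]]) auto
          moreover have "x \<bullet> h s = 0" by (simp add: x_def inner_diff_left mult.commute)
          moreover have "x \<bullet> T s = - (\<phi> s \<bullet> h s)"
            by (simp add: x_def \<phi>_def inner_diff_left mult.commute)
          ultimately show ?thesis by simp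
        qed
        then show "\<psi> s = lam - (lam \<bullet> T s + \<phi> s \<bullet> h s) *\<^sub>R T s"
          unfolding \<psi>_def x_def[symmetric] by (simp add: scaleR_add_left)
      qed
    qed
    have b2: "AE s\<in>{a..b} in lebesgue. s \<in> J i \<longrightarrow> h s = ((h s \<bullet> \<phi> s) / (\<phi> s \<bullet> \<phi> s)) *\<^sub>R \<phi> s"
      using hD T_h
    proof eventually_elim
      case (elim s)
      show ?case
      proof (intro impI)
        assume s: "s \<in> {a..b}" and sJ: "s \<in> J i"
        then have s0: "s \<in> {0..l}" using ab0 by auto
        have Tp: "T s \<bullet> \<phi> s = 0" using phiT[of s] by (simp add: inner_commute)
        have "h s = (h s \<bullet> T s) *\<^sub>R T s + (h s \<bullet> \<phi> s / (\<phi> s \<bullet> \<phi> s)) *\<^sub>R \<phi> s"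
          using nz[OF sJ] D(2) elim(1) s
          by (intro plane_orthogonal_decomposition[OF D(1) _ TD phiD _ Tp T_T[OF s0]]) auto
        moreover have "h s \<bullet> T s = 0" using elim(2) s0 by (simp add: inner_commute)
        ultimately show "h s = ((h s \<bullet> \<phi> s) / (\<phi> s \<bullet> \<phi> s)) *\<^sub>R \<phi> s" by simp
      qed
    qed
    show ?thesis using ab ab0 nz b1 b2 by blast
  qed
  \<comment> \<open>\<open>q\<close> is continuous on every arc even where \<alpha> and the
    curvature jump, because the jumps cancel in their product; so |q| = \<open>k |\<phi>|\<close>
    holds at every point of an arc and q keeps its sign.\<close>
  define q where "q s = \<phi> s \<bullet> (\<alpha> s *\<^sub>R h' s)" for s
  have cq: "continuous_on (J i) q" if i: "i < N" for i
    unfolding q_def by (rule continuous_on_inner[OF continuous_on_subset[OF cphi sub[OF i]] cont[OF i]])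
  have arc_q: "\<bar>q s\<bar> = k * norm (\<phi> s)" if i: "i < N" and s: "s \<in> J i" for i s
  proof -
    have "J i \<noteq> {}" using s by auto
    from arc[OF i this] obtain a b where ab: "a \<le> b" "closure (J i) = {a..b}" "{a<..<b} \<subseteq> J i" "J i \<subseteq> {a..b}"
      "0 \<le> a" "b \<le> l" "AE s\<in>{a..b} in lebesgue. s \<in> J i \<longrightarrow> h s = ((h s \<bullet> \<phi> s) / (\<phi> s \<bullet> \<phi> s)) *\<^sub>R \<phi> s"
      and nz: "\<forall>s\<in>J i. \<phi> s \<noteq> 0" by blast
    have sl: "s \<in> {0..l}" using sub[OF i] s by auto
    have "openin (top_of_set {0..l}) (J i)" using op[OF i] .
    then obtain d where d: "d > 0" "\<And>y. y \<in> {0..l} \<Longrightarrow> dist y s < d \<Longrightarrow> y \<in> J i"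
      using s unfolding openin_euclidean_subtopology_iff by blast
    define u where "u = max 0 (s - d / 2)"
    define v where "v = min l (s + d / 2)"
    have uv: "u < v" "s \<in> {u..v}" using sl l_pos d(1) by (auto simp: u_def v_def)
    have uvJ: "{u..v} \<subseteq> J i"
    proof
      fix y assume "y \<in> {u..v}"
      then have "y \<in> {0..l}" "dist y s < d" using d(1) sl by (auto simp: u_def v_def dist_real_def)
      then show "y \<in> J i" by (rule d(2))
    qed
    have "(\<lambda>s. \<bar>q s\<bar> - k * norm (\<phi> s)) s = 0"
    proof (rule continuous_AE_zero[OF _ uv(1) _ uv(2)])
      show "continuous_on {u..v} (\<lambda>s. \<bar>q s\<bar> - k * norm (\<phi> s))"
        using continuous_on_subset[OF cq[OF i] uvJ] continuous_on_subset[OF continuous_on_subset[OF cphi sub[OF i]] uvJ]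
        by (intro continuous_intros)
      show "AE s\<in>{u..v} in lebesgue. \<bar>q s\<bar> - k * norm (\<phi> s) = 0"
        using ab(7) heq
      proof eventually_elim
        case (elim y)
        show ?case
        proof
          assume "y \<in> {u..v}"
          then have yJ: "y \<in> J i" using uvJ by blast
          then have y: "y \<in> {a..b}" "y \<in> {0..l}" using ab(4) sub[OF i] by auto
          have hy: "h' y = h y" "h y = ((h y \<bullet> \<phi> y) / (\<phi> y \<bullet> \<phi> y)) *\<^sub>R \<phi> y" using elim y yJ by auto
          have p0: "norm (\<phi> y) > 0" using nz yJ by simp
          have "norm (h y) = norm (((h y \<bullet> \<phi> y) / (\<phi> y \<bullet> \<phi> y)) *\<^sub>R \<phi> y)" using hy(2) by (rule arg_cong)
          also have "\<dots> = \<bar>h y \<bullet> \<phi> y\<bar> / (norm (\<phi> y))\<^sup>2 * norm (\<phi> y)" by (simp flip: power2_norm_eq_inner)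
          finally have "\<bar>h y \<bullet> \<phi> y\<bar> = norm (h y) * norm (\<phi> y)" using p0 by (simp add: power2_eq_square)
          then show "\<bar>q y\<bar> - k * norm (\<phi> y) = 0"
            using hk[OF i yJ] alpha_pos[OF y(2)] hy(1) by (simp add: q_def abs_mult inner_commute)
        qed
      qed
    qed
    then show ?thesis by simp
  qed
  have sign: "(\<forall>s\<in>J i. 0 < q s) \<or> (\<forall>s\<in>J i. q s < 0)" if i: "i < N" for i
  proof (cases "J i = {}")
    case False
    then have nz: "\<forall>s\<in>J i. \<phi> s \<noteq> 0" using arc[OF i] by blast
    show ?thesis
    proof (rule nonvanishing_sign)
      show "connected (J i)" using int[OF i] is_interval_connected by blast
      show "continuous_on (J i) q"
        by (rule cq[OF i])
      show "q s \<noteq> 0" if "s \<in> J i" for s using arc_q[OF i that] nz that k by auto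
    qed
  qed auto
  \<comment> \<open>The factor \<open>\<sigma>\<close> treats both signs of the curvature at once:
    the certificate is \<open>\<sigma> *\<^sub>R \<phi>\<close> with the vector
    \<open>\<sigma> *\<^sub>R lam\<close>.\<close>
  have cert: "inf_elastica l \<alpha> a1 a2 T1 T2 \<gamma>"
    if sg: "\<bar>\<sigma>\<bar> = 1" and pos: "\<And>i s. i < N \<Longrightarrow> s \<in> J i \<Longrightarrow> 0 < \<sigma> * q s" and nonempty: "i0 < N" "s0 \<in> J i0" for \<sigma> i0 s0
  proof -
    have "AE s\<in>{0..l} in lebesgue. \<psi> s = lam - (lam \<bullet> T s + \<phi> s \<bullet> h s) *\<^sub>R T s"
    proof -
      have "AE s\<in>{0..l} in lebesgue. (\<forall>i\<in>{..<N}. s \<in> J i \<longrightarrow> \<psi> s = lam - (lam \<bullet> T s + \<phi> s \<bullet> h s) *\<^sub>R T s)"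
      proof (rule AE_ball_finite_imp)
        fix i assume "i \<in> {..<N}"
        then have i: "i < N" by simp
        show "AE s\<in>{0..l} in lebesgue. s \<in> J i \<longrightarrow> \<psi> s = lam - (lam \<bullet> T s + \<phi> s \<bullet> h s) *\<^sub>R T s"
        proof (cases "J i = {}")
          case False
          from arc[OF i this] obtain a b where "J i \<subseteq> {a..b}"
            "AE s\<in>{a..b} in lebesgue. \<psi> s = lam - (lam \<bullet> T s + \<phi> s \<bullet> h s) *\<^sub>R T s" by blast
          then show ?thesis by (auto elim!: eventually_mono)
        qed simp
      qed simp
      then show ?thesis
      proof eventually_elim
        case (elim s)
        show ?case
        proof
          assume s: "s \<in> {0..l}"
          show "\<psi> s = lam - (lam \<bullet> T s + \<phi> s \<bullet> h s) *\<^sub>R T s"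
          proof (cases "\<exists>i<N. s \<in> J i")
            case True then show ?thesis using elim s by blast
          next
            case False
            then obtain x where "c s = x *\<^sub>R lam" using off[OF s] by (auto simp: span_singleton)
            moreover have "\<phi> s = 0" using phi0[OF s] False by blast
            ultimately show ?thesis by (simp add: \<psi>_def)
          qed
        qed
      qed
    qed
    note psi = this
    show ?thesis
    proof (rule certificate_imp_elastica)
      show "WD 0 l (\<lambda>s. \<sigma> *\<^sub>R \<phi> s) (\<lambda>s. \<sigma> *\<^sub>R \<psi> s)" by (rule WD_scaleR_const[OF WDp])
      show "AE s\<in>{0..l} in lebesgue. \<sigma> *\<^sub>R \<psi> s = \<sigma> *\<^sub>R lam - ((\<sigma> *\<^sub>R lam) \<bullet> T s + (\<sigma> *\<^sub>R \<phi> s) \<bullet> h s) *\<^sub>R T s"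
        using psi
      proof eventually_elim
        case (elim s)
        show ?case
        proof
          assume "s \<in> {0..l}"
          with elim have e: "\<psi> s = lam - (lam \<bullet> T s + \<phi> s \<bullet> h s) *\<^sub>R T s" by blast
          show "\<sigma> *\<^sub>R \<psi> s = \<sigma> *\<^sub>R lam - ((\<sigma> *\<^sub>R lam) \<bullet> T s + (\<sigma> *\<^sub>R \<phi> s) \<bullet> h s) *\<^sub>R T s"
            unfolding e by (simp add: algebra_simps)
        qed
      qed
      show "AE s\<in>{0..l} in lebesgue. (\<sigma> *\<^sub>R \<phi> s) \<bullet> h s = norm (\<sigma> *\<^sub>R \<phi> s) * k / \<alpha> s"
        using heq
      proof eventually_elim
        case (elim s)
        show ?case
        proof
          assume s: "s \<in> {0..l}"
          show "(\<sigma> *\<^sub>R \<phi> s) \<bullet> h s = norm (\<sigma> *\<^sub>R \<phi> s) * k / \<alpha> s"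
          proof (cases "\<exists>i<N. s \<in> J i")
            case True
            then obtain i where i: "i < N" "s \<in> J i" by blast
            have "\<sigma> * q s = \<bar>\<sigma> * q s\<bar>" using pos[OF i] by simp
            also have "\<dots> = k * norm (\<phi> s)" using arc_q[OF i] sg by (simp add: abs_mult)
            finally have "\<sigma> * (\<phi> s \<bullet> h s) * \<alpha> s = k * norm (\<phi> s)" using elim s by (simp add: q_def mult_ac)
            then show ?thesis using alpha_pos[OF s] sg by (simp add: field_simps)
          next
            case False
            then have "\<phi> s = 0" using phi0[OF s] by blast
            then show ?thesis by simp
          qed
        qed
      qed
      show "s0 \<in> {0..l}" using sub nonempty by blast
      show "\<sigma> *\<^sub>R \<phi> s0 \<noteq> 0" using arc[OF nonempty(1)] nonempty sg by fastforce
    qed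
  qed
  show ?thesis
  proof (cases "\<exists>i<N. J i \<noteq> {}")
    case False
    have "c s \<in> span {lam}" if "s \<in> {0..l}" for s using off[OF that] False by blast
    then have "AE s\<in>{0..l} in lebesgue. T s \<in> span {lam}"
      by (intro WD_in_subspace[OF WD_gamma l_nonneg, of _ p]) (auto simp: c_def)
    then have "T s \<in> span {lam}" if "s \<in> {0..l}" for s
      using that by (intro continuous_AE_in_subspace[OF continuous_T l_pos]) auto
    then obtain w where "\<forall>s\<in>{0..l}. T s = w" using parallel_T_imp_const by blast
    then have "k = 0" using const_T_imp_zero_curvature by blast
    then show ?thesis using k by simp
  next
    case True
    then obtain i0 s0 where i0: "i0 < N" "s0 \<in> J i0" by blast
    show ?thesis
    proof (cases "\<exists>i<N. J i = {0..l}")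
      case True
      then obtain i1 where i1: "i1 < N" "J i1 = {0..l}" by blast
      have only: "i = i1" if "i < N" "s \<in> J i" for i s
        using disj[OF that(1) i1(1)] that sub[OF that(1)] i1(2) by blast
      from sign[OF i1(1)] show ?thesis
      proof
        assume "\<forall>s\<in>J i1. 0 < q s"
        then show ?thesis using cert[of 1, OF _ _ i0] only by fastforce
      next
        assume "\<forall>s\<in>J i1. q s < 0"
        then show ?thesis using cert[of "-1", OF _ _ i0] only by fastforce
      qed
    next
      case False
      have "0 < q s" if i: "i < N" and s: "s \<in> J i" for i s
      proof (rule ccontr)
        assume "\<not> 0 < q s"
        then have neg: "\<forall>s\<in>J i. q s < 0" using sign[OF i] s by force
        have ne: "J i \<noteq> {}" using s by blast
        from arc[OF i ne] obtain a b where ab: "a \<le> b" "closure (J i) = {a..b}" "{a<..<b} \<subseteq> J i" "J i \<subseteq> {a..b}"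
          "0 \<le> a" "b \<le> l" "AE s\<in>{a..b} in lebesgue. s \<in> J i \<longrightarrow> h s = ((h s \<bullet> \<phi> s) / (\<phi> s \<bullet> \<phi> s)) *\<^sub>R \<phi> s"
          "AE s\<in>{a..b} in lebesgue. \<psi> s = lam - (lam \<bullet> T s + \<phi> s \<bullet> h s) *\<^sub>R T s"
          and nz: "\<forall>s\<in>J i. \<phi> s \<noteq> 0" by blast
        have "\<not> closed (J i)"
          using openin_interval_subset[OF op[OF i] _ ne l_nonneg] False i by blast
        then have "closure (J i) \<noteq> J i" by (metis closed_closure)
        then obtain e where e: "e \<in> closure (J i) - J i" using closure_subset by blast
        have el: "e \<in> {0..l}" "e \<in> {a..b}" using e ab by auto
        have eab: "e = a \<or> e = b" using e ab by force
        have ltab: "a < b"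
        proof (rule ccontr)
          assume "\<not> a < b"
          then have "e = a" "s = a" using eab s ab(1,4) by auto
          then show False using e s by simp
        qed
        \<comment> \<open>The end \<open>e\<close> lies in no other arc either: such an arc is
          relatively open and would meet \<open>J i\<close>. So \<open>e\<close> is mapped to the
          line.\<close>
        have "\<phi> e = 0"
        proof (rule phi0[OF el(1)])
          fix j assume j: "j < N"
          show "e \<notin> J j"
          proof
            assume ej: "e \<in> J j"
            then have ji: "j \<noteq> i" using e by auto
            obtain U where U: "open U" "J j = {0..l} \<inter> U" using op[OF j] by (auto simp: openin_open)
            have "e \<in> U" using ej U by auto
            then have "U \<inter> J i \<noteq> {}" using e U(1) by (auto simp: closure_iff_nhds_not_empty)
            then have "J j \<inter> J i \<noteq> {}" using U sub[OF i] by auto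
            then show False using disj[OF j i ji] by simp
          qed
        qed
        note pe = this
        obtain \<delta> where \<delta>: "\<delta> > 0" "\<And>s. s\<in>{e<..<e+\<delta>} \<inter> J i \<Longrightarrow> lam \<bullet> h' s > 0"
          "\<And>s. s\<in>{e-\<delta><..<e} \<inter> J i \<Longrightarrow> lam \<bullet> h' s < 0" using ends[OF i e] by blast
        have WDpab: "WD a b \<phi> \<psi>" using WD_subset[OF WDp ab(5,6)] .
        obtain m where m: "WD a b (\<lambda>x. norm (\<phi> x)) m"
          "AE x\<in>{a..b} in lebesgue. norm (\<phi> x) * m x = \<phi> x \<bullet> \<psi> x"
          by (rule WD_norm_exists[OF WDpab ab(1)]) (rule that)
        \<comment> \<open>The derivative \<open>m\<close> of the norm of \<open>\<phi>\<close> is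
          \<open>lam \<bullet> \<phi>\<close> divided by that norm. If the curvature vector is a
          negative multiple of \<open>\<phi>\<close>, then \<open>m\<close> and
          \<open>lam \<bullet> h'\<close> have opposite signs.\<close>
        have msign: "AE s\<in>{a..b} in lebesgue. s \<in> J i \<longrightarrow> m s * (lam \<bullet> h' s) \<le> 0"
          using m(2) ab(7,8) heq
        proof eventually_elim
          case (elim s)
          show ?case
          proof (intro impI)
            assume s: "s \<in> {a..b}" "s \<in> J i"
            then have sl: "s \<in> {0..l}" using ab by auto
            have p0: "norm (\<phi> s) > 0" using nz s by simp
            have "norm (\<phi> s) * m s = \<phi> s \<bullet> \<psi> s" using elim(1) s(1) by simp
            also have "\<psi> s = lam - (lam \<bullet> T s + \<phi> s \<bullet> h s) *\<^sub>R T s" using elim(3) s(1) by simp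
            finally have 1: "norm (\<phi> s) * m s = \<phi> s \<bullet> lam" using phiT[of s] by (simp add: inner_diff_right)
            have "\<phi> s \<bullet> h s < 0" using neg s(2) alpha_pos[OF sl] elim(4) sl by (auto simp: q_def mult_less_0_iff)
            then have hp: "(h s \<bullet> \<phi> s) / (\<phi> s \<bullet> \<phi> s) \<le> 0" using p0 by (simp add: inner_commute divide_nonpos_pos)
            have "lam \<bullet> h s = ((h s \<bullet> \<phi> s) / (\<phi> s \<bullet> \<phi> s)) * (lam \<bullet> \<phi> s)"
              using arg_cong[of "h s" _ "\<lambda>x. lam \<bullet> x", OF elim(2)[rule_format, OF s]] by simp
            then have 2: "lam \<bullet> h' s = ((h s \<bullet> \<phi> s) / (\<phi> s \<bullet> \<phi> s)) * (norm (\<phi> s) * m s)"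
              using 1 elim(4) sl by (simp add: inner_commute)
            have "m s * (lam \<bullet> h' s) = ((h s \<bullet> \<phi> s) / (\<phi> s \<bullet> \<phi> s)) * (norm (\<phi> s) * (m s)\<^sup>2)"
              unfolding 2 by (simp add: power2_eq_square)
            also have "\<dots> \<le> 0" using hp p0 by (intro mult_nonpos_nonneg) auto
            finally show "m s * (lam \<bullet> h' s) \<le> 0" .
          qed
        qed
        from eab show False
        proof
          assume ea: "e = a"
          define t where "t = min (a + \<delta> / 2) ((a + b) / 2)"
          have t: "a < t" "t < b" "t < a + \<delta>" using \<delta>(1) ltab by (auto simp: t_def min_def field_simps)
          \<comment> \<open>By the end condition the norm of \<open>\<phi>\<close> cannot increase
            just after its zero at \<open>a\<close>, so it vanishes inside the arc, a contradiction.
            The right end is symmetric.\<close>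
          have "norm (\<phi> a) \<ge> norm (\<phi> t)"
          proof -
            have "- norm (\<phi> a) \<le> - norm (\<phi> t)"
            proof (rule WD_mono[OF WD_minus[OF WD_subset[OF m(1)]]])
              have "AE s in lebesgue. s \<noteq> a"
                using AE_lborel_singleton[of a] by (simp add: AE_completion_iff)
              with msign show "AE s\<in>{a..t} in lebesgue. 0 \<le> - m s"
              proof eventually_elim
                case (elim s)
                show ?case
                proof
                  assume s: "s \<in> {a..t}"
                  then have "s \<in> {a<..<b}" using elim t by auto
                  then have sJ: "s \<in> J i" using ab by blast
                  have "lam \<bullet> h' s > 0" using \<delta>(2)[of s] s elim t sJ ea by auto
                  moreover have "m s * (lam \<bullet> h' s) \<le> 0" using elim sJ s t by auto
                  ultimately show "0 \<le> - m s" by (simp add: mult_le_0_iff)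
                qed
              qed
            qed (use t in auto)
            then show ?thesis by simp
          qed
          then have "\<phi> t = 0" using pe ea by simp
          moreover have "t \<in> J i" using t ab by force
          ultimately show False using nz by blast
        next
          assume eb: "e = b"
          define t where "t = max (b - \<delta> / 2) ((a + b) / 2)"
          have t: "a < t" "t < b" "b - \<delta> < t" using \<delta>(1) ltab by (auto simp: t_def max_def field_simps)
          have "norm (\<phi> t) \<le> norm (\<phi> b)"
          proof (rule WD_mono[OF WD_subset[OF m(1)]])
            have "AE s in lebesgue. s \<noteq> b"
              using AE_lborel_singleton[of b] by (simp add: AE_completion_iff)
            with msign show "AE s\<in>{t..b} in lebesgue. 0 \<le> m s"
            proof eventually_elim
              case (elim s)
              show ?case
              proof
                assume s: "s \<in> {t..b}"
                then have "s \<in> {a<..<b}" using elim t by auto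
                then have sJ: "s \<in> J i" using ab by blast
                have "lam \<bullet> h' s < 0" using \<delta>(3)[of s] s elim t sJ eb by auto
                moreover have "m s * (lam \<bullet> h' s) \<le> 0" using elim sJ s t by auto
                ultimately show "0 \<le> m s" by (simp add: mult_le_0_iff)
              qed
            qed
          qed (use t in auto)
          then have "\<phi> t = 0" using pe eb by simp
          moreover have "t \<in> J i" using t ab by force
          ultimately show False using nz by blast
        qed
      qed
      then show ?thesis using cert[of 1, OF _ _ i0] by simp
    qed
  qed
qed

end

section \<open>Necessity: deformation by paths of skew matrices\<close>

text \<open>The 2-form x \<and> y as a skew matrix. The sign is chosen so that
  \<open>wedge x T *v T = x\<close> for a unit vector T orthogonal to x.\<close>

definition wedge :: "real ^ 'n \<Rightarrow> real ^ 'n \<Rightarrow> real ^ 'n ^ 'n" where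
  "wedge x y = (\<chi> i j. x $ i * y $ j - y $ i * x $ j)"

lemma wedge_mult_vec: "wedge x y *v z = (y \<bullet> z) *\<^sub>R x - (x \<bullet> z) *\<^sub>R y"
  by (simp add: wedge_def vec_eq_iff matrix_vector_mult_def inner_vec_def sum_distrib_right
      sum_subtractf algebra_simps sum_distrib_left)

lemma bounded_bilinear_wedge: "bounded_bilinear wedge"
proof -
  have "bilinear wedge"
    unfolding bilinear_def
    by (auto intro!: linearI simp: wedge_def vec_eq_iff algebra_simps)
  then show ?thesis by (simp add: bilinear_conv_bounded_bilinear)
qed

lemma bounded_bilinear_mult_vec: "bounded_bilinear (\<lambda>(A :: real ^ 'n ^ 'm) x. A *v x)"
proof -
  have "bilinear (\<lambda>(A :: real ^ 'n ^ 'm) x. A *v x)"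
    unfolding bilinear_def
    by (auto intro!: linearI simp: matrix_vector_mult_add_rdistrib matrix_vector_right_distrib
        matrix_vector_mult_scaleR scaleR_matrix_vector_assoc)
  then show ?thesis by (simp add: bilinear_conv_bounded_bilinear)
qed

section \<open>Skew matrices and normalisation\<close>

definition skew :: "real ^ 'n ^ 'n \<Rightarrow> bool" where
  "skew A \<longleftrightarrow> (\<forall>x y. (A *v x) \<bullet> y = - (x \<bullet> (A *v y)))"

lemma skew_self: "skew A \<Longrightarrow> (A *v x) \<bullet> x = 0"
  unfolding skew_def by (metis equal_neg_zero inner_commute)

lemma skew_add: "skew A \<Longrightarrow> skew B \<Longrightarrow> skew (A + B)"
  by (simp add: skew_def matrix_vector_mult_add_rdistrib inner_add_left inner_add_right)

lemma skew_scaleR: "skew A \<Longrightarrow> skew (c *\<^sub>R A)"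
  by (simp add: skew_def flip: scaleR_matrix_vector_assoc)

lemma skew_wedge: "skew (wedge x y)"
  by (simp add: skew_def wedge_mult_vec inner_diff_left inner_diff_right inner_commute mult.commute)

lemma normalize_lipschitz:
  fixes x y :: "'a::real_normed_vector"
  assumes "1 \<le> norm x" "1 \<le> norm y"
  shows "norm (x /\<^sub>R norm x - y /\<^sub>R norm y) \<le> 2 * norm (x - y)"
proof -
  have x: "norm x > 0" and y: "norm y > 0" using assms by auto
  have "x /\<^sub>R norm x - y /\<^sub>R norm y = (x - y) /\<^sub>R norm x + (inverse (norm x) - inverse (norm y)) *\<^sub>R y"
    by (simp add: algebra_simps)
  also have "norm \<dots> \<le> norm ((x - y) /\<^sub>R norm x) + norm ((inverse (norm x) - inverse (norm y)) *\<^sub>R y)"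
    by (rule norm_triangle_ineq)
  also have "norm ((x - y) /\<^sub>R norm x) \<le> norm (x - y)"
  proof -
    have "norm ((x - y) /\<^sub>R norm x) = norm (x - y) / norm x" by (simp add: divide_inverse_commute)
    also have "\<dots> \<le> norm (x - y) / 1" using assms by (intro frac_le) auto
    finally show ?thesis by simp
  qed
  also have "norm ((inverse (norm x) - inverse (norm y)) *\<^sub>R y) = \<bar>norm y - norm x\<bar> / norm x"
  proof -
    have "inverse (norm x) - inverse (norm y) = (norm y - norm x) / (norm x * norm y)"
      using x y by (simp add: field_simps)
    then show ?thesis using x y by (simp add: abs_mult)
  qed
  also have "\<bar>norm y - norm x\<bar> / norm x \<le> \<bar>norm y - norm x\<bar> / 1" using assms by (intro frac_le) auto
  also have "\<bar>norm y - norm x\<bar> / 1 = \<bar>norm y - norm x\<bar>" by simp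
  also have "\<dots> \<le> norm (x - y)" using norm_triangle_ineq3[of y x] by (simp add: norm_minus_commute)
  finally show ?thesis by simp
qed

text \<open>The vector is the derivative of X / |X| in direction Y, that is, the part of Y normal to
  X divided by |X|. Since |X| is at least 1, normalising never enlarges the curvature.\<close>

lemma norm_derivative_normalize_le:
  fixes X Y :: "'a::real_inner"
  assumes "1 \<le> norm X"
  shows "norm ((- (X \<bullet> Y) / norm X ^ 3) *\<^sub>R X + Y /\<^sub>R norm X) \<le> norm Y"
proof -
  define n where "n = norm X"
  have n: "n > 0" "n \<ge> 1" using assms by (auto simp: n_def)
  have XX: "X \<bullet> X = n\<^sup>2" by (simp add: n_def power2_norm_eq_inner)
  define Z where "Z = (- (X \<bullet> Y) / n ^ 3) *\<^sub>R X + Y /\<^sub>R n"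
  define r q where "r = - (X \<bullet> Y) / n ^ 3" and "q = inverse n"
  have "Z = r *\<^sub>R X + q *\<^sub>R Y" by (simp add: Z_def r_def q_def)
  then have "Z \<bullet> Z = r * r * n\<^sup>2 + 2 * r * q * (X \<bullet> Y) + q * q * (Y \<bullet> Y)"
    by (simp add: inner_add_left inner_add_right XX inner_commute algebra_simps)
  also have "\<dots> = (Y \<bullet> Y) / n\<^sup>2 - (X \<bullet> Y)\<^sup>2 / n ^ 4"
    using n unfolding r_def q_def by (simp add: eval_nat_numeral field_simps)
  finally have "Z \<bullet> Z = (Y \<bullet> Y) / n\<^sup>2 - (X \<bullet> Y)\<^sup>2 / n ^ 4" .
  also have "\<dots> \<le> (Y \<bullet> Y) / n\<^sup>2" using n by simp
  also have "\<dots> \<le> (Y \<bullet> Y) / 1" using n by (intro frac_le) (auto simp: one_le_power)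
  finally show ?thesis by (simp add: Z_def n_def norm_le)
qed

text \<open>Pythagoras: \<open>W *v z\<close> is orthogonal to \<open>z\<close>, so the change of
  length is of second order in \<open>\<epsilon>\<close>.\<close>

lemma skew_perturbation_norm:
  assumes "skew W" "norm (W *v z) \<le> C * norm z" "0 \<le> C"
  shows "norm (z + \<epsilon> *\<^sub>R (W *v z)) \<le> norm z * (1 + \<epsilon>\<^sup>2 * C\<^sup>2)"
proof (rule power2_le_imp_le)
  have "(norm (z + \<epsilon> *\<^sub>R (W *v z)))\<^sup>2 = (norm z)\<^sup>2 + \<epsilon>\<^sup>2 * (norm (W *v z))\<^sup>2"
    unfolding power2_norm_eq_inner using skew_self[OF assms(1), of z]
    by (simp add: inner_add_left inner_add_right inner_commute power2_eq_square)
  also have "\<dots> \<le> (norm z)\<^sup>2 + \<epsilon>\<^sup>2 * (C * norm z)\<^sup>2"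
    using assms(2) by (intro add_left_mono mult_left_mono power_mono) auto
  also have "(norm z)\<^sup>2 + \<epsilon>\<^sup>2 * (C * norm z)\<^sup>2 = (norm z)\<^sup>2 * (1 + \<epsilon>\<^sup>2 * C\<^sup>2)"
    by (simp add: power_mult_distrib algebra_simps)
  also have "\<dots> \<le> (norm z)\<^sup>2 * (1 + \<epsilon>\<^sup>2 * C\<^sup>2)\<^sup>2"
  proof (rule mult_left_mono)
    have "0 \<le> \<epsilon>\<^sup>2 * C\<^sup>2" by simp
    then show "1 + \<epsilon>\<^sup>2 * C\<^sup>2 \<le> (1 + \<epsilon>\<^sup>2 * C\<^sup>2)\<^sup>2" by (simp add: self_le_power)
  qed simp
  finally show "(norm (z + \<epsilon> *\<^sub>R (W *v z)))\<^sup>2 \<le> (norm z * (1 + \<epsilon>\<^sup>2 * C\<^sup>2))\<^sup>2"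
    by (simp add: power_mult_distrib)
qed (simp add: add_nonneg_nonneg)

section \<open>Deformed tangents and correction of the end point\<close>

context curve
begin

lemma curve_from_tangent:
  assumes S: "WD 0 l S \<sigma>" and unit: "\<And>s. s \<in> {0..l} \<Longrightarrow> norm (S s) = 1"
    and ends: "S 0 = T1" "S l = T2" and int: "integral {0..l} S = a2 - a1"
  obtains g where "adm l a1 a2 T1 T2 g" "\<And>s. s \<in> {0..l} \<Longrightarrow> vel l g s = S s"
proof -
  define g where "g s = a1 + integral {0..s} S" for s
  have d: "(g has_vector_derivative S s) (at s within {0..l})" if "s \<in> {0..l}" for s
    unfolding g_def
    using has_vector_derivative_add[OF has_vector_derivative_const
        integral_has_vector_derivative[OF WD_continuous[OF S] that], of a1] by simp
  have v: "vel l g s = S s" if "s \<in> {0..l}" for s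
    unfolding vel_def using d[OF that] that l_pos
    by (intro vector_derivative_within_cbox[of 0 l, unfolded cbox_interval]) auto
  obtain L where "L-lipschitz_on {0..l} S" using WD_lip[OF S] by blast
  then have "L-lipschitz_on {0..l} (vel l g)" using v by (simp add: lipschitz_on_def)
  moreover have "g differentiable (at s within {0..l})" if "s \<in> {0..l}" for s
    using d[OF that] by (rule differentiableI_vector)
  ultimately have "W2inf l g" by (auto simp: W2inf_def)
  moreover have "g 0 = a1" "g l = a2" using int by (auto simp: g_def)
  ultimately have "adm l a1 a2 T1 T2 g"
    using v unit ends l_nonneg by (auto simp: adm_def)
  then show ?thesis using that v by blast
qed

abbreviation normal_part :: "real ^ 'n \<Rightarrow> real \<Rightarrow> real ^ 'n" where
  "normal_part y s \<equiv> y - (T s \<bullet> y) *\<^sub>R T s"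

text \<open>It vanishes at 0 and l, so a variation of the tangent multiplied by it keeps both end
  directions while it still moves the end point.\<close>

definition bump :: "real \<Rightarrow> real" where "bump s = s * (l - s)"

lemma WD_bump: "WD 0 l bump (\<lambda>s. l - 2 * s)"
proof -
  have "WD 0 l (\<lambda>s. s * (l - s)) (\<lambda>s. 1 * (l - s) + s * (0 - 1))"
    by (intro WD_mult WD_diff WD_ident WD_const l_nonneg)
  then show ?thesis
    by (rule WD_cong_AE[OF WD_cong]) (auto simp: bump_def)
qed

lemma bump_bounds: "s \<in> {0..l} \<Longrightarrow> 0 \<le> bump s" "s \<in> {0..l} \<Longrightarrow> bump s \<le> l\<^sup>2"
proof -
  assume s: "s \<in> {0..l}"
  then show "0 \<le> bump s" by (simp add: bump_def)
  show "bump s \<le> l\<^sup>2" unfolding bump_def power2_eq_square using s by (intro mult_mono) auto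
qed

lemma normal_part_norm: "s \<in> {0..l} \<Longrightarrow> norm (normal_part y s) \<le> 2 * norm y"
proof -
  assume s: "s \<in> {0..l}"
  have "norm (normal_part y s) \<le> norm y + norm ((T s \<bullet> y) *\<^sub>R T s)" by (rule norm_triangle_ineq4)
  also have "norm ((T s \<bullet> y) *\<^sub>R T s) \<le> norm y"
    using Cauchy_Schwarz_ineq2[of "T s" y] norm_T[OF s] by simp
  finally show ?thesis by simp
qed

definition bump_mean :: "real ^ 'n \<Rightarrow> real ^ 'n" where
  "bump_mean y = integral {0..l} (\<lambda>s. bump s *\<^sub>R (normal_part y s))"

lemma bump_continuous: "continuous_on {0..l} (\<lambda>s. bump s *\<^sub>R (normal_part y s))"
  using WD_continuous[OF WD_bump] continuous_T by (intro continuous_intros)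

text \<open>\<open>bump_mean y\<close> is the first-order shift of the end point caused by the
  variation \<open>bump s *\<^sub>R normal_part y s\<close>. Its inner product with y is the
  integral of \<open>bump s * (norm (normal_part y s))\<^sup>2\<close>; if this is 0, T is
  everywhere parallel to y, hence constant, against \<open>k > 0\<close>. So every small shift can
  be produced, at proportional cost.\<close>

lemma bump_mean_inverse:
  assumes k: "k > 0"
  obtains B K where "linear B" "\<And>z. bump_mean (B z) = z" "K > 0" "\<And>z. norm (B z) \<le> K * norm z"
proof -
  have lin: "linear bump_mean"
  proof (rule linearI)
    fix x y
    have "bump_mean (x + y) = integral {0..l} (\<lambda>s. bump s *\<^sub>R (normal_part x s) + bump s *\<^sub>R (normal_part y s))"
      unfolding bump_mean_def by (rule integral_cong) (simp add: algebra_simps)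
    also have "\<dots> = bump_mean x + bump_mean y"
      unfolding bump_mean_def by (intro integral_add integrable_continuous_real bump_continuous)
    finally show "bump_mean (x + y) = bump_mean x + bump_mean y" .
    fix c
    have "bump_mean (c *\<^sub>R x) = integral {0..l} (\<lambda>s. c *\<^sub>R (bump s *\<^sub>R (normal_part x s)))"
      unfolding bump_mean_def by (rule integral_cong) (simp add: algebra_simps)
    then show "bump_mean (c *\<^sub>R x) = c *\<^sub>R bump_mean x"
      unfolding bump_mean_def by (simp only: integral_cmul)
  qed
  have "y = 0" if z: "bump_mean y = 0" for y
  proof (rule ccontr)
    assume y0: "y \<noteq> 0"
    have sq: "bump s *\<^sub>R (normal_part y s) \<bullet> y = bump s * (norm (normal_part y s))\<^sup>2"
      if "s \<in> {0..l}" for s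
      using T_T[OF that] by (simp add: power2_norm_eq_inner inner_diff_left inner_diff_right inner_commute)
    have "((\<lambda>s. bump s *\<^sub>R (normal_part y s)) has_integral 0) {0..l}"
      using z integrable_integral[OF integrable_continuous_real[OF bump_continuous[of y]]]
      by (simp add: bump_mean_def)
    from has_integral_linear[OF this bounded_linear_inner_left[of y]]
    have "((\<lambda>s. bump s *\<^sub>R (normal_part y s) \<bullet> y) has_integral 0) {0..l}"
      by (simp add: o_def)
    then have int0: "integral {0..l} (\<lambda>s. bump s *\<^sub>R (normal_part y s) \<bullet> y) = 0" by (rule integral_unique)
    have cont: "continuous_on {0..l} (\<lambda>s. bump s *\<^sub>R (normal_part y s) \<bullet> y)"
      by (intro continuous_on_inner bump_continuous continuous_on_const)
    have nn: "0 \<le> bump s *\<^sub>R (normal_part y s) \<bullet> y" if "s \<in> {0..l}" for s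
      unfolding sq[OF that] using bump_bounds(1)[OF that] by simp
    have zero: "\<forall>s\<in>{0..l}. bump s *\<^sub>R (normal_part y s) \<bullet> y = 0"
      using integral_eq_0_iff[OF cont l_pos nn] int0 by blast
    have in0: "T s \<in> span {y}" if s: "s \<in> {0<..<l}" for s
    proof -
      have "bump s > 0" using s by (simp add: bump_def)
      moreover have s': "s \<in> {0..l}" using s by simp
      have "bump s * (norm (normal_part y s))\<^sup>2 = 0"
        using bspec[OF zero s'] unfolding sq[OF s'] .
      ultimately have "y = (T s \<bullet> y) *\<^sub>R T s" by auto
      then have "T s = inverse (T s \<bullet> y) *\<^sub>R y"
        using y0 by (metis scaleR_left_imp_eq scaleR_scaleR scaleR_one scaleR_zero_left left_inverse)
      then show ?thesis by (metis span_base span_scale singletonI)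
    qed
    have "AE s in lebesgue. s \<noteq> 0 \<and> s \<noteq> l" by (rule AE_neq_two)
    then have "AE s\<in>{0..l} in lebesgue. T s \<in> span {y}"
      by eventually_elim (use in0 in auto)
    then have "T s \<in> span {y}" if "s \<in> {0..l}" for s
      using that by (intro continuous_AE_in_subspace[OF continuous_T l_pos]) auto
    then obtain w where "\<forall>s\<in>{0..l}. T s = w" using parallel_T_imp_const by blast
    then have "k = 0" using const_T_imp_zero_curvature by blast
    then show False using k by simp
  qed
  then have "inj bump_mean" using linear_injective_0[OF lin] by blast
  then obtain B where B: "linear B" "\<forall>x. bump_mean (B x) = x"
    using linear_injective_isomorphism[OF lin] by blast
  obtain K where K: "K > 0" "\<And>z. norm (B z) \<le> norm z * K"
    using bounded_linear.pos_bounded[OF linear_conv_bounded_linear[THEN iffD1, OF B(1)]] by blast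
  show ?thesis by (rule that[OF B(1) _ K(1)]) (use B(2) K(2) in \<open>auto simp: mult.commute\<close>)
qed


text \<open>A control is a path \<open>\<omega>\<close> of skew matrices; it deforms the tangent to the normalised
  \<open>T + \<epsilon> *\<^sub>R \<omega> T\<close>. As \<open>\<omega>\<close> is skew, the first-order change of the curvature involves only
  the derivative \<open>\<Omega>\<close> of \<open>\<omega>\<close>, so no differential equation has to be solved.\<close>

definition control :: "real \<Rightarrow> (real \<Rightarrow> real ^ 'n ^ 'n) \<Rightarrow> (real \<Rightarrow> real ^ 'n ^ 'n) \<Rightarrow> bool" where
  "control c \<omega> \<Omega> \<longleftrightarrow> WD 0 l \<omega> \<Omega> \<and> \<omega> 0 = 0 \<and> (\<forall>s\<in>{0..l}. skew (\<omega> s)) \<and>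
     (AE s\<in>{0..l} in lebesgue. \<alpha> s * norm (h s + \<Omega> s *v T s) \<le> k - c)"

lemma matrix_path_bound:
  fixes \<omega> :: "real \<Rightarrow> real ^ 'n ^ 'n"
  assumes "WD 0 l \<omega> \<Omega>"
  obtains C where "C > 0" "\<And>s z. s \<in> {0..l} \<Longrightarrow> norm (\<omega> s *v z) \<le> C * norm z"
    "AE s\<in>{0..l} in lebesgue. (\<forall>z. norm (\<Omega> s *v z) \<le> C * norm z)"
proof -
  obtain K where K: "K > 0" "\<And>(A :: real ^ 'n ^ 'n) x. norm (A *v x) \<le> norm A * norm x * K"
    using bounded_bilinear.pos_bounded[OF bounded_bilinear_mult_vec] by blast
  obtain L where L: "L-lipschitz_on {0..l} \<omega>" using WD_lip[OF assms] by blast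
  obtain B1 where B1: "B1 \<ge> 0" "\<And>s. s \<in> {0..l} \<Longrightarrow> norm (\<omega> s) \<le> B1"
    by (rule lipschitz_bounded_norm[OF L]) (rule that)
  obtain B2 where B2: "B2 \<ge> 0" "AE s\<in>{0..l} in lebesgue. norm (\<Omega> s) \<le> B2"
    using WD_bounded_AE[OF assms l_nonneg] by blast
  define B where "B = B1 + B2 + 1"
  have mb: "norm (A *v z) \<le> (B * K) * norm z" if "norm A \<le> B1 \<or> norm A \<le> B2" for A :: "real ^ 'n ^ 'n" and z
  proof -
    have "norm A \<le> B" using that B1(1) B2(1) by (auto simp: B_def)
    then have "norm A * norm z * K \<le> B * norm z * K" using K(1) by (intro mult_right_mono) auto
    then show ?thesis using K(2)[of A z] by (simp add: mult_ac)
  qed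
  show ?thesis
  proof (rule that[of "B * K"])
    show "0 < B * K" using B1(1) B2(1) K(1) by (simp add: B_def)
    show "norm (\<omega> s *v z) \<le> (B * K) * norm z" if "s \<in> {0..l}" for s z
      using mb[of "\<omega> s" z] B1(2)[OF that] by blast
    show "AE s\<in>{0..l} in lebesgue. (\<forall>z. norm (\<Omega> s *v z) \<le> (B * K) * norm z)"
      using B2(2) by eventually_elim (use mb in blast)
  qed
qed

text \<open>The curvature before normalisation is, to first order, z =
  \<open>h + \<epsilon> \<Omega> T\<close> plus a rotated copy of itself. By convexity \<alpha> |z|
  is at most \<open>k - \<epsilon> c\<close>; the rotated copy is orthogonal to z and costs only
  second order. The parameter \<open>y\<close> is kept free to repair the end point afterwards, and
  its contribution to the curvature is of order \<open>\<epsilon> |y|\<close>.\<close>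

lemma control_deformation:
  assumes ctrl: "control c \<omega> \<Omega>" and k: "k > 0" and c: "0 \<le> c" "c \<le> k"
    and end0: "\<omega> l *v T2 = 0"
  obtains C :: real and S where "C > 0"
    "\<And>\<epsilon> y. \<lbrakk>0 < \<epsilon>; \<epsilon> \<le> 1; norm y \<le> 1\<rbrakk> \<Longrightarrow> \<exists>\<sigma>. WD 0 l (S \<epsilon> y) \<sigma> \<and>
        (AE s\<in>{0..l} in lebesgue. \<alpha> s * norm (\<sigma> s) \<le> k - \<epsilon> * c + C * (\<epsilon>\<^sup>2 + \<epsilon> * norm y))"
    "\<And>\<epsilon> y s. \<lbrakk>0 < \<epsilon>; \<epsilon> \<le> 1; norm y \<le> 1; s \<in> {0..l}\<rbrakk> \<Longrightarrow> norm (S \<epsilon> y s) = 1"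
    "\<And>\<epsilon> y. S \<epsilon> y 0 = T1" "\<And>\<epsilon> y. S \<epsilon> y l = T2"
    "\<And>\<epsilon> y s. \<lbrakk>0 < \<epsilon>; \<epsilon> \<le> 1; norm y \<le> 1; s \<in> {0..l}\<rbrakk> \<Longrightarrow>
        norm (S \<epsilon> y s - (T s + \<epsilon> *\<^sub>R (\<omega> s *v T s + bump s *\<^sub>R (normal_part y s)))) \<le> C * \<epsilon>\<^sup>2"
    "\<And>\<epsilon> y s. \<lbrakk>0 < \<epsilon>; \<epsilon> \<le> 1; norm y \<le> 1; s \<in> {0..l}\<rbrakk> \<Longrightarrow> norm (S \<epsilon> y s - T s) \<le> C * \<epsilon>"
    "\<And>\<epsilon> y y' s. \<lbrakk>0 < \<epsilon>; \<epsilon> \<le> 1; norm y \<le> 1; norm y' \<le> 1; s \<in> {0..l}\<rbrakk> \<Longrightarrow>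
        norm (S \<epsilon> y s - S \<epsilon> y' s) \<le> C * norm (y - y')"
proof -
  have om: "WD 0 l \<omega> \<Omega>" "\<omega> 0 = 0" "\<And>s. s \<in> {0..l} \<Longrightarrow> skew (\<omega> s)"
    and om_le: "AE s\<in>{0..l} in lebesgue. \<alpha> s * norm (h s + \<Omega> s *v T s) \<le> k - c"
    using ctrl by (auto simp: control_def)
  obtain A B where AB: "A > 0" "B > 0" "\<And>s. s \<in> {0..l} \<Longrightarrow> A \<le> \<alpha> s" "\<And>s. s \<in> {0..l} \<Longrightarrow> \<alpha> s \<le> B"
    by (rule alpha_bounds) (rule that)
  obtain D where D: "D > 0" "\<And>s z. s \<in> {0..l} \<Longrightarrow> norm (\<omega> s *v z) \<le> D * norm z"
    "AE s\<in>{0..l} in lebesgue. (\<forall>z. norm (\<Omega> s *v z) \<le> D * norm z)"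
    by (rule matrix_path_bound[OF om(1)]) (rule that)
  \<comment> \<open>The correction enters as the infinitesimal rotation y \<and> T, which sends T to
    the normal part of y; \<open>bump\<close> switches it off at both ends.\<close>
  define W where "W y s = \<omega> s + bump s *\<^sub>R wedge y (T s)" for y s
  define E where "E = D + l\<^sup>2 * 2"
  have E0: "E > 0" using D(1) by (simp add: E_def add_pos_nonneg)
  have Wskew: "skew (W y s)" if "s \<in> {0..l}" for y s
    unfolding W_def using om(3)[OF that] by (intro skew_add skew_scaleR skew_wedge)
  have WT: "W y s *v T s = \<omega> s *v T s + bump s *\<^sub>R (normal_part y s)" if "s \<in> {0..l}" for y s
    unfolding W_def matrix_vector_mult_add_rdistrib
    by (simp add: wedge_mult_vec T_T[OF that] inner_commute flip: scaleR_matrix_vector_assoc)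
  have Wb: "norm (W y s *v z) \<le> E * norm z" if s: "s \<in> {0..l}" and y: "norm y \<le> 1" for y s z
  proof -
    have "norm (wedge y (T s) *v z) \<le> norm ((T s \<bullet> z) *\<^sub>R y) + norm ((y \<bullet> z) *\<^sub>R T s)"
      unfolding wedge_mult_vec by (rule norm_triangle_ineq4)
    also have "norm ((T s \<bullet> z) *\<^sub>R y) \<le> norm z * 1"
      using Cauchy_Schwarz_ineq2[of "T s" z] norm_T[OF s] y unfolding norm_scaleR
      by (intro mult_mono) auto
    also have "norm ((y \<bullet> z) *\<^sub>R T s) \<le> 1 * norm z"
    proof -
      have "\<bar>y \<bullet> z\<bar> \<le> norm y * norm z" by (rule Cauchy_Schwarz_ineq2)
      also have "\<dots> \<le> 1 * norm z" using y by (intro mult_right_mono) auto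
      finally show ?thesis using norm_T[OF s] by simp
    qed
    finally have "norm (wedge y (T s) *v z) \<le> 2 * norm z" by simp
    then have "bump s * norm (wedge y (T s) *v z) \<le> l\<^sup>2 * (2 * norm z)"
      using bump_bounds[OF s] by (intro mult_mono) auto
    moreover have "norm (W y s *v z) \<le> norm (\<omega> s *v z) + bump s * norm (wedge y (T s) *v z)"
      unfolding W_def matrix_vector_mult_add_rdistrib scaleR_matrix_vector_assoc[symmetric]
      using bump_bounds[OF s] norm_triangle_ineq[of "\<omega> s *v z" "bump s *\<^sub>R (wedge y (T s) *v z)"] by simp
    ultimately show ?thesis using D(2)[OF s, of z] by (simp add: E_def algebra_simps)
  qed
  define X where "X \<epsilon> y s = T s + \<epsilon> *\<^sub>R (W y s *v T s)" for \<epsilon> y s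
  define S where "S \<epsilon> y s = X \<epsilon> y s /\<^sub>R norm (X \<epsilon> y s)" for \<epsilon> y s
  have XX: "(norm (X \<epsilon> y s))\<^sup>2 = 1 + \<epsilon>\<^sup>2 * (norm (W y s *v T s))\<^sup>2" if s: "s \<in> {0..l}" for \<epsilon> y s
    unfolding X_def power2_norm_eq_inner using skew_self[OF Wskew[OF s], of y "T s"] T_T[OF s]
    by (simp add: inner_add_left inner_add_right inner_commute power2_eq_square)
  have X1: "1 \<le> norm (X \<epsilon> y s)" if s: "s \<in> {0..l}" for \<epsilon> y s
  proof (rule power2_le_imp_le)
    show "1\<^sup>2 \<le> (norm (X \<epsilon> y s))\<^sup>2" unfolding XX[OF s] by simp
  qed simp
  have WTb: "norm (W y s *v T s) \<le> E" if "s \<in> {0..l}" "norm y \<le> 1" for y s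
    using Wb[OF that, of "T s"] norm_T[OF that(1)] by simp
  have SX: "norm (S \<epsilon> y s - X \<epsilon> y s) \<le> \<epsilon>\<^sup>2 * E\<^sup>2" if s: "s \<in> {0..l}" and y: "norm y \<le> 1" for \<epsilon> y s
  proof -
    let ?n = "norm (X \<epsilon> y s)"
    have n: "1 \<le> ?n" by (rule X1[OF s])
    have "S \<epsilon> y s - X \<epsilon> y s = (inverse ?n - 1) *\<^sub>R X \<epsilon> y s" by (simp add: S_def algebra_simps)
    then have "norm (S \<epsilon> y s - X \<epsilon> y s) = \<bar>inverse ?n - 1\<bar> * ?n" by simp
    also have "\<dots> = \<bar>(inverse ?n - 1) * ?n\<bar>" by (simp add: abs_mult)
    also have "(inverse ?n - 1) * ?n = 1 - ?n"
    proof -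
      have "?n \<noteq> 0" using n by linarith
      then have "inverse ?n * ?n = 1" by (rule Fields.left_inverse)
      then show ?thesis by (simp only: left_diff_distrib mult_1)
    qed
    also have "\<bar>1 - ?n\<bar> = ?n - 1" using n by simp
    also have "\<dots> \<le> ?n\<^sup>2 - 1" using n by (simp add: self_le_power)
    also have "\<dots> = \<epsilon>\<^sup>2 * (norm (W y s *v T s))\<^sup>2" by (simp add: XX[OF s])
    also have "\<dots> \<le> \<epsilon>\<^sup>2 * E\<^sup>2" using WTb[OF s y] by (intro mult_left_mono power_mono) auto
    finally show ?thesis .
  qed
  \<comment> \<open>\<open>G\<close> bounds the contribution \<open>r\<close> of the correction: |l
    - 2 s| \<le> l meets a normal part of size at most 2 |y|, and bump \<le> l^2 meets a curvature
    of size at most k / A. The factor 2 in the last term is slack.\<close>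
  define G where "G = l * 2 + 2 * l\<^sup>2 * k / A"
  have G0: "G \<ge> 0" using l_nonneg k AB(1) by (simp add: G_def)
  define C where "C = E\<^sup>2 + E + 4 * l\<^sup>2 + k * E\<^sup>2 + B * E * D + B * G + 1"
  have C: "E\<^sup>2 \<le> C" "E\<^sup>2 + E \<le> C" "4 * l\<^sup>2 \<le> C" "k * E\<^sup>2 + B * E * D \<le> C" "B * G \<le> C" "C > 0"
    unfolding C_def using E0 k AB D(1) G0 by (auto intro!: add_nonneg_nonneg add_nonneg_pos)
  show ?thesis
  proof (rule that[OF C(6)])
    fix \<epsilon> :: real and y :: "real ^ 'n" assume e: "0 < \<epsilon>" "\<epsilon> \<le> 1" and y: "norm y \<le> 1"
    define V where "V s = \<Omega> s + ((l - 2 * s) *\<^sub>R wedge y (T s) + bump s *\<^sub>R wedge y (h s))" for s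
    have WW: "WD 0 l (W y) V"
    proof -
      have "WD 0 l (\<lambda>s. wedge y (T s)) (\<lambda>s. wedge y (h s))"
        by (rule WD_linear[OF WD_T bounded_bilinear.bounded_linear_right[OF bounded_bilinear_wedge]])
      from WD_add[OF om(1) WD_scaleR[OF WD_bump this l_nonneg]] show ?thesis
        by (simp add: W_def[abs_def] V_def[abs_def])
    qed
    define Z where "Z s = h s + \<epsilon> *\<^sub>R (V s *v T s + W y s *v h s)" for s
    have WX: "WD 0 l (X \<epsilon> y) Z"
      unfolding X_def[abs_def] Z_def[abs_def]
      by (intro WD_add WD_T WD_scaleR_const WD_bilinear[OF bounded_bilinear_mult_vec] WW l_nonneg)
    have Xnz: "X \<epsilon> y s \<noteq> 0" if "s \<in> {0..l}" for s using X1[OF that, of \<epsilon> y] by auto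
    define \<sigma> where "\<sigma> s = (- (X \<epsilon> y s \<bullet> Z s) / norm (X \<epsilon> y s) ^ 3) *\<^sub>R X \<epsilon> y s + Z s /\<^sub>R norm (X \<epsilon> y s)" for s
    have "WD 0 l (S \<epsilon> y) \<sigma>"
      unfolding S_def[abs_def] \<sigma>_def[abs_def] by (rule WD_normalize[OF WX l_nonneg Xnz])
    moreover have "AE s\<in>{0..l} in lebesgue. \<alpha> s * norm (\<sigma> s) \<le> k - \<epsilon> * c + C * (\<epsilon>\<^sup>2 + \<epsilon> * norm y)"
      using om_le h_bound T_h D(3)
    proof eventually_elim
      case (elim s)
      show ?case
      proof
        assume s: "s \<in> {0..l}"
        have a: "\<alpha> s > 0" "A \<le> \<alpha> s" "\<alpha> s \<le> B" using alpha_pos AB s by auto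
        have el: "\<alpha> s * norm (h s + \<Omega> s *v T s) \<le> k - c" "\<alpha> s * norm (h s) \<le> k" "T s \<bullet> h s = 0"
          "\<And>z. norm (\<Omega> s *v z) \<le> D * norm z" using elim s by auto
        define z where "z = h s + \<epsilon> *\<^sub>R (\<Omega> s *v T s)"
        define r where "r = (l - 2 * s) *\<^sub>R (normal_part y s) - (bump s * (y \<bullet> T s)) *\<^sub>R h s"
        have "V s *v T s = \<Omega> s *v T s + r"
          using el(3) T_T[OF s]
          by (simp add: V_def r_def matrix_vector_mult_add_rdistrib wedge_mult_vec inner_commute
              flip: scaleR_matrix_vector_assoc)
        \<comment> \<open>The term \<open>W y s *v h s\<close> is rewritten as
          \<open>W y s *v z\<close> minus an \<open>\<epsilon>\<close> term: applied to
          \<open>z\<close> itself the skew matrix is harmless, whereas relative to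
          \<open>h s\<close> it would leave an error of first order.\<close>
        then have Zs: "Z s = (z + \<epsilon> *\<^sub>R (W y s *v z)) - \<epsilon>\<^sup>2 *\<^sub>R (W y s *v (\<Omega> s *v T s)) + \<epsilon> *\<^sub>R r"
          by (simp add: Z_def z_def matrix_vector_right_distrib matrix_vector_mult_scaleR
              algebra_simps power2_eq_square)
        have nh: "norm (h s) \<le> k / A"
        proof -
          have "A * norm (h s) \<le> \<alpha> s * norm (h s)" using a by (intro mult_right_mono) auto
          then show ?thesis using el(2) AB(1) by (simp add: field_simps)
        qed
        have nr: "norm r \<le> G * norm y"
        proof -
          have "norm r \<le> \<bar>l - 2 * s\<bar> * norm (normal_part y s) + \<bar>bump s * (y \<bullet> T s)\<bar> * norm (h s)"
            unfolding r_def using norm_triangle_ineq4 by (metis norm_scaleR)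
          also have "\<dots> \<le> l * (2 * norm y) + (l\<^sup>2 * norm y) * (k / A)"
          proof (intro add_mono mult_mono)
            show "\<bar>l - 2 * s\<bar> \<le> l" using s by auto
            show "norm (normal_part y s) \<le> 2 * norm y" by (rule normal_part_norm[OF s])
            have "\<bar>y \<bullet> T s\<bar> \<le> norm y" using Cauchy_Schwarz_ineq2[of y "T s"] norm_T[OF s] by simp
            then show "\<bar>bump s * (y \<bullet> T s)\<bar> \<le> l\<^sup>2 * norm y"
              using bump_bounds[OF s] by (simp add: abs_mult mult_mono)
          qed (use nh l_nonneg in auto)
          also have "\<dots> \<le> G * norm y"
          proof -
            have "0 \<le> l\<^sup>2 * norm y * (k / A)" using k AB(1) by (intro mult_nonneg_nonneg) auto
            moreover have "G * norm y = l * (2 * norm y) + 2 * (l\<^sup>2 * norm y * (k / A))"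
              by (simp add: G_def algebra_simps)
            ultimately show ?thesis by linarith
          qed
          finally show ?thesis .
        qed
        have az: "\<alpha> s * norm z \<le> k - \<epsilon> * c"
        proof -
          \<comment> \<open>\<open>z\<close> is a convex combination of the old curvature and the
            fully controlled one, which is where the gain \<open>\<epsilon> c\<close> comes
            from.\<close>
          have "z = (1 - \<epsilon>) *\<^sub>R h s + \<epsilon> *\<^sub>R (h s + \<Omega> s *v T s)" by (simp add: z_def algebra_simps)
          then have "norm z \<le> norm ((1 - \<epsilon>) *\<^sub>R h s) + norm (\<epsilon> *\<^sub>R (h s + \<Omega> s *v T s))"
            by (metis norm_triangle_ineq)
          then have "norm z \<le> (1 - \<epsilon>) * norm (h s) + \<epsilon> * norm (h s + \<Omega> s *v T s)" using e by simp
          then have "\<alpha> s * norm z \<le> \<alpha> s * ((1 - \<epsilon>) * norm (h s) + \<epsilon> * norm (h s + \<Omega> s *v T s))"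
            using a by (intro mult_left_mono) auto
          also have "\<dots> = (1 - \<epsilon>) * (\<alpha> s * norm (h s)) + \<epsilon> * (\<alpha> s * norm (h s + \<Omega> s *v T s))"
            by (simp add: algebra_simps)
          also have "\<dots> \<le> (1 - \<epsilon>) * k + \<epsilon> * (k - c)"
            using el e by (intro add_mono mult_left_mono) auto
          finally show ?thesis by (simp add: algebra_simps)
        qed
        have n1: "norm (z + \<epsilon> *\<^sub>R (W y s *v z)) \<le> norm z * (1 + \<epsilon>\<^sup>2 * E\<^sup>2)"
          by (rule skew_perturbation_norm[OF Wskew[OF s] Wb[OF s y]]) (use E0 in simp)
        have n2: "norm (W y s *v (\<Omega> s *v T s)) \<le> E * D"
        proof -
          have "norm (W y s *v (\<Omega> s *v T s)) \<le> E * norm (\<Omega> s *v T s)" by (rule Wb[OF s y])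
          also have "\<dots> \<le> E * D" using el(4)[of "T s"] norm_T[OF s] E0 by (intro mult_left_mono) auto
          finally show ?thesis .
        qed
        have "norm (\<sigma> s) \<le> norm (Z s)"
          unfolding \<sigma>_def by (rule norm_derivative_normalize_le[OF X1[OF s]])
        also have "\<dots> \<le> norm z * (1 + \<epsilon>\<^sup>2 * E\<^sup>2) + \<epsilon>\<^sup>2 * (E * D) + \<epsilon> * (G * norm y)"
        proof -
          have "norm (\<epsilon>\<^sup>2 *\<^sub>R (W y s *v (\<Omega> s *v T s))) \<le> \<epsilon>\<^sup>2 * (E * D)"
            using n2 by (simp add: mult_left_mono)
          moreover have "norm (\<epsilon> *\<^sub>R r) \<le> \<epsilon> * (G * norm y)" using nr e by (simp add: mult_left_mono)
          moreover have "norm (Z s) \<le> norm (z + \<epsilon> *\<^sub>R (W y s *v z)) + norm (\<epsilon>\<^sup>2 *\<^sub>R (W y s *v (\<Omega> s *v T s))) + norm (\<epsilon> *\<^sub>R r)"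
            unfolding Zs by (rule order_trans[OF norm_triangle_ineq add_right_mono[OF norm_triangle_ineq4]])
          ultimately show ?thesis using n1 by linarith
        qed
        finally have "\<alpha> s * norm (\<sigma> s) \<le> \<alpha> s * (norm z * (1 + \<epsilon>\<^sup>2 * E\<^sup>2) + \<epsilon>\<^sup>2 * (E * D) + \<epsilon> * (G * norm y))"
          using a by (intro mult_left_mono) auto
        also have "\<dots> = (\<alpha> s * norm z) + (\<alpha> s * norm z) * (\<epsilon>\<^sup>2 * E\<^sup>2) + \<alpha> s * (\<epsilon>\<^sup>2 * (E * D)) + \<alpha> s * (\<epsilon> * (G * norm y))"
          by (simp add: algebra_simps)
        also have "\<dots> \<le> (k - \<epsilon> * c) + k * (\<epsilon>\<^sup>2 * E\<^sup>2) + B * (\<epsilon>\<^sup>2 * (E * D)) + B * (\<epsilon> * (G * norm y))"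
        proof -
          have "\<alpha> s * norm z \<le> k" using az e c mult_nonneg_nonneg[of \<epsilon> c] by linarith
          then show ?thesis using az a E0 D(1) G0 e by (intro add_mono mult_right_mono) auto
        qed
        also have "\<dots> = (k - \<epsilon> * c) + (k * E\<^sup>2 + B * E * D) * \<epsilon>\<^sup>2 + (B * G) * (\<epsilon> * norm y)"
          by (simp add: algebra_simps)
        also have "\<dots> \<le> (k - \<epsilon> * c) + C * \<epsilon>\<^sup>2 + C * (\<epsilon> * norm y)"
          using C(4,5) e by (intro add_mono mult_right_mono) auto
        finally show "\<alpha> s * norm (\<sigma> s) \<le> k - \<epsilon> * c + C * (\<epsilon>\<^sup>2 + \<epsilon> * norm y)" by (simp add: algebra_simps)
      qed
    qed
    ultimately show "\<exists>\<sigma>. WD 0 l (S \<epsilon> y) \<sigma> \<and>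
        (AE s\<in>{0..l} in lebesgue. \<alpha> s * norm (\<sigma> s) \<le> k - \<epsilon> * c + C * (\<epsilon>\<^sup>2 + \<epsilon> * norm y))" by blast
  next
    fix \<epsilon> :: real and y :: "real ^ 'n" and s
    assume "0 < \<epsilon>" "\<epsilon> \<le> 1" "norm y \<le> 1" and s: "s \<in> {0..l}"
    have "norm (X \<epsilon> y s) > 0" using X1[OF s, of \<epsilon> y] by linarith
    then show "norm (S \<epsilon> y s) = 1" by (simp add: S_def)
  next
    fix \<epsilon> :: real and y :: "real ^ 'n"
    have "W y 0 *v T 0 = 0" using WT[of 0 y] om(2) l_nonneg by (simp add: bump_def)
    then show "S \<epsilon> y 0 = T1" using norm_T[of 0] l_nonneg T_ends by (simp add: S_def X_def)
    have "W y l *v T l = 0" using WT[of l y] end0 T_ends l_nonneg by (simp add: bump_def)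
    then show "S \<epsilon> y l = T2" using norm_T[of l] l_nonneg T_ends by (simp add: S_def X_def)
  next
    fix \<epsilon> :: real and y :: "real ^ 'n" and s
    assume e: "0 < \<epsilon>" "\<epsilon> \<le> 1" and y: "norm y \<le> 1" and s: "s \<in> {0..l}"
    have c1: "E\<^sup>2 * \<epsilon>\<^sup>2 \<le> C * \<epsilon>\<^sup>2" using C(1) by (intro mult_right_mono) auto
    show "norm (S \<epsilon> y s - (T s + \<epsilon> *\<^sub>R (\<omega> s *v T s + bump s *\<^sub>R (normal_part y s)))) \<le> C * \<epsilon>\<^sup>2"
      using SX[OF s y, of \<epsilon>] c1 unfolding X_def WT[OF s] by (simp add: mult.commute)
    have "norm (S \<epsilon> y s - T s) \<le> norm (S \<epsilon> y s - X \<epsilon> y s) + norm (X \<epsilon> y s - T s)"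
      using norm_triangle_ineq[of "S \<epsilon> y s - X \<epsilon> y s" "X \<epsilon> y s - T s"] by simp
    also have "norm (X \<epsilon> y s - T s) \<le> \<epsilon> * E" using WTb[OF s y] e by (simp add: X_def)
    also have "norm (S \<epsilon> y s - X \<epsilon> y s) \<le> \<epsilon> * E\<^sup>2"
    proof -
      have "\<epsilon>\<^sup>2 \<le> \<epsilon>" using e by (simp add: power2_eq_square mult_left_le)
      then have "\<epsilon>\<^sup>2 * E\<^sup>2 \<le> \<epsilon> * E\<^sup>2" by (intro mult_right_mono) auto
      then show ?thesis using SX[OF s y, of \<epsilon>] by linarith
    qed
    also have "\<epsilon> * E\<^sup>2 + \<epsilon> * E = (E\<^sup>2 + E) * \<epsilon>" by (simp add: algebra_simps)
    also have "\<dots> \<le> C * \<epsilon>" using C(2) e by (intro mult_right_mono) auto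
    finally show "norm (S \<epsilon> y s - T s) \<le> C * \<epsilon>" by simp
  next
    fix \<epsilon> :: real and y y' :: "real ^ 'n" and s
    assume e: "0 < \<epsilon>" "\<epsilon> \<le> 1" and y: "norm y \<le> 1" "norm y' \<le> 1" and s: "s \<in> {0..l}"
    have "X \<epsilon> y s - X \<epsilon> y' s = (\<epsilon> * bump s) *\<^sub>R ((y - y') - (T s \<bullet> (y - y')) *\<^sub>R T s)"
      unfolding X_def WT[OF s] by (simp add: algebra_simps inner_diff_right)
    then have "norm (X \<epsilon> y s - X \<epsilon> y' s) = (\<epsilon> * bump s) * norm ((y - y') - (T s \<bullet> (y - y')) *\<^sub>R T s)"
      using e bump_bounds[OF s] by simp
    also have "\<dots> \<le> (1 * l\<^sup>2) * (2 * norm (y - y'))"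
      using e bump_bounds[OF s] normal_part_norm[OF s, of "y - y'"] by (intro mult_mono) auto
    finally have "2 * norm (X \<epsilon> y s - X \<epsilon> y' s) \<le> (4 * l\<^sup>2) * norm (y - y')" by (simp add: mult_ac)
    also have "\<dots> \<le> C * norm (y - y')" using C(3) by (intro mult_right_mono) auto
    finally show "norm (S \<epsilon> y s - S \<epsilon> y' s) \<le> C * norm (y - y')"
      using normalize_lipschitz[OF X1[OF s] X1[OF s], of \<epsilon> y \<epsilon> y'] unfolding S_def by linarith
  qed
qed

text \<open>If both end conditions hold to first order, the deformed curve misses the end point by
  O(\<open>\<epsilon>\<^sup>2\<close>), which a correction \<open>y\<close> of size
  O(\<open>\<epsilon>\<close>) repairs. Its cost \<open>\<epsilon> |y|\<close> and the penalty term
  are then both O(\<open>\<epsilon>\<^sup>2\<close>), against a gain of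
  \<open>\<epsilon> c\<close>.\<close>

lemma elastica_no_admissible_control:
  assumes ela: "inf_elastica l \<alpha> a1 a2 T1 T2 \<gamma>" and k: "k > 0"
    and ctrl: "control c \<omega> \<Omega>" and c: "0 < c" "c \<le> k"
    and end0: "\<omega> l *v T2 = 0" and int0: "integral {0..l} (\<lambda>s. \<omega> s *v T s) = 0"
  shows False
proof -
  obtain C S where C: "C > 0"
    and S_WD: "\<And>\<epsilon> y. \<lbrakk>0 < \<epsilon>; \<epsilon> \<le> 1; norm y \<le> 1\<rbrakk> \<Longrightarrow> \<exists>\<sigma>. WD 0 l (S \<epsilon> y) \<sigma> \<and>
        (AE s\<in>{0..l} in lebesgue. \<alpha> s * norm (\<sigma> s) \<le> k - \<epsilon> * c + C * (\<epsilon>\<^sup>2 + \<epsilon> * norm y))"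
    and S_unit: "\<And>\<epsilon> y s. \<lbrakk>0 < \<epsilon>; \<epsilon> \<le> 1; norm y \<le> 1; s \<in> {0..l}\<rbrakk> \<Longrightarrow> norm (S \<epsilon> y s) = 1"
    and S_ends: "\<And>\<epsilon> y. S \<epsilon> y 0 = T1" "\<And>\<epsilon> y. S \<epsilon> y l = T2"
    and S_first: "\<And>\<epsilon> y s. \<lbrakk>0 < \<epsilon>; \<epsilon> \<le> 1; norm y \<le> 1; s \<in> {0..l}\<rbrakk> \<Longrightarrow>
        norm (S \<epsilon> y s - (T s + \<epsilon> *\<^sub>R (\<omega> s *v T s + bump s *\<^sub>R (normal_part y s)))) \<le> C * \<epsilon>\<^sup>2"
    and S_close: "\<And>\<epsilon> y s. \<lbrakk>0 < \<epsilon>; \<epsilon> \<le> 1; norm y \<le> 1; s \<in> {0..l}\<rbrakk> \<Longrightarrow> norm (S \<epsilon> y s - T s) \<le> C * \<epsilon>"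
    and S_lip: "\<And>\<epsilon> y y' s. \<lbrakk>0 < \<epsilon>; \<epsilon> \<le> 1; norm y \<le> 1; norm y' \<le> 1; s \<in> {0..l}\<rbrakk> \<Longrightarrow>
        norm (S \<epsilon> y s - S \<epsilon> y' s) \<le> C * norm (y - y')"
    by (rule control_deformation[OF ctrl k less_imp_le[OF c(1)] c(2) end0]) (rule that)
  obtain Bi K where Bi: "linear Bi" "\<And>z. bump_mean (Bi z) = z" and K: "K > 0" "\<And>z. norm (Bi z) \<le> K * norm z"
    by (rule bump_mean_inverse[OF k]) (rule that)
  obtain M where M: "\<And>g. adm l a1 a2 T1 T2 g \<Longrightarrow>
      k \<le> K_alpha l \<alpha> g + M / 2 * integral {0..l} (\<lambda>s. (norm (vel l g s - T s))\<^sup>2)"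
    using ela unfolding inf_elastica_def by blast
  \<comment> \<open>\<open>\<epsilon> * R\<close> is the integral over [0, l] of the second-order
    error \<open>C * \<epsilon>\<^sup>2\<close>, divided by \<open>\<epsilon>\<close>.\<close>
  define R where "R = C * l"
  have R0: "R > 0" using C l_pos by (simp add: R_def)
  have cS: "continuous_on {0..l} (S \<epsilon> y)" if "0 < \<epsilon>" "\<epsilon> \<le> 1" "norm y \<le> 1" for \<epsilon> y
    using S_WD[OF that] WD_continuous by blast
  have cV: "continuous_on {0..l} (\<lambda>s. \<omega> s *v T s + bump s *\<^sub>R (normal_part y s))" for y
  proof -
    have "WD 0 l \<omega> \<Omega>" using ctrl by (simp add: control_def)
    from WD_continuous[OF WD_bilinear[OF bounded_bilinear_mult_vec this WD_T l_nonneg]]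
    show ?thesis by (intro continuous_on_add bump_continuous)
  qed
  have intV: "integral {0..l} (\<lambda>s. \<omega> s *v T s + bump s *\<^sub>R (normal_part y s)) = bump_mean y" for y
  proof -
    have "WD 0 l \<omega> \<Omega>" using ctrl by (simp add: control_def)
    from WD_continuous[OF WD_bilinear[OF bounded_bilinear_mult_vec this WD_T l_nonneg]]
    have "(\<lambda>s. \<omega> s *v T s) integrable_on {0..l}" by (rule integrable_continuous_real)
    then show ?thesis
      using integral_add[of "\<lambda>s. \<omega> s *v T s" "{0..l}" "\<lambda>s. bump s *\<^sub>R (normal_part y s)"]
        integrable_continuous_real[OF bump_continuous] int0 by (simp add: bump_mean_def)
  qed
  have key: "c \<le> \<epsilon> * (C * (1 + K * R) + \<bar>M\<bar> / 2 * (l * C\<^sup>2))" if e: "0 < \<epsilon>" "\<epsilon> \<le> 1" "K * (\<epsilon> * R) \<le> 1" for \<epsilon>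
  proof -
    \<comment> \<open>The miss of the end point in units of \<open>\<epsilon>\<close>. As the
      control itself contributes nothing to first order, \<open>G\<close> is within
      \<open>\<epsilon> * R\<close> of \<open>bump_mean\<close>.\<close>
    define G where "G y = (1 / \<epsilon>) *\<^sub>R integral {0..l} (\<lambda>s. S \<epsilon> y s - T s)" for y
    let ?Bl = "cball (0 :: real ^ 'n) (\<epsilon> * R)"
    have By: "norm (Bi z) \<le> K * (\<epsilon> * R)" "norm (Bi z) \<le> 1" if "z \<in> ?Bl" for z
    proof -
      have "K * norm z \<le> K * (\<epsilon> * R)" using that K(1) by (intro mult_left_mono) auto
      then show "norm (Bi z) \<le> K * (\<epsilon> * R)" "norm (Bi z) \<le> 1" using K(2)[of z] e(3) by auto
    qed
    have dist: "norm (G y - bump_mean y) \<le> \<epsilon> * R" if y: "norm y \<le> 1" for y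
    proof -
      have "integral {0..l} (\<lambda>s. S \<epsilon> y s - (T s + \<epsilon> *\<^sub>R (\<omega> s *v T s + bump s *\<^sub>R (normal_part y s))))
          = integral {0..l} (\<lambda>s. (S \<epsilon> y s - T s) - \<epsilon> *\<^sub>R (\<omega> s *v T s + bump s *\<^sub>R (normal_part y s)))"
        by (rule integral_cong) simp
      also have "\<dots> = integral {0..l} (\<lambda>s. S \<epsilon> y s - T s) - integral {0..l} (\<lambda>s. \<epsilon> *\<^sub>R (\<omega> s *v T s + bump s *\<^sub>R (normal_part y s)))"
        by (intro integral_diff integrable_continuous_real continuous_on_diff cS[OF e(1,2) y] continuous_T
            continuous_on_scaleR continuous_on_const cV)
      also have "\<dots> = integral {0..l} (\<lambda>s. S \<epsilon> y s - T s) - \<epsilon> *\<^sub>R bump_mean y"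
        by (simp only: integral_cmul intV)
      also have "\<dots> = \<epsilon> *\<^sub>R (G y - bump_mean y)" using e by (simp add: G_def scaleR_diff_right)
      finally have eq: "integral {0..l} (\<lambda>s. S \<epsilon> y s - (T s + \<epsilon> *\<^sub>R (\<omega> s *v T s + bump s *\<^sub>R (normal_part y s))))
          = \<epsilon> *\<^sub>R (G y - bump_mean y)" .
      have "norm (\<epsilon> *\<^sub>R (G y - bump_mean y)) \<le> (C * \<epsilon>\<^sup>2) * measure lborel {0..l}"
        unfolding eq[symmetric]
      proof (rule has_integral_bound_real[of _ "{}"])
        show "((\<lambda>s. S \<epsilon> y s - (T s + \<epsilon> *\<^sub>R (\<omega> s *v T s + bump s *\<^sub>R (normal_part y s)))) has_integral
           integral {0..l} (\<lambda>s. S \<epsilon> y s - (T s + \<epsilon> *\<^sub>R (\<omega> s *v T s + bump s *\<^sub>R (normal_part y s))))) {0..l}"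
          by (intro integrable_integral integrable_continuous_real continuous_on_diff continuous_on_add cS[OF e(1,2) y] continuous_T
            continuous_on_scaleR continuous_on_const cV)
      qed (use S_first[OF e(1,2) y] C in auto)
      then have "\<epsilon> * norm (G y - bump_mean y) \<le> \<epsilon> * (\<epsilon> * R)"
        using e l_nonneg by (simp add: R_def power2_eq_square mult_ac)
      then show ?thesis using e by simp
    qed
    have "continuous_on ?Bl (\<lambda>z. z - G (Bi z))"
    proof (intro continuous_on_diff continuous_on_id lipschitz_on_continuous_on)
      show "((1 / \<epsilon>) * (C * K * l))-lipschitz_on ?Bl (\<lambda>z. G (Bi z))"
      proof (rule lipschitz_onI)
        fix z z' assume z: "z \<in> ?Bl" "z' \<in> ?Bl"
        have "G (Bi z) - G (Bi z') = (1 / \<epsilon>) *\<^sub>R integral {0..l} (\<lambda>s. S \<epsilon> (Bi z) s - S \<epsilon> (Bi z') s)"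
        proof -
          have "integral {0..l} (\<lambda>s. S \<epsilon> (Bi z) s - S \<epsilon> (Bi z') s)
            = integral {0..l} (\<lambda>s. (S \<epsilon> (Bi z) s - T s) - (S \<epsilon> (Bi z') s - T s))" by (rule integral_cong) simp
          also have "\<dots> = integral {0..l} (\<lambda>s. S \<epsilon> (Bi z) s - T s) - integral {0..l} (\<lambda>s. S \<epsilon> (Bi z') s - T s)"
            by (intro integral_diff integrable_continuous_real continuous_on_diff cS e By z continuous_T)
          finally show ?thesis by (simp add: G_def scaleR_diff_right)
        qed
        moreover have "norm (integral {0..l} (\<lambda>s. S \<epsilon> (Bi z) s - S \<epsilon> (Bi z') s)) \<le> (C * (K * norm (z - z'))) * measure lborel {0..l}"
        proof (rule has_integral_bound_real[of _ "{}"])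
          show "((\<lambda>s. S \<epsilon> (Bi z) s - S \<epsilon> (Bi z') s) has_integral integral {0..l} (\<lambda>s. S \<epsilon> (Bi z) s - S \<epsilon> (Bi z') s)) {0..l}"
            by (intro integrable_integral integrable_continuous_real continuous_on_diff cS e By z)
          fix s assume "s \<in> {0..l} - {}"
          then have s: "s \<in> {0..l}" by simp
          have "norm (S \<epsilon> (Bi z) s - S \<epsilon> (Bi z') s) \<le> C * norm (Bi z - Bi z')"
            by (rule S_lip[OF e(1,2) By(2)[OF z(1)] By(2)[OF z(2)] s])
          also have "\<dots> \<le> C * (K * norm (z - z'))"
            using K(2)[of "z - z'"] C by (simp add: linear_diff[OF Bi(1)])
          finally show "norm (S \<epsilon> (Bi z) s - S \<epsilon> (Bi z') s) \<le> C * (K * norm (z - z'))" .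
        qed (use C K in auto)
        ultimately show "dist (G (Bi z)) (G (Bi z')) \<le> (1 / \<epsilon>) * (C * K * l) * dist z z'"
          using e l_nonneg by (simp add: dist_norm divide_right_mono mult_ac)
      qed (use e C K l_nonneg in auto)
    qed
    \<comment> \<open>Composed with the inverse \<open>Bi\<close>, the map \<open>G\<close> is
      uniformly close to the identity, so z - G (Bi z) maps the ball of radius
      \<open>\<epsilon> * R\<close> into itself; a fixed point is a zero of
      \<open>G\<close>.\<close>
    moreover have "(\<lambda>z. z - G (Bi z)) \<in> ?Bl \<rightarrow> ?Bl"
    proof
      fix z assume z: "z \<in> ?Bl"
      have "norm (G (Bi z) - z) \<le> \<epsilon> * R" using dist[OF By(2)[OF z]] by (simp add: Bi(2))
      then show "z - G (Bi z) \<in> ?Bl" by (simp add: norm_minus_commute)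
    qed
    moreover have "?Bl \<noteq> {}" using R0 e(1) by (simp add: not_less)
    ultimately have "\<exists>z. z \<in> ?Bl \<and> z - G (Bi z) = z"
      using brouwer[OF compact_cball convex_cball, of "0 :: real ^ 'n" "\<epsilon> * R" "\<lambda>z. z - G (Bi z)"] by blast
    then obtain z where z: "z \<in> ?Bl" "z - G (Bi z) = z" by blast
    define y where "y = Bi z"
    have y: "norm y \<le> 1" "norm y \<le> K * (\<epsilon> * R)" using By[OF z(1)] by (auto simp: y_def)
    obtain \<sigma> where sg: "WD 0 l (S \<epsilon> y) \<sigma>"
      "AE s\<in>{0..l} in lebesgue. \<alpha> s * norm (\<sigma> s) \<le> k - \<epsilon> * c + C * (\<epsilon>\<^sup>2 + \<epsilon> * norm y)"
      using S_WD[OF e(1,2) y(1)] by blast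
    have "integral {0..l} (\<lambda>s. S \<epsilon> y s - T s) = 0" using z(2) e by (simp add: G_def y_def)
    moreover have "integral {0..l} (\<lambda>s. S \<epsilon> y s - T s) = integral {0..l} (S \<epsilon> y) - integral {0..l} T"
      by (intro integral_diff integrable_continuous_real cS[OF e(1,2) y(1)] continuous_T)
    moreover have "integral {0..l} T = a2 - a1"
      using integral_unique[OF WD_int[OF WD_gamma order_refl l_nonneg order_refl]] gamma_ends by simp
    ultimately have "integral {0..l} (S \<epsilon> y) = a2 - a1" by simp
    from curve_from_tangent[OF sg(1) S_unit[OF e(1,2) y(1)] S_ends this]
    obtain g where g: "adm l a1 a2 T1 T2 g" "\<And>s. s \<in> {0..l} \<Longrightarrow> vel l g s = S \<epsilon> y s" by metis
    have gW: "W2inf l g" using g(1) by (simp add: adm_def)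
    have "WD 0 l (vel l g) \<sigma>" by (rule WD_cong[OF sg(1)]) (simp add: g(2))
    then have Kg: "K_alpha l \<alpha> g \<le> k - \<epsilon> * c + C * (\<epsilon>\<^sup>2 + \<epsilon> * norm y)"
      by (rule K_alpha_le[OF gW _ sg(2)])
    have i0: "0 \<le> integral {0..l} (\<lambda>s. (norm (vel l g s - T s))\<^sup>2)"
      and il: "integral {0..l} (\<lambda>s. (norm (vel l g s - T s))\<^sup>2) \<le> (C * \<epsilon>)\<^sup>2 * l"
    proof -
      have ci: "((\<lambda>s. (norm (vel l g s - T s))\<^sup>2) has_integral integral {0..l} (\<lambda>s. (norm (vel l g s - T s))\<^sup>2)) {0..l}"
        by (intro integrable_integral integrable_continuous_real continuous_on_power continuous_on_norm continuous_on_diff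
          WD_continuous[OF \<open>WD 0 l (vel l g) \<sigma>\<close>] continuous_T)
      show "0 \<le> integral {0..l} (\<lambda>s. (norm (vel l g s - T s))\<^sup>2)" using ci by (rule has_integral_nonneg) simp
      have "((\<lambda>s. (C * \<epsilon>)\<^sup>2) has_integral (l - 0) *\<^sub>R (C * \<epsilon>)\<^sup>2) {0..l}"
        using has_integral_const_real[of "(C * \<epsilon>)\<^sup>2" 0 l] l_nonneg by simp
      with ci have "integral {0..l} (\<lambda>s. (norm (vel l g s - T s))\<^sup>2) \<le> (l - 0) *\<^sub>R (C * \<epsilon>)\<^sup>2"
      proof (rule has_integral_le)
        fix s assume s: "s \<in> {0..l}"
        show "(norm (vel l g s - T s))\<^sup>2 \<le> (C * \<epsilon>)\<^sup>2"
          using S_close[OF e(1,2) y(1) s] g(2)[OF s] by (intro power_mono) auto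
      qed
      then show "integral {0..l} (\<lambda>s. (norm (vel l g s - T s))\<^sup>2) \<le> (C * \<epsilon>)\<^sup>2 * l" by (simp add: mult.commute)
    qed
    have "M / 2 * integral {0..l} (\<lambda>s. (norm (vel l g s - T s))\<^sup>2) \<le> \<bar>M\<bar> / 2 * ((C * \<epsilon>)\<^sup>2 * l)"
      using i0 il by (intro mult_mono) auto
    then have "k \<le> (k - \<epsilon> * c + C * (\<epsilon>\<^sup>2 + \<epsilon> * norm y)) + \<bar>M\<bar> / 2 * ((C * \<epsilon>)\<^sup>2 * l)"
      using M[OF g(1)] Kg by linarith
    moreover have "C * (\<epsilon>\<^sup>2 + \<epsilon> * norm y) \<le> C * (\<epsilon>\<^sup>2 + \<epsilon> * (K * (\<epsilon> * R)))"
      using C e y(2) by (intro mult_left_mono add_left_mono) auto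
    ultimately have "\<epsilon> * c \<le> C * (\<epsilon>\<^sup>2 + \<epsilon> * (K * (\<epsilon> * R))) + \<bar>M\<bar> / 2 * ((C * \<epsilon>)\<^sup>2 * l)" by linarith
    also have "\<dots> = \<epsilon> * (\<epsilon> * (C * (1 + K * R) + \<bar>M\<bar> / 2 * (l * C\<^sup>2)))"
      by (simp add: power2_eq_square algebra_simps)
    finally show ?thesis using e by simp
  qed
  define Q where "Q = C * (1 + K * R) + \<bar>M\<bar> / 2 * (l * C\<^sup>2)"
  have Q0: "Q > 0" unfolding Q_def using C K(1) R0 l_pos by (intro add_pos_nonneg mult_pos_pos) auto
  \<comment> \<open>The bound 1 / (K R) keeps the norm of \<open>y\<close> below 1, and c / (2 Q)
    makes the total error at most half of the gain.\<close>
  define \<epsilon> where "\<epsilon> = min (min 1 (1 / (K * R))) (c / (2 * Q))"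
  have "\<epsilon> > 0" "\<epsilon> \<le> 1" using K(1) R0 Q0 c by (auto simp: \<epsilon>_def)
  moreover have "K * (\<epsilon> * R) \<le> 1"
  proof -
    have "\<epsilon> \<le> 1 / (K * R)" by (simp add: \<epsilon>_def)
    then show ?thesis using K(1) R0 by (simp add: field_simps)
  qed
  ultimately have "c \<le> \<epsilon> * Q" using key unfolding Q_def by blast
  also have "\<dots> \<le> c / (2 * Q) * Q" using Q0 by (intro mult_right_mono) (auto simp: \<epsilon>_def)
  also have "\<dots> = c / 2" using Q0 by simp
  finally show False using c by simp
qed

end

section \<open>Necessity: the multiplier\<close>

lemma matrix_eq_inner:
  fixes A B :: "real ^ 'n ^ 'm"
  assumes "\<And>x y. x \<bullet> (A *v y) = x \<bullet> (B *v y)"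
  shows "A = B"
proof -
  have "A *v y = B *v y" for y using assms vector_eq_ldot by blast
  then show ?thesis by (simp add: matrix_eq)
qed

text \<open>The inner product of two simple 2-forms, read in both orders. It moves a variable form
  out of a linear functional, which is then represented by one fixed matrix.\<close>

lemma wedge_inner: "(wedge x y *v z) \<bullet> w = x \<bullet> (wedge w z *v y)"
  by (simp add: wedge_mult_vec inner_diff_left inner_diff_right inner_commute)

lemma wedge_minus_left: "wedge (- x) y = - wedge x y"
  by (simp add: wedge_def vec_eq_iff)

lemma wedge_diff_right: "wedge x (y - z) = wedge x y - wedge x z"
  by (simp add: wedge_def vec_eq_iff algebra_simps)

lemma minus_matrix_vec: "(- A) *v (x :: real ^ 'n) = - (A *v x)"
  by (simp add: matrix_vector_mult_def vec_eq_iff sum_negf)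

lemma matrix_vec_minus: "A *v (- x :: real ^ 'n) = - (A *v x)"
  by (simp add: matrix_vector_mult_def vec_eq_iff sum_negf)

lemma skew_minus: "skew A \<Longrightarrow> skew (- A)"
  by (simp add: skew_def minus_matrix_vec)

text \<open>A 2-form that vanishes on pairs of vectors orthogonal to \<open>t\<close> contains
  \<open>t\<close> as a factor: only its values on pairs with one entry \<open>t\<close> remain, and
  they are recorded in \<open>V *v t\<close>.\<close>

lemma skew_eq_wedge:
  assumes V: "skew V" and t: "t \<bullet> t = 1"
    and z: "\<And>a b. (a - (t \<bullet> a) *\<^sub>R t) \<bullet> (V *v (b - (t \<bullet> b) *\<^sub>R t)) = 0"
  shows "V = wedge (V *v t) t"
proof (rule matrix_eq_inner)
  fix x y
  have tt: "t \<bullet> (V *v t) = 0" using skew_self[OF V, of t] by (simp add: inner_commute)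
  have sk: "t \<bullet> (V *v y) = - ((V *v t) \<bullet> y)" using V unfolding skew_def by (metis minus_minus)
  have "0 = (x - (t \<bullet> x) *\<^sub>R t) \<bullet> (V *v (y - (t \<bullet> y) *\<^sub>R t))" by (simp add: z)
  also have "\<dots> = x \<bullet> (V *v y) - (t \<bullet> y) * (x \<bullet> (V *v t)) - (t \<bullet> x) * (t \<bullet> (V *v y))"
    by (simp add: matrix_vector_mult_diff_distrib matrix_vector_mult_scaleR inner_diff_left inner_diff_right tt)
  finally show "x \<bullet> (V *v y) = x \<bullet> (wedge (V *v t) t *v y)"
    unfolding wedge_mult_vec sk by (simp add: inner_diff_right inner_commute algebra_simps)
qed

section \<open>Controls, their end defects and the multiplier\<close>

context curve
begin

text \<open>The first summand turns the curvature \<open>h\<close> into the prescribed normal field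
  \<open>v\<close>. The second annihilates T when \<open>e\<close> and \<open>f\<close> are normal,
  so it changes the end defects without changing the curvature. These two freedoms yield the two
  halves of the multiplier rule.\<close>

lemma control_exists:
  assumes h': "h' \<in> borel_measurable lebesgue" "\<And>s. norm (h' s) \<le> Bh" "AE s\<in>{0..l} in lebesgue. h' s = h s"
    and v: "v \<in> borel_measurable lebesgue" "\<And>s. s \<in> {0..l} \<Longrightarrow> norm (v s) \<le> Bv"
      "\<And>s. s \<in> {0..l} \<Longrightarrow> T s \<bullet> v s = 0" "\<And>s. s \<in> {0..l} \<Longrightarrow> \<alpha> s * norm (v s) \<le> k - c"
    and e: "continuous_on {0..l} e" "\<And>s. s \<in> {0..l} \<Longrightarrow> T s \<bullet> e s = 0"
    and f: "continuous_on {0..l} f" "\<And>s. s \<in> {0..l} \<Longrightarrow> T s \<bullet> f s = 0"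
  obtains \<omega> where "control c \<omega> (\<lambda>s. wedge (v s - h' s) (T s) + wedge (e s) (f s))"
proof -
  let ?i = "indicator {0..l} :: real \<Rightarrow> real"
  define \<Omega> where "\<Omega> s = wedge (v s - h' s) (T s) + wedge (e s) (f s)" for s
  \<comment> \<open>The same path cut off outside [0, l], which makes it measurable on the whole
    line; \<open>\<omega>\<close> is its primitive and inherits skewness.\<close>
  define \<Omega>' where "\<Omega>' s = wedge (v s - h' s) (?i s *\<^sub>R T s) + wedge (?i s *\<^sub>R e s) (?i s *\<^sub>R f s)" for s
  have eq: "\<Omega>' s = \<Omega> s" if "s \<in> {0..l}" for s using that by (simp add: \<Omega>_def \<Omega>'_def)
  have meas: "\<Omega>' \<in> borel_measurable lebesgue"
    unfolding \<Omega>'_def[abs_def]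
    by (intro borel_measurable_add measurable_bilinear[OF bounded_bilinear_wedge] borel_measurable_diff v(1) h'(1)
        continuous_indicator_measurable continuous_T e(1) f(1))
  obtain K where K: "K > 0" "\<And>x y. norm (wedge x y :: real ^ 'n ^ 'n) \<le> norm x * norm y * K"
    using bounded_bilinear.pos_bounded[OF bounded_bilinear_wedge] by blast
  have bdd: "\<exists>C\<ge>0. \<forall>s\<in>{0..l}. norm (u s) \<le> C" if "continuous_on {0..l} u" for u :: "real \<Rightarrow> real ^ 'n"
  proof -
    have "bounded (u ` {0..l})" by (intro compact_imp_bounded compact_continuous_image that) simp
    then obtain C where "\<forall>y\<in>u ` {0..l}. norm y \<le> C" unfolding bounded_iff by blast
    then show ?thesis by (intro exI[of _ "max C 0"]) (auto simp: le_max_iff_disj)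
  qed
  obtain Ce where Ce: "Ce \<ge> 0" "\<forall>s\<in>{0..l}. norm (e s) \<le> Ce" using bdd[OF e(1)] by blast
  obtain Cf where Cf: "Cf \<ge> 0" "\<forall>s\<in>{0..l}. norm (f s) \<le> Cf" using bdd[OF f(1)] by blast
  have B: "norm (\<Omega>' s) \<le> (Bv + Bh) * 1 * K + Ce * Cf * K" if s: "s \<in> {0..l}" for s
  proof -
    have vh: "norm (v s - h' s) \<le> Bv + Bh"
      using norm_triangle_ineq4[of "v s" "h' s"] v(2)[OF s] h'(2)[of s] by linarith
    have "norm (wedge (v s - h' s) (T s)) \<le> norm (v s - h' s) * norm (T s) * K" by (rule K(2))
    also have "\<dots> \<le> (Bv + Bh) * 1 * K" using vh norm_T[OF s] K(1) by (intro mult_right_mono) auto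
    finally have 1: "norm (wedge (v s - h' s) (T s)) \<le> (Bv + Bh) * 1 * K" .
    have "norm (wedge (e s) (f s)) \<le> norm (e s) * norm (f s) * K" by (rule K(2))
    also have "\<dots> \<le> Ce * Cf * K" using Ce Cf s K(1) by (intro mult_right_mono mult_mono) auto
    finally show ?thesis unfolding eq[OF s] \<Omega>_def using 1 norm_triangle_ineq[of "wedge (v s - h' s) (T s)" "wedge (e s) (f s)"]
      by linarith
  qed
  define \<omega> where "\<omega> s = integral {0..s} \<Omega>'" for s
  have "WD 0 l \<omega> \<Omega>'" unfolding \<omega>_def[abs_def] by (rule WD_integral[OF meas B])
  then have W: "WD 0 l \<omega> \<Omega>" by (rule WD_cong_AE) (auto simp: eq)
  have w0: "\<omega> 0 = 0" by (simp add: \<omega>_def)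
  have Osk: "skew (\<Omega> s)" for s unfolding \<Omega>_def by (intro skew_add skew_wedge)
  have "skew (\<omega> s)" if s: "s \<in> {0..l}" for s
    unfolding skew_def
  proof (intro allI)
    fix x y
    have "WD 0 l (\<lambda>s. (\<omega> s *v x) \<bullet> y + x \<bullet> (\<omega> s *v y)) (\<lambda>s. (\<Omega> s *v x) \<bullet> y + x \<bullet> (\<Omega> s *v y))"
      by (intro WD_add WD_inner_left WD_linear[OF WD_linear[OF W bounded_bilinear.bounded_linear_left[OF bounded_bilinear_mult_vec]] bounded_linear_inner_right]
          WD_linear[OF W bounded_bilinear.bounded_linear_left[OF bounded_bilinear_mult_vec]])
    then have "WD 0 s (\<lambda>s. (\<omega> s *v x) \<bullet> y + x \<bullet> (\<omega> s *v y)) (\<lambda>s. (\<Omega> s *v x) \<bullet> y + x \<bullet> (\<Omega> s *v y))"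
      by (rule WD_subset) (use s in auto)
    then have "(\<omega> 0 *v x) \<bullet> y + x \<bullet> (\<omega> 0 *v y) = (\<omega> s *v x) \<bullet> y + x \<bullet> (\<omega> s *v y)"
      by (rule WD_const_if_zero) (use s Osk in \<open>auto simp: skew_def\<close>)
    then show "(\<omega> s *v x) \<bullet> y = - (x \<bullet> (\<omega> s *v y))" by (simp add: w0)
  qed
  moreover have "AE s\<in>{0..l} in lebesgue. \<alpha> s * norm (h s + \<Omega> s *v T s) \<le> k - c"
    using h'(3) T_h
  proof eventually_elim
    case (elim s)
    show ?case
    proof
      assume s: "s \<in> {0..l}"
      have "T s \<bullet> (v s - h' s) = 0" using elim s v(3)[OF s] by (simp add: inner_diff_right)
      then have "(v s - h' s) \<bullet> T s = 0" by (simp add: inner_commute)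
      then have "\<Omega> s *v T s = v s - h' s"
        using T_T[OF s] e(2)[OF s, unfolded inner_commute[of "T s"]] f(2)[OF s, unfolded inner_commute[of "T s"]]
        by (simp add: \<Omega>_def matrix_vector_mult_add_rdistrib wedge_mult_vec)
      then show "\<alpha> s * norm (h s + \<Omega> s *v T s) \<le> k - c" using v(4)[OF s] elim s by simp
    qed
  qed
  ultimately have "control c \<omega> \<Omega>" using W w0 by (simp add: control_def)
  then show ?thesis by (intro that[of \<omega>]) (simp add: \<Omega>_def[abs_def])
qed

text \<open>Integration by parts, with T written as minus the derivative of
  \<open>\<gamma> l - \<gamma> s\<close>, expresses both end defects through \<open>\<Omega>\<close>
  alone, which can be prescribed pointwise.\<close>

lemma control_functional:
  assumes ctrl: "control c \<omega> \<Omega>"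
  shows "((\<lambda>s. (\<Omega> s *v T2) \<bullet> q + (\<Omega> s *v (\<gamma> l - \<gamma> s)) \<bullet> \<mu>) has_integral
    q \<bullet> (\<omega> l *v T2) + \<mu> \<bullet> integral {0..l} (\<lambda>s. \<omega> s *v T s)) {0..l}"
proof -
  have W: "WD 0 l \<omega> \<Omega>" and w0: "\<omega> 0 = 0" using ctrl by (auto simp: control_def)
  have g: "WD 0 l (\<lambda>s. \<gamma> l - \<gamma> s) (\<lambda>s. 0 - T s)" by (intro WD_diff WD_const WD_gamma)
  have "WD 0 l (\<lambda>s. (\<omega> s *v T2) \<bullet> q + (\<omega> s *v (\<gamma> l - \<gamma> s)) \<bullet> \<mu>)
     (\<lambda>s. (\<Omega> s *v T2) \<bullet> q + (\<Omega> s *v (\<gamma> l - \<gamma> s) + \<omega> s *v (0 - T s)) \<bullet> \<mu>)"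
    by (intro WD_add WD_inner_left WD_bilinear[OF bounded_bilinear_mult_vec W g l_nonneg]
       WD_linear[OF W bounded_bilinear.bounded_linear_left[OF bounded_bilinear_mult_vec]])
  from WD_int[OF this order_refl l_nonneg order_refl]
  have 1: "((\<lambda>s. (\<Omega> s *v T2) \<bullet> q + (\<Omega> s *v (\<gamma> l - \<gamma> s) + \<omega> s *v (0 - T s)) \<bullet> \<mu>) has_integral (\<omega> l *v T2) \<bullet> q) {0..l}"
    by (simp add: w0)
  have "((\<lambda>s. \<omega> s *v T s) has_integral integral {0..l} (\<lambda>s. \<omega> s *v T s)) {0..l}"
    by (intro integrable_integral integrable_continuous_real
        WD_continuous[OF WD_bilinear[OF bounded_bilinear_mult_vec W WD_T l_nonneg]])
  from has_integral_linear[OF this bounded_linear_inner_left[of \<mu>]]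
  have 2: "((\<lambda>s. (\<omega> s *v T s) \<bullet> \<mu>) has_integral integral {0..l} (\<lambda>s. \<omega> s *v T s) \<bullet> \<mu>) {0..l}" by (simp add: o_def)
  show ?thesis
    using has_integral_add[OF 1 2]
    by (simp add: matrix_vector_mult_diff_distrib matrix_vec_minus inner_diff_left inner_add_left inner_commute
        inner_diff_right inner_add_right)
qed

text \<open>Only the pair of end defects of a control matters, so the separation takes place in a
  finite-dimensional product space. Defects are linear in the control and the curvature bound is
  convex in it, hence the set of defects with some gain c > 0 is convex; it does not contain 0,
  because no admissible control has zero defect.\<close>

lemma elastica_separating_functional:
  assumes ela: "inf_elastica l \<alpha> a1 a2 T1 T2 \<gamma>" and k: "k > 0"
  obtains q \<mu> where "q \<noteq> 0 \<or> \<mu> \<noteq> 0" "q \<bullet> T2 = 0"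
    "\<And>c \<omega> \<Omega>. 0 < c \<Longrightarrow> c \<le> k \<Longrightarrow> control c \<omega> \<Omega> \<Longrightarrow>
      0 \<le> q \<bullet> (\<omega> l *v T2) + \<mu> \<bullet> integral {0..l} (\<lambda>s. \<omega> s *v T s)"
proof -
  define F where "F \<omega> = (\<omega> l *v T2, integral {0..l} (\<lambda>s. \<omega> s *v T s))" for \<omega> :: "real \<Rightarrow> real ^ 'n ^ 'n"
  define X where "X = {F \<omega> | \<omega> c \<Omega>. 0 < c \<and> c \<le> k \<and> control c \<omega> \<Omega>}"
  have cont: "continuous_on {0..l} (\<lambda>s. \<omega> s *v T s)" if "control c \<omega> \<Omega>" for c \<omega> \<Omega>
  proof -
    have "WD 0 l \<omega> \<Omega>" using that by (simp add: control_def)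
    from WD_continuous[OF WD_bilinear[OF bounded_bilinear_mult_vec this WD_T l_nonneg]] show ?thesis .
  qed
  have "convex X"
    unfolding convex_def
  proof (intro ballI allI impI)
    fix x y and u v :: real
    assume x: "x \<in> X" and y: "y \<in> X" and uv: "0 \<le> u" "0 \<le> v" "u + v = 1"
    obtain \<omega>1 c1 \<Omega>1 where 1: "x = F \<omega>1" "0 < c1" "c1 \<le> k" "control c1 \<omega>1 \<Omega>1" using x by (auto simp: X_def)
    obtain \<omega>2 c2 \<Omega>2 where 2: "y = F \<omega>2" "0 < c2" "c2 \<le> k" "control c2 \<omega>2 \<Omega>2" using y by (auto simp: X_def)
    define \<omega> where "\<omega> s = u *\<^sub>R \<omega>1 s + v *\<^sub>R \<omega>2 s" for s
    define \<Omega> where "\<Omega> s = u *\<^sub>R \<Omega>1 s + v *\<^sub>R \<Omega>2 s" for s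
    define c where "c = u * c1 + v * c2"
    have c0: "0 < c"
    proof (cases "u = 0")
      case True then show ?thesis using uv 2 by (simp add: c_def)
    next
      case False then show ?thesis using uv 1 2 by (auto simp: c_def intro!: add_pos_nonneg)
    qed
    have ck: "c \<le> k"
    proof -
      have "c \<le> u * k + v * k" unfolding c_def using uv 1 2 by (intro add_mono mult_left_mono) auto
      also have "\<dots> = k" using uv(3) by (simp flip: distrib_right)
      finally show ?thesis .
    qed
    have "control c \<omega> \<Omega>"
      unfolding control_def
    proof (intro conjI ballI)
      show "WD 0 l \<omega> \<Omega>" unfolding \<omega>_def[abs_def] \<Omega>_def[abs_def]
        using 1(4) 2(4) by (intro WD_add WD_scaleR_const) (auto simp: control_def)
      show "\<omega> 0 = 0" using 1(4) 2(4) by (simp add: control_def \<omega>_def)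
      show "skew (\<omega> s)" if "s \<in> {0..l}" for s
        unfolding \<omega>_def using 1(4) 2(4) that by (intro skew_add skew_scaleR) (auto simp: control_def)
      have "AE s\<in>{0..l} in lebesgue. \<alpha> s * norm (h s + \<Omega>1 s *v T s) \<le> k - c1"
        "AE s\<in>{0..l} in lebesgue. \<alpha> s * norm (h s + \<Omega>2 s *v T s) \<le> k - c2"
        using 1(4) 2(4) by (auto simp: control_def)
      then show "AE s\<in>{0..l} in lebesgue. \<alpha> s * norm (h s + \<Omega> s *v T s) \<le> k - c"
      proof eventually_elim
        case (elim s)
        show ?case
        proof
          assume s: "s \<in> {0..l}"
          have a: "\<alpha> s > 0" by (rule alpha_pos[OF s])
          have "h s + \<Omega> s *v T s = u *\<^sub>R (h s + \<Omega>1 s *v T s) + v *\<^sub>R (h s + \<Omega>2 s *v T s)"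
          proof -
            have "h s = u *\<^sub>R h s + v *\<^sub>R h s" using uv(3) by (simp flip: scaleR_add_left)
            then show ?thesis
              by (simp add: \<Omega>_def matrix_vector_mult_add_rdistrib scaleR_add_right flip: scaleR_matrix_vector_assoc)
          qed
          then have "norm (h s + \<Omega> s *v T s) \<le> u * norm (h s + \<Omega>1 s *v T s) + v * norm (h s + \<Omega>2 s *v T s)"
            using norm_triangle_ineq[of "u *\<^sub>R (h s + \<Omega>1 s *v T s)" "v *\<^sub>R (h s + \<Omega>2 s *v T s)"] uv by simp
          then have "\<alpha> s * norm (h s + \<Omega> s *v T s) \<le> \<alpha> s * (u * norm (h s + \<Omega>1 s *v T s) + v * norm (h s + \<Omega>2 s *v T s))"
            using a by (intro mult_left_mono) auto
          also have "\<dots> = u * (\<alpha> s * norm (h s + \<Omega>1 s *v T s)) + v * (\<alpha> s * norm (h s + \<Omega>2 s *v T s))"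
            by (simp add: algebra_simps)
          also have "\<dots> \<le> u * (k - c1) + v * (k - c2)" using elim s uv by (intro add_mono mult_left_mono) auto
          also have "\<dots> = (u + v) * k - c" by (simp add: c_def algebra_simps)
          finally show "\<alpha> s * norm (h s + \<Omega> s *v T s) \<le> k - c" using uv(3) by simp
        qed
      qed
    qed
    moreover have "u *\<^sub>R x + v *\<^sub>R y = F \<omega>"
    proof -
      have "integral {0..l} (\<lambda>s. \<omega> s *v T s) = integral {0..l} (\<lambda>s. u *\<^sub>R (\<omega>1 s *v T s) + v *\<^sub>R (\<omega>2 s *v T s))"
        by (rule integral_cong) (simp add: \<omega>_def matrix_vector_mult_add_rdistrib flip: scaleR_matrix_vector_assoc)
      also have "\<dots> = integral {0..l} (\<lambda>s. u *\<^sub>R (\<omega>1 s *v T s)) + integral {0..l} (\<lambda>s. v *\<^sub>R (\<omega>2 s *v T s))"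
        by (intro integral_add integrable_continuous_real continuous_on_scaleR continuous_on_const cont[OF 1(4)] cont[OF 2(4)])
      also have "\<dots> = u *\<^sub>R integral {0..l} (\<lambda>s. \<omega>1 s *v T s) + v *\<^sub>R integral {0..l} (\<lambda>s. \<omega>2 s *v T s)"
        by (simp only: integral_cmul)
      finally show ?thesis
        by (simp add: F_def 1(1) 2(1)) (simp add: \<omega>_def matrix_vector_mult_add_rdistrib flip: scaleR_matrix_vector_assoc)
    qed
    ultimately show "u *\<^sub>R x + v *\<^sub>R y \<in> X" using c0 ck by (auto simp: X_def)
  qed
  moreover have "X \<noteq> {}"
  proof -
    obtain h' Bh where h': "h' \<in> borel_measurable lebesgue" "\<And>s. norm (h' s) \<le> Bh" "Bh \<ge> 0" "WD 0 l T h'"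
      "AE s\<in>{0..l} in lebesgue. h' s = h s" by (rule WD_nice[OF WD_T l_nonneg]) (rule that)
    \<comment> \<open>Prescribing curvature 0 gives a control with the largest gain c = k.\<close>
    obtain \<omega> where "control k \<omega> (\<lambda>s. wedge (0 - h' s) (T s) + wedge 0 0)"
      by (rule control_exists[OF h'(1,2,5), of "\<lambda>_. 0" 0 k "\<lambda>_. 0" "\<lambda>_. 0"]) auto
    then have "F \<omega> \<in> X" unfolding X_def using k by blast
    then show ?thesis by blast
  qed
  moreover have "0 \<notin> X"
  proof
    assume "0 \<in> X"
    then obtain \<omega> c \<Omega> where w: "0 < c" "c \<le> k" "control c \<omega> \<Omega>" "F \<omega> = 0" by (auto simp: X_def)
    then have "\<omega> l *v T2 = 0" "integral {0..l} (\<lambda>s. \<omega> s *v T s) = 0" by (auto simp: F_def zero_prod_def)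
    then show False using elastica_no_admissible_control[OF ela k w(3,1,2)] by blast
  qed
  ultimately obtain a where a: "a \<in> span X" "a \<noteq> 0" "\<And>x. x \<in> X \<Longrightarrow> 0 \<le> a \<bullet> x"
    using separating_hyperplane_set_0_inspan[of X] by blast
  \<comment> \<open>The first component of a defect is a skew matrix applied to T2, thus orthogonal
    to T2, and \<open>a\<close> lies in the span of the defects. Without this normalisation the
    functional could have a component along T2 that no control sees.\<close>
  have "fst a \<bullet> T2 = 0"
    using a(1)
  proof (induction rule: span_induct_alt)
    case base show ?case by simp
  next
    case (step c x y)
    then obtain \<omega> c' \<Omega> where w: "control c' \<omega> \<Omega>" "x = F \<omega>" by (auto simp: X_def)
    then have "skew (\<omega> l)" using l_nonneg by (simp add: control_def)
    then have "fst x \<bullet> T2 = 0" using w(2) by (simp add: F_def skew_self)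
    then show ?case using step by (simp add: inner_add_left)
  qed
  moreover have "fst a \<noteq> 0 \<or> snd a \<noteq> 0" using a(2) by (auto simp: prod_eq_iff)
  moreover have "0 \<le> fst a \<bullet> (\<omega> l *v T2) + snd a \<bullet> integral {0..l} (\<lambda>s. \<omega> s *v T s)"
    if "0 < c" "c \<le> k" "control c \<omega> \<Omega>" for c \<omega> \<Omega>
  proof -
    have "F \<omega> \<in> X" using that by (auto simp: X_def)
    then show ?thesis using a(3) by (fastforce simp: F_def inner_prod_def)
  qed
  ultimately show ?thesis using that by blast
qed

text \<open>The separating functional is represented by a path \<open>V\<close> of 2-forms, and the
  multiplier is W = - V. Varying the part of the control that leaves the curvature alone shows that
  \<open>V\<close> vanishes on normal pairs, so it has T as a factor. Varying the prescribed
  curvature gives a maximum principle: the integral of \<open>h \<bullet> \<phi>\<close> is at least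
  k times that of \<open>|\<phi>|\<close> / \<alpha>, so Cauchy-Schwarz is an equality almost
  everywhere.\<close>

lemma elastica_imp_multiplier:
  assumes ela: "inf_elastica l \<alpha> a1 a2 T1 T2 \<gamma>" and k: "k > 0"
  obtains lam W0 where "skew W0"
    "\<And>s. s \<in> {0..l} \<Longrightarrow> wedge lam (\<gamma> s) + W0 = wedge ((wedge lam (\<gamma> s) + W0) *v T s) (T s)"
    "AE s\<in>{0..l} in lebesgue. (wedge lam (\<gamma> s) + W0) *v T s \<noteq> 0 \<longrightarrow>
       h s = (k / (\<alpha> s * norm ((wedge lam (\<gamma> s) + W0) *v T s))) *\<^sub>R ((wedge lam (\<gamma> s) + W0) *v T s)"
    "\<exists>s\<in>{0..l}. (wedge lam (\<gamma> s) + W0) *v T s \<noteq> 0"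
proof -
  obtain q \<mu> where qm: "q \<noteq> 0 \<or> \<mu> \<noteq> 0" "q \<bullet> T2 = 0"
    and sep: "\<And>c \<omega> \<Omega>. 0 < c \<Longrightarrow> c \<le> k \<Longrightarrow> control c \<omega> \<Omega> \<Longrightarrow>
      0 \<le> q \<bullet> (\<omega> l *v T2) + \<mu> \<bullet> integral {0..l} (\<lambda>s. \<omega> s *v T s)"
    by (rule elastica_separating_functional[OF ela k]) (rule that)
  obtain h' Bh where h': "h' \<in> borel_measurable lebesgue" "\<And>s. norm (h' s) \<le> Bh" "Bh \<ge> 0" "WD 0 l T h'"
    "AE s\<in>{0..l} in lebesgue. h' s = h s" by (rule WD_nice[OF WD_T l_nonneg]) (rule that)
  define V where "V s = wedge q T2 + wedge \<mu> (\<gamma> l - \<gamma> s)" for s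
  have Vsk: "skew (V s)" for s unfolding V_def by (intro skew_add skew_wedge)
  have cg: "continuous_on {0..l} \<gamma>" by (rule WD_continuous[OF WD_gamma])
  have cV: "continuous_on {0..l} V" unfolding V_def[abs_def]
    by (intro continuous_on_add continuous_on_const bounded_bilinear.continuous_on[OF bounded_bilinear_wedge]
        continuous_on_diff cg)
  have cmv: "continuous_on {0..l} (\<lambda>s. V s *v u s)" if "continuous_on {0..l} u" for u
    by (rule bounded_bilinear.continuous_on[OF bounded_bilinear_mult_vec cV that])
  have func: "(wedge x y *v T2) \<bullet> q + (wedge x y *v (\<gamma> l - \<gamma> s)) \<bullet> \<mu> = x \<bullet> (V s *v y)" for x y s
    unfolding wedge_inner V_def matrix_vector_mult_add_rdistrib by (simp add: inner_add_right)
  have ineq: "\<exists>I\<ge>0. ((\<lambda>s. (v s - h' s) \<bullet> (V s *v T s) + e s \<bullet> (V s *v f s)) has_integral I) {0..l}"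
    if c: "0 < c" "c \<le> k"
    and v: "v \<in> borel_measurable lebesgue" "\<And>s. s \<in> {0..l} \<Longrightarrow> norm (v s) \<le> Bv"
      "\<And>s. s \<in> {0..l} \<Longrightarrow> T s \<bullet> v s = 0" "\<And>s. s \<in> {0..l} \<Longrightarrow> \<alpha> s * norm (v s) \<le> k - c"
    and e: "continuous_on {0..l} e" "\<And>s. s \<in> {0..l} \<Longrightarrow> T s \<bullet> e s = 0"
    and f: "continuous_on {0..l} f" "\<And>s. s \<in> {0..l} \<Longrightarrow> T s \<bullet> f s = 0" for c v Bv e f
  proof -
    obtain \<omega> where w: "control c \<omega> (\<lambda>s. wedge (v s - h' s) (T s) + wedge (e s) (f s))"
      by (rule control_exists[OF h'(1,2,5) v e f])
    have "((wedge (v s - h' s) (T s) + wedge (e s) (f s)) *v T2) \<bullet> q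
         + ((wedge (v s - h' s) (T s) + wedge (e s) (f s)) *v (\<gamma> l - \<gamma> s)) \<bullet> \<mu>
       = (v s - h' s) \<bullet> (V s *v T s) + e s \<bullet> (V s *v f s)" for s
      unfolding func[symmetric] by (simp add: matrix_vector_mult_add_rdistrib inner_add_left)
    then show ?thesis using control_functional[OF w, of q \<mu>] sep[OF c w] by auto
  qed
  have orth: "T s \<bullet> (normal_part a s) = 0" if "s \<in> {0..l}" for a s
    using T_T[OF that] by (simp add: inner_diff_right)
  have cP: "continuous_on {0..l} (\<lambda>s. a - (T s \<bullet> a) *\<^sub>R T s)" for a
    by (intro continuous_intros continuous_T)
  have Vwedge: "V s = wedge (V s *v T s) (T s)" if s: "s \<in> {0..l}" for s
  proof (rule skew_eq_wedge[OF Vsk T_T[OF s]])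
    fix a b
    \<comment> \<open>With e = t r times the normal part of a, and f the normal part of b, the
      inequality reads I0 + t I1 \<ge> 0 for every real t, so the integral I1 of r^2 must be
      0.\<close>
    define r where "r s = (normal_part a s) \<bullet> (V s *v (normal_part b s))" for s
    have cr: "continuous_on {0..l} r" unfolding r_def[abs_def] by (intro continuous_on_inner cP cmv)
    have cr2: "continuous_on {0..l} (\<lambda>s. r s * r s)" by (intro continuous_on_mult cr)
    define I1 where "I1 = integral {0..l} (\<lambda>s. r s * r s)"
    have I1: "((\<lambda>s. r s * r s) has_integral I1) {0..l}"
      unfolding I1_def by (intro integrable_integral integrable_continuous_real cr2)
    have zero: "\<exists>I\<ge>0. ((\<lambda>s. (0 - h' s) \<bullet> (V s *v T s) + ((t * r s) *\<^sub>R (normal_part a s)) \<bullet> (V s *v (normal_part b s))) has_integral I) {0..l}" for t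
      by (rule ineq[of k "\<lambda>_. 0" 0]) (use k orth in \<open>auto intro!: continuous_on_scaleR continuous_on_mult cr cP\<close>)
    from zero[of 0] obtain I0 where I0: "((\<lambda>s. (0 - h' s) \<bullet> (V s *v T s)) has_integral I0) {0..l}" by auto
    have "0 \<le> I0 + t * I1" for t
    proof -
      obtain I where I: "I \<ge> 0" "((\<lambda>s. (0 - h' s) \<bullet> (V s *v T s) + ((t * r s) *\<^sub>R (normal_part a s)) \<bullet> (V s *v (normal_part b s))) has_integral I) {0..l}"
        using zero by blast
      have "((\<lambda>s. (0 - h' s) \<bullet> (V s *v T s) + t * (r s * r s)) has_integral I0 + t * I1) {0..l}"
        by (intro has_integral_add has_integral_mult_right I0 I1)
      then have "((\<lambda>s. (0 - h' s) \<bullet> (V s *v T s) + ((t * r s) *\<^sub>R (normal_part a s)) \<bullet> (V s *v (normal_part b s))) has_integral I0 + t * I1) {0..l}"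
        by (simp add: r_def mult.assoc)
      then have "I = I0 + t * I1" using I(2) has_integral_unique by blast
      then show ?thesis using I(1) by simp
    qed
    note all_t = this
    have "I1 = 0"
    proof (rule ccontr)
      assume "I1 \<noteq> 0"
      then show False using all_t[of "- (I0 + 1) / I1"] by simp
    qed
    then have "\<forall>s\<in>{0..l}. r s * r s = 0"
      using integral_eq_0_iff[OF cr2 l_pos] unfolding I1_def by simp
    then show "(normal_part a s) \<bullet> (V s *v (normal_part b s)) = 0"
      using s by (simp add: r_def)
  qed
  define \<phi> where "\<phi> s = - (V s *v T s)" for s
  have cphi: "continuous_on {0..l} \<phi>" unfolding \<phi>_def[abs_def] by (intro continuous_on_minus cmv continuous_T)
  have phiT: "T s \<bullet> \<phi> s = 0" for s using skew_self[OF Vsk, of s "T s"] by (simp add: \<phi>_def inner_commute)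
  define Q where "Q = integral {0..l} (\<lambda>s. norm (\<phi> s) / \<alpha> s)"
  have Q: "((\<lambda>s. norm (\<phi> s) / \<alpha> s) has_integral Q) {0..l}"
    unfolding Q_def by (intro integrable_integral over_alpha_integrable continuous_on_norm cphi)
  obtain A B where AB: "A > 0" "B > 0" "\<And>s. s \<in> {0..l} \<Longrightarrow> A \<le> \<alpha> s" "\<And>s. s \<in> {0..l} \<Longrightarrow> \<alpha> s \<le> B"
    by (rule alpha_bounds) (rule that)
  let ?i = "indicator {0..l} :: real \<Rightarrow> real"
  have step: "\<exists>I\<ge>0. ((\<lambda>s. h' s \<bullet> \<phi> s - (k - c) * (norm (\<phi> s) / \<alpha> s)) has_integral I) {0..l}" if c: "0 < c" "c \<le> k" for c
  proof -
    \<comment> \<open>The field of largest admissible length in direction \<open>\<phi>\<close>.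
      Where \<open>\<phi>\<close> vanishes, \<open>inverse 0 = 0\<close> makes \<open>v\<close>
      equal to 0.\<close>
    define v where "v s = (?i s * ((k - c) / \<alpha> s)) *\<^sub>R (inverse (norm (?i s *\<^sub>R \<phi> s)) *\<^sub>R (?i s *\<^sub>R \<phi> s))" for s
    have [measurable]: "(\<lambda>s. ?i s *\<^sub>R \<phi> s) \<in> borel_measurable lebesgue" by (rule continuous_indicator_measurable[OF cphi])
    have [measurable]: "(\<lambda>s. ?i s * ((k - c) / \<alpha> s)) \<in> borel_measurable lebesgue"
      by (rule over_alpha_measurable) (rule continuous_on_const)
    have vm: "v \<in> borel_measurable lebesgue" unfolding v_def[abs_def] by measurable
    have vs: "v s = ((k - c) / \<alpha> s) *\<^sub>R (inverse (norm (\<phi> s)) *\<^sub>R \<phi> s)" if "s \<in> {0..l}" for s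
      using that by (simp add: v_def)
    have nv: "norm (v s) \<le> (k - c) / \<alpha> s" if s: "s \<in> {0..l}" for s
    proof -
      have n1: "norm (inverse (norm (\<phi> s)) *\<^sub>R \<phi> s) \<le> 1" by (cases "\<phi> s = 0") auto
      have "0 \<le> (k - c) / \<alpha> s" using c alpha_pos[OF s] by simp
      then have "norm (v s) = (k - c) / \<alpha> s * norm (inverse (norm (\<phi> s)) *\<^sub>R \<phi> s)"
        unfolding vs[OF s] norm_scaleR[of "(k - c) / \<alpha> s"] by (simp only: abs_of_nonneg)
      also have "\<dots> \<le> (k - c) / \<alpha> s * 1" using n1 \<open>0 \<le> (k - c) / \<alpha> s\<close> by (rule mult_left_mono)
      finally show ?thesis by simp
    qed
    have "\<exists>I\<ge>0. ((\<lambda>s. (v s - h' s) \<bullet> (V s *v T s) + 0 \<bullet> (V s *v 0)) has_integral I) {0..l}"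
    proof (rule ineq[OF c vm, of "(k - c) / A"])
      fix s assume s: "s \<in> {0..l}"
      have "(k - c) / \<alpha> s \<le> (k - c) / A" using AB(1) AB(3)[OF s] c by (intro frac_le) auto
      then show "norm (v s) \<le> (k - c) / A" using nv[OF s] by linarith
      show "T s \<bullet> v s = 0" unfolding vs[OF s] by (simp add: phiT)
      show "\<alpha> s * norm (v s) \<le> k - c" using nv[OF s] alpha_pos[OF s] by (simp add: field_simps)
    qed auto
    then obtain I where I: "I \<ge> 0" "((\<lambda>s. (v s - h' s) \<bullet> (V s *v T s)) has_integral I) {0..l}" by auto
    have "((\<lambda>s. h' s \<bullet> \<phi> s - (k - c) * (norm (\<phi> s) / \<alpha> s)) has_integral I) {0..l}"
    proof (rule has_integral_eq[OF _ I(2)])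
      fix s assume s: "s \<in> {0..l}"
      have "v s \<bullet> \<phi> s = (k - c) * (norm (\<phi> s) / \<alpha> s)"
      proof (cases "\<phi> s = 0")
        case False
        have "v s \<bullet> \<phi> s = (k - c) / \<alpha> s * (inverse (norm (\<phi> s)) * (norm (\<phi> s))\<^sup>2)"
          unfolding vs[OF s] by (simp add: power2_norm_eq_inner)
        then show ?thesis using False by (simp add: power2_eq_square)
      qed simp
      then show "(v s - h' s) \<bullet> (V s *v T s) = h' s \<bullet> \<phi> s - (k - c) * (norm (\<phi> s) / \<alpha> s)"
        by (simp add: \<phi>_def inner_diff_left)
    qed
    then show ?thesis using I(1) by blast
  qed
  obtain I0 where I0: "I0 \<ge> 0" "((\<lambda>s. h' s \<bullet> \<phi> s - (k - k) * (norm (\<phi> s) / \<alpha> s)) has_integral I0) {0..l}"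
    using step[of k] k by auto
  then have I0': "((\<lambda>s. h' s \<bullet> \<phi> s) has_integral I0) {0..l}" by simp
  have le: "k * Q - I0 \<le> c * Q" if c: "0 < c" "c \<le> k" for c
  proof -
    obtain I where I: "I \<ge> 0" "((\<lambda>s. h' s \<bullet> \<phi> s - (k - c) * (norm (\<phi> s) / \<alpha> s)) has_integral I) {0..l}"
      using step[OF c] by blast
    have "((\<lambda>s. h' s \<bullet> \<phi> s - (k - c) * (norm (\<phi> s) / \<alpha> s)) has_integral I0 - (k - c) * Q) {0..l}"
      by (intro has_integral_diff has_integral_mult_right I0' Q)
    then have "I = I0 - (k - c) * Q" using I(2) has_integral_unique by blast
    then show ?thesis using I(1) by (simp add: algebra_simps)
  qed
  have Q0: "0 \<le> Q"
    using Q by (rule has_integral_nonneg) (use alpha_pos in \<open>simp add: less_imp_le\<close>)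
  have kQ: "k * Q - I0 \<le> 0"
  proof (rule ccontr)
    assume "\<not> ?thesis"
    then have pos: "k * Q - I0 > 0" by simp
    \<comment> \<open>The choice makes c Q at most half of the supposedly positive gap; Q + 1 avoids
      a division by 0.\<close>
    define c where "c = min k ((k * Q - I0) / (2 * (Q + 1)))"
    have c: "0 < c" "c \<le> k" using pos k Q0 by (auto simp: c_def)
    have "c * Q \<le> (k * Q - I0) / (2 * (Q + 1)) * Q" using Q0 by (intro mult_right_mono) (auto simp: c_def)
    also have "\<dots> = (k * Q - I0) / 2 * (Q / (Q + 1))" by simp
    also have "\<dots> \<le> (k * Q - I0) / 2 * 1" using pos Q0 by (intro mult_left_mono) auto
    finally show False using le[OF c] pos by simp
  qed
  have gap: "((\<lambda>s. k * (norm (\<phi> s) / \<alpha> s) - h' s \<bullet> \<phi> s) has_integral k * Q - I0) {0..l}"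
    by (intro has_integral_diff has_integral_mult_right I0' Q)
  have gap_nonneg: "AE s\<in>{0..l} in lebesgue. 0 \<le> k * (norm (\<phi> s) / \<alpha> s) - h' s \<bullet> \<phi> s"
    using h_bound h'(5)
  proof eventually_elim
    case (elim s)
    show ?case
    proof
      assume s: "s \<in> {0..l}"
      have "norm (h s) \<le> k / \<alpha> s" using elim(1) s alpha_pos[OF s] by (simp add: field_simps)
      then have "norm (h s) * norm (\<phi> s) \<le> k / \<alpha> s * norm (\<phi> s)" by (intro mult_right_mono) auto
      then show "0 \<le> k * (norm (\<phi> s) / \<alpha> s) - h' s \<bullet> \<phi> s"
        using norm_cauchy_schwarz[of "h s" "\<phi> s"] elim(2) s by simp
    qed
  qed
  have gap_max: "((\<lambda>s. max 0 (k * (norm (\<phi> s) / \<alpha> s) - h' s \<bullet> \<phi> s)) has_integral k * Q - I0) {0..l}"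
    by (rule has_integral_cong_AE[OF gap]) (use gap_nonneg in \<open>auto elim!: eventually_mono\<close>)
  have "0 \<le> k * Q - I0" using gap_max by (rule has_integral_nonneg) simp
  then have "k * Q - I0 = 0" using kQ by simp
  then have "AE s\<in>{0..l} in lebesgue. max 0 (k * (norm (\<phi> s) / \<alpha> s) - h' s \<bullet> \<phi> s) = 0"
    using gap_max by (intro has_integral_zero_nonneg_AE) auto
  then have h_dir: "AE s\<in>{0..l} in lebesgue. \<phi> s \<noteq> 0 \<longrightarrow> h s = (k / (\<alpha> s * norm (\<phi> s))) *\<^sub>R \<phi> s"
    using gap_nonneg h'(5) h_bound
  proof eventually_elim
    case (elim s)
    show ?case
    proof (intro impI)
      assume s: "s \<in> {0..l}" and nz: "\<phi> s \<noteq> 0"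
      have a: "\<alpha> s > 0" by (rule alpha_pos[OF s])
      have n: "norm (\<phi> s) > 0" using nz by simp
      have hp: "h s \<bullet> \<phi> s = k * (norm (\<phi> s) / \<alpha> s)" using elim(1,2,3) s by (simp add: max_def split: if_splits)
      have hk: "norm (h s) \<le> k / \<alpha> s" using elim(4) s a by (simp add: field_simps)
      \<comment> \<open>\<open>b *\<^sub>R \<phi> s\<close> is the extremal vector in
        Cauchy-Schwarz; expanding the square of its distance from \<open>h s\<close> gives at most
        0.\<close>
      define b where "b = k / (\<alpha> s * norm (\<phi> s))"
      have "(norm (h s - b *\<^sub>R \<phi> s))\<^sup>2 = (norm (h s))\<^sup>2 - 2 * b * (h s \<bullet> \<phi> s) + b\<^sup>2 * (norm (\<phi> s))\<^sup>2"
        unfolding power2_norm_eq_inner by (simp add: inner_diff_left inner_diff_right inner_commute power2_eq_square algebra_simps)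
      also have "b\<^sup>2 * (norm (\<phi> s))\<^sup>2 = (k / \<alpha> s)\<^sup>2" using n a by (simp add: b_def field_simps power2_eq_square)
      also have "2 * b * (h s \<bullet> \<phi> s) = 2 * (k / \<alpha> s)\<^sup>2" using n a by (simp add: b_def hp field_simps power2_eq_square)
      also have "(norm (h s))\<^sup>2 - 2 * (k / \<alpha> s)\<^sup>2 + (k / \<alpha> s)\<^sup>2 \<le> 0"
        using power_mono[OF hk norm_ge_zero, of 2] by simp
      finally have "norm (h s - b *\<^sub>R \<phi> s) = 0" by simp
      then show "h s = (k / (\<alpha> s * norm (\<phi> s))) *\<^sub>R \<phi> s" by (simp add: b_def)
    qed
  qed
  \<comment> \<open>The minus sign makes \<open>\<phi>\<close> point along the curvature vector and
    not against it.\<close>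
  define W0 where "W0 = - (wedge q T2 + wedge \<mu> (\<gamma> l))"
  have WV: "wedge \<mu> (\<gamma> s) + W0 = - V s" for s by (simp add: V_def W0_def wedge_diff_right)
  have Wphi: "(wedge \<mu> (\<gamma> s) + W0) *v T s = \<phi> s" for s unfolding WV by (simp add: minus_matrix_vec \<phi>_def)
  have wphi: "- V s = wedge (\<phi> s) (T s)" if "s \<in> {0..l}" for s
    unfolding \<phi>_def wedge_minus_left using Vwedge[OF that] by simp
  \<comment> \<open>If \<open>\<phi>\<close> were identically 0, so would \<open>V\<close> be. At l
    this gives q \<and> T2 = 0, hence q = 0 by orthogonality; then \<open>\<mu>\<close> \<and> T = 0
    with \<open>\<mu> \<noteq> 0\<close>, so T is constant, against \<open>k > 0\<close>.\<close>
  have "\<exists>s\<in>{0..l}. \<phi> s \<noteq> 0"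
  proof (rule ccontr)
    assume "\<not> ?thesis"
    then have V0: "V s = 0" if "s \<in> {0..l}" for s
      using wphi[OF that] that by (simp add: wedge_def vec_eq_iff)
    have "wedge q T2 = 0" using V0[of l] l_nonneg by (simp add: V_def wedge_def vec_eq_iff)
    then have "wedge q T2 *v T2 = 0" by simp
    moreover have "T2 \<bullet> T2 = 1" using T_T[of l] T_ends l_nonneg by simp
    ultimately have q0: "q = 0" using qm(2) by (simp add: wedge_mult_vec)
    then have "\<mu> \<noteq> 0" using qm(1) by simp
    have "WD 0 l (\<lambda>s. wedge \<mu> (\<gamma> s)) (\<lambda>s. wedge \<mu> (T s))"
      by (rule WD_linear[OF WD_gamma bounded_bilinear.bounded_linear_right[OF bounded_bilinear_wedge]])
    then have "AE s\<in>{0..l} in lebesgue. wedge \<mu> (T s) = 0"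
    proof (rule WD_zero_AE[OF _ l_nonneg])
      fix s assume "s \<in> {0..l}"
      then have "V s = 0" by (rule V0)
      then have "wedge \<mu> (\<gamma> l) - wedge \<mu> (\<gamma> s) = 0" unfolding V_def wedge_diff_right using \<open>wedge q T2 = 0\<close> by simp
      then show "wedge \<mu> (\<gamma> s) = wedge \<mu> (\<gamma> l)" by simp
    qed
    moreover have "continuous_on {0..l} (\<lambda>s. wedge \<mu> (T s))"
      by (intro bounded_bilinear.continuous_on[OF bounded_bilinear_wedge] continuous_on_const continuous_T)
    ultimately have w0: "wedge \<mu> (T s) = 0" if "s \<in> {0..l}" for s
      using continuous_AE_zero[OF _ l_pos] that by blast
    have "T s \<in> span {\<mu>}" if s: "s \<in> {0..l}" for s
    proof -
      have "wedge \<mu> (T s) *v T s = 0" using w0[OF s] by simp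
      then have e: "\<mu> = (\<mu> \<bullet> T s) *\<^sub>R T s" using T_T[OF s] by (simp add: wedge_mult_vec)
      then have "\<mu> \<bullet> T s \<noteq> 0" using \<open>\<mu> \<noteq> 0\<close> by auto
      then have "T s = inverse (\<mu> \<bullet> T s) *\<^sub>R \<mu>"
        by (subst (2) e) simp
      then show ?thesis by (metis span_base span_scale singletonI)
    qed
    then obtain w where "\<forall>s\<in>{0..l}. T s = w" using parallel_T_imp_const by blast
    then have "k = 0" using const_T_imp_zero_curvature by blast
    then show False using k by simp
  qed
  moreover have "skew W0" unfolding W0_def by (intro skew_minus skew_add skew_wedge)
  ultimately show ?thesis
    using that[of W0 \<mu>] wphi h_dir unfolding Wphi unfolding WV by blast
qed

end

section \<open>Necessity: structure of the multiplier\<close>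

lemma WD_increment_bound:
  fixes f :: "real \<Rightarrow> 'a::euclidean_space"
  assumes f: "WD a b f h" and ab: "a \<le> b" and C: "0 \<le> C"
    and h: "AE x\<in>{a..b} in lebesgue. norm (h x) \<le> C"
  shows "norm (f b - f a) \<le> C * (b - a)"
proof -
  define h' where "h' x = (if norm (h x) \<le> C then h x else 0)" for x
  have "(h' has_integral f b - f a) {a..b}"
    by (rule has_integral_cong_AE[OF WD_int[OF f order_refl ab order_refl]])
       (use h in \<open>auto simp: h'_def elim!: eventually_mono\<close>)
  then have "norm (f b - f a) \<le> C * measure lborel {a..b}"
    by (rule has_integral_bound_real[OF C finite.emptyI]) (use C in \<open>auto simp: h'_def\<close>)
  then show ?thesis using ab by simp
qed

text \<open>The permitted loss is variation times length. Over n equal pieces the variations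
  telescope while each length is (t - s) / n, so the total loss is at most a constant over
  n.\<close>

lemma mono_of_small_decrease:
  fixes f V :: "real \<Rightarrow> real"
  assumes f: "\<And>s t. a \<le> s \<Longrightarrow> s \<le> t \<Longrightarrow> t \<le> b \<Longrightarrow> f s - C * (V t - V s) * (t - s) \<le> f t"
    and st: "a \<le> s" "s \<le> t" "t \<le> b"
  shows "f s \<le> f t"
proof (rule ccontr)
  assume "\<not> f s \<le> f t"
  then have pos: "0 < f s - f t" by simp
  define D where "D = C * (V t - V s) * (t - s)"
  obtain N :: nat where N: "D / (f s - f t) < real N" using reals_Archimedean2 by blast
  define n where "n = Suc N"
  define d where "d = (t - s) / real n"
  have d: "0 \<le> d" "real n * d = t - s" using st by (auto simp: d_def n_def)
  have step: "f s - C * (V (s + real i * d) - V s) * d \<le> f (s + real i * d)" if "i \<le> n" for i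
    using that
  proof (induction i)
    case 0 then show ?case by simp
  next
    case (Suc i)
    have "real (Suc i) * d \<le> real n * d" using Suc.prems d by (intro mult_right_mono) auto
    then have le: "s + real (Suc i) * d \<le> b" using d st by simp
    have "f (s + real i * d) - C * (V (s + real (Suc i) * d) - V (s + real i * d)) * ((s + real (Suc i) * d) - (s + real i * d))
       \<le> f (s + real (Suc i) * d)"
    proof (rule f)
      have "0 \<le> real i * d" using d by simp
      then show "a \<le> s + real i * d" using st by linarith
      show "s + real i * d \<le> s + real (Suc i) * d" using d by (simp add: algebra_simps)
    qed (rule le)
    moreover have "(s + real (Suc i) * d) - (s + real i * d) = d" by (simp add: algebra_simps)
    moreover have "f s - C * (V (s + real i * d) - V s) * d \<le> f (s + real i * d)" using Suc by simp
    ultimately show ?case by (simp add: algebra_simps)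
  qed
  have "f s - C * (V t - V s) * d \<le> f t" using step[of n] d by simp
  then have "f s - f t \<le> D / real n" by (simp add: D_def d_def)
  moreover have "D / real n < f s - f t"
  proof -
    have "D < real N * (f s - f t)" using N pos by (simp add: field_simps)
    also have "\<dots> \<le> real n * (f s - f t)" using pos by (intro mult_right_mono) (auto simp: n_def)
    finally show ?thesis by (simp add: n_def field_simps)
  qed
  ultimately show False by simp
qed

text \<open>If \<open>\<alpha>\<close> were constant, \<open>\<beta> + k m / \<alpha>\<close> would be a first integral of \<open>\<alpha> \<beta>' = - k m'\<close>; for
  \<open>\<alpha>\<close> of bounded variation it changes at most by a factor depending on the variation of \<open>\<alpha>\<close>.\<close>

lemma bounded_variation_energy_positive:
  fixes \<alpha> V \<beta> m :: "real \<Rightarrow> real"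
  assumes V: "\<And>x y. a \<le> x \<Longrightarrow> x \<le> y \<Longrightarrow> y \<le> b \<Longrightarrow> \<bar>\<alpha> y - \<alpha> x\<bar> \<le> V y - V x"
    and A: "0 < A" "\<And>x. x \<in> {a..b} \<Longrightarrow> A \<le> \<alpha> x" and k: "0 \<le> k"
    and \<beta>: "WD a b \<beta> \<beta>'" and m: "WD a b m m'"
    and eq: "AE x\<in>{a..b} in lebesgue. \<alpha> x * \<beta>' x = - k * m' x"
    and nn: "\<And>x. x \<in> {a..b} \<Longrightarrow> 0 \<le> \<beta> x" "\<And>x. x \<in> {a..b} \<Longrightarrow> 0 \<le> m x"
    and st: "s \<in> {a..b}" "t \<in> {a..b}" and pos: "0 < \<beta> s + k * m s / \<alpha> s"
  shows "0 < \<beta> t + k * m t / \<alpha> t"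
proof -
  define E where "E x = \<beta> x + k * m x / \<alpha> x" for x
  have ab: "a \<le> b" using st by auto
  obtain Lm where Lm: "Lm \<ge> 0" "AE x\<in>{a..b} in lebesgue. norm (m' x) \<le> Lm"
    using WD_bounded_AE[OF m ab] by blast
  have Vm: "V x \<le> V y" if "a \<le> x" "x \<le> y" "y \<le> b" for x y using V[OF that] by linarith
  \<comment> \<open>\<open>C\<close> comes from k m' times the difference of two values of 1 /
    \<alpha>, with |m'| \<le> Lm and \<alpha> \<ge> A.\<close>
  define C where "C = k * Lm / A\<^sup>2"
  have C0: "0 \<le> C" using k Lm A by (simp add: C_def)
  have two: "E x * exp (- (V v - V u) / A) - C * (V v - V u) * (v - u) \<le> E y"
    if uv: "a \<le> u" "u \<le> v" "v \<le> b" and xy: "(x = u \<and> y = v) \<or> (x = v \<and> y = u)" for u v x y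
  proof -
    define \<Delta> where "\<Delta> = V v - V u"
    have D0: "0 \<le> \<Delta>" using Vm[OF uv] by (simp add: \<Delta>_def)
    have x: "x \<in> {a..b}" and y: "y \<in> {a..b}" using uv xy by auto
    have ax: "A \<le> \<alpha> x" "A \<le> \<alpha> y" using A(2) x y by auto
    have osc: "\<bar>\<alpha> y - \<alpha> z\<bar> \<le> \<Delta>" if z: "z \<in> {u..v}" for z
    proof -
      have "\<bar>\<alpha> z - \<alpha> u\<bar> \<le> V z - V u" "\<bar>\<alpha> v - \<alpha> z\<bar> \<le> V v - V z" "V u \<le> V z" "V z \<le> V v"
        using V[of u z] V[of z v] Vm[of u z] Vm[of z v] z uv by auto
      then show ?thesis using xy by (auto simp: \<Delta>_def)
    qed
    have "WD u v (\<lambda>z. \<beta> z + (k / \<alpha> y) *\<^sub>R m z) (\<lambda>z. \<beta>' z + (k / \<alpha> y) *\<^sub>R m' z)"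
      by (intro WD_add WD_scaleR_const WD_subset[OF \<beta>] WD_subset[OF m]) (use uv in auto)
    then have "norm ((\<beta> v + (k / \<alpha> y) *\<^sub>R m v) - (\<beta> u + (k / \<alpha> y) *\<^sub>R m u)) \<le> (C * \<Delta>) * (v - u)"
    proof (rule WD_increment_bound)
      show "AE z\<in>{u..v} in lebesgue. norm (\<beta>' z + (k / \<alpha> y) *\<^sub>R m' z) \<le> C * \<Delta>"
        using eq Lm(2)
      proof eventually_elim
        case (elim z)
        show ?case
        proof
          assume z: "z \<in> {u..v}"
          then have zab: "z \<in> {a..b}" using uv by auto
          have az: "A \<le> \<alpha> z" using A(2)[OF zab] .
          have p: "\<alpha> z > 0" "\<alpha> y > 0" using az ax A by auto
          have "\<beta>' z = - k * m' z / \<alpha> z" using elim(1) zab p by (simp add: field_simps)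
          then have "\<beta>' z + (k / \<alpha> y) *\<^sub>R m' z = k * m' z * (\<alpha> z - \<alpha> y) / (\<alpha> z * \<alpha> y)"
            using p by (simp add: field_simps)
          then have "norm (\<beta>' z + (k / \<alpha> y) *\<^sub>R m' z) = k * \<bar>m' z\<bar> * \<bar>\<alpha> y - \<alpha> z\<bar> / (\<alpha> z * \<alpha> y)"
            using p k by (simp add: abs_mult abs_minus_commute)
          also have "\<dots> \<le> k * Lm * \<Delta> / (A * A)"
          proof (rule frac_le)
            show "k * \<bar>m' z\<bar> * \<bar>\<alpha> y - \<alpha> z\<bar> \<le> k * Lm * \<Delta>"
              using elim(2) zab osc[OF z] k Lm(1) by (intro mult_mono mult_nonneg_nonneg) auto
            show "A * A \<le> \<alpha> z * \<alpha> y" using az ax A by (intro mult_mono) auto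
          qed (use k Lm D0 A in auto)
          also have "\<dots> = C * \<Delta>" by (simp add: C_def power2_eq_square)
          finally show "norm (\<beta>' z + (k / \<alpha> y) *\<^sub>R m' z) \<le> C * \<Delta>" .
        qed
      qed
    qed (use uv C0 D0 in auto)
    then have inc: "\<bar>(\<beta> y + (k / \<alpha> y) * m y) - (\<beta> x + (k / \<alpha> y) * m x)\<bar> \<le> C * \<Delta> * (v - u)"
      using xy by (auto simp: abs_minus_commute)
    have Ey: "E y = \<beta> y + (k / \<alpha> y) * m y" by (simp add: E_def)
    have fac: "exp (- \<Delta> / A) \<le> \<alpha> x / \<alpha> y"
    proof -
      have "\<alpha> y \<le> \<alpha> x + \<Delta>" using osc[of x] xy uv by auto
      also have "\<dots> \<le> \<alpha> x + \<alpha> x * (\<Delta> / A)"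
      proof -
        have "A * (\<Delta> / A) \<le> \<alpha> x * (\<Delta> / A)" using ax D0 A by (intro mult_right_mono) auto
        then show ?thesis using A by simp
      qed
      also have "\<dots> = \<alpha> x * (1 + \<Delta> / A)" by (simp add: algebra_simps)
      also have "\<dots> \<le> \<alpha> x * exp (\<Delta> / A)" using ax A exp_ge_add_one_self[of "\<Delta> / A"] by (intro mult_left_mono) auto
      finally have "\<alpha> y * exp (- (\<Delta> / A)) \<le> \<alpha> x * exp (\<Delta> / A) * exp (- (\<Delta> / A))" by (intro mult_right_mono) auto
      also have "\<dots> = \<alpha> x" by (simp add: mult.assoc flip: exp_add)
      finally show ?thesis using ax A by (simp add: field_simps)
    qed
    have e1: "exp (- \<Delta> / A) \<le> 1" using D0 A by simp
    have "E x * exp (- \<Delta> / A) = \<beta> x * exp (- \<Delta> / A) + (k * m x / \<alpha> x) * exp (- \<Delta> / A)"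
      by (simp add: E_def algebra_simps)
    also have "\<dots> \<le> \<beta> x * 1 + (k * m x / \<alpha> x) * (\<alpha> x / \<alpha> y)"
      using nn[OF x] k ax A e1 fac by (intro add_mono mult_left_mono) auto
    also have "\<dots> = \<beta> x + (k / \<alpha> y) * m x" using ax A by simp
    finally have "E x * exp (- \<Delta> / A) \<le> \<beta> x + (k / \<alpha> y) * m x" .
    moreover have "(\<beta> x + (k / \<alpha> y) * m x) - C * \<Delta> * (v - u) \<le> \<beta> y + (k / \<alpha> y) * m y"
      using abs_le_D2[OF inc] by (simp only: minus_diff_eq diff_le_eq add.commute)
    ultimately have "E x * exp (- \<Delta> / A) - C * \<Delta> * (v - u) \<le> E y" unfolding Ey
      by (meson diff_right_mono order_trans)
    then show ?thesis by (simp only: \<Delta>_def)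
  qed
  have Es: "0 < E s" using pos by (simp add: E_def)
  have "0 < E t"
  proof (cases "s \<le> t")
    case True
    \<comment> \<open>The exponential of V / A absorbs the multiplicative losses, leaving only the
      second-order ones; running backwards, the sign of V changes.\<close>
    define F where "F x = E x * exp (V x / A)" for x
    have "F s \<le> F t"
    proof (rule mono_of_small_decrease[of a b F "C * exp (V b / A)" V])
      fix u v assume uv: "a \<le> u" "u \<le> v" "v \<le> b"
      have "(E u * exp (- (V v - V u) / A) - C * (V v - V u) * (v - u)) * exp (V v / A) \<le> E v * exp (V v / A)"
        using two[OF uv, of u v] by (intro mult_right_mono) auto
      moreover have "E u * exp (- (V v - V u) / A) * exp (V v / A) = F u"
        using A by (simp add: F_def mult.assoc diff_divide_distrib flip: exp_add)
      moreover have "C * (V v - V u) * (v - u) * exp (V v / A) \<le> C * (V v - V u) * (v - u) * exp (V b / A)"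
        using C0 Vm[OF uv] Vm[of v b] uv A by (intro mult_left_mono) (auto simp: divide_right_mono)
      moreover have "C * exp (V b / A) * (V v - V u) * (v - u) = C * (V v - V u) * (v - u) * exp (V b / A)"
        by (simp only: mult_ac)
      ultimately show "F u - C * exp (V b / A) * (V v - V u) * (v - u) \<le> F v"
        unfolding left_diff_distrib F_def[of v] by linarith
    qed (use st True in auto)
    moreover have "0 < F s" using Es by (simp add: F_def)
    ultimately have "0 < F t" by linarith
    then show ?thesis by (simp add: F_def zero_less_mult_iff)
  next
    case False
    define F where "F x = - (E x * exp (- V x / A))" for x
    have "F t \<le> F s"
    proof (rule mono_of_small_decrease[of a b F "C * exp (- V a / A)" V])
      fix u v assume uv: "a \<le> u" "u \<le> v" "v \<le> b"
      have "(E v * exp (- (V v - V u) / A) - C * (V v - V u) * (v - u)) * exp (- V u / A) \<le> E u * exp (- V u / A)"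
        using two[OF uv, of v u] by (intro mult_right_mono) auto
      moreover have "E v * exp (- (V v - V u) / A) * exp (- V u / A) = - F v"
        using A by (simp add: F_def mult.assoc diff_divide_distrib flip: exp_add)
      moreover have "C * (V v - V u) * (v - u) * exp (- V u / A) \<le> C * (V v - V u) * (v - u) * exp (- V a / A)"
        using C0 Vm[OF uv] Vm[of a u] uv A by (intro mult_left_mono) (auto simp: divide_right_mono)
      moreover have "C * exp (- V a / A) * (V v - V u) * (v - u) = C * (V v - V u) * (v - u) * exp (- V a / A)"
        by (simp only: mult_ac)
      ultimately show "F u - C * exp (- V a / A) * (V v - V u) * (v - u) \<le> F v"
        unfolding left_diff_distrib F_def[of u] by linarith
    qed (use st False in auto)
    moreover have "F s < 0" using Es by (simp add: F_def)
    ultimately have "F t < 0" by simp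
    then show ?thesis by (simp add: F_def zero_less_mult_iff)
  qed
  then show ?thesis by (simp add: E_def)
qed

section \<open>Gaps of the zero set\<close>

lemma zeros_gap:
  fixes m :: "real \<Rightarrow> real"
  assumes m: "continuous_on {x..y} m" "m x = 0" "m y = 0" and s: "s \<in> {x..y}" "m s \<noteq> 0"
  obtains a b where "x \<le> a" "a < s" "s < b" "b \<le> y" "m a = 0" "m b = 0" "\<And>u. u \<in> {a<..<b} \<Longrightarrow> m u \<noteq> 0"
proof -
  define Za where "Za = {x..s} \<inter> m -` {0}"
  define Zb where "Zb = {s..y} \<inter> m -` {0}"
  have c: "continuous_on {x..s} m" "continuous_on {s..y} m" using m(1) s by (auto intro: continuous_on_subset)
  have cl: "closed Za" "closed Zb" unfolding Za_def Zb_def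
    using continuous_closed_preimage[OF c(1) closed_atLeastAtMost closed_singleton]
      continuous_closed_preimage[OF c(2) closed_atLeastAtMost closed_singleton] by (auto simp: vimage_def)
  have cp: "compact Za" "compact Zb"
    using cl by (auto simp: compact_eq_bounded_closed Za_def Zb_def intro: bounded_subset[OF bounded_closed_interval])
  have ne: "Za \<noteq> {}" "Zb \<noteq> {}" using m s by (auto simp: Za_def Zb_def)
  obtain a where a: "a \<in> Za" "\<And>z. z \<in> Za \<Longrightarrow> z \<le> a" using compact_attains_sup[OF cp(1) ne(1)] by blast
  obtain b where b: "b \<in> Zb" "\<And>z. z \<in> Zb \<Longrightarrow> b \<le> z" using compact_attains_inf[OF cp(2) ne(2)] by blast
  show ?thesis
  proof (rule that[of a b])
    show "x \<le> a" "m a = 0" "b \<le> y" "m b = 0" using a(1) b(1) by (auto simp: Za_def Zb_def)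
    have "a \<noteq> s" "b \<noteq> s" using a(1) b(1) s(2) by (auto simp: Za_def Zb_def)
    then show "a < s" "s < b" using a(1) b(1) by (auto simp: Za_def Zb_def)
    fix u assume u: "u \<in> {a<..<b}"
    show "m u \<noteq> 0"
    proof
      assume "m u = 0"
      then have "u \<in> Za \<or> u \<in> Zb" using u a(1) b(1) by (auto simp: Za_def Zb_def)
      then show False using a(2)[of u] b(2)[of u] u by auto
    qed
  qed
qed

text \<open>Each component meets some piece \<open>C i\<close>, contains it by connectedness, and is
  thus determined by the index; any point of the piece may represent it.\<close>

lemma finite_components_if_connected_cover:
  assumes fin: "finite I" and con: "\<And>i. i \<in> I \<Longrightarrow> connected (C i)" and sub: "\<And>i. i \<in> I \<Longrightarrow> C i \<subseteq> S"
    and cov: "S \<subseteq> (\<Union>i\<in>I. C i)"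
  shows "finite (components S)"
proof (rule finite_subset)
  show "components S \<subseteq> (\<lambda>i. connected_component_set S (SOME x. x \<in> C i)) ` I"
  proof
    fix K assume "K \<in> components S"
    then obtain x where x: "x \<in> S" "K = connected_component_set S x" by (auto simp: components_def)
    then obtain i where i: "i \<in> I" "x \<in> C i" using cov by blast
    define y where "y = (SOME x. x \<in> C i)"
    have "y \<in> C i" unfolding y_def using i(2) by (rule someI)
    then have "connected_component S x y"
      unfolding connected_component_def using con[OF i(1)] sub[OF i(1)] i(2) by blast
    then have "connected_component_set S x = connected_component_set S y"
      by (metis connected_component_eq mem_Collect_eq)
    then show "K \<in> (\<lambda>i. connected_component_set S (SOME x. x \<in> C i)) ` I" using x(2) i(1) y_def by blast
  qed
qed (use fin in simp)

text \<open>In a small ball Z is convex, so the complement has at most a part to its left and a part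
  to its right; compactness leaves finitely many balls.\<close>

lemma finite_components_locally_convex_complement:
  fixes Z :: "real set"
  assumes loc: "\<And>z. z \<in> {0..l} \<Longrightarrow> \<exists>\<delta>>0. \<forall>x\<in>Z \<inter> ball z \<delta>. \<forall>y\<in>Z \<inter> ball z \<delta>. \<forall>s. x \<le> s \<and> s \<le> y \<longrightarrow> s \<in> Z"
    and Z: "Z \<subseteq> {0..l}"
  shows "finite (components ({0..l} - Z))"
proof -
  obtain d where d: "\<And>z. z \<in> {0..l} \<Longrightarrow> d z > 0"
    "\<And>z x y s. z \<in> {0..l} \<Longrightarrow> x \<in> Z \<inter> ball z (d z) \<Longrightarrow> y \<in> Z \<inter> ball z (d z) \<Longrightarrow> x \<le> s \<Longrightarrow> s \<le> y \<Longrightarrow> s \<in> Z"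
    using loc by metis
  obtain F where F: "F \<subseteq> {0..l}" "finite F" "{0..l} \<subseteq> (\<Union>z\<in>F. ball z (d z))"
  proof -
    have "{0..l} \<subseteq> (\<Union>z\<in>{0..l}. ball z (d z))" using d(1) by force
    then show ?thesis using compactE_image[OF compact_Icc, of "{0..l}" "\<lambda>z. ball z (d z)"] that by (metis open_ball)
  qed
  \<comment> \<open>If the ball does not meet Z at all, the whole trace of the interval belongs to
    the left part, since the condition is vacuous.\<close>
  define L where "L z = {s \<in> {0..l} - Z. s \<in> ball z (d z) \<and> (\<forall>x\<in>Z \<inter> ball z (d z). s < x)}" for z
  define R where "R z = {s \<in> {0..l} - Z. s \<in> ball z (d z) \<and> (\<exists>x\<in>Z \<inter> ball z (d z). x < s)}" for z
  have ballc: "t \<in> ball z e" if "s1 \<in> ball z e" "s2 \<in> ball z e" "s1 \<le> t" "t \<le> s2" for s1 s2 t z e :: real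
    using that by (auto simp: dist_real_def)
  have Lc: "is_interval (L z)" for z
    unfolding is_interval_1
  proof (intro ballI allI impI)
    fix s1 s2 t assume s: "s1 \<in> L z" "s2 \<in> L z" and t0: "s1 \<le> t \<and> t \<le> s2"
    have t: "s1 \<le> t" "t \<le> s2" using t0 by auto
    have tb: "t \<in> ball z (d z)" using ballc[of s1 z _ s2 t] s t by (auto simp: L_def)
    have "\<forall>x\<in>Z \<inter> ball z (d z). s2 < x" using s(2) unfolding L_def by blast
    then have lt: "\<forall>x\<in>Z \<inter> ball z (d z). t < x" using t(2) le_less_trans by blast
    then have "t \<notin> Z" using tb by blast
    moreover have "t \<in> {0..l}" using s t by (auto simp: L_def)
    ultimately show "t \<in> L z" using tb lt by (simp add: L_def)
  qed
  have Rc: "is_interval (R z)" if z: "z \<in> {0..l}" for z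
    unfolding is_interval_1
  proof (intro ballI allI impI)
    fix s1 s2 t assume s: "s1 \<in> R z" "s2 \<in> R z" and t0: "s1 \<le> t \<and> t \<le> s2"
    have t: "s1 \<le> t" "t \<le> s2" using t0 by auto
    have tb: "t \<in> ball z (d z)" using ballc[of s1 z _ s2 t] s t by (auto simp: R_def)
    obtain x where x: "x \<in> Z \<inter> ball z (d z)" "x < s1" using s by (auto simp: R_def)
    have "t \<notin> Z"
    proof
      assume "t \<in> Z"
      then have "s1 \<in> Z" using d(2)[OF z x(1), of t s1] tb x t by auto
      then show False using s by (simp add: R_def)
    qed
    moreover have "t \<in> {0..l}" using s t by (auto simp: R_def)
    moreover have "x < t" using x(2) t(1) by simp
    ultimately show "t \<in> R z" using tb x(1) unfolding R_def by blast
  qed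
  define C where "C i = (if snd i then L (fst i) else R (fst i))" for i :: "real \<times> bool"
  show ?thesis
  proof (rule finite_components_if_connected_cover[of "F \<times> UNIV" C])
    show "finite (F \<times> (UNIV :: bool set))" using F(2) by simp
    fix i assume "i \<in> F \<times> (UNIV :: bool set)"
    then have "fst i \<in> {0..l}" using F(1) by auto
    then show "connected (C i)" unfolding C_def using Lc Rc is_interval_connected by auto
    show "C i \<subseteq> {0..l} - Z" by (auto simp: C_def L_def R_def)
  next
    show "{0..l} - Z \<subseteq> (\<Union>i\<in>F \<times> UNIV. C i)"
    proof
      fix s assume s: "s \<in> {0..l} - Z"
      then obtain z where z: "z \<in> F" "s \<in> ball z (d z)" using F(3) by blast
      have "s \<in> L z \<or> s \<in> R z"
      proof (cases "\<forall>x\<in>Z \<inter> ball z (d z). s < x")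
        case True then show ?thesis using s z by (simp add: L_def)
      next
        case False
        then obtain x where "x \<in> Z \<inter> ball z (d z)" "x \<le> s" by (meson not_le)
        moreover have "x \<noteq> s" using s calculation by auto
        ultimately have "x < s" by simp
        then have "s \<in> R z" using s z(2) \<open>x \<in> Z \<inter> ball z (d z)\<close> unfolding R_def by blast
        then show ?thesis ..
      qed
      then have "s \<in> C (z, True) \<or> s \<in> C (z, False)" by (auto simp: C_def)
      then show "s \<in> (\<Union>i\<in>F \<times> UNIV. C i)" using z(1) by blast
    qed
  qed
qed

section \<open>Consequences of the costate equation\<close>

locale multiplier = curve l \<alpha> a1 a2 T1 T2 \<gamma>
  for l \<alpha> and a1 a2 T1 T2 :: "real ^ 'n" and \<gamma> +
  fixes lam :: "real ^ 'n" and W0 :: "real ^ 'n ^ 'n"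
  assumes k_pos: "k > 0" and skew_W0: "skew W0"
    and W_wedge: "\<And>s. s \<in> {0..l} \<Longrightarrow> wedge lam (\<gamma> s) + W0 = wedge ((wedge lam (\<gamma> s) + W0) *v T s) (T s)"
    and h_along: "AE s\<in>{0..l} in lebesgue. (wedge lam (\<gamma> s) + W0) *v T s \<noteq> 0 \<longrightarrow>
       h s = (k / (\<alpha> s * norm ((wedge lam (\<gamma> s) + W0) *v T s))) *\<^sub>R ((wedge lam (\<gamma> s) + W0) *v T s)"
    and nontrivial: "\<exists>s\<in>{0..l}. (wedge lam (\<gamma> s) + W0) *v T s \<noteq> 0"
begin

definition W :: "real \<Rightarrow> real ^ 'n ^ 'n" where "W s = wedge lam (\<gamma> s) + W0"

definition \<phi> :: "real \<Rightarrow> real ^ 'n" where "\<phi> s = W s *v T s"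

definition \<psi> :: "real \<Rightarrow> real ^ 'n" where "\<psi> s = lam - (lam \<bullet> T s + \<phi> s \<bullet> h s) *\<^sub>R T s"

lemma W_eq: "s \<in> {0..l} \<Longrightarrow> W s = wedge (\<phi> s) (T s)"
  using W_wedge by (simp add: W_def \<phi>_def)

lemma W_vec: "s \<in> {0..l} \<Longrightarrow> W s *v x = (T s \<bullet> x) *\<^sub>R \<phi> s - (\<phi> s \<bullet> x) *\<^sub>R T s"
  using W_eq by (simp add: wedge_mult_vec)

lemma W_shift: "W s = W t + wedge lam (\<gamma> s - \<gamma> t)"
  by (simp add: W_def wedge_diff_right)

lemma phi_T: "\<phi> s \<bullet> T s = 0"
  unfolding \<phi>_def W_def by (intro skew_self skew_add skew_wedge skew_W0)

lemma T_phi: "T s \<bullet> \<phi> s = 0" using phi_T by (simp add: inner_commute)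

lemma h_phi: "AE s\<in>{0..l} in lebesgue. \<phi> s \<noteq> 0 \<longrightarrow> h s = (k / (\<alpha> s * norm (\<phi> s))) *\<^sub>R \<phi> s"
  using h_along by (simp add: \<phi>_def W_def)

text \<open>In the product rule for W T, the derivative of W is lam \<and> T, which applied to T
  gives the normal part of \<open>lam\<close>; and W = \<open>\<phi>\<close> \<and> T applied to the
  normal vector h is a multiple of T.\<close>

lemma WD_phi: "WD 0 l \<phi> \<psi>"
proof -
  have "WD 0 l (\<lambda>s. wedge lam (\<gamma> s) + W0) (\<lambda>s. wedge lam (T s) + 0)"
    by (intro WD_add WD_const WD_linear[OF WD_gamma bounded_bilinear.bounded_linear_right[OF bounded_bilinear_wedge]])
  from WD_bilinear[OF bounded_bilinear_mult_vec this WD_T l_nonneg]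
  have 1: "WD 0 l \<phi> (\<lambda>s. wedge lam (T s) *v T s + W s *v h s)"
    by (simp add: \<phi>_def[abs_def] W_def)
  show ?thesis
  proof (rule WD_cong_AE[OF 1])
    show "AE s\<in>{0..l} in lebesgue. wedge lam (T s) *v T s + W s *v h s = \<psi> s"
      using T_h
    proof eventually_elim
      case (elim s)
      show ?case
      proof
        assume s: "s \<in> {0..l}"
        then have "W s *v h s = - (\<phi> s \<bullet> h s) *\<^sub>R T s" using W_vec[OF s, of "h s"] elim by simp
        then show "wedge lam (T s) *v T s + W s *v h s = \<psi> s"
          using T_T[OF s] by (simp add: \<psi>_def wedge_mult_vec scaleR_add_left)
      qed
    qed
  qed
qed

lemma continuous_phi: "continuous_on {0..l} \<phi>" by (rule WD_continuous[OF WD_phi])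

lemma phi_psi: "\<phi> s \<bullet> \<psi> s = lam \<bullet> \<phi> s"
  using phi_T[of s] by (simp add: \<psi>_def inner_diff_right inner_commute)

lemma WD_norm_phi:
  assumes "0 \<le> u" "u \<le> v" "v \<le> l" "\<And>s. s \<in> {u..v} \<Longrightarrow> \<phi> s \<noteq> 0"
  shows "WD u v (\<lambda>s. norm (\<phi> s)) (\<lambda>s. (lam \<bullet> \<phi> s) / norm (\<phi> s))"
  using WD_norm[OF WD_subset[OF WD_phi assms(1,3)] assms(2,4)] by (simp add: phi_psi)

text \<open>For such x, evaluating \<open>W r *v x\<close> in two ways gives
  \<open>|\<phi>|\<^sup>2 f' = f (lam \<bullet> \<phi>)\<close>, while the norm of
  \<open>\<phi>\<close> has derivative \<open>lam \<bullet> \<phi> / |\<phi>|\<close>. Hence the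
  quotient of f by the norm of \<open>\<phi>\<close> is constant, and it is 0 at t.\<close>

lemma arc_normal_components_constant:
  assumes uv: "0 \<le> u" "u \<le> v" "v \<le> l" and nz: "\<And>s. s \<in> {u..v} \<Longrightarrow> \<phi> s \<noteq> 0"
    and t: "t \<in> {u..v}" and x: "lam \<bullet> x = 0" "W t *v x = 0" and s: "s \<in> {u..v}"
  shows "\<gamma> s \<bullet> x = \<gamma> t \<bullet> x"
proof -
  define f where "f s = (\<gamma> s - \<gamma> t) \<bullet> x" for s
  have key: "(norm (\<phi> r))\<^sup>2 * (T r \<bullet> x) = f r * (lam \<bullet> \<phi> r)" if r: "r \<in> {u..v}" for r
  proof -
    have rl: "r \<in> {0..l}" using r uv by auto
    have "W r *v x = f r *\<^sub>R lam"
      unfolding W_shift[of r t] matrix_vector_mult_add_rdistrib using x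
      by (simp add: wedge_mult_vec f_def)
    then have "(W r *v x) \<bullet> \<phi> r = f r * (lam \<bullet> \<phi> r)" by simp
    moreover have "(W r *v x) \<bullet> \<phi> r = (norm (\<phi> r))\<^sup>2 * (T r \<bullet> x)"
      unfolding W_vec[OF rl] by (simp add: inner_diff_left T_phi power2_norm_eq_inner mult.commute)
    ultimately show ?thesis by simp
  qed
  have WDf: "WD u v f (\<lambda>s. T s \<bullet> x)"
  proof -
    have "WD 0 l f (\<lambda>s. (T s - 0) \<bullet> x)"
      unfolding f_def[abs_def] by (intro WD_inner_left WD_diff WD_gamma WD_const)
    then show ?thesis using WD_subset[of 0 l f _ u v] uv by simp
  qed
  have WDi: "WD u v (\<lambda>s. inverse (norm (\<phi> s))) (\<lambda>s. - (lam \<bullet> \<phi> s) / norm (\<phi> s) ^ 3)"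
    using WD_inverse_norm[OF WD_subset[OF WD_phi uv(1,3)] uv(2) nz] by (simp add: phi_psi)
  have WDq: "WD u v (\<lambda>s. f s * inverse (norm (\<phi> s)))
     (\<lambda>s. (T s \<bullet> x) * inverse (norm (\<phi> s)) + f s * (- (lam \<bullet> \<phi> s) / norm (\<phi> s) ^ 3))"
    by (rule WD_mult[OF WDf WDi uv(2)])
  have zero: "(T r \<bullet> x) * inverse (norm (\<phi> r)) + f r * (- (lam \<bullet> \<phi> r) / norm (\<phi> r) ^ 3) = 0"
    if r: "r \<in> {u..v}" for r
  proof -
    have n: "norm (\<phi> r) > 0" using nz[OF r] by simp
    have "(T r \<bullet> x) * inverse (norm (\<phi> r)) + f r * (- (lam \<bullet> \<phi> r) / norm (\<phi> r) ^ 3)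
      = ((norm (\<phi> r))\<^sup>2 * (T r \<bullet> x) - f r * (lam \<bullet> \<phi> r)) / norm (\<phi> r) ^ 3"
      using n by (simp add: field_simps power2_eq_square power3_eq_cube)
    then show ?thesis by (simp add: key[OF r])
  qed
  have const: "f p * inverse (norm (\<phi> p)) = f q * inverse (norm (\<phi> q))" if "u \<le> p" "p \<le> q" "q \<le> v" for p q
    by (rule WD_const_if_zero[OF WD_subset[OF WDq that(1,3)] _ that(2)]) (use zero that in auto)
  have "f s * inverse (norm (\<phi> s)) = f t * inverse (norm (\<phi> t))"
  proof (cases "s \<le> t")
    case True then show ?thesis by (intro const) (use s t in auto)
  next
    case False then show ?thesis by (intro const[symmetric]) (use s t in auto)
  qed
  moreover have "f t = 0" by (simp add: f_def)
  ultimately have "f s = 0" using nz[OF s] by simp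
  then show ?thesis by (simp add: f_def inner_diff_left)
qed

lemma WD_direction:
  assumes "0 \<le> u" "u \<le> v" "v \<le> l" "\<And>s. s \<in> {u..v} \<Longrightarrow> \<phi> s \<noteq> 0"
  shows "WD u v (\<lambda>s. \<phi> s /\<^sub>R norm (\<phi> s))
    (\<lambda>s. (- (lam \<bullet> \<phi> s) / norm (\<phi> s) ^ 3) *\<^sub>R \<phi> s + \<psi> s /\<^sub>R norm (\<phi> s))"
  using WD_normalize[OF WD_subset[OF WD_phi assms(1,3)] assms(2,4)] by (simp add: phi_psi)

lemma phi_h: "AE s\<in>{0..l} in lebesgue. \<phi> s \<bullet> h s = k * norm (\<phi> s) / \<alpha> s"
  using h_phi
proof eventually_elim
  case (elim s)
  show ?case
  proof
    assume s: "s \<in> {0..l}"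
    show "\<phi> s \<bullet> h s = k * norm (\<phi> s) / \<alpha> s"
    proof (cases "\<phi> s = 0")
      case False
      then have "h s = (k / (\<alpha> s * norm (\<phi> s))) *\<^sub>R \<phi> s" using elim s by blast
      then have "\<phi> s \<bullet> h s = k / (\<alpha> s * norm (\<phi> s)) * (norm (\<phi> s))\<^sup>2" by (simp add: power2_norm_eq_inner)
      then show ?thesis using False by (simp add: power2_eq_square)
    qed simp
  qed
qed

text \<open>A vector orthogonal to \<open>lam\<close>, \<open>\<phi> 0\<close> and
  \<open>T 0\<close> is annihilated by W 0, so the curve has a constant component along it.\<close>

lemma three_dimensional:
  assumes nz: "\<And>s. s \<in> {0..l} \<Longrightarrow> \<phi> s \<noteq> 0"
  shows "\<exists>A::(real ^ 'n) set. affine A \<and> aff_dim A \<le> 3 \<and> \<gamma> ` {0..l} \<subseteq> A"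
proof -
  define D where "D = span {lam, \<phi> 0, T 0}"
  have D: "subspace D" by (simp add: D_def)
  have "dim D \<le> card {lam, \<phi> 0, T 0}" unfolding D_def dim_span by (rule dim_le_card) (auto intro: span_base)
  also have "\<dots> \<le> 3" by (simp add: card_insert_le_m1)
  finally have dD: "dim D \<le> 3" .
  have mem: "\<gamma> s - \<gamma> 0 \<in> D" if s: "s \<in> {0..l}" for s
  proof -
    have "\<gamma> s - \<gamma> 0 \<in> orthogonal_comp (orthogonal_comp D)"
      unfolding orthogonal_comp_def[of "orthogonal_comp D"]
    proof clarify
      fix x assume "x \<in> orthogonal_comp D"
      then have xD: "\<And>y. y \<in> D \<Longrightarrow> y \<bullet> x = 0" by (auto simp: orthogonal_comp_def orthogonal_def)
      have x: "lam \<bullet> x = 0" "\<phi> 0 \<bullet> x = 0" "T 0 \<bullet> x = 0" by (auto intro!: xD span_base simp: D_def)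
      then have "W 0 *v x = 0" using W_vec[of 0 x] l_nonneg by simp
      then have "\<gamma> s \<bullet> x = \<gamma> 0 \<bullet> x"
        using arc_normal_components_constant[of 0 l 0 x s] nz x(1) s l_nonneg by simp
      then show "orthogonal x (\<gamma> s - \<gamma> 0)" by (simp add: orthogonal_def inner_diff_right inner_commute)
    qed
    then show ?thesis using orthogonal_comp_self[OF D] by simp
  qed
  show ?thesis
  proof (intro exI conjI)
    show "affine ((+) (\<gamma> 0) ` D)" using subspace_imp_affine[OF D] affine_translation by blast
    show "aff_dim ((+) (\<gamma> 0) ` D) \<le> 3" using aff_dim_translation_eq[of "\<gamma> 0" D] aff_dim_subspace[OF D] dD by simp
    show "\<gamma> ` {0..l} \<subseteq> (+) (\<gamma> 0) ` D"
    proof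
      fix y assume "y \<in> \<gamma> ` {0..l}"
      then obtain s where s: "s \<in> {0..l}" "y = \<gamma> s" by blast
      then show "y \<in> (+) (\<gamma> 0) ` D" using mem[OF s(1)] by (intro image_eqI[of _ _ "\<gamma> s - \<gamma> 0"]) auto
    qed
  qed
qed

text \<open>With \<open>\<nu>\<close> the direction of \<open>\<phi>\<close>, the product of
  \<alpha> and the curvature vector is k \<open>\<nu>\<close>, and the equation for
  \<open>\<nu>\<close> is the required system with \<open>g = k |\<phi>|\<close> when
  \<open>lam\<close> is a unit vector. When \<open>lam = 0\<close>, both sides of the equation
  vanish for e = T 0, and g needs only the right derivative and a positive sign.\<close>

lemma nonvanishing_system:
  assumes lam: "norm lam = 1 \<or> lam = 0" and nz: "\<And>s. s \<in> {0..l} \<Longrightarrow> \<phi> s \<noteq> 0"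
  shows "\<exists>e::real ^ 'n. norm e = 1
    \<and> (\<exists>A::(real ^ 'n) set. affine A \<and> aff_dim A \<le> 3 \<and> \<gamma> ` {0..l} \<subseteq> A)
    \<and> (\<exists>h. weak_deriv l T h
      \<and> (\<exists>L. L-lipschitz_on {0..l} (\<lambda>s. \<alpha> s *\<^sub>R h s))
      \<and> (\<forall>s\<in>{0..l}. \<alpha> s * norm (h s) = k)
      \<and> (\<exists>w g. weak_deriv l (\<lambda>s. \<alpha> s *\<^sub>R h s) w
          \<and> W2inf l (g :: real \<Rightarrow> real) \<and> (\<forall>s\<in>{0..l}. g s > 0)
          \<and> (AE s in lebesgue. s \<in> {0<..<l} \<longrightarrow>
                g s *\<^sub>R (w s + (k\<^sup>2 / \<alpha> s) *\<^sub>R T s) = k\<^sup>2 *\<^sub>R proj_perp (T s) (h s) e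
              \<and> vel l g s = \<alpha> s * (e \<bullet> h s))))"
proof -
  define \<nu> where "\<nu> s = \<phi> s /\<^sub>R norm (\<phi> s)" for s
  define \<nu>' where "\<nu>' s = (- (lam \<bullet> \<phi> s) / norm (\<phi> s) ^ 3) *\<^sub>R \<phi> s + \<psi> s /\<^sub>R norm (\<phi> s)" for s
  have WDn: "WD 0 l \<nu> \<nu>'" unfolding \<nu>_def[abs_def] \<nu>'_def[abs_def]
    by (rule WD_direction[OF order_refl l_nonneg order_refl nz])
  have n1: "norm (\<nu> s) = 1" if "s \<in> {0..l}" for s using nz[OF that] by (simp add: \<nu>_def)
  \<comment> \<open>This representative makes the Lipschitz property and the constancy of the
    curvature hold at every point, not only almost everywhere.\<close>
  define h' where "h' s = (k / \<alpha> s) *\<^sub>R \<nu> s" for s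
  have ah: "\<alpha> s *\<^sub>R h' s = k *\<^sub>R \<nu> s" if "s \<in> {0..l}" for s
    using alpha_pos[OF that] by (simp add: h'_def)
  have "AE s\<in>{0..l} in lebesgue. h s = h' s"
    using h_phi
  proof eventually_elim
    case (elim s)
    show ?case
    proof
      assume s: "s \<in> {0..l}"
      then have "h s = (k / (\<alpha> s * norm (\<phi> s))) *\<^sub>R \<phi> s" using elim nz by blast
      also have "\<dots> = h' s" by (simp add: h'_def \<nu>_def divide_inverse)
      finally show "h s = h' s" .
    qed
  qed
  then have "WD 0 l T h'" by (rule WD_cong_AE[OF WD_T])
  then have wdT: "weak_deriv l T h'" by (simp add: WD_iff_weak_deriv)
  have WDa: "WD 0 l (\<lambda>s. \<alpha> s *\<^sub>R h' s) (\<lambda>s. k *\<^sub>R \<nu>' s)"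
    by (rule WD_cong[OF WD_scaleR_const[OF WDn, of k]]) (simp add: ah)
  have nh: "\<alpha> s * norm (h' s) = k" if s: "s \<in> {0..l}" for s
    using n1[OF s] alpha_pos[OF s] k_pos by (simp add: h'_def)
  have "\<exists>e g. norm e = 1 \<and> WD 0 l g (\<lambda>s. k * (e \<bullet> \<nu> s)) \<and> (\<forall>s\<in>{0..l}. 0 < g s) \<and>
     (AE s\<in>{0..l} in lebesgue. g s *\<^sub>R (k *\<^sub>R \<nu>' s + (k\<^sup>2 / \<alpha> s) *\<^sub>R T s) = k\<^sup>2 *\<^sub>R proj_perp (T s) (h' s) e)"
  proof -
    have proj: "proj_perp (T s) (h' s) e = e - (e \<bullet> T s) *\<^sub>R T s - (e \<bullet> \<nu> s) *\<^sub>R \<nu> s" if s: "s \<in> {0..l}" for e s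
    proof -
      have a: "k / \<alpha> s \<noteq> 0" using k_pos alpha_pos[OF s] by simp
      have nn: "\<nu> s \<bullet> \<nu> s = 1" using n1[OF s] by (simp add: norm_eq_1)
      have "T s \<bullet> h' s = 0" by (simp add: h'_def \<nu>_def T_phi)
      moreover have "h' s \<noteq> 0" using a n1[OF s] by (auto simp: h'_def)
      ultimately have "proj_perp (T s) (h' s) e = e - (e \<bullet> T s) *\<^sub>R T s - (e \<bullet> h' s / (h' s \<bullet> h' s)) *\<^sub>R h' s"
        by (intro proj_perp_orthogonal T_T[OF s])
      also have "(e \<bullet> h' s / (h' s \<bullet> h' s)) *\<^sub>R h' s = (e \<bullet> \<nu> s) *\<^sub>R \<nu> s"
        using a by (simp add: h'_def nn)
      finally show ?thesis .
    qed
    have main: "norm (\<phi> s) *\<^sub>R (k *\<^sub>R \<nu>' s + (k\<^sup>2 / \<alpha> s) *\<^sub>R T s) = k *\<^sub>R (lam - (lam \<bullet> T s) *\<^sub>R T s - (lam \<bullet> \<nu> s) *\<^sub>R \<nu> s)"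
      if s: "s \<in> {0..l}" and ph: "\<phi> s \<bullet> h s = k * norm (\<phi> s) / \<alpha> s" for s
    proof -
      define n where "n = norm (\<phi> s)"
      have n: "n > 0" using nz[OF s] by (simp add: n_def)
      have "n *\<^sub>R \<nu>' s = - ((lam \<bullet> \<nu> s) *\<^sub>R \<nu> s) + \<psi> s"
        using n by (simp add: \<nu>'_def \<nu>_def flip: n_def) (simp add: field_simps power3_eq_cube)
      moreover have "\<psi> s = lam - (lam \<bullet> T s) *\<^sub>R T s - (k * n / \<alpha> s) *\<^sub>R T s"
        by (simp add: \<psi>_def ph n_def scaleR_add_left)
      ultimately have e: "n *\<^sub>R \<nu>' s = lam - (lam \<bullet> T s) *\<^sub>R T s - (lam \<bullet> \<nu> s) *\<^sub>R \<nu> s - (k * n / \<alpha> s) *\<^sub>R T s" by simp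
      have "n *\<^sub>R (k *\<^sub>R \<nu>' s + (k\<^sup>2 / \<alpha> s) *\<^sub>R T s) = k *\<^sub>R (n *\<^sub>R \<nu>' s + (k * n / \<alpha> s) *\<^sub>R T s)"
        by (simp add: scaleR_add_right power2_eq_square mult_ac)
      then show ?thesis unfolding e n_def[symmetric] by simp
    qed
    from lam show ?thesis
    proof
      assume l1: "norm lam = 1"
      show ?thesis
      proof (intro exI conjI ballI)
        show "norm lam = 1" by (rule l1)
        have "WD 0 l (\<lambda>s. k *\<^sub>R norm (\<phi> s)) (\<lambda>s. k *\<^sub>R ((lam \<bullet> \<phi> s) / norm (\<phi> s)))"
          by (rule WD_scaleR_const[OF WD_norm_phi[OF order_refl l_nonneg order_refl nz]])
        then show "WD 0 l (\<lambda>s. k * norm (\<phi> s)) (\<lambda>s. k * (lam \<bullet> \<nu> s))"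
          by (simp add: \<nu>_def divide_inverse mult.commute mult.left_commute)
        show "0 < k * norm (\<phi> s)" if "s \<in> {0..l}" for s using k_pos nz[OF that] by simp
        show "AE s in lebesgue. s \<in> {0..l} \<longrightarrow>
          (k * norm (\<phi> s)) *\<^sub>R (k *\<^sub>R \<nu>' s + (k\<^sup>2 / \<alpha> s) *\<^sub>R T s) = k\<^sup>2 *\<^sub>R proj_perp (T s) (h' s) lam"
          using phi_h
        proof eventually_elim
          case (elim s)
          show ?case
          proof
            assume s: "s \<in> {0..l}"
            have "(k * norm (\<phi> s)) *\<^sub>R (k *\<^sub>R \<nu>' s + (k\<^sup>2 / \<alpha> s) *\<^sub>R T s)
               = k *\<^sub>R (norm (\<phi> s) *\<^sub>R (k *\<^sub>R \<nu>' s + (k\<^sup>2 / \<alpha> s) *\<^sub>R T s))" by simp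
            also have "\<dots> = k *\<^sub>R (k *\<^sub>R proj_perp (T s) (h' s) lam)"
              using main[OF s] elim s unfolding proj[OF s] by simp
            also have "\<dots> = k\<^sup>2 *\<^sub>R proj_perp (T s) (h' s) lam" by (simp add: power2_eq_square)
            finally show "(k * norm (\<phi> s)) *\<^sub>R (k *\<^sub>R \<nu>' s + (k\<^sup>2 / \<alpha> s) *\<^sub>R T s) = k\<^sup>2 *\<^sub>R proj_perp (T s) (h' s) lam" .
          qed
        qed
      qed
    next
      assume l0: "lam = 0"
      have zero0: "(0::real) \<in> {0..l}" using l_nonneg by simp
      define e where "e = T 0"
      have e1: "norm e = 1" unfolding e_def by (rule norm_T[OF zero0])
      \<comment> \<open>If \<open>lam = 0\<close>, W is constant, so T and \<open>\<nu>\<close> span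
        the same plane for all s, and this plane contains T 0.\<close>
      have eproj: "e - (e \<bullet> T s) *\<^sub>R T s - (e \<bullet> \<nu> s) *\<^sub>R \<nu> s = 0" if s: "s \<in> {0..l}" for s
      proof -
        define x where "x = e - (e \<bullet> T s) *\<^sub>R T s - (e \<bullet> \<nu> s) *\<^sub>R \<nu> s"
        have nn: "\<nu> s \<bullet> \<nu> s = 1" using n1[OF s] by (simp add: norm_eq_1)
        have Tn: "T s \<bullet> \<nu> s = 0" "\<nu> s \<bullet> T s = 0" by (simp_all add: \<nu>_def T_phi phi_T)
        have xT: "x \<bullet> T s = 0" using T_T[OF s] Tn by (simp add: x_def inner_diff_left)
        have xn: "x \<bullet> \<nu> s = 0" using nn Tn by (simp add: x_def inner_diff_left)
        have "x \<bullet> \<phi> s = 0" using xn nz[OF s] by (simp add: \<nu>_def)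
        then have "W s *v x = 0" using W_vec[OF s, of x] xT by (simp add: inner_commute)
        moreover have "W s = W 0"
        proof -
          have "wedge lam (\<gamma> s - \<gamma> 0) = 0" using l0 by (simp add: wedge_def vec_eq_iff)
          then show ?thesis using W_shift[of s 0] by (metis add.right_neutral)
        qed
        ultimately have "(T 0 \<bullet> x) *\<^sub>R \<phi> 0 - (\<phi> 0 \<bullet> x) *\<^sub>R T 0 = 0" using W_vec[OF zero0, of x] by simp
        from arg_cong[OF this, of "\<lambda>y. y \<bullet> \<phi> 0"] have "(T 0 \<bullet> x) * (\<phi> 0 \<bullet> \<phi> 0) = 0"
          by (simp add: inner_diff_left T_phi)
        then have "e \<bullet> x = 0" using nz[OF zero0] by (simp add: e_def)
        moreover have "x \<bullet> x = x \<bullet> e - (e \<bullet> T s) * (x \<bullet> T s) - (e \<bullet> \<nu> s) * (x \<bullet> \<nu> s)"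
          by (subst (2) x_def) (simp add: inner_diff_right)
        ultimately have "x \<bullet> x = 0" using xT xn by (simp add: inner_commute)
        then show ?thesis by (simp add: x_def)
      qed
      have cn: "continuous_on {0..l} (\<lambda>s. k * (e \<bullet> \<nu> s))" by (intro continuous_intros WD_continuous[OF WDn])
      \<comment> \<open>The derivative has modulus at most k, so the initial value k l + 1 keeps
        \<open>g\<close> at least 1.\<close>
      define g where "g s = (k * l + 1) + integral {0..s} (\<lambda>s. k * (e \<bullet> \<nu> s))" for s
      have gd: "(g has_vector_derivative k * (e \<bullet> \<nu> s)) (at s within {0..l})" if "s \<in> {0..l}" for s
        unfolding g_def using has_vector_derivative_add[OF has_vector_derivative_const integral_has_vector_derivative[OF cn that], of "k * l + 1"]
        by simp
      have WDg: "WD 0 l g (\<lambda>s. k * (e \<bullet> \<nu> s))" by (rule C1_imp_WD[OF gd cn])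
      have gpos: "0 < g s" if s: "s \<in> {0..l}" for s
      proof -
        have "norm (g s - g 0) \<le> k * (s - 0)"
        proof (rule WD_increment_bound[OF WD_subset[OF WDg]])
          show "AE x\<in>{0..s} in lebesgue. norm (k * (e \<bullet> \<nu> x)) \<le> k"
          proof (rule AE_I2, rule impI)
            fix x assume "x \<in> {0..s}"
            then have "x \<in> {0..l}" using s by auto
            then have "\<bar>e \<bullet> \<nu> x\<bar> \<le> 1" using Cauchy_Schwarz_ineq2[of e "\<nu> x"] e1 n1 by simp
            then have "k * \<bar>e \<bullet> \<nu> x\<bar> \<le> k * 1" using k_pos by (intro mult_left_mono) auto
            then show "norm (k * (e \<bullet> \<nu> x)) \<le> k" using k_pos by (simp add: abs_mult)
          qed
        qed (use s k_pos in auto)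
        moreover have "k * (s - 0) \<le> k * l" using s k_pos by simp
        moreover have "g 0 = k * l + 1" by (simp add: g_def)
        ultimately show ?thesis unfolding real_norm_def by linarith
      qed
      show ?thesis
      proof (intro exI conjI ballI)
        show "norm e = 1" by (rule e1)
        show "WD 0 l g (\<lambda>s. k * (e \<bullet> \<nu> s))" by (rule WDg)
        show "0 < g s" if "s \<in> {0..l}" for s by (rule gpos[OF that])
        show "AE s\<in>{0..l} in lebesgue. g s *\<^sub>R (k *\<^sub>R \<nu>' s + (k\<^sup>2 / \<alpha> s) *\<^sub>R T s) = k\<^sup>2 *\<^sub>R proj_perp (T s) (h' s) e"
          using phi_h
        proof eventually_elim
          case (elim s)
          show ?case
          proof
            assume s: "s \<in> {0..l}"
            have "norm (\<phi> s) *\<^sub>R (k *\<^sub>R \<nu>' s + (k\<^sup>2 / \<alpha> s) *\<^sub>R T s) = 0" using main[OF s] elim s l0 by simp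
            then have "k *\<^sub>R \<nu>' s + (k\<^sup>2 / \<alpha> s) *\<^sub>R T s = 0" using nz[OF s] by simp
            then show "g s *\<^sub>R (k *\<^sub>R \<nu>' s + (k\<^sup>2 / \<alpha> s) *\<^sub>R T s) = k\<^sup>2 *\<^sub>R proj_perp (T s) (h' s) e"
              unfolding proj[OF s] eproj[OF s] by simp
          qed
        qed
      qed
    qed
  qed
  then obtain e g where eg: "norm e = 1" "WD 0 l g (\<lambda>s. k * (e \<bullet> \<nu> s))" "\<forall>s\<in>{0..l}. 0 < g s"
    "AE s\<in>{0..l} in lebesgue. g s *\<^sub>R (k *\<^sub>R \<nu>' s + (k\<^sup>2 / \<alpha> s) *\<^sub>R T s) = k\<^sup>2 *\<^sub>R proj_perp (T s) (h' s) e" by blast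
  have WDv: "WD 0 l (\<lambda>s. k *\<^sub>R (\<nu> s \<bullet> e)) (\<lambda>s. k *\<^sub>R (\<nu>' s \<bullet> e))"
    by (intro WD_scaleR_const WD_inner_left WDn)
  have cn: "continuous_on {0..l} (\<lambda>s. k * (e \<bullet> \<nu> s))" by (intro continuous_intros WD_continuous[OF WDn])
  have gd: "(g has_vector_derivative k * (e \<bullet> \<nu> s)) (at s within {0..l})" if "s \<in> {0..l}" for s
    by (rule WD_has_vector_derivative[OF eg(2) cn that])
  have gv: "vel l g s = k * (e \<bullet> \<nu> s)" if "s \<in> {0..l}" for s
    unfolding vel_def using gd[OF that] that l_pos
    by (intro vector_derivative_within_cbox[of 0 l, unfolded cbox_interval]) auto
  have "W2inf l g"
  proof -
    obtain L where L: "L-lipschitz_on {0..l} (\<lambda>s. k *\<^sub>R (\<nu> s \<bullet> e))" using WD_lip[OF WDv] by blast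
    then have "L-lipschitz_on {0..l} (vel l g)" using gv by (simp add: lipschitz_on_def inner_commute)
    moreover have "g differentiable (at s within {0..l})" if "s \<in> {0..l}" for s
      using gd[OF that] by (rule differentiableI_vector)
    ultimately show ?thesis by (auto simp: W2inf_def)
  qed
  moreover have "AE s in lebesgue. s \<in> {0<..<l} \<longrightarrow>
      g s *\<^sub>R (k *\<^sub>R \<nu>' s + (k\<^sup>2 / \<alpha> s) *\<^sub>R T s) = k\<^sup>2 *\<^sub>R proj_perp (T s) (h' s) e \<and> vel l g s = \<alpha> s * (e \<bullet> h' s)"
    using eg(4)
  proof eventually_elim
    case (elim s)
    show ?case
    proof
      assume "s \<in> {0<..<l}"
      then have s: "s \<in> {0..l}" by simp
      have "vel l g s = \<alpha> s * (e \<bullet> h' s)" unfolding gv[OF s] using alpha_pos[OF s] by (simp add: h'_def)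
      then show "g s *\<^sub>R (k *\<^sub>R \<nu>' s + (k\<^sup>2 / \<alpha> s) *\<^sub>R T s) = k\<^sup>2 *\<^sub>R proj_perp (T s) (h' s) e \<and> vel l g s = \<alpha> s * (e \<bullet> h' s)"
        using elim s by blast
    qed
  qed
  moreover have "weak_deriv l (\<lambda>s. \<alpha> s *\<^sub>R h' s) (\<lambda>s. k *\<^sub>R \<nu>' s)" "\<exists>L. L-lipschitz_on {0..l} (\<lambda>s. \<alpha> s *\<^sub>R h' s)"
    using WDa by (auto simp: WD_iff_weak_deriv)
  ultimately show ?thesis using eg(1,3) three_dimensional[OF nz] wdT nh by blast
qed

end

text \<open>The conditions are homogeneous in (lam, W0); a positive factor preserves the direction
  of \<open>\<phi>\<close>, so a nonzero \<open>lam\<close> may be normalised.\<close>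

lemma (in multiplier) rescaled:
  assumes c: "c > 0"
  shows "multiplier l \<alpha> a1 a2 T1 T2 \<gamma> (c *\<^sub>R lam) (c *\<^sub>R W0)"
proof -
  have W: "wedge (c *\<^sub>R lam) (\<gamma> s) + c *\<^sub>R W0 = c *\<^sub>R W s" for s
    by (simp add: W_def wedge_def vec_eq_iff algebra_simps)
  have p: "(c *\<^sub>R W s) *v T s = c *\<^sub>R \<phi> s" for s by (simp add: \<phi>_def flip: scaleR_matrix_vector_assoc)
  show ?thesis
  proof unfold_locales
    show "0 < k" by (rule k_pos)
    show "skew (c *\<^sub>R W0)" by (rule skew_scaleR[OF skew_W0])
    show "wedge (c *\<^sub>R lam) (\<gamma> s) + c *\<^sub>R W0 = wedge ((wedge (c *\<^sub>R lam) (\<gamma> s) + c *\<^sub>R W0) *v T s) (T s)"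
      if "s \<in> {0..l}" for s
    proof -
      have "wedge (c *\<^sub>R \<phi> s) (T s) = c *\<^sub>R wedge (\<phi> s) (T s)" by (simp add: wedge_def vec_eq_iff algebra_simps)
      then show ?thesis unfolding W p by (simp add: W_eq[OF that, symmetric])
    qed
    show "AE s\<in>{0..l} in lebesgue. (wedge (c *\<^sub>R lam) (\<gamma> s) + c *\<^sub>R W0) *v T s \<noteq> 0 \<longrightarrow>
       h s = (k / (\<alpha> s * norm ((wedge (c *\<^sub>R lam) (\<gamma> s) + c *\<^sub>R W0) *v T s))) *\<^sub>R ((wedge (c *\<^sub>R lam) (\<gamma> s) + c *\<^sub>R W0) *v T s)"
      unfolding W p using h_phi by eventually_elim (use c in auto)
    show "\<exists>s\<in>{0..l}. (wedge (c *\<^sub>R lam) (\<gamma> s) + c *\<^sub>R W0) *v T s \<noteq> 0"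
      unfolding W p using nontrivial c by (simp add: \<phi>_def W_def)
  qed
qed

section \<open>Multipliers with a zero: rotation along an arc\<close>

locale multiplier_with_zero = multiplier l \<alpha> a1 a2 T1 T2 \<gamma> lam W0
  for l \<alpha> and a1 a2 T1 T2 :: "real ^ 'n" and \<gamma> lam W0 +
  fixes z0 :: real
  assumes norm_lam: "norm lam = 1" and z0: "z0 \<in> {0..l}" "\<phi> z0 = 0"
begin

definition c :: "real \<Rightarrow> real ^ 'n" where "c s = \<gamma> s - \<gamma> z0"

definition \<tau> :: "real \<Rightarrow> real" where "\<tau> s = lam \<bullet> T s"

text \<open>The component of \<open>lam\<close> along the direction of \<open>\<phi>\<close>; on an
  arc it is also the derivative of the norm of \<open>\<phi>\<close>. At zeros of
  \<open>\<phi>\<close> it is 0 by the convention for division.\<close>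

definition f :: "real \<Rightarrow> real" where "f s = (lam \<bullet> \<phi> s) / norm (\<phi> s)"

lemma lam_lam: "lam \<bullet> lam = 1" using norm_lam by (simp add: norm_eq_1)

lemma W_c: "W s = wedge lam (c s)"
proof -
  have "W z0 = 0" using W_eq[OF z0(1)] z0(2) by (simp add: wedge_def vec_eq_iff)
  then show ?thesis using W_shift[of s z0] by (simp add: c_def)
qed

lemma phi_zero_iff: "s \<in> {0..l} \<Longrightarrow> \<phi> s = 0 \<longleftrightarrow> c s \<in> span {lam}"
proof
  assume s: "s \<in> {0..l}" and "\<phi> s = 0"
  then have "W s = 0" using W_eq[OF s] by (simp add: wedge_def vec_eq_iff)
  then have "wedge lam (c s) *v lam = 0" by (simp add: W_c)
  then have "c s = (c s \<bullet> lam) *\<^sub>R lam" by (simp add: wedge_mult_vec lam_lam)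
  then show "c s \<in> span {lam}" by (metis span_base span_scale singletonI)
next
  assume "c s \<in> span {lam}"
  then obtain x where "c s = x *\<^sub>R lam" by (auto simp: span_singleton)
  then show "\<phi> s = 0" by (simp add: \<phi>_def W_c wedge_mult_vec)
qed

lemma continuous_tau: "continuous_on {0..l} \<tau>"
  unfolding \<tau>_def[abs_def] by (intro continuous_intros continuous_T)

lemma tau_bounds: "s \<in> {0..l} \<Longrightarrow> \<bar>\<tau> s\<bar> \<le> 1"
  using Cauchy_Schwarz_ineq2[of lam "T s"] norm_T norm_lam by (simp add: \<tau>_def)

lemma continuous_norm_phi: "continuous_on {0..l} (\<lambda>s. norm (\<phi> s))"
  by (intro continuous_on_norm continuous_phi)

lemma WD_tau: "WD 0 l \<tau> (\<lambda>s. lam \<bullet> h s)"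
  using WD_inner_left[OF WD_T, of lam] by (simp add: \<tau>_def[abs_def] inner_commute)

text \<open>The energy argument is applied to \<open>1 - \<tau>\<close> and the norm of
  \<open>\<phi>\<close>; the energy is positive at a point where \<open>\<phi> \<noteq> 0\<close>,
  hence also at z, where only \<open>1 - \<tau>\<close> is left. The relation between the
  derivatives also has to hold on the zero set of \<open>\<phi>\<close>, which may have positive
  measure; there densities on level sets are used.\<close>

lemma tau_lt_1_at_zeros:
  assumes z: "z \<in> {0..l}" "\<phi> z = 0"
  shows "\<tau> z < 1"
proof -
  obtain A B where AB: "A > 0" "B > 0" "\<And>s. s \<in> {0..l} \<Longrightarrow> A \<le> \<alpha> s" "\<And>s. s \<in> {0..l} \<Longrightarrow> \<alpha> s \<le> B"
    by (rule alpha_bounds) (rule that)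
  obtain V where V: "\<And>x y. 0 \<le> x \<Longrightarrow> x \<le> y \<Longrightarrow> y \<le> l \<Longrightarrow> \<bar>\<alpha> y - \<alpha> x\<bar> \<le> V y - V x"
    by (rule bounded_variation_dominating_function[OF alpha_bv]) (rule that)
  obtain m where m: "WD 0 l (\<lambda>s. norm (\<phi> s)) m"
    "AE s\<in>{0..l} in lebesgue. norm (\<phi> s) * m s = \<phi> s \<bullet> \<psi> s"
    by (rule WD_norm_exists[OF WD_phi l_nonneg]) (rule that)
  have level_m: "AE s\<in>{0..l} in lebesgue. norm (\<phi> s) = 0 \<longrightarrow> m s = 0"
    by (rule WD_level_set[OF m(1) l_nonneg])
  have level_phi: "AE s\<in>{0..l} in lebesgue. (\<forall>e\<in>Basis. \<phi> s \<bullet> e = 0 \<longrightarrow> \<psi> s \<bullet> e = 0)"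
    by (rule AE_ball_finite_imp) (use WD_level_set[OF WD_inner_left[OF WD_phi] l_nonneg] in auto)
  \<comment> \<open>On the zero set \<open>lam\<close> turns out to be \<open>\<tau>\<close> T, so
    \<open>\<tau>\<^sup>2 = 1\<close>; the level set of \<open>1 - \<tau>\<^sup>2\<close> then shows
    that the derivative of \<open>\<tau>\<close> is 0 there as well.\<close>
  have "WD 0 l (\<lambda>s. 1 - \<tau> s * \<tau> s) (\<lambda>s. 0 - ((lam \<bullet> h s) * \<tau> s + \<tau> s * (lam \<bullet> h s)))"
    by (intro WD_diff WD_const WD_mult WD_tau l_nonneg)
  from WD_level_set[OF this l_nonneg]
  have level_tau: "AE s\<in>{0..l} in lebesgue. 1 - \<tau> s * \<tau> s = 0 \<longrightarrow> \<tau> s * (lam \<bullet> h s) = 0"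
    by eventually_elim (auto simp: algebra_simps)
  have eq: "AE s\<in>{0..l} in lebesgue. \<alpha> s * (0 - lam \<bullet> h s) = - k * m s"
    using m(2) level_m level_phi level_tau h_phi
  proof eventually_elim
    case (elim s)
    show ?case
    proof
      assume s: "s \<in> {0..l}"
      have a: "\<alpha> s > 0" by (rule alpha_pos[OF s])
      show "\<alpha> s * (0 - lam \<bullet> h s) = - k * m s"
      proof (cases "\<phi> s = 0")
        case False
        then have n: "norm (\<phi> s) > 0" by simp
        have hs: "h s = (k / (\<alpha> s * norm (\<phi> s))) *\<^sub>R \<phi> s" using elim(5) s False by blast
        have "norm (\<phi> s) * m s = lam \<bullet> \<phi> s" using elim(1) s phi_psi by simp
        then have ms: "m s = (lam \<bullet> \<phi> s) / norm (\<phi> s)" using n by (simp add: field_simps)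
        have "\<alpha> s * (lam \<bullet> h s) = \<alpha> s * (k / (\<alpha> s * norm (\<phi> s))) * (lam \<bullet> \<phi> s)" by (subst hs) simp
        also have "\<dots> = k * m s" using a n by (simp add: ms)
        finally show ?thesis by simp
      next
        case True
        have m0: "m s = 0" using elim(2) s True by simp
        have "\<forall>e\<in>Basis. \<psi> s \<bullet> e = 0" using elim(3) s True by simp
        then have "\<psi> s = 0" by (simp add: euclidean_all_zero_iff)
        then have "lam - \<tau> s *\<^sub>R T s = 0" by (simp add: \<psi>_def True \<tau>_def)
        from arg_cong[OF this, of "\<lambda>x. lam \<bullet> x"] have "1 - \<tau> s * \<tau> s = 0"
          by (simp add: inner_diff_right lam_lam \<tau>_def)
        then have "\<tau> s * (lam \<bullet> h s) = 0" "\<tau> s \<noteq> 0" using elim(4) s by auto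
        then show ?thesis using m0 by simp
      qed
    qed
  qed
  obtain s1 where s1: "s1 \<in> {0..l}" "\<phi> s1 \<noteq> 0" using nontrivial by (auto simp: \<phi>_def W_def)
  have "0 < (1 - \<tau> z) + k * norm (\<phi> z) / \<alpha> z"
  proof (rule bounded_variation_energy_positive[OF V AB(1,3) less_imp_le[OF k_pos] WD_diff[OF WD_const WD_tau] m(1) eq _ _ s1(1) z(1)])
    show "0 \<le> 1 - \<tau> x" if "x \<in> {0..l}" for x using tau_bounds[OF that] by linarith
    have "0 < k * norm (\<phi> s1) / \<alpha> s1" using k_pos s1(2) alpha_pos[OF s1(1)] by simp
    then show "0 < (1 - \<tau> s1) + k * norm (\<phi> s1) / \<alpha> s1" using tau_bounds[OF s1(1)] by linarith
  qed auto
  then show ?thesis using z(2) by simp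
qed

text \<open>The remainder x of \<open>lam\<close> is annihilated by W = lam \<and> c, and
  \<open>lam \<bullet> x = x \<bullet> x\<close>. If x were nonzero, \<open>c\<close> would be a
  multiple of \<open>lam\<close> and \<open>\<phi>\<close> would vanish.\<close>

lemma arc_plane:
  assumes s: "s \<in> {0..l}" "\<phi> s \<noteq> 0"
  shows "lam = \<tau> s *\<^sub>R T s + f s *\<^sub>R (\<phi> s /\<^sub>R norm (\<phi> s))" and "(f s)\<^sup>2 + (\<tau> s)\<^sup>2 = 1"
proof -
  define \<nu> where "\<nu> = \<phi> s /\<^sub>R norm (\<phi> s)"
  have "norm \<nu> = 1" using s(2) by (simp add: \<nu>_def)
  then have nn: "\<nu> \<bullet> \<nu> = 1" by (simp add: norm_eq_1)
  have Tn: "T s \<bullet> \<nu> = 0" "\<nu> \<bullet> T s = 0" by (simp_all add: \<nu>_def T_phi phi_T)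
  have fn: "f s = lam \<bullet> \<nu>" by (simp add: f_def \<nu>_def divide_inverse mult.commute)
  define x where "x = lam - \<tau> s *\<^sub>R T s - f s *\<^sub>R \<nu>"
  have xT: "T s \<bullet> x = 0" using T_T[OF s(1)] Tn by (simp add: x_def inner_diff_right \<tau>_def inner_commute)
  have xn: "\<nu> \<bullet> x = 0" using nn Tn by (simp add: x_def inner_diff_right fn inner_commute)
  have "\<phi> s \<bullet> x = 0" using xn s(2) by (simp add: \<nu>_def)
  then have "W s *v x = 0" using W_vec[OF s(1), of x] xT by simp
  then have w: "(c s \<bullet> x) *\<^sub>R lam = (lam \<bullet> x) *\<^sub>R c s" by (simp add: W_c wedge_mult_vec)
  have lx: "lam \<bullet> x = x \<bullet> x"
  proof -
    have "x \<bullet> x = lam \<bullet> x - \<tau> s * (T s \<bullet> x) - f s * (\<nu> \<bullet> x)"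
      by (subst (1) x_def) (simp add: inner_diff_left)
    then show ?thesis using xT xn by simp
  qed
  have x0: "x = 0"
  proof (rule ccontr)
    assume "x \<noteq> 0"
    then have nz: "lam \<bullet> x \<noteq> 0" using lx by simp
    have "inverse (lam \<bullet> x) *\<^sub>R ((lam \<bullet> x) *\<^sub>R c s) = inverse (lam \<bullet> x) *\<^sub>R ((c s \<bullet> x) *\<^sub>R lam)" using w by simp
    then have "c s = (inverse (lam \<bullet> x) * (c s \<bullet> x)) *\<^sub>R lam" using nz by simp
    then have "c s \<in> span {lam}" by (metis span_base span_scale singletonI)
    then show False using phi_zero_iff[OF s(1)] s(2) by simp
  qed
  then show e: "lam = \<tau> s *\<^sub>R T s + f s *\<^sub>R (\<phi> s /\<^sub>R norm (\<phi> s))" by (simp add: x_def \<nu>_def algebra_simps)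
  have "lam \<bullet> lam = \<tau> s * (lam \<bullet> T s) + f s * (lam \<bullet> \<nu>)"
    using e by (metis \<nu>_def inner_add_right inner_scaleR_right)
  then show "(f s)\<^sup>2 + (\<tau> s)\<^sup>2 = 1" by (simp add: lam_lam fn \<tau>_def power2_eq_square)
qed

text \<open>The terms of order \<open>1 / |\<phi>|\<close> cancel by
  \<open>f\<^sup>2 + \<tau>\<^sup>2 = 1\<close>, so the derivative stays controlled up to the ends
  of the arc.\<close>

lemma WD_f:
  assumes uv: "0 \<le> u" "u \<le> v" "v \<le> l" and nz: "\<And>s. s \<in> {u..v} \<Longrightarrow> \<phi> s \<noteq> 0"
  shows "WD u v f (\<lambda>s. - (k / \<alpha> s) * \<tau> s)"
proof -
  let ?d = "\<lambda>s. (- (lam \<bullet> \<phi> s) / norm (\<phi> s) ^ 3) *\<^sub>R \<phi> s + \<psi> s /\<^sub>R norm (\<phi> s)"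
  have "WD u v (\<lambda>s. (\<phi> s /\<^sub>R norm (\<phi> s)) \<bullet> lam) (\<lambda>s. ?d s \<bullet> lam)"
    by (rule WD_inner_left[OF WD_direction[OF uv nz]])
  then have 1: "WD u v f (\<lambda>s. ?d s \<bullet> lam)"
    by (rule WD_cong) (simp add: f_def inner_commute divide_inverse mult.commute)
  show ?thesis
  proof (rule WD_cong_AE[OF 1])
    show "AE s\<in>{u..v} in lebesgue. ?d s \<bullet> lam = - (k / \<alpha> s) * \<tau> s"
      using phi_h
    proof eventually_elim
      case (elim s)
      show ?case
      proof
        assume s: "s \<in> {u..v}"
        then have sl: "s \<in> {0..l}" using uv by auto
        define n where "n = norm (\<phi> s)"
        have n: "n > 0" using nz[OF s] by (simp add: n_def)
        have lp: "lam \<bullet> \<phi> s = f s * n" using n by (simp add: f_def n_def)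
        have ph: "\<phi> s \<bullet> h s = k * n / \<alpha> s" using elim sl by (simp add: n_def)
        have ft: "1 - \<tau> s * \<tau> s - f s * f s = 0" using arc_plane(2)[OF sl nz[OF s]] by (simp add: power2_eq_square)
        have "lam \<bullet> \<psi> s = 1 - (\<tau> s + k * n / \<alpha> s) * \<tau> s"
          by (simp add: \<psi>_def inner_diff_right lam_lam ph \<tau>_def)
        then have "\<psi> s \<bullet> lam = 1 - (\<tau> s + k * n / \<alpha> s) * \<tau> s" by (simp add: inner_commute)
        then have "?d s \<bullet> lam = - (f s * n) / n ^ 3 * (f s * n) + (1 - (\<tau> s + k * n / \<alpha> s) * \<tau> s) / n"
          by (simp add: inner_add_left inner_diff_left inner_commute[of "\<phi> s" lam] lp n_def[symmetric] divide_inverse mult.commute)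
        also have "\<dots> = (1 - \<tau> s * \<tau> s - f s * f s) / n - (k / \<alpha> s) * \<tau> s"
          using n alpha_pos[OF sl] by (simp add: field_simps power3_eq_cube)
        finally show "?d s \<bullet> lam = - (k / \<alpha> s) * \<tau> s" using ft by simp
      qed
    qed
  qed
qed

text \<open>Inside the interval \<open>f\<close> is the derivative of the norm of
  \<open>\<phi>\<close>. The end points themselves may be zeros, as they are in the
  applications.\<close>

lemma norm_phi_increase:
  assumes uv: "0 \<le> u" "u \<le> v" "v \<le> l" and nz: "\<And>s. s \<in> {u<..<v} \<Longrightarrow> \<phi> s \<noteq> 0"
  shows "(\<And>s. s \<in> {u<..<v} \<Longrightarrow> 0 \<le> f s) \<Longrightarrow> norm (\<phi> u) \<le> norm (\<phi> v)"
    and "(\<And>s. s \<in> {u<..<v} \<Longrightarrow> f s \<le> 0) \<Longrightarrow> norm (\<phi> v) \<le> norm (\<phi> u)"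
proof -
  obtain m where m: "WD 0 l (\<lambda>s. norm (\<phi> s)) m"
    "AE s\<in>{0..l} in lebesgue. norm (\<phi> s) * m s = \<phi> s \<bullet> \<psi> s"
    by (rule WD_norm_exists[OF WD_phi l_nonneg]) (rule that)
  have "AE s in lebesgue. s \<noteq> u \<and> s \<noteq> v" by (rule AE_neq_two)
  with m(2) have mf: "AE s\<in>{u..v} in lebesgue. m s = f s \<and> s \<in> {u<..<v}"
  proof eventually_elim
    case (elim s)
    show ?case
    proof
      assume s: "s \<in> {u..v}"
      then have i: "s \<in> {u<..<v}" using elim by auto
      have "norm (\<phi> s) * m s = lam \<bullet> \<phi> s" using elim(1) s uv phi_psi by simp
      then show "m s = f s \<and> s \<in> {u<..<v}" using nz[OF i] i by (simp add: f_def field_simps)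
    qed
  qed
  have mw: "WD u v (\<lambda>s. norm (\<phi> s)) m" by (rule WD_subset[OF m(1) uv(1,3)])
  show "norm (\<phi> u) \<le> norm (\<phi> v)" if "\<And>s. s \<in> {u<..<v} \<Longrightarrow> 0 \<le> f s"
    by (rule WD_mono[OF mw _ uv(2)]) (use mf that in \<open>auto elim!: eventually_mono\<close>)
  show "norm (\<phi> v) \<le> norm (\<phi> u)" if "\<And>s. s \<in> {u<..<v} \<Longrightarrow> f s \<le> 0"
  proof -
    have "- norm (\<phi> u) \<le> - norm (\<phi> v)"
      by (rule WD_mono[OF WD_minus[OF mw] _ uv(2)]) (use mf that in \<open>auto elim!: eventually_mono\<close>)
    then show ?thesis by simp
  qed
qed

lemma f_mono:
  assumes uv: "0 \<le> u" "u \<le> v" "v \<le> l" and nz: "\<And>s. s \<in> {u..v} \<Longrightarrow> \<phi> s \<noteq> 0"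
    and t: "\<And>s. s \<in> {u..v} \<Longrightarrow> \<tau> s \<le> 0"
  shows "f u \<le> f v"
proof (rule WD_mono[OF WD_f[OF uv nz] _ uv(2)])
  show "AE s\<in>{u..v} in lebesgue. 0 \<le> - (k / \<alpha> s) * \<tau> s"
  proof (rule AE_I2, rule impI)
    fix s assume s: "s \<in> {u..v}"
    then have "\<alpha> s > 0" using alpha_pos uv by auto
    then show "0 \<le> - (k / \<alpha> s) * \<tau> s" using t[OF s] k_pos by (simp add: divide_nonpos_pos mult_nonneg_nonpos)
  qed
qed

lemma f_continuous: "continuous_on {s \<in> {0..l}. \<phi> s \<noteq> 0} f"
  unfolding f_def[abs_def]
  by (intro continuous_intros continuous_on_subset[OF continuous_phi]) auto

text \<open>Two regimes near a zero. Where \<open>\<tau>\<close> is negative, \<open>f\<close> does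
  not decrease along an arc; where \<open>\<tau>\<close> lies strictly between -1 and 1,
  \<open>f\<close> cannot vanish on an arc. Either way \<open>f\<close> cannot pass from positive to
  negative.\<close>

lemma near_zero_cases:
  assumes z: "z \<in> {0..l}" "\<phi> z = 0"
  obtains d where "d > 0" "\<And>s. s \<in> {0..l} \<Longrightarrow> \<bar>s - z\<bar> < d \<Longrightarrow> \<tau> s < 0"
  | d where "d > 0" "\<And>s. s \<in> {0..l} \<Longrightarrow> \<bar>s - z\<bar> < d \<Longrightarrow> \<bar>\<tau> s\<bar> < 1"
proof -
  have lt: "\<tau> z < 1" by (rule tau_lt_1_at_zeros[OF z])
  show ?thesis
  proof (cases "\<tau> z < 0")
    case True
    then obtain d where d: "d > 0" "\<And>s. s \<in> {0..l} \<Longrightarrow> dist s z < d \<Longrightarrow> dist (\<tau> s) (\<tau> z) < - \<tau> z"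
      using continuous_tau z(1) unfolding continuous_on_iff by (metis neg_0_less_iff_less)
    show ?thesis
    proof (rule that(1)[OF d(1)])
      fix s assume "s \<in> {0..l}" "\<bar>s - z\<bar> < d"
      then have "dist (\<tau> s) (\<tau> z) < - \<tau> z" using d(2) by (simp add: dist_real_def)
      then show "\<tau> s < 0" by (simp add: dist_real_def)
    qed
  next
    case False
    then have "1 - \<tau> z > 0" using lt by simp
    then obtain d where d: "d > 0" "\<And>s. s \<in> {0..l} \<Longrightarrow> dist s z < d \<Longrightarrow> dist (\<tau> s) (\<tau> z) < 1 - \<tau> z"
      using continuous_tau z(1) unfolding continuous_on_iff by metis
    show ?thesis
    proof (rule that(2)[OF d(1)])
      fix s assume "s \<in> {0..l}" "\<bar>s - z\<bar> < d"
      then have "dist (\<tau> s) (\<tau> z) < 1 - \<tau> z" using d(2) by (simp add: dist_real_def)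
      then show "\<bar>\<tau> s\<bar> < 1" using False by (auto simp: dist_real_def abs_if split: if_splits)
    qed
  qed
qed

lemma f_nonzero:
  assumes "s \<in> {0..l}" "\<phi> s \<noteq> 0" "\<bar>\<tau> s\<bar> < 1"
  shows "f s \<noteq> 0"
proof
  assume "f s = 0"
  then have "(\<tau> s)\<^sup>2 = 1" using arc_plane(2)[OF assms(1,2)] by simp
  then show False using assms(3) by (simp add: power2_eq_1_iff abs_if split: if_splits)
qed

text \<open>The norm of \<open>\<phi>\<close> has to grow from 0, so \<open>f\<close> is positive at
  points arbitrarily close to z; monotonicity or constancy of sign carries this to the
  right.\<close>

lemma f_positive_after_zero:
  assumes z: "z \<in> {0..l}" "\<phi> z = 0" and b: "z < b" "b \<le> l" and nz: "\<And>s. s \<in> {z<..<b} \<Longrightarrow> \<phi> s \<noteq> 0"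
  obtains \<delta> where "\<delta> > 0" "\<And>s. s \<in> {z<..<z+\<delta>} \<Longrightarrow> s < b \<Longrightarrow> 0 < f s"
proof -
  have down: "\<exists>u\<in>{z<..<s}. 0 < f u" if s: "s \<in> {z<..<b}" for s
  proof (rule ccontr)
    assume "\<not> ?thesis"
    then have "norm (\<phi> s) \<le> norm (\<phi> z)"
      by (intro norm_phi_increase(2)) (use s b z nz in \<open>auto simp: not_less\<close>)
    then show False using z(2) nz[OF s] by simp
  qed
  from near_zero_cases[OF z] show ?thesis
  proof cases
    case (1 d)
    show ?thesis
    proof (rule that[OF 1(1)])
      fix s assume s: "s \<in> {z<..<z+d}" "s < b"
      then obtain u where u: "u \<in> {z<..<s}" "0 < f u" using down[of s] by auto
      have "f u \<le> f s"
        by (rule f_mono) (use u s z b nz 1(2) in \<open>auto intro!: less_imp_le\<close>)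
      then show "0 < f s" using u by simp
    qed
  next
    case (2 d)
    define J where "J = {z<..<min b (z + d)}"
    have sg: "(\<forall>s\<in>J. 0 < f s) \<or> (\<forall>s\<in>J. f s < 0)"
    proof (rule nonvanishing_sign)
      show "connected J" by (simp add: J_def)
      show "continuous_on J f" by (rule continuous_on_subset[OF f_continuous]) (use z b nz in \<open>auto simp: J_def\<close>)
      show "f s \<noteq> 0" if "s \<in> J" for s by (rule f_nonzero) (use that z b nz 2(2) in \<open>auto simp: J_def\<close>)
    qed
    show ?thesis
    proof (rule that[OF 2(1)])
      fix s assume s: "s \<in> {z<..<z+d}" "s < b"
      then obtain u where u: "u \<in> {z<..<s}" "0 < f u" using down[of s] by auto
      have "u \<in> J" "s \<in> J" using u s by (auto simp: J_def)
      then show "0 < f s" using sg u(2) by force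
    qed
  qed
qed

lemma f_negative_before_zero:
  assumes z: "z \<in> {0..l}" "\<phi> z = 0" and a: "0 \<le> a" "a < z" and nz: "\<And>s. s \<in> {a<..<z} \<Longrightarrow> \<phi> s \<noteq> 0"
  obtains \<delta> where "\<delta> > 0" "\<And>s. s \<in> {z-\<delta><..<z} \<Longrightarrow> a < s \<Longrightarrow> f s < 0"
proof -
  have up: "\<exists>u\<in>{s<..<z}. f u < 0" if s: "s \<in> {a<..<z}" for s
  proof (rule ccontr)
    assume "\<not> ?thesis"
    then have "norm (\<phi> s) \<le> norm (\<phi> z)"
      by (intro norm_phi_increase(1)) (use s a z nz in \<open>auto simp: not_less\<close>)
    then show False using z(2) nz[OF s] by simp
  qed
  from near_zero_cases[OF z] show ?thesis
  proof cases
    case (1 d)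
    show ?thesis
    proof (rule that[OF 1(1)])
      fix s assume s: "s \<in> {z-d<..<z}" "a < s"
      then obtain u where u: "u \<in> {s<..<z}" "f u < 0" using up[of s] by auto
      have "f s \<le> f u"
        by (rule f_mono) (use u s z a nz 1(2) in \<open>auto intro!: less_imp_le\<close>)
      then show "f s < 0" using u by simp
    qed
  next
    case (2 d)
    define J where "J = {max a (z - d)<..<z}"
    have sg: "(\<forall>s\<in>J. 0 < f s) \<or> (\<forall>s\<in>J. f s < 0)"
    proof (rule nonvanishing_sign)
      show "connected J" by (simp add: J_def)
      show "continuous_on J f" by (rule continuous_on_subset[OF f_continuous]) (use z a nz in \<open>auto simp: J_def\<close>)
      show "f s \<noteq> 0" if "s \<in> J" for s by (rule f_nonzero) (use that z a nz 2(2) in \<open>auto simp: J_def\<close>)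
    qed
    show ?thesis
    proof (rule that[OF 2(1)])
      fix s assume s: "s \<in> {z-d<..<z}" "a < s"
      then obtain u where u: "u \<in> {s<..<z}" "f u < 0" using up[of s] by auto
      have "u \<in> J" "s \<in> J" using u s by (auto simp: J_def)
      then show "f s < 0" using sg u(2) by force
    qed
  qed
qed

text \<open>An arc between two zeros near z would have \<open>f\<close> positive after its first end
  and negative before its second, which neither regime permits.\<close>

lemma no_short_arc:
  assumes z: "z \<in> {0..l}" "\<phi> z = 0"
  shows "\<exists>\<delta>>0. \<forall>a b. a \<in> {0..l} \<longrightarrow> b \<in> {0..l} \<longrightarrow> a < b \<longrightarrow> \<bar>a - z\<bar> < \<delta> \<longrightarrow> \<bar>b - z\<bar> < \<delta> \<longrightarrow>
    \<phi> a = 0 \<longrightarrow> \<phi> b = 0 \<longrightarrow> (\<exists>s\<in>{a<..<b}. \<phi> s = 0)"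
proof -
  obtain d where d: "d > 0" "(\<forall>s\<in>{0..l}. \<bar>s - z\<bar> < d \<longrightarrow> \<tau> s < 0) \<or> (\<forall>s\<in>{0..l}. \<bar>s - z\<bar> < d \<longrightarrow> \<bar>\<tau> s\<bar> < 1)"
    using near_zero_cases[OF z] by metis
  have "\<exists>s\<in>{a<..<b}. \<phi> s = 0"
    if ab: "a \<in> {0..l}" "b \<in> {0..l}" "a < b" "\<bar>a - z\<bar> < d" "\<bar>b - z\<bar> < d" "\<phi> a = 0" "\<phi> b = 0" for a b
  proof (rule ccontr)
    assume "\<not> ?thesis"
    then have nz: "\<And>s. s \<in> {a<..<b} \<Longrightarrow> \<phi> s \<noteq> 0" by blast
    obtain d1 where d1: "d1 > 0" "\<And>s. s \<in> {a<..<a+d1} \<Longrightarrow> s < b \<Longrightarrow> 0 < f s"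
      by (rule f_positive_after_zero[OF ab(1,6,3) _ nz]) (use ab in auto)
    obtain d2 where d2: "d2 > 0" "\<And>s. s \<in> {b-d2<..<b} \<Longrightarrow> a < s \<Longrightarrow> f s < 0"
      by (rule f_negative_before_zero[OF ab(2,7) _ ab(3) nz]) (use ab in auto)
    define u where "u = min (a + d1 / 2) (a + (b - a) / 3)"
    define v where "v = max (b - d2 / 2) (b - (b - a) / 3)"
    have u: "a < u" "u < a + d1" "u \<le> a + (b - a) / 3" using d1(1) ab(3) by (auto simp: u_def min_def)
    have v: "v < b" "b - d2 < v" "b - (b - a) / 3 \<le> v" using d2(1) ab(3) by (auto simp: v_def max_def)
    have uv: "u < v" using u(3) v(3) ab(3) by (simp add: field_simps)
    have fu: "0 < f u" using d1(2)[of u] u uv v by auto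
    have fv: "f v < 0" using d2(2)[of v] u uv v by auto
    have near: "s \<in> {0..l} \<and> \<bar>s - z\<bar> < d" if "s \<in> {u..v}" for s using that u v ab by auto
    from d(2) show False
    proof
      assume neg: "\<forall>s\<in>{0..l}. \<bar>s - z\<bar> < d \<longrightarrow> \<tau> s < 0"
      have "f u \<le> f v"
        by (rule f_mono) (use near neg uv u v nz ab in \<open>auto intro!: less_imp_le\<close>)
      then show False using fu fv by simp
    next
      assume tr: "\<forall>s\<in>{0..l}. \<bar>s - z\<bar> < d \<longrightarrow> \<bar>\<tau> s\<bar> < 1"
      have sg: "(\<forall>s\<in>{u..v}. 0 < f s) \<or> (\<forall>s\<in>{u..v}. f s < 0)"
      proof (rule nonvanishing_sign)
        show "connected {u..v}" by simp
        show "continuous_on {u..v} f" by (rule continuous_on_subset[OF f_continuous]) (use u v nz near in auto)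
        show "f s \<noteq> 0" if "s \<in> {u..v}" for s by (rule f_nonzero) (use that near tr u v nz in auto)
      qed
      then show False using fu fv uv by (meson atLeastAtMost_iff less_imp_le order_refl less_asym)
    qed
  qed
  then show ?thesis using d(1) by blast
qed

lemma zeros_locally_convex:
  assumes z: "z \<in> {0..l}"
  shows "\<exists>\<delta>>0. \<forall>x\<in>{s\<in>{0..l}. \<phi> s = 0} \<inter> ball z \<delta>. \<forall>y\<in>{s\<in>{0..l}. \<phi> s = 0} \<inter> ball z \<delta>.
    \<forall>s. x \<le> s \<and> s \<le> y \<longrightarrow> s \<in> {s\<in>{0..l}. \<phi> s = 0}"
proof (cases "\<phi> z = 0")
  case False
  then obtain d where d: "d > 0" "\<And>s. s \<in> {0..l} \<Longrightarrow> dist s z < d \<Longrightarrow> dist (\<phi> s) (\<phi> z) < norm (\<phi> z)"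
    using continuous_phi z unfolding continuous_on_iff by (metis zero_less_norm_iff)
  have "\<phi> s \<noteq> 0" if "s \<in> {0..l}" "s \<in> ball z d" for s
    using d(2)[OF that(1)] that(2) by (auto simp: dist_commute)
  then show ?thesis using d(1) by blast
next
  case True
  obtain d where d: "d > 0" "\<And>a b. a \<in> {0..l} \<Longrightarrow> b \<in> {0..l} \<Longrightarrow> a < b \<Longrightarrow> \<bar>a - z\<bar> < d \<Longrightarrow> \<bar>b - z\<bar> < d \<Longrightarrow>
    \<phi> a = 0 \<Longrightarrow> \<phi> b = 0 \<Longrightarrow> \<exists>s\<in>{a<..<b}. \<phi> s = 0"
    using no_short_arc[OF z True] by blast
  have "s \<in> {s\<in>{0..l}. \<phi> s = 0}"
    if xy: "x \<in> {s\<in>{0..l}. \<phi> s = 0} \<inter> ball z d" "y \<in> {s\<in>{0..l}. \<phi> s = 0} \<inter> ball z d" and s: "x \<le> s" "s \<le> y" for x y s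
  proof (rule ccontr)
    assume "\<not> ?thesis"
    then have "norm (\<phi> s) \<noteq> 0" using xy s by auto
    moreover have "continuous_on {x..y} (\<lambda>s. norm (\<phi> s))"
      by (rule continuous_on_subset[OF continuous_norm_phi]) (use xy in auto)
    ultimately obtain a b where ab: "x \<le> a" "a < s" "s < b" "b \<le> y" "norm (\<phi> a) = 0" "norm (\<phi> b) = 0"
      "\<And>u. u \<in> {a<..<b} \<Longrightarrow> norm (\<phi> u) \<noteq> 0"
      using zeros_gap[of x y "\<lambda>s. norm (\<phi> s)" s] xy s by auto
    have "\<exists>s\<in>{a<..<b}. \<phi> s = 0"
      by (rule d(2)) (use ab xy in \<open>auto simp: dist_real_def\<close>)
    then show False using ab(7) by auto
  qed
  then show ?thesis using d(1) by blast
qed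

lemma finite_arcs: "finite (components {s\<in>{0..l}. \<phi> s \<noteq> 0})"
proof -
  have "finite (components ({0..l} - {s\<in>{0..l}. \<phi> s = 0}))"
    by (rule finite_components_locally_convex_complement[OF zeros_locally_convex]) auto
  moreover have "{0..l} - {s\<in>{0..l}. \<phi> s = 0} = {s\<in>{0..l}. \<phi> s \<noteq> 0}" by auto
  ultimately show ?thesis by simp
qed

end

section \<open>Arcs as connected components\<close>

context multiplier_with_zero
begin

text \<open>The plane of an arc is spanned by \<open>lam\<close> and \<open>c\<close> at one of its
  points s1: vectors orthogonal to both are annihilated by W s1 = lam \<and> c s1, so the curve has
  constant components along them. The two vectors are independent because
  \<open>\<phi> s1 \<noteq> 0\<close>.\<close>

lemma arc_properties:
  assumes C: "C \<in> components {s\<in>{0..l}. \<phi> s \<noteq> 0}"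
  shows "is_interval C" and "C \<subseteq> {0..l}" and "openin (top_of_set {0..l}) C"
    and "\<exists>P. affine P \<and> aff_dim P = 2 \<and> \<gamma> ` closure C \<union> range (\<lambda>t. \<gamma> z0 + t *\<^sub>R lam) \<subseteq> P"
    and "\<And>s0. s0 \<in> closure C - C \<Longrightarrow> \<exists>\<delta>>0. (\<forall>s\<in>{s0<..<s0+\<delta>} \<inter> C. 0 < f s) \<and> (\<forall>s\<in>{s0-\<delta><..<s0} \<inter> C. f s < 0)"
proof -
  let ?S = "{s\<in>{0..l}. \<phi> s \<noteq> 0}"
  have CS: "C \<subseteq> ?S" and ne: "C \<noteq> {}" and con: "connected C"
    using in_components_subset[OF C] in_components_nonempty[OF C] in_components_connected[OF C] by auto
  show int: "is_interval C" using con is_interval_connected_1 by blast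
  show sub: "C \<subseteq> {0..l}" using CS by auto
  have opS: "openin (top_of_set {0..l}) ?S"
  proof -
    have "openin (top_of_set {0..l}) ({0..l} \<inter> \<phi> -` (- {0}))"
      by (rule continuous_openin_preimage_gen[OF continuous_phi]) auto
    moreover have "{0..l} \<inter> \<phi> -` (- {0}) = ?S" by auto
    ultimately show ?thesis by simp
  qed
  have "locally connected {0..l}" by (rule convex_imp_locally_connected) simp
  then show "openin (top_of_set {0..l}) C"
    unfolding locally_connected_open_component using opS C by blast
  have bC: "bounded C" using sub bounded_subset bounded_closed_interval by blast
  obtain a b where ab: "a \<le> b" "closure C = {a..b}" "{a<..<b} \<subseteq> C" "C \<subseteq> {a..b}"
    by (rule interval_closure_cases[OF int bC ne]) (rule that)
  have "{a..b} \<subseteq> {0..l}" using closure_minimal[OF sub] ab(2) by simp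
  then have abl: "0 \<le> a" "b \<le> l" using ab(1) by auto
  \<comment> \<open>A limit point of a component with \<open>\<phi> \<noteq> 0\<close> could be
    added without losing connectedness, against maximality.\<close>
  have end_zero: "\<phi> e = 0" if e: "e \<in> closure C - C" for e
  proof (rule ccontr)
    assume nz: "\<phi> e \<noteq> 0"
    have el: "e \<in> {0..l}" using e ab(2) abl by auto
    have "connected (insert e C)"
      by (rule connected_intermediate_closure[OF con]) (use e closure_subset in auto)
    moreover have "insert e C \<subseteq> ?S" using CS nz el by auto
    ultimately have "insert e C \<subseteq> C" using components_maximal[OF C] ne by blast
    then show False using e by auto
  qed
  obtain s1 where s1: "s1 \<in> C" using ne by blast
  have s1l: "s1 \<in> {0..l}" "\<phi> s1 \<noteq> 0" using s1 CS by auto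
  define D where "D = span {lam, c s1}"
  have subD: "subspace D" by (simp add: D_def)
  have memD: "c s \<in> D" if s: "s \<in> C" for s
  proof -
    have seg: "\<phi> r \<noteq> 0" if "r \<in> {min s s1..max s s1}" for r
    proof -
      have "r \<in> C" using int s s1 that unfolding is_interval_1 by (metis atLeastAtMost_iff min_def max_def)
      then show ?thesis using CS by auto
    qed
    have "c s \<in> orthogonal_comp (orthogonal_comp D)"
      unfolding orthogonal_comp_def[of "orthogonal_comp D"]
    proof clarify
      fix x assume "x \<in> orthogonal_comp D"
      then have xD: "\<And>y. y \<in> D \<Longrightarrow> y \<bullet> x = 0" by (auto simp: orthogonal_comp_def orthogonal_def)
      have x: "lam \<bullet> x = 0" "c s1 \<bullet> x = 0" by (auto intro!: xD span_base simp: D_def)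
      then have "W s1 *v x = 0" by (simp add: W_c wedge_mult_vec)
      then have "\<gamma> s \<bullet> x = \<gamma> s1 \<bullet> x"
        by (intro arc_normal_components_constant[of "min s s1" "max s s1" s1 x s, OF _ _ _ seg])
           (use s s1 sub x(1) in auto)
      then have "c s \<bullet> x = 0" using x(2) by (simp add: c_def inner_diff_left)
      then show "orthogonal x (c s)" by (simp add: orthogonal_def inner_commute)
    qed
    then show ?thesis using orthogonal_comp_self[OF subD] by simp
  qed
  show "\<exists>P. affine P \<and> aff_dim P = 2 \<and> \<gamma> ` closure C \<union> range (\<lambda>t. \<gamma> z0 + t *\<^sub>R lam) \<subseteq> P"
  proof (intro exI conjI)
    define P where "P = (+) (\<gamma> z0) ` D"
    show aff: "affine P" unfolding P_def using subspace_imp_affine[OF subD] affine_translation by blast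
    have "c s1 \<notin> span {lam}" using phi_zero_iff[OF s1l(1)] s1l(2) by simp
    then have "independent {c s1, lam}" "c s1 \<noteq> lam"
      using norm_lam by (auto simp: independent_insert span_base)
    then have "dim D = 2" unfolding D_def dim_span by (subst dim_eq_card_independent) (auto simp: insert_commute)
    then show "aff_dim P = 2" unfolding P_def using aff_dim_translation_eq[of "\<gamma> z0" D] aff_dim_subspace[OF subD] by simp
    have memP: "x \<in> P" if "x - \<gamma> z0 \<in> D" for x
      unfolding P_def using that by (intro image_eqI[of _ _ "x - \<gamma> z0"]) auto
    have "\<gamma> ` closure C \<subseteq> P"
    proof (rule image_closure_subset)
      show "continuous_on (closure C) \<gamma>"
        by (rule continuous_on_subset[OF WD_continuous[OF WD_gamma]]) (use ab abl in auto)
      show "closed P" unfolding P_def by (intro closed_translation closed_subspace subD)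
      show "\<gamma> ` C \<subseteq> P"
      proof
        fix y assume "y \<in> \<gamma> ` C"
        then obtain s where s: "s \<in> C" "y = \<gamma> s" by blast
        have "y - \<gamma> z0 \<in> D" using memD[OF s(1)] s(2) by (simp add: c_def)
        then show "y \<in> P" by (rule memP)
      qed
    qed
    moreover have "range (\<lambda>t. \<gamma> z0 + t *\<^sub>R lam) \<subseteq> P"
    proof
      fix y assume "y \<in> range (\<lambda>t. \<gamma> z0 + t *\<^sub>R lam)"
      then obtain t where "y = \<gamma> z0 + t *\<^sub>R lam" by blast
      moreover have "t *\<^sub>R lam \<in> D" unfolding D_def by (intro span_scale span_base) simp
      ultimately show "y \<in> P" by (intro memP) simp
    qed
    ultimately show "\<gamma> ` closure C \<union> range (\<lambda>t. \<gamma> z0 + t *\<^sub>R lam) \<subseteq> P" by blast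
  qed
  show "\<exists>\<delta>>0. (\<forall>s\<in>{e<..<e+\<delta>} \<inter> C. 0 < f s) \<and> (\<forall>s\<in>{e-\<delta><..<e} \<inter> C. f s < 0)"
    if e: "e \<in> closure C - C" for e
  proof -
    have el: "e \<in> {0..l}" using e ab(2) abl by auto
    have pe: "\<phi> e = 0" by (rule end_zero[OF e])
    have nz: "\<phi> s \<noteq> 0" if "s \<in> {a<..<b}" for s using that ab(3) CS by auto
    have eab: "e = a \<or> e = b"
    proof (rule ccontr)
      assume "\<not> ?thesis"
      then have "e \<in> {a<..<b}" using e ab(2) by auto
      then show False using ab(3) e by blast
    qed
    have "a < b"
    proof (rule ccontr)
      assume "\<not> a < b"
      then have "s1 = e" using eab s1 ab(1,4) by auto
      then show False using s1 e by simp
    qed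
    from eab show ?thesis
    proof
      assume ea: "e = a"
      obtain d where d: "d > 0" "\<And>s. s \<in> {e<..<e+d} \<Longrightarrow> s < b \<Longrightarrow> 0 < f s"
        by (rule f_positive_after_zero[OF el pe _ abl(2)]) (use ea \<open>a < b\<close> nz in auto)
      show ?thesis
      proof (intro exI[of _ "min d (b - a)"] conjI ballI)
        show "0 < min d (b - a)" using d(1) \<open>a < b\<close> by simp
        show "0 < f s" if "s \<in> {e<..<e + min d (b - a)} \<inter> C" for s using d(2)[of s] that ea by auto
        show "f s < 0" if "s \<in> {e - min d (b - a)<..<e} \<inter> C" for s using that ea ab(4) by auto
      qed
    next
      assume eb: "e = b"
      obtain d where d: "d > 0" "\<And>s. s \<in> {e-d<..<e} \<Longrightarrow> a < s \<Longrightarrow> f s < 0"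
        by (rule f_negative_before_zero[OF el pe abl(1)]) (use eb \<open>a < b\<close> nz in auto)
      show ?thesis
      proof (intro exI[of _ "min d (b - a)"] conjI ballI)
        show "0 < min d (b - a)" using d(1) \<open>a < b\<close> by simp
        show "0 < f s" if "s \<in> {e<..<e + min d (b - a)} \<inter> C" for s using that eb ab(4) by auto
        show "f s < 0" if "s \<in> {e - min d (b - a)<..<e} \<inter> C" for s using d(2)[of s] that eb by auto
      qed
    qed
  qed
qed

lemma planar_arcs:
  "\<exists>p::real ^ 'n. \<exists>N::nat. \<exists>J::nat \<Rightarrow> real set.
          (\<forall>i<N. is_interval (J i) \<and> J i \<subseteq> {0..l} \<and> openin (top_of_set {0..l}) (J i))
        \<and> (\<forall>i<N. \<forall>j<N. i \<noteq> j \<longrightarrow> J i \<inter> J j = {})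
        \<and> {s\<in>{0..l}. \<gamma> s \<in> range (\<lambda>t. p + t *\<^sub>R lam)} = {0..l} - (\<Union>i<N. J i)
        \<and> (\<forall>i<N. \<exists>P. affine P \<and> aff_dim P = 2 \<and>
               \<gamma> ` closure (J i) \<union> range (\<lambda>t. p + t *\<^sub>R lam) \<subseteq> P)
        \<and> (\<exists>h. weak_deriv l T h \<and>
             (\<forall>i<N. continuous_on (J i) (\<lambda>s. \<alpha> s *\<^sub>R h s)
                \<and> (\<forall>s\<in>J i. \<alpha> s * norm (h s) = k)
                \<and> (\<forall>s0 \<in> closure (J i) - J i. \<exists>\<delta>>0.
                     (\<forall>s\<in>{s0<..<s0+\<delta>} \<inter> J i. lam \<bullet> h s > 0)
                   \<and> (\<forall>s\<in>{s0-\<delta><..<s0} \<inter> J i. lam \<bullet> h s < 0))))"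
proof -
  let ?S = "{s\<in>{0..l}. \<phi> s \<noteq> 0}"
  define N where "N = card (components ?S)"
  obtain J where J: "bij_betw J {0..<N} (components ?S)"
    using ex_bij_betw_nat_finite[OF finite_arcs] unfolding N_def by blast
  have JC: "J i \<in> components ?S" if "i < N" for i using bij_betw_apply[OF J, of i] that by auto
  have UJ: "(\<Union>i<N. J i) = ?S"
  proof -
    have "J ` {..<N} = components ?S" using bij_betw_imp_surj_on[OF J] by (simp add: atLeast0LessThan)
    then show ?thesis using Union_components[of ?S] by metis
  qed
  \<comment> \<open>On the arcs the representative is given by the formula, so that continuity and
    signs hold pointwise; elsewhere the curvature is left as it is.\<close>
  define h' where "h' s = (if \<phi> s = 0 then h s else (k / (\<alpha> s * norm (\<phi> s))) *\<^sub>R \<phi> s)" for s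
  have "AE s\<in>{0..l} in lebesgue. h s = h' s"
    using h_phi by eventually_elim (auto simp: h'_def)
  then have "WD 0 l T h'" by (rule WD_cong_AE[OF WD_T])
  then have wd: "weak_deriv l T h'" by (simp add: WD_iff_weak_deriv)
  have on_arc: "\<alpha> s *\<^sub>R h' s = (k / norm (\<phi> s)) *\<^sub>R \<phi> s" "\<alpha> s * norm (h' s) = k" "lam \<bullet> h' s = (k / \<alpha> s) * f s"
    if "s \<in> ?S" for s
    using that alpha_pos[of s] k_pos by (auto simp: h'_def f_def)
  show ?thesis
  proof (intro exI[of _ "\<gamma> z0"] exI[of _ N] exI[of _ J] exI[of _ h'] conjI allI impI ballI wd)
    fix i assume i: "i < N"
    note C = JC[OF i]
    have CS: "J i \<subseteq> ?S" by (rule in_components_subset[OF C])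
    show "is_interval (J i)" "J i \<subseteq> {0..l}" "openin (top_of_set {0..l}) (J i)"
      "\<exists>P. affine P \<and> aff_dim P = 2 \<and> \<gamma> ` closure (J i) \<union> range (\<lambda>t. \<gamma> z0 + t *\<^sub>R lam) \<subseteq> P"
      using arc_properties[OF C] by blast+
    show "J i \<inter> J j = {}" if "j < N" "i \<noteq> j" for j
    proof -
      have "J i \<noteq> J j" using J i that by (auto simp: bij_betw_def inj_on_def)
      then show ?thesis using components_nonoverlap[OF C JC[OF that(1)]] by blast
    qed
    show "continuous_on (J i) (\<lambda>s. \<alpha> s *\<^sub>R h' s)"
    proof -
      have "continuous_on (J i) (\<lambda>s. (k / norm (\<phi> s)) *\<^sub>R \<phi> s)"
        by (intro continuous_intros continuous_on_subset[OF continuous_phi]) (use CS in auto)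
      moreover have "(k / norm (\<phi> s)) *\<^sub>R \<phi> s = \<alpha> s *\<^sub>R h' s" if "s \<in> J i" for s
        using on_arc(1)[of s] CS that by auto
      ultimately show ?thesis by (rule continuous_on_eq)
    qed
    show "\<alpha> s * norm (h' s) = k" if "s \<in> J i" for s using on_arc(2)[of s] CS that by blast
    fix e assume e: "e \<in> closure (J i) - J i"
    obtain d where d: "d > 0" "\<forall>s\<in>{e<..<e+d} \<inter> J i. 0 < f s" "\<forall>s\<in>{e-d<..<e} \<inter> J i. f s < 0"
      using arc_properties(5)[OF C e] by blast
    have sgn: "lam \<bullet> h' s > 0 \<longleftrightarrow> f s > 0" "lam \<bullet> h' s < 0 \<longleftrightarrow> f s < 0" if "s \<in> J i" for s
    proof -
      have s: "s \<in> ?S" using CS that by blast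
      have "k / \<alpha> s > 0" using k_pos alpha_pos[of s] s by simp
      then show "lam \<bullet> h' s > 0 \<longleftrightarrow> f s > 0" "lam \<bullet> h' s < 0 \<longleftrightarrow> f s < 0"
        unfolding on_arc(3)[OF s] by (metis mult_less_cancel_left_pos mult_zero_right)+
    qed
    show "\<exists>\<delta>>0. (\<forall>s\<in>{e<..<e+\<delta>} \<inter> J i. lam \<bullet> h' s > 0) \<and> (\<forall>s\<in>{e-\<delta><..<e} \<inter> J i. lam \<bullet> h' s < 0)"
      using d sgn by (intro exI[of _ d]) auto
  next
    have "\<gamma> s \<in> range (\<lambda>t. \<gamma> z0 + t *\<^sub>R lam) \<longleftrightarrow> c s \<in> span {lam}" for s
      by (auto simp: span_singleton c_def image_iff algebra_simps)
    then show "{s\<in>{0..l}. \<gamma> s \<in> range (\<lambda>t. \<gamma> z0 + t *\<^sub>R lam)} = {0..l} - (\<Union>i<N. J i)"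
      unfolding UJ using phi_zero_iff by auto
  qed
qed

end

section \<open>Straight curves and the equivalence\<close>

lemma (in curve) zero_curvature_straight:
  assumes "k = 0"
  shows "s \<in> {0..l} \<Longrightarrow> \<gamma> s = a1 + s *\<^sub>R T1"
proof -
  assume s: "s \<in> {0..l}"
  have h0: "AE s\<in>{0..l} in lebesgue. h s = 0"
    using h_bound
  proof eventually_elim
    case (elim s)
    show ?case
    proof
      assume s: "s \<in> {0..l}"
      then have "\<alpha> s * norm (h s) \<le> 0" using elim assms by simp
      then show "h s = 0" using alpha_pos[OF s] by (simp add: mult_le_0_iff)
    qed
  qed
  have Tc: "T t = T1" if t: "t \<in> {0..l}" for t
  proof -
    have "T 0 = T t"
      by (rule WD_const_if_zero[OF WD_subset[OF WD_T]]) (use t h0 in \<open>auto elim!: eventually_mono\<close>)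
    then show ?thesis using T_ends by simp
  qed
  have "WD 0 l (\<lambda>t. \<gamma> t - t *\<^sub>R T1) (\<lambda>t. T t - (1 *\<^sub>R T1 + t *\<^sub>R 0))"
    by (intro WD_diff WD_gamma WD_scaleR WD_ident WD_const l_nonneg)
  then have "\<gamma> 0 - 0 *\<^sub>R T1 = \<gamma> s - s *\<^sub>R T1"
    by (intro WD_const_if_zero[OF WD_subset]) (use s Tc in auto)
  then show "\<gamma> s = a1 + s *\<^sub>R T1" using gamma_ends by (simp add: algebra_simps)
qed

theorem mainTheorem3:
  fixes l :: real and \<alpha> :: "real \<Rightarrow> real"
    and a1 a2 T1 T2 :: "real ^ 'n" and \<gamma> :: "real \<Rightarrow> real ^ 'n"
  assumes n2: "CARD('n) \<ge> 2"
    and l_pos: "l > 0"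
    and alpha_pos: "\<forall>s\<in>{0..l}. \<alpha> s > 0"
    and alpha_bv: "bounded_variation_on 0 l \<alpha>"
    and alpha_inv_bdd: "bounded ((\<lambda>s. 1 / \<alpha> s) ` {0..l})"
    and T1: "norm T1 = 1" and T2: "norm T2 = 1"
    and gamma_adm: "adm l a1 a2 T1 T2 \<gamma>"
  defines "T \<equiv> vel l \<gamma>"
    and "k \<equiv> K_alpha l \<alpha> \<gamma>"
  shows "inf_elastica l \<alpha> a1 a2 T1 T2 \<gamma> \<longleftrightarrow>
    (\<exists>lam::real ^ 'n. norm lam = 1 \<and>
      ((\<exists>p::real ^ 'n. \<exists>N::nat. \<exists>J::nat \<Rightarrow> real set.
          (\<forall>i<N. is_interval (J i) \<and> J i \<subseteq> {0..l} \<and> openin (top_of_set {0..l}) (J i))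
        \<and> (\<forall>i<N. \<forall>j<N. i \<noteq> j \<longrightarrow> J i \<inter> J j = {})
        \<and> {s\<in>{0..l}. \<gamma> s \<in> range (\<lambda>t. p + t *\<^sub>R lam)} = {0..l} - (\<Union>i<N. J i)
        \<and> (\<forall>i<N. \<exists>P. affine P \<and> aff_dim P = 2 \<and>
               \<gamma> ` closure (J i) \<union> range (\<lambda>t. p + t *\<^sub>R lam) \<subseteq> P)
        \<and> (\<exists>h. weak_deriv l T h \<and>
             (\<forall>i<N. continuous_on (J i) (\<lambda>s. \<alpha> s *\<^sub>R h s)
                \<and> (\<forall>s\<in>J i. \<alpha> s * norm (h s) = k)
                \<and> (\<forall>s0 \<in> closure (J i) - J i. \<exists>\<delta>>0.
                     (\<forall>s\<in>{s0<..<s0+\<delta>} \<inter> J i. lam \<bullet> h s > 0)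
                   \<and> (\<forall>s\<in>{s0-\<delta><..<s0} \<inter> J i. lam \<bullet> h s < 0)))))
       \<or>
       ((\<exists>A::(real ^ 'n) set. affine A \<and> aff_dim A \<le> 3 \<and> \<gamma> ` {0..l} \<subseteq> A)
        \<and> (\<exists>h. weak_deriv l T h
             \<and> (\<exists>L. L-lipschitz_on {0..l} (\<lambda>s. \<alpha> s *\<^sub>R h s))
             \<and> (\<forall>s\<in>{0..l}. \<alpha> s * norm (h s) = k)
             \<and> (\<exists>w g. weak_deriv l (\<lambda>s. \<alpha> s *\<^sub>R h s) w
                  \<and> W2inf l (g :: real \<Rightarrow> real) \<and> (\<forall>s\<in>{0..l}. g s > 0)
                  \<and> (AE s in lebesgue. s \<in> {0<..<l} \<longrightarrow>
                        g s *\<^sub>R (w s + (k\<^sup>2 / \<alpha> s) *\<^sub>R T s) = k\<^sup>2 *\<^sub>R proj_perp (T s) (h s) lam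
                      \<and> vel l g s = \<alpha> s * (lam \<bullet> h s)))))))"
    (is "_ \<longleftrightarrow> (\<exists>lam. norm lam = 1 \<and> (?arcs lam \<or> ?system lam))")
proof -
  interpret curve l \<alpha> a1 a2 T1 T2 \<gamma>
    using l_pos alpha_pos alpha_bv alpha_inv_bdd gamma_adm by unfold_locales auto
  show ?thesis
  proof
    assume "\<exists>lam. norm lam = 1 \<and> (?arcs lam \<or> ?system lam)"
    then obtain lam :: "real ^ 'n" where "norm lam = 1 \<and> (?arcs lam \<or> ?system lam)" ..
    then have lam: "norm lam = 1" and "?arcs lam \<or> ?system lam" by (rule conjunct1, rule conjunct2)
    from this(2) show "inf_elastica l \<alpha> a1 a2 T1 T2 \<gamma>"
    proof
      assume "?arcs lam"
      then show ?thesis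
        unfolding T_def k_def
      proof (elim exE conjE, goal_cases)
        case (1 p N J h)
        show ?case
        proof (rule planar_arcs_imp_elastica[where lam = lam and N = N and J = J and p = p and h' = h, OF lam(1)])
          fix i assume i: "i < N"
          note a = mp[OF spec[OF 1(1)] i] and b = mp[OF spec[OF 1(6)] i]
          show "is_interval (J i)" by (rule conjunct1[OF a])
          show "J i \<subseteq> {0..l}" by (rule conjunct1[OF conjunct2[OF a]])
          show "openin (top_of_set {0..l}) (J i)" by (rule conjunct2[OF conjunct2[OF a]])
          show "J i \<inter> J j = {}" if "j < N" "i \<noteq> j" for j using 1(2) i that by simp
          show "\<exists>P. affine P \<and> aff_dim P = 2 \<and> \<gamma> ` closure (J i) \<union> range (\<lambda>t. p + t *\<^sub>R lam) \<subseteq> P"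
            by (rule mp[OF spec[OF 1(4)] i])
          show "continuous_on (J i) (\<lambda>s. \<alpha> s *\<^sub>R h s)" by (rule conjunct1[OF b])
          show "\<alpha> s * norm (h s) = K_alpha l \<alpha> \<gamma>" if "s \<in> J i" for s
            by (rule bspec[OF conjunct1[OF conjunct2[OF b]] that])
          show "\<exists>\<delta>>0. (\<forall>s\<in>{e<..<e + \<delta>} \<inter> J i. 0 < lam \<bullet> h s) \<and> (\<forall>s\<in>{e - \<delta><..<e} \<inter> J i. lam \<bullet> h s < 0)"
            if "e \<in> closure (J i) - J i" for e
            by (rule bspec[OF conjunct2[OF conjunct2[OF b]] that])
        qed (use 1(3,5) in simp_all)
      qed
    next
      assume "?system lam"
      then show ?thesis
        unfolding T_def k_def
      proof (elim exE conjE, goal_cases)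
        case (1 A h L w g)
        show ?case
          by (rule lipschitz_system_imp_elastica[where lam = lam and h' = h and L = L and w = w and g = g, OF lam(1)])
             (use 1 in blast)+
      qed
    qed
  next
    assume ela: "inf_elastica l \<alpha> a1 a2 T1 T2 \<gamma>"
    show "\<exists>lam. norm lam = 1 \<and> (?arcs lam \<or> ?system lam)"
    proof (cases "k = 0")
      case True
      then have line: "\<gamma> s = a1 + s *\<^sub>R T1" if "s \<in> {0..l}" for s
        using zero_curvature_straight that unfolding k_def by blast
      have wdh: "weak_deriv l T (acc l \<gamma>)" using WD_T unfolding T_def by (simp add: WD_iff_weak_deriv)
      \<comment> \<open>A straight curve satisfies (i) with its own line, direction T1 and no
        arcs.\<close>
      have arcs: "?arcs T1"
        by (rule exI[of _ a1], rule exI[of _ "0::nat"], rule exI[of _ "\<lambda>_. {}"]) (use wdh line in auto)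
      show ?thesis by (rule exI[of _ T1], rule conjI[OF T1 disjI1[OF arcs]])
    next
      case False
      then have kp: "0 < K_alpha l \<alpha> \<gamma>" using k_nonneg by (simp add: k_def)
      obtain lam0 W0 where m0: "multiplier l \<alpha> a1 a2 T1 T2 \<gamma> lam0 W0"
      proof (rule elastica_imp_multiplier[OF ela kp])
        fix lam W0
        assume "skew W0" "\<And>s. s \<in> {0..l} \<Longrightarrow> wedge lam (\<gamma> s) + W0 = wedge ((wedge lam (\<gamma> s) + W0) *v vel l \<gamma> s) (vel l \<gamma> s)"
          "AE s\<in>{0..l} in lebesgue. (wedge lam (\<gamma> s) + W0) *v vel l \<gamma> s \<noteq> 0 \<longrightarrow>
            acc l \<gamma> s = (K_alpha l \<alpha> \<gamma> / (\<alpha> s * norm ((wedge lam (\<gamma> s) + W0) *v vel l \<gamma> s))) *\<^sub>R ((wedge lam (\<gamma> s) + W0) *v vel l \<gamma> s)"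
          "\<exists>s\<in>{0..l}. (wedge lam (\<gamma> s) + W0) *v vel l \<gamma> s \<noteq> 0"
        then have "multiplier l \<alpha> a1 a2 T1 T2 \<gamma> lam W0"
          using kp by unfold_locales
        then show ?thesis by (rule that)
      qed
      have "\<exists>lam W0. multiplier l \<alpha> a1 a2 T1 T2 \<gamma> lam W0 \<and> (norm lam = 1 \<or> lam = 0)"
      proof (cases "lam0 = 0")
        case True then show ?thesis using m0 by blast
      next
        case False
        then have "multiplier l \<alpha> a1 a2 T1 T2 \<gamma> (inverse (norm lam0) *\<^sub>R lam0) (inverse (norm lam0) *\<^sub>R W0)"
          by (intro multiplier.rescaled[OF m0]) simp
        moreover have "norm (inverse (norm lam0) *\<^sub>R lam0) = 1" using False by simp
        ultimately show ?thesis by blast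
      qed
      then obtain lam W1 where m: "multiplier l \<alpha> a1 a2 T1 T2 \<gamma> lam W1" and lam: "norm lam = 1 \<or> lam = 0" by blast
      interpret M: multiplier l \<alpha> a1 a2 T1 T2 \<gamma> lam W1 by (rule m)
      show ?thesis
      proof (cases "\<exists>z\<in>{0..l}. M.\<phi> z = 0")
        case False
        then have nz: "\<And>s. s \<in> {0..l} \<Longrightarrow> M.\<phi> s \<noteq> 0" by blast
        have "\<exists>e. norm e = 1 \<and> ?system e"
          using M.nonvanishing_system[OF lam nz] unfolding T_def k_def .
        then obtain e where e: "norm e = 1 \<and> ?system e" ..
        show ?thesis by (rule exI[of _ e], rule conjI[OF conjunct1[OF e] disjI2[OF conjunct2[OF e]]])
      next
        case True
        then obtain z where z: "z \<in> {0..l}" "M.\<phi> z = 0" by blast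
        \<comment> \<open>With \<open>lam = 0\<close> the form W is constant, so a single zero of
          \<open>\<phi>\<close> would make it vanish identically.\<close>
        have "lam \<noteq> 0"
        proof
          assume l0: "lam = 0"
          have "M.W z = 0" using M.W_eq[OF z(1)] z(2) by (simp add: wedge_def vec_eq_iff)
          moreover have "M.W s = M.W z" for s
            using M.W_shift[of s z] l0 by (simp add: M.W_def wedge_def vec_eq_iff)
          ultimately have "M.\<phi> s = 0" for s by (simp add: M.\<phi>_def)
          then show False using M.nontrivial by (simp add: M.\<phi>_def M.W_def)
        qed
        then have "norm lam = 1" using lam by blast
        then interpret Z: multiplier_with_zero l \<alpha> a1 a2 T1 T2 \<gamma> lam W1 z
          using z by unfold_locales
        have arcs: "?arcs lam" using Z.planar_arcs unfolding T_def k_def .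
        show ?thesis by (rule exI[of _ lam], rule conjI[OF \<open>norm lam = 1\<close> disjI1[OF arcs]])
      qed
    qed
  qed
qed

end
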